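(* Suppose that $b$ and $\sigma$ are jointly continuous in $t$ and twice differentiable in $x$, that $f$ is jointly continuous in $t$, that $f$ and $g$ are twice differentiable in $x$, and that there is a constant $K\ge 0$ such that for all $x\in\mathbb{R}^d$, $a\in A$, $t\in[0,T]$, $$|D_xb(t,x,a)|+|D_x\sigma(t,x,a)|+|D_x^2b(t,x,a)|\le K,\qquad D_x^2\sigma(t,x,a)=0,$$ $$|D_xg(x)|+|D_xf(t,x,a)|+|D_x^2g(x)|+|D_x^2f(t,x,a)|\le K .$$ Then for any admissible controls $\varphi,\theta\in\mathcal{A}$ there exists a constant $C>0$ such that $$\begin{aligned}J(x,\varphi)-J(x,\theta)\le{}&\mathbb{E}\int_0^T\big[\mathcal{H}(s,X^\theta_s,Y^\theta_s,Z^\theta_s,\varphi_s)-\mathcal{H}(s,X^\theta_s,Y^\theta_s,Z^\theta_s,\theta_s)\big]\,ds\\&+C\,\mathbb{E}\int_0^T|b(s,X^\theta_s,\varphi_s)-b(s,X^\theta_s,\theta_s)|^2\,ds\\&+C\,\mathbb{E}\int_0^T|\sigma(s,X^\theta_s,\varphi_s)-\sigma(s,X^\theta_s,\theta_s)|^2\,ds\\&+C\,\mathbb{E}\int_0^T|D_x\mathcal{H}(s,X^\theta_s,Y^\theta_s,Z^\theta_s,\varphi_s)-D_x\mathcal{H}(s,X^\theta_s,Y^\theta_s,Z^\theta_s,\theta_s)|^2\,ds .\end{aligned}$$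
   Context: Fix $T\in(0,\infty)$, a filtered probability space $(\Omega,\mathcal{F},(\mathcal{F}_t)_{0\le t\le T},\mathbb{P})$, a $d'$-dimensional Wiener martingale $W$ on it, and a separable metric space $A$. Let $b:[0,T]\times\mathbb{R}^d\times A\to\mathbb{R}^d$, $\sigma:[0,T]\times\mathbb{R}^d\times A\to\mathbb{R}^{d\times d'}$, $f:[0,T]\times\mathbb{R}^d\times A\to\mathbb{R}$, $g:\mathbb{R}^d\to\mathbb{R}$ be measurable. $|\cdot|$ denotes a norm on a finite-dimensional Euclidean space; $D_x$, $D_x^2$ are the arrays of first and second partial derivatives in $x$. $\mathcal{A}$ is the space of admissible controls: $A$-valued progressively measurable processes $\alpha=(\alpha_s)_{s\in[0,T]}$ for which the objects below are well defined. For $x\in\mathbb{R}^d$ and $\alpha\in\mathcal{A}$, $X^\alpha$ is the unique solution of $$dX_s=b(s,X_s,\alpha_s)\,ds+\sigma(s,X_s,\alpha_s)\,dW_s,\quad s\in[0,T],\quad X_0=x,$$ and $$J(x,\alpha)=\mathbb{E}\Big[\int_0^Tf(s,X^\alpha_s,\alpha_s)\,ds+g(X^\alpha_T)\Big].$$ Hamiltonian: $\mathcal{H}(t,x,y,z,a)=b(t,x,a)\cdot y+\mathrm{tr}(\sigma^\top(t,x,a)z)+f(t,x,a)$ for $y\in\mathbb{R}^d$, $z\in\mathbb{R}^{d\times d'}$. For $\alpha\in\mathcal{A}$, $(Y^\alpha,Z^\alpha)$ is the solution of the adjoint backward SDE $$dY^\alpha_s=-D_x\mathcal{H}(s,X^\alpha_s,Y^\alpha_s,Z^\alpha_s,\alpha_s)\,ds+Z^\alpha_s\,dW_s,\quad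 s\in[0,T],\quad Y^\alpha_T=D_xg(X^\alpha_T).$$ *)

theory Defs
  imports "HOL-Probability.Probability"
begin

text \<open>Time-dependent objects are functions of all real times, of which only the times in
  \<open>{0..T}\<close> matter. A process is written \<open>X s \<omega>\<close>. Matrices in \<open>\<real>\<^bsup>d \<times> d'\<^esup>\<close> have type
  \<open>real^'e^'d\<close>, with \<open>d = CARD('d)\<close> and \<open>d' = CARD('e)\<close>. All norms are Euclidean
  (Frobenius on arrays).\<close>

section \<open>Arrays of partial derivatives\<close>

text \<open>Since \<open>Dx h\<close> is array-valued again, \<open>Dx (Dx h)\<close> is the array of second partial
  derivatives. The outermost index is the direction of differentiation.\<close>

definition Dx :: "(real^'d \<Rightarrow> 'b::real_normed_vector) \<Rightarrow> real^'d \<Rightarrow> 'b^'d" where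
  "Dx h x = (\<chi> i. vector_derivative (\<lambda>r. h (x + r *\<^sub>R axis i 1)) (at 0))"

text \<open>Differentiability is total (Frechet) differentiability; the second derivative need not
  be continuous.\<close>

definition twice_differentiable :: "(real^'d \<Rightarrow> 'b::real_normed_vector) \<Rightarrow> bool" where
  "twice_differentiable h \<longleftrightarrow>
     (\<forall>x. h differentiable (at x)) \<and> (\<forall>x. Dx h differentiable (at x))"

section \<open>Filtrations, progressive measurability, Wiener martingales\<close>

text \<open>The library's locale \<open>filtration\<close> is indexed by a whole type and does not relate the
  sub-\<open>\<sigma>\<close>-algebras to an ambient measure space. No completeness or right-continuity is
  assumed.\<close>

definition filtration_upto :: "'w measure \<Rightarrow> (real \<Rightarrow> 'w measure) \<Rightarrow> real \<Rightarrow> bool" where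
  "filtration_upto M F T \<longleftrightarrow>
     (\<forall>t\<in>{0..T}. subalgebra M (F t)) \<and>
     (\<forall>s t. 0 \<le> s \<longrightarrow> s \<le> t \<longrightarrow> t \<le> T \<longrightarrow> sets (F s) \<subseteq> sets (F t))"

definition progressively_measurable ::
  "(real \<Rightarrow> 'w measure) \<Rightarrow> real \<Rightarrow> (real \<Rightarrow> 'w \<Rightarrow> 'b::topological_space) \<Rightarrow> bool" where
  "progressively_measurable F T X \<longleftrightarrow>
     (\<forall>t\<in>{0..T}. (\<lambda>(s, \<omega>). X s \<omega>) \<in> borel_measurable (restrict_space borel {0..t} \<Otimes>\<^sub>M F t))"

definition wiener_martingale ::
  "'w measure \<Rightarrow> (real \<Rightarrow> 'w measure) \<Rightarrow> real \<Rightarrow> (real \<Rightarrow> 'w \<Rightarrow> real^'e) \<Rightarrow> bool" where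
  "wiener_martingale M F T W \<longleftrightarrow>
     (\<forall>t\<in>{0..T}. W t \<in> borel_measurable (F t)) \<and>
     (AE \<omega> in M. W 0 \<omega> = 0) \<and>
     (AE \<omega> in M. continuous_on {0..T} (\<lambda>t. W t \<omega>)) \<and>
     (\<forall>s t. 0 \<le> s \<longrightarrow> s < t \<longrightarrow> t \<le> T \<longrightarrow>
        distributed M lborel (\<lambda>\<omega>. W t \<omega> - W s \<omega>)
          (\<lambda>y. ennreal (\<Prod>j\<in>UNIV. normal_density 0 (sqrt (t - s)) (y $ j))) \<and>
        prob_space.indep_set M (sets (F s))
          (sets (vimage_algebra (space M) (\<lambda>\<omega>. W t \<omega> - W s \<omega>) borel)))"

section \<open>The Ito integral\<close>

text \<open>Bounded elementary integrands \<open>\<Sum>k<n. 1\<^bsub>(\<tau> k, \<tau> (k+1)]\<^esub> \<xi> k\<close> on a deterministic grid.\<close>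

definition elementary_integrand ::
  "(real \<Rightarrow> 'w measure) \<Rightarrow> real \<Rightarrow> nat \<Rightarrow> (nat \<Rightarrow> real) \<Rightarrow> (nat \<Rightarrow> 'w \<Rightarrow> real^'e^'d) \<Rightarrow> bool" where
  "elementary_integrand F T n \<tau> \<xi> \<longleftrightarrow>
     (\<forall>k\<le>n. \<tau> k \<in> {0..T}) \<and>
     (\<forall>k<n. \<tau> k \<le> \<tau> (Suc k) \<and> \<xi> k \<in> borel_measurable (F (\<tau> k)) \<and>
            bounded (\<xi> k ` space (F (\<tau> k))))"

definition elementary_process ::
  "nat \<Rightarrow> (nat \<Rightarrow> real) \<Rightarrow> (nat \<Rightarrow> 'w \<Rightarrow> real^'e^'d) \<Rightarrow> real \<Rightarrow> 'w \<Rightarrow> real^'e^'d" where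
  "elementary_process n \<tau> \<xi> s \<omega> = (\<Sum>k<n. indicator {\<tau> k<..\<tau> (Suc k)} s *\<^sub>R \<xi> k \<omega>)"

definition elementary_integral ::
  "(real \<Rightarrow> 'w \<Rightarrow> real^'e) \<Rightarrow> nat \<Rightarrow> (nat \<Rightarrow> real) \<Rightarrow> (nat \<Rightarrow> 'w \<Rightarrow> real^'e^'d)
     \<Rightarrow> real \<Rightarrow> 'w \<Rightarrow> real^'d" where
  "elementary_integral W n \<tau> \<xi> t \<omega> =
     (\<Sum>k<n. \<xi> k \<omega> *v (W (min (\<tau> (Suc k)) t) \<omega> - W (min (\<tau> k) t) \<omega>))"

text \<open>\<open>ito_integral M F T W H I\<close>: the process \<open>I\<close> is a continuous version of
  \<open>t \<mapsto> \<integral>\<^sub>0\<^sup>t H dW\<close> for a progressively measurable \<open>H\<close> with \<open>\<integral>\<^sub>0\<^sup>T |H|\<^sup>2 ds < \<infinity>\<close> a.s.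
  It is the limit in probability of integrals of elementary processes \<open>H\<^sub>m\<close> for which
  \<open>\<integral>\<^sub>0\<^sup>T |H\<^sub>m - H|\<^sup>2 ds \<rightarrow> 0\<close> in probability. Together with continuity, convergence at each
  fixed time determines \<open>I\<close> up to indistinguishability. Being a relation, it needs no
  existence theorem.\<close>

definition ito_integral ::
  "'w measure \<Rightarrow> (real \<Rightarrow> 'w measure) \<Rightarrow> real \<Rightarrow> (real \<Rightarrow> 'w \<Rightarrow> real^'e)
     \<Rightarrow> (real \<Rightarrow> 'w \<Rightarrow> real^'e^'d) \<Rightarrow> (real \<Rightarrow> 'w \<Rightarrow> real^'d) \<Rightarrow> bool" where
  "ito_integral M F T W H I \<longleftrightarrow>
     progressively_measurable F T H \<and>
     (AE \<omega> in M. (\<integral>\<^sup>+s\<in>{0..T}. ennreal ((norm (H s \<omega>))\<^sup>2) \<partial>lborel) < \<infinity>) \<and>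
     (\<forall>t\<in>{0..T}. I t \<in> borel_measurable M) \<and>
     (AE \<omega> in M. continuous_on {0..T} (\<lambda>t. I t \<omega>)) \<and>
     (\<exists>n \<tau> \<xi>. (\<forall>m. elementary_integrand F T (n m) (\<tau> m) (\<xi> m)) \<and>
        (\<forall>\<epsilon>>0. (\<lambda>m. measure M {\<omega>\<in>space M. ennreal \<epsilon> <
              (\<integral>\<^sup>+s\<in>{0..T}. ennreal ((norm (elementary_process (n m) (\<tau> m) (\<xi> m) s \<omega> - H s \<omega>))\<^sup>2) \<partial>lborel)})
            \<longlonglongrightarrow> 0) \<and>
        (\<forall>t\<in>{0..T}. \<forall>\<epsilon>>0. (\<lambda>m. measure M {\<omega>\<in>space M.
              \<epsilon> < norm (elementary_integral W (n m) (\<tau> m) (\<xi> m) t \<omega> - I t \<omega>)})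
            \<longlonglongrightarrow> 0))"

section \<open>State equation, cost, Hamiltonian, adjoint equation\<close>

text \<open>\<open>E \<integral>\<^sub>0\<^sup>T |U\<^sub>s|\<^sup>2 ds\<close>, possibly infinite. This is why the theorem's right-hand side lies in
  \<open>ereal\<close>: if its terms in \<open>b\<close> and \<open>\<sigma>\<close> are finite, the integral of the Hamiltonian difference
  converges under the theorem's assumptions (so it is not the Bochner default \<open>0\<close>); otherwise
  the right-hand side is \<open>\<infinity>\<close>.\<close>

definition mean_square ::
  "'w measure \<Rightarrow> real \<Rightarrow> (real \<Rightarrow> 'w \<Rightarrow> 'b::real_normed_vector) \<Rightarrow> ennreal" where
  "mean_square M T U = (\<integral>\<^sup>+\<omega>. (\<integral>\<^sup>+s\<in>{0..T}. ennreal ((norm (U s \<omega>))\<^sup>2) \<partial>lborel) \<partial>M)"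

definition indistinguishable ::
  "'w measure \<Rightarrow> real \<Rightarrow> (real \<Rightarrow> 'w \<Rightarrow> 'b) \<Rightarrow> (real \<Rightarrow> 'w \<Rightarrow> 'b) \<Rightarrow> bool" where
  "indistinguishable M T X X' \<longleftrightarrow> (AE \<omega> in M. \<forall>t\<in>{0..T}. X t \<omega> = X' t \<omega>)"

definition state_solution ::
  "'w measure \<Rightarrow> (real \<Rightarrow> 'w measure) \<Rightarrow> real \<Rightarrow> (real \<Rightarrow> 'w \<Rightarrow> real^'e)
     \<Rightarrow> (real \<Rightarrow> real^'d \<Rightarrow> 'a \<Rightarrow> real^'d) \<Rightarrow> (real \<Rightarrow> real^'d \<Rightarrow> 'a \<Rightarrow> real^'e^'d)
     \<Rightarrow> real^'d \<Rightarrow> (real \<Rightarrow> 'w \<Rightarrow> 'a) \<Rightarrow> (real \<Rightarrow> 'w \<Rightarrow> real^'d) \<Rightarrow> bool" where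
  "state_solution M F T W b \<sigma> x \<alpha> X \<longleftrightarrow>
     progressively_measurable F T X \<and>
     (AE \<omega> in M. continuous_on {0..T} (\<lambda>t. X t \<omega>)) \<and>
     (AE \<omega> in M. set_integrable lborel {0..T} (\<lambda>s. b s (X s \<omega>) (\<alpha> s \<omega>))) \<and>
     (\<exists>I. ito_integral M F T W (\<lambda>s \<omega>. \<sigma> s (X s \<omega>) (\<alpha> s \<omega>)) I \<and>
        (AE \<omega> in M. \<forall>t\<in>{0..T}.
           X t \<omega> = x + (LBINT s:{0..t}. b s (X s \<omega>) (\<alpha> s \<omega>)) + I t \<omega>))"

definition state ::
  "'w measure \<Rightarrow> (real \<Rightarrow> 'w measure) \<Rightarrow> real \<Rightarrow> (real \<Rightarrow> 'w \<Rightarrow> real^'e)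
     \<Rightarrow> (real \<Rightarrow> real^'d \<Rightarrow> 'a \<Rightarrow> real^'d) \<Rightarrow> (real \<Rightarrow> real^'d \<Rightarrow> 'a \<Rightarrow> real^'e^'d)
     \<Rightarrow> real^'d \<Rightarrow> (real \<Rightarrow> 'w \<Rightarrow> 'a) \<Rightarrow> real \<Rightarrow> 'w \<Rightarrow> real^'d" where
  "state M F T W b \<sigma> x \<alpha> = (SOME X. state_solution M F T W b \<sigma> x \<alpha> X)"

definition pathwise_cost ::
  "real \<Rightarrow> (real \<Rightarrow> real^'d \<Rightarrow> 'a \<Rightarrow> real) \<Rightarrow> (real^'d \<Rightarrow> real)
     \<Rightarrow> (real \<Rightarrow> 'w \<Rightarrow> real^'d) \<Rightarrow> (real \<Rightarrow> 'w \<Rightarrow> 'a) \<Rightarrow> 'w \<Rightarrow> real" where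
  "pathwise_cost T f g X \<alpha> \<omega> = (LBINT s:{0..T}. f s (X s \<omega>) (\<alpha> s \<omega>)) + g (X T \<omega>)"

definition cost_functional ::
  "'w measure \<Rightarrow> (real \<Rightarrow> 'w measure) \<Rightarrow> real \<Rightarrow> (real \<Rightarrow> 'w \<Rightarrow> real^'e)
     \<Rightarrow> (real \<Rightarrow> real^'d \<Rightarrow> 'a \<Rightarrow> real^'d) \<Rightarrow> (real \<Rightarrow> real^'d \<Rightarrow> 'a \<Rightarrow> real^'e^'d)
     \<Rightarrow> (real \<Rightarrow> real^'d \<Rightarrow> 'a \<Rightarrow> real) \<Rightarrow> (real^'d \<Rightarrow> real)
     \<Rightarrow> real^'d \<Rightarrow> (real \<Rightarrow> 'w \<Rightarrow> 'a) \<Rightarrow> real" where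
  "cost_functional M F T W b \<sigma> f g x \<alpha> =
     (\<integral>\<omega>. pathwise_cost T f g (state M F T W b \<sigma> x \<alpha>) \<alpha> \<omega> \<partial>M)"

definition hamiltonian ::
  "(real \<Rightarrow> real^'d \<Rightarrow> 'a \<Rightarrow> real^'d) \<Rightarrow> (real \<Rightarrow> real^'d \<Rightarrow> 'a \<Rightarrow> real^'e^'d)
     \<Rightarrow> (real \<Rightarrow> real^'d \<Rightarrow> 'a \<Rightarrow> real)
     \<Rightarrow> real \<Rightarrow> real^'d \<Rightarrow> real^'d \<Rightarrow> real^'e^'d \<Rightarrow> 'a \<Rightarrow> real" where
  "hamiltonian b \<sigma> f t x y z a =
     b t x a \<bullet> y + trace (transpose (\<sigma> t x a) ** z) + f t x a"

definition Dx_hamiltonian ::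
  "(real \<Rightarrow> real^'d \<Rightarrow> 'a \<Rightarrow> real^'d) \<Rightarrow> (real \<Rightarrow> real^'d \<Rightarrow> 'a \<Rightarrow> real^'e^'d)
     \<Rightarrow> (real \<Rightarrow> real^'d \<Rightarrow> 'a \<Rightarrow> real)
     \<Rightarrow> real \<Rightarrow> real^'d \<Rightarrow> real^'d \<Rightarrow> real^'e^'d \<Rightarrow> 'a \<Rightarrow> real^'d" where
  "Dx_hamiltonian b \<sigma> f t x y z a = Dx (\<lambda>x'. hamiltonian b \<sigma> f t x' y z a) x"

text \<open>Solutions of the adjoint backward equation are sought, as usual, among the pairs of
  square-integrable progressively measurable processes with \<open>Y\<close> continuous; without an
  integrability class for \<open>Z\<close> backward equations do not have unique solutions.\<close>

definition adjoint_solution ::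
  "'w measure \<Rightarrow> (real \<Rightarrow> 'w measure) \<Rightarrow> real \<Rightarrow> (real \<Rightarrow> 'w \<Rightarrow> real^'e)
     \<Rightarrow> (real \<Rightarrow> real^'d \<Rightarrow> 'a \<Rightarrow> real^'d) \<Rightarrow> (real \<Rightarrow> real^'d \<Rightarrow> 'a \<Rightarrow> real^'e^'d)
     \<Rightarrow> (real \<Rightarrow> real^'d \<Rightarrow> 'a \<Rightarrow> real) \<Rightarrow> (real^'d \<Rightarrow> real)
     \<Rightarrow> (real \<Rightarrow> 'w \<Rightarrow> 'a) \<Rightarrow> (real \<Rightarrow> 'w \<Rightarrow> real^'d)
     \<Rightarrow> (real \<Rightarrow> 'w \<Rightarrow> real^'d) \<Rightarrow> (real \<Rightarrow> 'w \<Rightarrow> real^'e^'d) \<Rightarrow> bool" where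
  "adjoint_solution M F T W b \<sigma> f g \<alpha> X Y Z \<longleftrightarrow>
     progressively_measurable F T Y \<and> progressively_measurable F T Z \<and>
     (AE \<omega> in M. continuous_on {0..T} (\<lambda>t. Y t \<omega>)) \<and>
     mean_square M T Y < \<infinity> \<and> mean_square M T Z < \<infinity> \<and>
     (AE \<omega> in M. set_integrable lborel {0..T}
        (\<lambda>s. Dx_hamiltonian b \<sigma> f s (X s \<omega>) (Y s \<omega>) (Z s \<omega>) (\<alpha> s \<omega>))) \<and>
     (\<exists>I. ito_integral M F T W Z I \<and>
        (AE \<omega> in M. \<forall>t\<in>{0..T}.
           Y t \<omega> = Y 0 \<omega>
             - (LBINT s:{0..t}. Dx_hamiltonian b \<sigma> f s (X s \<omega>) (Y s \<omega>) (Z s \<omega>) (\<alpha> s \<omega>))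
             + I t \<omega>)) \<and>
     (AE \<omega> in M. Y T \<omega> = Dx g (X T \<omega>))"

definition adjoint_processes ::
  "'w measure \<Rightarrow> (real \<Rightarrow> 'w measure) \<Rightarrow> real \<Rightarrow> (real \<Rightarrow> 'w \<Rightarrow> real^'e)
     \<Rightarrow> (real \<Rightarrow> real^'d \<Rightarrow> 'a \<Rightarrow> real^'d) \<Rightarrow> (real \<Rightarrow> real^'d \<Rightarrow> 'a \<Rightarrow> real^'e^'d)
     \<Rightarrow> (real \<Rightarrow> real^'d \<Rightarrow> 'a \<Rightarrow> real) \<Rightarrow> (real^'d \<Rightarrow> real)
     \<Rightarrow> real^'d \<Rightarrow> (real \<Rightarrow> 'w \<Rightarrow> 'a)
     \<Rightarrow> (real \<Rightarrow> 'w \<Rightarrow> real^'d) \<times> (real \<Rightarrow> 'w \<Rightarrow> real^'e^'d)" where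
  "adjoint_processes M F T W b \<sigma> f g x \<alpha> =
     (SOME (Y, Z). adjoint_solution M F T W b \<sigma> f g \<alpha> (state M F T W b \<sigma> x \<alpha>) Y Z)"

text \<open>Admissible controls: progressively measurable, and for every initial value the state,
  the cost and the adjoint processes are well defined. Uniqueness is up to
  indistinguishability, and up to \<open>dt \<otimes> dP\<close>-null sets for \<open>Z\<close>.\<close>

definition admissible ::
  "'w measure \<Rightarrow> (real \<Rightarrow> 'w measure) \<Rightarrow> real \<Rightarrow> (real \<Rightarrow> 'w \<Rightarrow> real^'e)
     \<Rightarrow> (real \<Rightarrow> real^'d \<Rightarrow> 'a \<Rightarrow> real^'d) \<Rightarrow> (real \<Rightarrow> real^'d \<Rightarrow> 'a \<Rightarrow> real^'e^'d)
     \<Rightarrow> (real \<Rightarrow> real^'d \<Rightarrow> 'a \<Rightarrow> real) \<Rightarrow> (real^'d \<Rightarrow> real)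
     \<Rightarrow> (real \<Rightarrow> 'w \<Rightarrow> 'a::topological_space) set" where
  "admissible M F T W b \<sigma> f g = {\<alpha>. progressively_measurable F T \<alpha> \<and>
     (\<forall>x. let X = state M F T W b \<sigma> x \<alpha> in
        (\<exists>X'. state_solution M F T W b \<sigma> x \<alpha> X') \<and>
        (\<forall>X1 X2. state_solution M F T W b \<sigma> x \<alpha> X1 \<longrightarrow> state_solution M F T W b \<sigma> x \<alpha> X2 \<longrightarrow>
           indistinguishable M T X1 X2) \<and>
        (AE \<omega> in M. set_integrable lborel {0..T} (\<lambda>s. f s (X s \<omega>) (\<alpha> s \<omega>))) \<and>
        integrable M (pathwise_cost T f g X \<alpha>) \<and>
        (\<exists>Y Z. adjoint_solution M F T W b \<sigma> f g \<alpha> X Y Z) \<and>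
        (\<forall>Y1 Z1 Y2 Z2.
           adjoint_solution M F T W b \<sigma> f g \<alpha> X Y1 Z1 \<longrightarrow>
           adjoint_solution M F T W b \<sigma> f g \<alpha> X Y2 Z2 \<longrightarrow>
           indistinguishable M T Y1 Y2 \<and>
           (AE \<omega> in M. AE s in lborel. s \<in> {0..T} \<longrightarrow> Z1 s \<omega> = Z2 s \<omega>)))}"

end

theory Submission
  imports Defs
begin

text \<open>Write \<open>U = X\<^sup>\<phi> - X\<^sup>\<theta>\<close>. Taylor's formula for \<open>g\<close> and the product formula for \<open>Y \<bullet> U\<close> turn
  \<open>J(x,\<phi>) - J(x,\<theta>)\<close> into the expected integral of the Hamiltonian difference, plus the expected integral
  of \<open>(D\<^sub>xH(\<phi>) - D\<^sub>xH(\<theta>)) \<bullet> U\<close>, plus Taylor remainders of order \<open>(1 + |Y|) |U|\<^sup>2\<close>; as \<open>\<sigma>\<close> is affine in \<open>x\<close>,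
  no remainder involves the unbounded \<open>Z\<close>. It remains to bound \<open>E |U|\<^sup>2\<close> by the mean squares of the
  differences of \<open>b\<close> and \<open>\<sigma>\<close>, and \<open>Y\<close> by a constant; both follow from Gronwall's inequality.

  No Ito formula is needed. For square-integrable processes the product formula in expectation follows
  by Fubini's theorem from the isometry and from the orthogonality of \<open>\<integral>\<^sub>s\<^sup>T H dW\<close> to
  the past of \<open>s\<close>. Localisation uses only truncation of elementary integrands along their grids, which
  yields \<open>E [1{A < R} |I|\<^sup>2] \<le> E [min A R]\<close> for a stochastic integral \<open>I\<close> with quadratic variation \<open>A\<close>.\<close>

section \<open>The time interval\<close>

text \<open>Two integrability gaps shape the proof. The state equation gives only continuous paths,
  so \<open>E |U|^2\<close> is not known to be finite before it is estimated, and Gronwall's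
  inequality says nothing about an infinite function. Hence the estimate is run on the event that
  the running quadratic variation of the martingale part is below \<open>R\<close>, where the second
  moment of that part is at most \<open>R\<close>; the constants are free of \<open>R\<close>, and
  the event is removed by Fatou's lemma. Second, the Taylor remainder carries the factor
  \<open>|Y| |U|^2\<close>, and second moments of \<open>U\<close> cannot absorb a merely
  square-integrable \<open>Y\<close>. Bounded first derivatives make \<open>Y\<close> bounded almost
  surely: the product formula, localised to an arbitrary event \<open>A\<close> of
  \<open>F t\<close>, gives \<open>E [1_A |Y_t|^2] \<le> c P(A)\<close>, so the event where
  \<open>|Y_t|^2\<close> exceeds \<open>c\<close> must be null. If one of the three mean squares is
  infinite, so is the right-hand side. The constant depends only on \<open>K\<close>,
  \<open>T\<close> and the dimension, hence is uniform in the initial value and in both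
  controls.\<close>

definition time_measure :: "real \<Rightarrow> real measure" where
  "time_measure T = restrict_space lborel {0..T}"

lemma space_time_measure [simp]: "space (time_measure T) = {0..T}"
  by (simp add: time_measure_def space_restrict_space)

lemma sets_time_measure [measurable_cong]:
  "sets (time_measure T) = sets (restrict_space borel {0..T})"
  unfolding time_measure_def by (rule sets_restrict_space_cong) simp

lemma emeasure_time_measure: "0 \<le> T \<Longrightarrow> emeasure (time_measure T) {0..T} = ennreal T"
  by (simp add: time_measure_def emeasure_restrict_space)

lemma finite_measure_time_measure [simp]: "finite_measure (time_measure T)"
  by (rule finite_measureI)
     (cases "0 \<le> T"; simp add: time_measure_def space_restrict_space emeasure_restrict_space)

lemma nn_integral_time_measure:
  "(\<integral>\<^sup>+s. h s \<partial>time_measure T) = (\<integral>\<^sup>+s\<in>{0..T}. h s \<partial>lborel)"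
  unfolding time_measure_def by (subst nn_integral_restrict_space) auto

lemma integrable_time_measure:
  fixes h :: "real \<Rightarrow> 'b::{banach, second_countable_topology}"
  shows "integrable (time_measure T) h \<longleftrightarrow> set_integrable lborel {0..T} h"
  unfolding time_measure_def set_integrable_def by (subst integrable_restrict_space) auto

lemma integral_time_measure:
  fixes h :: "real \<Rightarrow> 'b::{banach, second_countable_topology}"
  shows "(\<integral>s. h s \<partial>time_measure T) = (LBINT s:{0..T}. h s)"
  unfolding time_measure_def set_lebesgue_integral_def by (subst integral_restrict_space) auto

text \<open>Integrals up to a variable time are kept over the one finite measure
  \<open>time_measure T\<close>, with the bound moved into an indicator. Fubini's theorem and
  measurability in \<open>t\<close> then concern a single product space.\<close>

lemma integral_time_measure_initial:
  fixes h :: "real \<Rightarrow> 'b::{banach, second_countable_topology}"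
  assumes "t \<le> T"
  shows "(LBINT s:{0..t}. h s) = (\<integral>s. indicator {..t} s *\<^sub>R h s \<partial>time_measure T)"
  unfolding integral_time_measure set_lebesgue_integral_def
  using assms by (intro Bochner_Integration.integral_cong) (auto simp: indicator_def)

lemma borel_set_in_time_measure: "A \<in> sets borel \<Longrightarrow> A \<inter> {0..T} \<in> sets (time_measure T)"
  by (auto simp: sets_time_measure sets_restrict_space)

lemma measurable_ident_time_measure:
  "(\<lambda>s. s) \<in> borel_measurable (time_measure T)"
  by (simp add: measurable_restrict_space1 measurable_cong_sets[OF sets_time_measure refl])

text \<open>Cauchy-Schwarz against the constant function, obtained by expanding the nonnegative
  integral of \<open>(\<mu> |h| - \<integral>|h|)^2\<close>. If \<open>h\<close> is not
  square-integrable, the positive total mass makes the right-hand side infinite.\<close>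

lemma square_integral_le:
  fixes h :: "'c \<Rightarrow> 'b::{banach, second_countable_topology}"
  assumes fin: "finite_measure N" and pos: "0 < measure N (space N)"
    and [measurable]: "h \<in> borel_measurable N"
  shows "ennreal ((norm (\<integral>s. h s \<partial>N))\<^sup>2)
    \<le> ennreal (measure N (space N)) * (\<integral>\<^sup>+s. ennreal ((norm (h s))\<^sup>2) \<partial>N)"
proof (cases "(\<integral>\<^sup>+s. ennreal ((norm (h s))\<^sup>2) \<partial>N) < \<infinity>")
  case True
  interpret finite_measure N by fact
  let ?\<mu> = "measure N (space N)"
  have sq: "integrable N (\<lambda>s. (norm (h s))\<^sup>2)"
    using True by (intro integrableI_bounded) auto
  have n1: "integrable N (\<lambda>s. norm (h s))"
  proof (rule Bochner_Integration.integrable_bound[of _ "\<lambda>s. 1 + (norm (h s))\<^sup>2"])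
    show "AE s in N. norm (norm (h s)) \<le> norm (1 + (norm (h s))\<^sup>2)"
    proof (rule AE_I2)
      fix s
      have "2 * norm (h s) \<le> 1 + (norm (h s))\<^sup>2"
        using sum_squares_bound[of 1 "norm (h s)"] by simp
      then show "norm (norm (h s)) \<le> norm (1 + (norm (h s))\<^sup>2)"
        using norm_ge_zero[of "h s"] by (simp del: norm_ge_zero)
    qed
  qed (use sq in auto)
  let ?I = "\<integral>s. norm (h s) \<partial>N" and ?J = "\<integral>s. (norm (h s))\<^sup>2 \<partial>N"
  have "0 \<le> (\<integral>s. (?\<mu> * norm (h s) - ?I)\<^sup>2 \<partial>N)" by simp
  also have "\<dots> = (\<integral>s. (?\<mu>\<^sup>2 * (norm (h s))\<^sup>2 - (2 * ?\<mu> * ?I) * norm (h s)) + ?I\<^sup>2 \<partial>N)"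
    by (simp add: power2_eq_square algebra_simps)
  also have "\<dots> = ?\<mu>\<^sup>2 * ?J - (2 * ?\<mu> * ?I) * ?I + ?I\<^sup>2 * ?\<mu>"
    using sq n1 by simp
  also have "\<dots> = ?\<mu> * (?\<mu> * ?J - ?I\<^sup>2)"
    by (simp add: power2_eq_square algebra_simps)
  finally have IJ: "?I\<^sup>2 \<le> ?\<mu> * ?J" using pos by (simp add: zero_le_mult_iff)
  have "norm (\<integral>s. h s \<partial>N) \<le> ?I" by (rule integral_norm_bound)
  then have "(norm (\<integral>s. h s \<partial>N))\<^sup>2 \<le> ?I\<^sup>2" by (rule power_mono) simp
  from order_trans[OF this IJ] have "(norm (\<integral>s. h s \<partial>N))\<^sup>2 \<le> ?\<mu> * ?J" .
  moreover have "(\<integral>\<^sup>+s. ennreal ((norm (h s))\<^sup>2) \<partial>N) = ennreal ?J"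
    using sq by (intro nn_integral_eq_integral) auto
  ultimately show ?thesis
    by (metis ennreal_leI ennreal_mult' measure_nonneg)
next
  case False
  then have "(\<integral>\<^sup>+s. ennreal ((norm (h s))\<^sup>2) \<partial>N) = top" by (simp add: less_top[symmetric])
  then show ?thesis using pos by (simp add: ennreal_mult_top)
qed

section \<open>Gronwall inequalities\<close>

text \<open>A contraction argument in the weighted supremum norm \<open>S\<close> of
  \<open>w / e\<close>: by \<open>ke\<close> the integral operator has norm at most 1/2 there, so
  \<open>S \<le> a + S / 2\<close> and \<open>S \<le> 2 a\<close>. Only the weight is integrated
  exactly, \<open>w\<close> being compared with \<open>S e\<close> under the integral. The
  set-valued \<open>\<kappa>\<close> lets one proof serve both directions of time.\<close>

lemma gronwall_weighted:
  fixes w :: "'c \<Rightarrow> ennreal" and a B :: ennreal and c E :: real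
  assumes B: "\<And>t. t \<in> space N \<Longrightarrow> w t \<le> B" "B < \<infinity>"
    and c: "0 \<le> c"
    and e: "\<And>t. t \<in> space N \<Longrightarrow> 1 \<le> e t \<and> e t \<le> E" and [measurable]: "e \<in> borel_measurable N"
    and k: "\<And>t. t \<in> space N \<Longrightarrow> \<kappa> t \<inter> space N \<in> sets N"
    and ke: "\<And>t. t \<in> space N \<Longrightarrow>
      ennreal c * (\<integral>\<^sup>+r\<in>\<kappa> t. ennreal (e r) \<partial>N) \<le> ennreal (e t / 2)"
    and le: "\<And>t. t \<in> space N \<Longrightarrow> w t \<le> a + ennreal c * (\<integral>\<^sup>+r\<in>\<kappa> t. w r \<partial>N)"
    and t: "t \<in> space N"
  shows "w t \<le> 2 * ennreal E * a"
proof (cases "a = top")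
  case True
  have "E > 0" using e[OF t] by linarith
  then show ?thesis using True by (simp add: ennreal_mult_top ennreal_zero_less_mult_iff)
next
  case a: False
  have epos: "0 < e r" if "r \<in> space N" for r using e[OF that] by linarith
  define S where "S = (SUP t\<in>space N. w t / ennreal (e t))"
  have wS: "w r \<le> S * ennreal (e r)" if r: "r \<in> space N" for r
  proof -
    have "w r / ennreal (e r) \<le> S" unfolding S_def by (rule SUP_upper[OF r])
    then have "w r / ennreal (e r) * ennreal (e r) \<le> S * ennreal (e r)"
      by (rule mult_right_mono) simp
    then show ?thesis using epos[OF r]
      by (metis ennreal_divide_times ennreal_divide_self ennreal_less_top ennreal_less_zero_iff
          ennreal_mult_divide_eq infinity_ennreal_def linorder_neq_iff mult.commute
          mult.right_neutral times_divide_eq_right top.not_eq_extremum ennreal_times_divide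
          ennreal_eq_0_iff not_le)
  qed
  \<comment> \<open>Finiteness of \<open>S\<close> is what permits \<open>S / 2\<close> to be moved
    to the left-hand side; \<open>e \<ge> 1\<close> transfers it from the bound on
    \<open>w\<close>.\<close>
  have "S \<le> B" unfolding S_def
  proof (rule SUP_least)
    fix r assume r: "r \<in> space N"
    have "w r \<le> w r * ennreal (e r)"
      using e[OF r] mult_left_mono[of 1 "ennreal (e r)" "w r"] by simp
    then have "w r / ennreal (e r) \<le> w r * ennreal (e r) / ennreal (e r)"
      by (rule divide_right_mono_ennreal)
    also have "\<dots> = w r" using epos[OF r] by (simp add: ennreal_mult_divide_eq)
    finally show "w r / ennreal (e r) \<le> B" using B(1)[OF r] by simp
  qed
  then have Sfin: "S < top" using B(2) by (simp add: le_less_trans)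
  have "S \<le> a + S / 2"
    unfolding S_def
  proof (rule SUP_least, fold S_def)
    fix t assume t: "t \<in> space N"
    have [measurable]: "\<kappa> t \<inter> space N \<in> sets N" by (rule k[OF t])
    have ind: "(\<lambda>r. ennreal (e r) * indicator (\<kappa> t) r) \<in> borel_measurable N"
    proof (subst measurable_cong)
      show "ennreal (e r) * indicator (\<kappa> t) r = ennreal (e r) * indicator (\<kappa> t \<inter> space N) r"
        if "r \<in> space N" for r using that by (simp add: indicator_def)
    qed measurable
    have "(\<integral>\<^sup>+r\<in>\<kappa> t. w r \<partial>N) \<le> (\<integral>\<^sup>+r. S * (ennreal (e r) * indicator (\<kappa> t) r) \<partial>N)"
      using wS by (intro nn_integral_mono) (auto simp: indicator_def)
    also have "\<dots> = S * (\<integral>\<^sup>+r\<in>\<kappa> t. ennreal (e r) \<partial>N)"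
      using ind by (rule nn_integral_cmult)
    finally have "a + ennreal c * (\<integral>\<^sup>+r\<in>\<kappa> t. w r \<partial>N)
        \<le> a + ennreal c * (S * (\<integral>\<^sup>+r\<in>\<kappa> t. ennreal (e r) \<partial>N))"
      by (intro add_left_mono mult_left_mono) auto
    from order_trans[OF le[OF t] this]
    have "w t \<le> a + S * (ennreal c * (\<integral>\<^sup>+r\<in>\<kappa> t. ennreal (e r) \<partial>N))"
      by (simp add: ac_simps)
    also have "\<dots> \<le> a + S * ennreal (e t / 2)"
      by (intro add_left_mono mult_left_mono ke t) auto
    finally have 1: "w t \<le> a + S * ennreal (e t / 2)" .
    have eq: "S = ennreal (enn2real S)" "a = ennreal (enn2real a)"
      using Sfin a by (simp_all add: less_top)
    have "a + S * ennreal (e t / 2) = ennreal (enn2real a + enn2real S * (e t / 2))"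
      using epos[OF t] ennreal_mult[of "enn2real S" "e t / 2"] ennreal_plus[of "enn2real a" "enn2real S * (e t / 2)"]
        eq by simp
    with 1 have "w t / ennreal (e t) \<le> ennreal (enn2real a + enn2real S * (e t / 2)) / ennreal (e t)"
      by (simp add: divide_right_mono_ennreal)
    also have "\<dots> = ennreal ((enn2real a + enn2real S * (e t / 2)) / e t)"
      using epos[OF t] by (intro divide_ennreal) auto
    also have "\<dots> \<le> ennreal (enn2real a + enn2real S / 2)"
    proof (rule ennreal_leI)
      have "enn2real a \<le> enn2real a * e t"
        using e[OF t] mult_left_mono[of 1 "e t" "enn2real a"] by simp
      then show "(enn2real a + enn2real S * (e t / 2)) / e t \<le> enn2real a + enn2real S / 2"
        using epos[OF t] by (simp add: field_simps)
    qed
    also have "\<dots> = a + S / 2"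
      using eq divide_ennreal[of "enn2real S" 2] by simp
    finally show "w t / ennreal (e t) \<le> a + S / 2" .
  qed
  moreover have eq: "S = ennreal (enn2real S)" "a = ennreal (enn2real a)"
    using Sfin a by (simp_all add: less_top)
  ultimately have "ennreal (enn2real S) \<le> ennreal (enn2real a + enn2real S / 2)"
    by (metis divide_ennreal enn2real_nonneg ennreal_numeral ennreal_plus zero_less_numeral
        divide_nonneg_pos)
  then have "enn2real S \<le> 2 * enn2real a"
    by (subst (asm) ennreal_le_iff) auto
  then have "ennreal (enn2real S) \<le> ennreal (2 * enn2real a)" by (rule ennreal_leI)
  then have S2: "S \<le> 2 * a"
    using eq by (metis enn2real_nonneg ennreal_mult' ennreal_numeral zero_le_numeral)
  have "w t \<le> S * ennreal (e t)" by (rule wS[OF t])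
  also have "\<dots> \<le> (2 * a) * ennreal E"
    using e[OF t] by (intro mult_mono S2 ennreal_leI) auto
  finally show ?thesis by (simp add: ac_simps)
qed

text \<open>The weight \<open>exp (2 c r)\<close> grows so fast that \<open>c\<close> times its
  integral up to \<open>t\<close> is at most half its value at \<open>t\<close>. The factor 2 in the
  exponent is thus the origin of the contraction constant 1/2.\<close>

lemma gronwall_forward:
  fixes w :: "real \<Rightarrow> ennreal"
  assumes B: "\<And>t. t \<in> {0..T} \<Longrightarrow> w t \<le> B" "B < \<infinity>" and c: "0 < c"
    and le: "\<And>t. t \<in> {0..T} \<Longrightarrow>
      w t \<le> a + ennreal c * (\<integral>\<^sup>+r\<in>{..t}. w r \<partial>time_measure T)"
    and t: "t \<in> {0..T}"
  shows "w t \<le> 2 * ennreal (exp (2 * c * T)) * a"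
proof (rule gronwall_weighted[where N="time_measure T" and w=w and B=B and c=c and t=t
      and e="\<lambda>r. exp (2 * c * r)" and \<kappa>="\<lambda>t. {..t}"])
  note measurable_ident_time_measure [measurable]
  show "(\<lambda>r. exp (2 * c * r)) \<in> borel_measurable (time_measure T)" by measurable
  fix t assume t: "t \<in> space (time_measure T)"
  then show "1 \<le> exp (2 * c * t) \<and> exp (2 * c * t) \<le> exp (2 * c * T)" using c by simp
  show "{..t} \<inter> space (time_measure T) \<in> sets (time_measure T)"
    using borel_set_in_time_measure[of "{..t}" T] by (simp del: Int_atMost)
  have "(\<integral>\<^sup>+r\<in>{..t}. ennreal (exp (2 * c * r)) \<partial>time_measure T)
      = (\<integral>\<^sup>+r\<in>{0..t}. ennreal (exp (2 * c * r)) \<partial>lborel)"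
    unfolding nn_integral_time_measure using t
    by (intro nn_integral_cong) (auto simp: indicator_def)
  also have "\<dots> = ennreal (exp (2 * c * t) / (2 * c) - exp (2 * c * 0) / (2 * c))"
    using t c by (intro nn_integral_FTC_Icc) (auto intro!: derivative_eq_intros)
  finally have "ennreal c * (\<integral>\<^sup>+r\<in>{..t}. ennreal (exp (2 * c * r)) \<partial>time_measure T)
     = ennreal (c * (exp (2 * c * t) / (2 * c) - exp (2 * c * 0) / (2 * c)))"
    using c by (simp add: ennreal_mult')
  also have "\<dots> \<le> ennreal (exp (2 * c * t) / 2)"
    using c by (intro ennreal_leI) (simp add: field_simps)
  finally show "ennreal c * (\<integral>\<^sup>+r\<in>{..t}. ennreal (exp (2 * c * r)) \<partial>time_measure T)
    \<le> ennreal (exp (2 * c * t) / 2)" .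
qed (use assms in auto)

text \<open>The mirror image, with weight \<open>exp (2 c (T - r))\<close>. The inequality is known
  only from \<open>t0\<close> on, whereas the weighted version asks for it on all of
  \<open>{0..T}\<close>; cutting \<open>w\<close> off to 0 before \<open>t0\<close> makes it trivial
  there.\<close>

lemma gronwall_backward:
  fixes w :: "real \<Rightarrow> ennreal"
  assumes B: "\<And>t. t \<in> {t0..T} \<Longrightarrow> w t \<le> B" "B < \<infinity>" and c: "0 < c" and t0: "0 \<le> t0" "t0 \<le> T"
    and le: "\<And>t. t \<in> {t0..T} \<Longrightarrow>
      w t \<le> a + ennreal c * (\<integral>\<^sup>+r\<in>{t..}. w r \<partial>time_measure T)"
  shows "w t0 \<le> 2 * ennreal (exp (2 * c * T)) * a"
proof -
  let ?v = "\<lambda>r. w r * indicator {t0..} r"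
  have "?v t0 \<le> 2 * ennreal (exp (2 * c * T)) * a"
  proof (rule gronwall_weighted[where N="time_measure T" and w="?v" and B=B and c=c and t=t0
        and e="\<lambda>r. exp (2 * c * (T - r))" and \<kappa>="\<lambda>t. {t..}"])
    note measurable_ident_time_measure [measurable]
    show "(\<lambda>r. exp (2 * c * (T - r))) \<in> borel_measurable (time_measure T)" by measurable
    fix t assume t: "t \<in> space (time_measure T)"
    then show "1 \<le> exp (2 * c * (T - t)) \<and> exp (2 * c * (T - t)) \<le> exp (2 * c * T)"
      using c by simp
    show "{t..} \<inter> space (time_measure T) \<in> sets (time_measure T)"
      using borel_set_in_time_measure[of "{t..}" T] by (simp del: Int_atMost)
    show "?v t \<le> B" using B(1)[of t] t by (auto simp: indicator_def)
    show "?v t \<le> a + ennreal c * (\<integral>\<^sup>+r\<in>{t..}. ?v r \<partial>time_measure T)"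
    proof (cases "t0 \<le> t")
      case True
      have "?v t \<le> a + ennreal c * (\<integral>\<^sup>+r\<in>{t..}. w r \<partial>time_measure T)"
        using True t le[of t] by simp
      also have "(\<integral>\<^sup>+r\<in>{t..}. w r \<partial>time_measure T) = (\<integral>\<^sup>+r\<in>{t..}. ?v r \<partial>time_measure T)"
        using True by (intro nn_integral_cong) (auto simp: indicator_def)
      finally show ?thesis .
    qed simp
    have "(\<integral>\<^sup>+r\<in>{t..}. ennreal (exp (2 * c * (T - r))) \<partial>time_measure T)
        = (\<integral>\<^sup>+r\<in>{t..T}. ennreal (exp (2 * c * (T - r))) \<partial>lborel)"
      unfolding nn_integral_time_measure using t
      by (intro nn_integral_cong) (auto simp: indicator_def)
    also have "\<dots> = ennreal (- exp (2 * c * (T - T)) / (2 * c) - (- exp (2 * c * (T - t)) / (2 * c)))"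
      using t c by (intro nn_integral_FTC_Icc) (auto intro!: derivative_eq_intros)
    finally have "ennreal c * (\<integral>\<^sup>+r\<in>{t..}. ennreal (exp (2 * c * (T - r))) \<partial>time_measure T)
       = ennreal (c * (- exp (2 * c * (T - T)) / (2 * c) - (- exp (2 * c * (T - t)) / (2 * c))))"
      using c by (simp add: ennreal_mult')
    also have "\<dots> \<le> ennreal (exp (2 * c * (T - t)) / 2)"
      using c by (intro ennreal_leI) (simp add: field_simps)
    finally show "ennreal c * (\<integral>\<^sup>+r\<in>{t..}. ennreal (exp (2 * c * (T - r))) \<partial>time_measure T)
      \<le> ennreal (exp (2 * c * (T - t)) / 2)" .
  qed (use assms in auto)
  then show ?thesis by simp
qed

section \<open>Arrays of partial derivatives\<close>

text \<open>The link between the array \<open>Dx\<close>, whose norm the hypotheses bound, and the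
  Frechet derivative as a linear map.\<close>

definition Dx_along :: "(real^'d \<Rightarrow> 'b::real_normed_vector) \<Rightarrow> real^'d \<Rightarrow> real^'d \<Rightarrow> 'b" where
  "Dx_along h x v = (\<Sum>i\<in>UNIV. (v $ i) *\<^sub>R (Dx h x $ i))"

lemma partial_derivative:
  fixes h :: "real^'d \<Rightarrow> 'b::real_normed_vector"
  assumes "(h has_derivative h') (at x)"
  shows "((\<lambda>r. h (x + r *\<^sub>R axis i 1)) has_vector_derivative h' (axis i 1)) (at 0)"
proof -
  have 1: "((\<lambda>r. x + r *\<^sub>R axis i 1) has_derivative (\<lambda>r. r *\<^sub>R axis i (1::real))) (at 0)"
    by (auto intro!: derivative_eq_intros)
  have "((\<lambda>r. h (x + r *\<^sub>R axis i 1)) has_derivative (\<lambda>r. h' (r *\<^sub>R axis i 1))) (at 0)"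
    using has_derivative_compose[OF 1, of h h'] assms by simp
  moreover have "h' (r *\<^sub>R axis i 1) = r *\<^sub>R h' (axis i 1)" for r
    using has_derivative_bounded_linear[OF assms] by (simp add: linear_simps)
  ultimately show ?thesis by (simp add: has_vector_derivative_def)
qed

lemma Dx_nth:
  "(h has_derivative h') (at x) \<Longrightarrow> Dx h x $ i = h' (axis i 1)"
  unfolding Dx_def by (simp add: vector_derivative_at[OF partial_derivative])

lemma has_derivative_Dx_along:
  fixes h :: "real^'d \<Rightarrow> 'b::real_normed_vector"
  assumes "h differentiable (at x)"
  shows "(h has_derivative Dx_along h x) (at x)"
proof -
  obtain h' where h': "(h has_derivative h') (at x)" using assms by (auto simp: differentiable_def)
  interpret bounded_linear h' using h' by (rule has_derivative_bounded_linear)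
  have "h' v = Dx_along h x v" for v
  proof -
    have "h' v = h' (\<Sum>i\<in>UNIV. v $ i *\<^sub>R axis i 1)"
      using basis_expansion[of v] by (simp add: scalar_mult_eq_scaleR)
    also have "\<dots> = Dx_along h x v"
      by (simp add: sum scaleR Dx_along_def Dx_nth[OF h'])
    finally show ?thesis .
  qed
  then show ?thesis using h' by (metis ext)
qed

text \<open>Cauchy-Schwarz for \<open>L2_set\<close>. Because the norm of an array is the Euclidean
  norm of the norms of its entries, no dimension factor appears, and bounds on \<open>Dx\<close>
  become Lipschitz constants as they stand.\<close>

lemma norm_sum_scaleR_vec_le:
  fixes D :: "'b::real_normed_vector^'d"
  shows "norm (\<Sum>i\<in>UNIV. (v $ i) *\<^sub>R (D $ i)) \<le> norm D * norm (v :: real^'d)"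
proof -
  have "norm (\<Sum>i\<in>UNIV. (v $ i) *\<^sub>R (D $ i)) \<le> (\<Sum>i\<in>UNIV. norm (v $ i) * norm (D $ i))"
    by (rule order_trans[OF norm_sum]) simp
  also have "\<dots> \<le> L2_set (\<lambda>i. norm (v $ i)) UNIV * L2_set (\<lambda>i. norm (D $ i)) UNIV"
    using L2_set_mult_ineq[of "\<lambda>i. norm (v $ i)" "\<lambda>i. norm (D $ i)" UNIV] by simp
  finally show ?thesis by (simp add: norm_vec_def mult.commute)
qed

lemma norm_Dx_along_le: "norm (Dx_along h x v) \<le> norm (Dx h x) * norm v"
  unfolding Dx_along_def by (rule norm_sum_scaleR_vec_le)

lemma Dx_Lipschitz:
  fixes h :: "real^'d \<Rightarrow> 'b::real_normed_vector"
  assumes d: "\<And>x. h differentiable (at x)" and K: "\<And>x. norm (Dx h x) \<le> K"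
  shows "norm (h y - h x) \<le> K * norm (y - x)"
proof -
  have "onorm (Dx_along h z) \<le> K" for z
  proof (rule onorm_bound)
    show "0 \<le> K" using K[of z] norm_ge_zero order_trans by blast
    show "norm (Dx_along h z v) \<le> K * norm v" for v
      by (rule order_trans[OF norm_Dx_along_le]) (simp add: mult_right_mono K)
  qed
  then show ?thesis
    by (intro differentiable_bound[of UNIV h "Dx_along h"]) (auto intro: has_derivative_Dx_along d)
qed

lemma Dx_along_diff: "Dx_along h x v - Dx_along h y v = (\<Sum>i\<in>UNIV. (v $ i) *\<^sub>R ((Dx h x - Dx h y) $ i))"
  by (simp add: Dx_along_def sum_subtractf scaleR_diff_right)

text \<open>The second derivative need not be continuous, so the integral form of the remainder is
  avoided. The mean value inequality is applied on the segment to \<open>h\<close> minus its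
  linearisation, whose derivative is at most \<open>K |y - x|\<close> since \<open>Dx h\<close> is
  \<open>K\<close>-Lipschitz. The price is the constant \<open>K\<close> in place of
  \<open>K / 2\<close>.\<close>

lemma Dx_Taylor:
  fixes h :: "real^'d \<Rightarrow> 'b::real_normed_vector"
  assumes h: "twice_differentiable h" and K: "\<And>x. norm (Dx (Dx h) x) \<le> K"
  shows "norm (h y - h x - Dx_along h x (y - x)) \<le> K * (norm (y - x))\<^sup>2"
proof -
  let ?B = "K * norm (y - x)"
  let ?p = "\<lambda>z. h z - Dx_along h x z"
  have K0: "0 \<le> K" using K[of x] norm_ge_zero order_trans by blast
  have dh: "\<And>z. h differentiable (at z)" using h by (simp add: twice_differentiable_def)
  have bl: "bounded_linear (Dx_along h x)"
    using has_derivative_Dx_along[OF dh] by (rule has_derivative_bounded_linear)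
  have der: "(?p has_derivative (\<lambda>v. Dx_along h z v - Dx_along h x v)) (at z within closed_segment x y)" for z
    by (rule has_derivative_diff) (auto intro: has_derivative_at_withinI has_derivative_Dx_along dh
      bounded_linear.has_derivative[OF bl] bounded_linear_imp_has_derivative[OF bl])
  have on: "onorm (\<lambda>v. Dx_along h z v - Dx_along h x v) \<le> ?B" if z: "z \<in> closed_segment x y" for z
  proof (rule onorm_bound)
    show "0 \<le> ?B" using K0 by simp
    fix v
    have "norm (Dx_along h z v - Dx_along h x v) \<le> norm (Dx h z - Dx h x) * norm v"
      unfolding Dx_along_diff by (rule norm_sum_scaleR_vec_le)
    also have "norm (Dx h z - Dx h x) \<le> K * norm (z - x)"
      using h by (intro Dx_Lipschitz K) (simp add: twice_differentiable_def)
    also have "norm (z - x) \<le> norm (y - x)"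
      using segment_bound1[OF z] by simp
    finally show "norm (Dx_along h z v - Dx_along h x v) \<le> ?B * norm v"
      using K0 by (simp add: mult_right_mono mult_left_mono)
  qed
  have "norm (?p y - ?p x) \<le> ?B * norm (y - x)"
    using der on by (intro differentiable_bound[of "closed_segment x y" ?p]) auto
  moreover have "?p y - ?p x = h y - h x - Dx_along h x (y - x)"
    using bl by (simp add: linear_simps)
  ultimately show ?thesis by (simp add: power2_eq_square)
qed

section \<open>Increments of the Wiener martingale\<close>

lemma borel_measurable_matrix_vector_mult [measurable (raw)]:
  fixes A :: "'c \<Rightarrow> real^'e^'d"
  assumes "A \<in> borel_measurable N" "v \<in> borel_measurable N"
  shows "(\<lambda>x. A x *v v x) \<in> borel_measurable N"
proof (rule borel_measurable_continuous_Pair[OF assms])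
  show "continuous_on UNIV (\<lambda>p::(real^'e^'d) \<times> (real^'e). fst p *v snd p)"
    unfolding matrix_vector_mult_def by (intro continuous_intros)
qed

text \<open>Lebesgue measure on a Euclidean space is the image of the product of one-dimensional
  Lebesgue measures under recombination of coordinates, so a product of coordinate functions
  integrates factor by factor.\<close>

lemma integral_lborel_prod:
  fixes h :: "'b::euclidean_space \<Rightarrow> real \<Rightarrow> real"
  assumes h: "\<And>b. b \<in> Basis \<Longrightarrow> integrable lborel (h b)"
  shows "integrable lborel (\<lambda>x::'b. \<Prod>b\<in>Basis. h b (x \<bullet> b))"
    and "(\<integral>x. (\<Prod>b\<in>Basis. h b (x \<bullet> b)) \<partial>(lborel :: 'b measure)) = (\<Prod>b\<in>Basis. \<integral>x. h b x \<partial>lborel)"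
proof -
  interpret product_sigma_finite "\<lambda>_::'b. lborel :: real measure" ..
  have [measurable]: "\<And>b. b \<in> Basis \<Longrightarrow> h b \<in> borel_measurable borel"
    using borel_measurable_integrable[OF h] by simp
  have m: "(\<lambda>x::'b. \<Prod>b\<in>Basis. h b (x \<bullet> b)) \<in> borel_measurable borel"
    by measurable
  have m2: "(\<lambda>f::'b \<Rightarrow> real. \<Sum>b\<in>Basis. f b *\<^sub>R b) \<in> measurable (\<Pi>\<^sub>M b\<in>Basis. lborel) borel"
    by measurable
  have c: "(\<Sum>b\<in>Basis. x b *\<^sub>R b) \<bullet> b' = x b'" if "b' \<in> Basis" for x and b' :: 'b
    using that by (simp add: inner_sum_left inner_Basis if_distrib sum.delta' cong: if_cong)
  have i: "integrable (\<Pi>\<^sub>M b\<in>Basis. lborel) (\<lambda>x. \<Prod>b\<in>(Basis::'b set). h b (x b))"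
    by (intro product_integrable_prod h) auto
  show "integrable lborel (\<lambda>x::'b. \<Prod>b\<in>Basis. h b (x \<bullet> b))"
    unfolding lborel_eq[where 'a='b] using m i m2
    by (subst integrable_distr_eq) (auto simp: c cong: prod.cong)
  show "(\<integral>x. (\<Prod>b\<in>Basis. h b (x \<bullet> b)) \<partial>(lborel :: 'b measure)) = (\<Prod>b\<in>Basis. \<integral>x. h b x \<partial>lborel)"
    unfolding lborel_eq[where 'a='b] using m m2
    by (subst integral_distr) (auto simp: c product_integral_prod h cong: prod.cong)
qed

text \<open>One formula for all mixed moments of a centred Gaussian vector with independent
  components; mean and covariance of the increments are read off by choosing the exponents
  \<open>k\<close>.\<close>

lemma normal_product_moments:
  fixes k :: "'e::finite \<Rightarrow> nat"
  assumes s: "0 < s"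
  shows "integrable lborel (\<lambda>y::real^'e. (\<Prod>j\<in>UNIV. normal_density 0 s (y $ j)) * (\<Prod>j\<in>UNIV. (y $ j) ^ k j))"
    and "(\<integral>y. (\<Prod>j\<in>UNIV. normal_density 0 s (y $ j)) * (\<Prod>j\<in>UNIV. (y $ j) ^ k j) \<partial>(lborel :: (real^'e) measure))
      = (\<Prod>j\<in>UNIV. \<integral>x. normal_density 0 s x * x ^ k j \<partial>lborel)"
proof -
  let ?k = "\<lambda>b::real^'e. k (axis_index b)"
  let ?h = "\<lambda>b x. normal_density 0 s x * x ^ ?k b"
  have B: "(Basis :: (real^'e) set) = (\<lambda>j. axis j 1) ` UNIV"
    by (auto simp: Basis_vec_def)
  have inj: "inj (\<lambda>j::'e. axis j (1::real))" by (simp add: inj_on_def axis_eq_axis)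
  have re: "(\<Prod>b\<in>Basis. G b) = (\<Prod>j\<in>UNIV. G (axis j 1))" for G :: "real^'e \<Rightarrow> real"
    unfolding B by (subst prod.reindex[OF inj]) simp
  have ai: "axis_index (axis j (1::real)) = j" for j :: 'e
    by (simp add: axis_index_def axis_eq_axis)
  have eq: "(\<Prod>j\<in>UNIV. normal_density 0 s (y $ j)) * (\<Prod>j\<in>UNIV. (y $ j) ^ k j)
      = (\<Prod>b\<in>Basis. ?h b (y \<bullet> b))" for y :: "real^'e"
    unfolding re by (simp add: ai inner_axis prod.distrib)
  have int: "integrable lborel (?h b)" for b
    using integrable_normal_moment[OF s, of 0 "?k b"] by simp
  show "integrable lborel (\<lambda>y::real^'e. (\<Prod>j\<in>UNIV. normal_density 0 s (y $ j)) * (\<Prod>j\<in>UNIV. (y $ j) ^ k j))"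
    unfolding eq by (rule integral_lborel_prod(1)) (rule int)
  show "(\<integral>y. (\<Prod>j\<in>UNIV. normal_density 0 s (y $ j)) * (\<Prod>j\<in>UNIV. (y $ j) ^ k j) \<partial>(lborel :: (real^'e) measure))
      = (\<Prod>j\<in>UNIV. \<integral>x. normal_density 0 s x * x ^ k j \<partial>lborel)"
    unfolding eq by (subst integral_lborel_prod(2)) (auto simp: int re ai)
qed

lemma normal_moments:
  assumes "0 < s"
  shows "(\<integral>x. normal_density 0 s x * x ^ 0 \<partial>lborel) = 1"
    and "(\<integral>x. normal_density 0 s x * x ^ 1 \<partial>lborel) = 0"
    and "(\<integral>x. normal_density 0 s x * x ^ 2 \<partial>lborel) = s\<^sup>2"
proof -
  show "(\<integral>x. normal_density 0 s x * x ^ 0 \<partial>lborel) = 1"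
    using assms by simp
  show "(\<integral>x. normal_density 0 s x * x ^ 1 \<partial>lborel) = 0"
    using has_bochner_integral_integral_eq[OF normal_moment_odd[OF assms, of 0 0]] by simp
  show "(\<integral>x. normal_density 0 s x * x ^ 2 \<partial>lborel) = s\<^sup>2"
    using has_bochner_integral_integral_eq[OF normal_moment_even[OF assms, of 0 1]] by simp
qed

lemma borel_measurable_vec_component [measurable (raw)]:
  fixes A :: "'c \<Rightarrow> 'b::euclidean_space^'d"
  assumes "A \<in> borel_measurable N"
  shows "(\<lambda>x. A x $ i) \<in> borel_measurable N"
  using assms by (rule borel_measurable_continuous_on[rotated]) (intro continuous_intros)

locale wiener_space = prob_space M for M :: "'w measure" +
  fixes F :: "real \<Rightarrow> 'w measure" and T :: real and W :: "real \<Rightarrow> 'w \<Rightarrow> real^'e"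
  assumes T_pos: "0 < T"
    and filtration: "filtration_upto M F T"
    and wiener: "wiener_martingale M F T W"
begin

lemma subalgebra_F: "t \<in> {0..T} \<Longrightarrow> subalgebra M (F t)"
  using filtration by (simp add: filtration_upto_def)

lemma space_F: "t \<in> {0..T} \<Longrightarrow> space (F t) = space M"
  using subalgebra_F by (auto simp: subalgebra_def)

lemma F_mono: "0 \<le> s \<Longrightarrow> s \<le> t \<Longrightarrow> t \<le> T \<Longrightarrow> subalgebra (F t) (F s)"
  using filtration by (auto simp: filtration_upto_def subalgebra_def)

lemma F_measurable_mono:
  "X \<in> measurable (F s) N \<Longrightarrow> 0 \<le> s \<Longrightarrow> s \<le> t \<Longrightarrow> t \<le> T \<Longrightarrow> X \<in> measurable (F t) N"
  using measurable_from_subalg[OF F_mono] by blast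

lemma F_measurable_M: "X \<in> measurable (F s) N \<Longrightarrow> s \<in> {0..T} \<Longrightarrow> X \<in> measurable M N"
  using measurable_from_subalg[OF subalgebra_F] by blast

lemma F_sets_M: "A \<in> sets (F s) \<Longrightarrow> s \<in> {0..T} \<Longrightarrow> A \<in> sets M"
  using subalgebra_F by (auto simp: subalgebra_def)

lemma F_sets_mono: "A \<in> sets (F s) \<Longrightarrow> 0 \<le> s \<Longrightarrow> s \<le> t \<Longrightarrow> t \<le> T \<Longrightarrow> A \<in> sets (F t)"
  using F_mono by (auto simp: subalgebra_def)

lemma W_adapted: "t \<in> {0..T} \<Longrightarrow> W t \<in> borel_measurable (F t)"
  using wiener by (simp add: wiener_martingale_def)

lemma W_measurable: "t \<in> {0..T} \<Longrightarrow> W t \<in> borel_measurable M"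
  using W_adapted F_measurable_M by blast

lemma increment_moments:
  fixes k :: "'e \<Rightarrow> nat"
  assumes "0 \<le> s" "s < t" "t \<le> T"
  shows "integrable M (\<lambda>\<omega>. \<Prod>j\<in>UNIV. ((W t \<omega> - W s \<omega>) $ j) ^ k j)"
    and "(\<integral>\<omega>. (\<Prod>j\<in>UNIV. ((W t \<omega> - W s \<omega>) $ j) ^ k j) \<partial>M)
      = (\<Prod>j\<in>UNIV. \<integral>x. normal_density 0 (sqrt (t - s)) x * x ^ k j \<partial>lborel)"
proof -
  let ?g = "\<lambda>y::real^'e. \<Prod>j\<in>UNIV. (y $ j) ^ k j"
  let ?d = "\<lambda>y::real^'e. \<Prod>j\<in>UNIV. normal_density 0 (sqrt (t - s)) (y $ j)"
  have d: "distributed M lborel (\<lambda>\<omega>. W t \<omega> - W s \<omega>) (\<lambda>y. ennreal (?d y))"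
    using wiener assms by (simp add: wiener_martingale_def)
  have pos: "0 < sqrt (t - s)" using assms by simp
  have dn: "0 \<le> ?d y" for y by (intro prod_nonneg) simp
  show "integrable M (\<lambda>\<omega>. ?g (W t \<omega> - W s \<omega>))"
    using distributed_integrable[OF d, of ?g] normal_product_moments(1)[OF pos, of k] dn by simp
  show "(\<integral>\<omega>. ?g (W t \<omega> - W s \<omega>) \<partial>M)
      = (\<Prod>j\<in>UNIV. \<integral>x. normal_density 0 (sqrt (t - s)) x * x ^ k j \<partial>lborel)"
    using distributed_integral[OF d, of ?g] normal_product_moments(2)[OF pos, of k] dn by simp
qed

lemma increment_mean:
  assumes "0 \<le> s" "s < t" "t \<le> T"
  shows "integrable M (\<lambda>\<omega>. (W t \<omega> - W s \<omega>) $ j)" "(\<integral>\<omega>. (W t \<omega> - W s \<omega>) $ j \<partial>M) = 0"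
proof -
  let ?k = "\<lambda>i. if i = j then 1 else 0 :: nat"
  have eq: "(\<Prod>i\<in>UNIV. (y $ i) ^ ?k i) = y $ j" for y :: "real^'e"
    by (simp add: if_distrib[of "\<lambda>n. _ ^ n"] cong: if_cong)
  have pos: "0 < sqrt (t - s)" using assms by simp
  show "integrable M (\<lambda>\<omega>. (W t \<omega> - W s \<omega>) $ j)"
    using increment_moments(1)[OF assms, of ?k] unfolding eq .
  have "(\<Prod>i\<in>UNIV. \<integral>x. normal_density 0 (sqrt (t - s)) x * x ^ ?k i \<partial>lborel) = 0"
    using normal_moments(2)[OF pos] by (intro prod_zero) (auto intro!: bexI[of _ j])
  then show "(\<integral>\<omega>. (W t \<omega> - W s \<omega>) $ j \<partial>M) = 0"
    using increment_moments(2)[OF assms, of ?k] unfolding eq by simp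
qed

lemma increment_covariance:
  assumes "0 \<le> s" "s < t" "t \<le> T"
  shows "integrable M (\<lambda>\<omega>. (W t \<omega> - W s \<omega>) $ i * (W t \<omega> - W s \<omega>) $ j)"
    and "(\<integral>\<omega>. (W t \<omega> - W s \<omega>) $ i * (W t \<omega> - W s \<omega>) $ j \<partial>M) = (if i = j then t - s else 0)"
proof -
  \<comment> \<open>Two one-hot exponents are added, so \<open>i = j\<close> produces the exponent 2
    and hence the variance, while \<open>i \<noteq> j\<close> leaves a factor with exponent 1, which
    integrates to 0.\<close>
  let ?k = "\<lambda>l. (if l = i then 1 else 0) + (if l = j then 1 else 0) :: nat"
  let ?m = "\<lambda>n. \<integral>x. normal_density 0 (sqrt (t - s)) x * x ^ n \<partial>lborel"
  have eq: "(\<Prod>l\<in>UNIV. (y $ l) ^ ?k l) = y $ i * y $ j" for y :: "real^'e"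
    by (simp add: power_add prod.distrib if_distrib[of "\<lambda>n. _ ^ n"] cong: if_cong)
  have pos: "0 < sqrt (t - s)" using assms by simp
  note m = normal_moments[OF pos]
  show "integrable M (\<lambda>\<omega>. (W t \<omega> - W s \<omega>) $ i * (W t \<omega> - W s \<omega>) $ j)"
    using increment_moments(1)[OF assms, of ?k] unfolding eq .
  have "(\<Prod>l\<in>UNIV. ?m (?k l)) = (if i = j then t - s else 0)"
  proof (cases "i = j")
    case True
    have "(\<Prod>l\<in>UNIV. ?m (?k l)) = (\<Prod>l\<in>UNIV. if l = j then t - s else 1)"
      using True m assms by (intro prod.cong) (auto simp: numeral_2_eq_2)
    then show ?thesis using True by simp
  next
    case False
    then show ?thesis using m(2) by (auto intro!: prod_zero bexI[of _ j])
  qed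
  then show "(\<integral>\<omega>. (W t \<omega> - W s \<omega>) $ i * (W t \<omega> - W s \<omega>) $ j \<partial>M) = (if i = j then t - s else 0)"
    using increment_moments(2)[OF assms, of ?k] unfolding eq by simp
qed

text \<open>Independence in \<open>wiener_martingale\<close> is between \<sigma>-algebras; it is
  inherited by the smaller ones generated by \<open>\<zeta>\<close> and by \<open>g\<close> of the
  increment.\<close>

lemma increment_indep:
  fixes g :: "real^'e \<Rightarrow> real" and \<zeta> :: "'w \<Rightarrow> real"
  assumes st: "0 \<le> s" "s < t" "t \<le> T"
    and \<zeta>: "\<zeta> \<in> borel_measurable (F s)" and g: "g \<in> borel_measurable borel"
  shows "indep_var borel \<zeta> borel (\<lambda>\<omega>. g (W t \<omega> - W s \<omega>))"
proof -
  let ?w = "\<lambda>\<omega>. W t \<omega> - W s \<omega>"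
  have ind: "indep_set (sets (F s)) (sets (vimage_algebra (space M) ?w borel))"
    using wiener st by (simp add: wiener_martingale_def)
  have w[measurable]: "?w \<in> borel_measurable M" using W_measurable st by simp
  have "sigma_sets (space M) {\<zeta> -` A \<inter> space M |A. A \<in> sets borel} \<subseteq> sets (F s)"
  proof (rule sets.sigma_sets_subset')
    have sp: "space (F s) = space M" using st by (simp add: space_F)
    show "{\<zeta> -` A \<inter> space M |A. A \<in> sets borel} \<subseteq> sets (F s)"
      using measurable_sets[OF \<zeta>] unfolding sp by blast
    show "space M \<in> sets (F s)" using sets.top[of "F s"] unfolding sp .
  qed
  moreover have "sigma_sets (space M) {(\<lambda>\<omega>. g (?w \<omega>)) -` A \<inter> space M |A. A \<in> sets borel}
      \<subseteq> sets (vimage_algebra (space M) ?w borel)"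
  proof (rule sets.sigma_sets_subset')
    show "space M \<in> sets (vimage_algebra (space M) ?w borel)"
      using sets.top[of "vimage_algebra (space M) ?w borel"] by simp
    show "{(\<lambda>\<omega>. g (?w \<omega>)) -` A \<inter> space M |A. A \<in> sets borel} \<subseteq> sets (vimage_algebra (space M) ?w borel)"
    proof safe
      fix A :: "real set" assume "A \<in> sets borel"
      then have "g -` A \<in> sets borel" using measurable_sets[OF g] by simp
      then have "?w -` (g -` A) \<inter> space M \<in> sets (vimage_algebra (space M) ?w borel)"
        by (rule in_vimage_algebra)
      then show "(\<lambda>\<omega>. g (?w \<omega>)) -` A \<inter> space M \<in> sets (vimage_algebra (space M) ?w borel)"
        by (simp add: vimage_def)
    qed
  qed
  ultimately have "indep_set (sigma_sets (space M) {\<zeta> -` A \<inter> space M |A. A \<in> sets borel})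
      (sigma_sets (space M) {(\<lambda>\<omega>. g (?w \<omega>)) -` A \<inter> space M |A. A \<in> sets borel})"
    using ind unfolding indep_set_def
    by (elim indep_sets_mono_sets) (auto split: bool.split)
  moreover have "\<zeta> \<in> borel_measurable M" using F_measurable_M[OF \<zeta>] st by simp
  ultimately show ?thesis
    unfolding indep_var_eq using g by simp
qed

lemma increment_orthogonal:
  assumes st: "0 \<le> s" "s \<le> t" "t \<le> T"
    and \<zeta>: "\<zeta> \<in> borel_measurable (F s)" "integrable M \<zeta>"
  shows "integrable M (\<lambda>\<omega>. \<zeta> \<omega> * (W t \<omega> - W s \<omega>) $ j)"
    and "(\<integral>\<omega>. \<zeta> \<omega> * (W t \<omega> - W s \<omega>) $ j \<partial>M) = 0"
    and "integrable M (\<lambda>\<omega>. \<zeta> \<omega> * ((W t \<omega> - W s \<omega>) $ i * (W t \<omega> - W s \<omega>) $ j))"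
    and "(\<integral>\<omega>. \<zeta> \<omega> * ((W t \<omega> - W s \<omega>) $ i * (W t \<omega> - W s \<omega>) $ j) \<partial>M)
      = (if i = j then (t - s) * (\<integral>\<omega>. \<zeta> \<omega> \<partial>M) else 0)"
proof -
  have *: "integrable M (\<lambda>\<omega>. \<zeta> \<omega> * (W t \<omega> - W s \<omega>) $ j) \<and>
    (\<integral>\<omega>. \<zeta> \<omega> * (W t \<omega> - W s \<omega>) $ j \<partial>M) = 0 \<and>
    integrable M (\<lambda>\<omega>. \<zeta> \<omega> * ((W t \<omega> - W s \<omega>) $ i * (W t \<omega> - W s \<omega>) $ j)) \<and>
    (\<integral>\<omega>. \<zeta> \<omega> * ((W t \<omega> - W s \<omega>) $ i * (W t \<omega> - W s \<omega>) $ j) \<partial>M)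
      = (if i = j then (t - s) * (\<integral>\<omega>. \<zeta> \<omega> \<partial>M) else 0)"
  proof (cases "s = t")
    case False
    then have st': "0 \<le> s" "s < t" "t \<le> T" using st by auto
    have 1: "indep_var borel \<zeta> borel (\<lambda>\<omega>. (W t \<omega> - W s \<omega>) $ j)"
      using increment_indep[OF st' \<zeta>(1), of "\<lambda>y. y $ j"] by simp
    have 2: "indep_var borel \<zeta> borel (\<lambda>\<omega>. (W t \<omega> - W s \<omega>) $ i * (W t \<omega> - W s \<omega>) $ j)"
      using increment_indep[OF st' \<zeta>(1), of "\<lambda>y. y $ i * y $ j"] by simp
    note m = increment_mean[OF st', of j] and c = increment_covariance[OF st', of i j]
    show ?thesis
      using indep_var_integrable[OF 1 \<zeta>(2) m(1)] indep_var_lebesgue_integral[OF 1 \<zeta>(2) m(1)]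
        indep_var_integrable[OF 2 \<zeta>(2) c(1)] indep_var_lebesgue_integral[OF 2 \<zeta>(2) c(1)] m(2) c(2)
      by simp
  qed simp
  then show "integrable M (\<lambda>\<omega>. \<zeta> \<omega> * (W t \<omega> - W s \<omega>) $ j)"
    "(\<integral>\<omega>. \<zeta> \<omega> * (W t \<omega> - W s \<omega>) $ j \<partial>M) = 0"
    "integrable M (\<lambda>\<omega>. \<zeta> \<omega> * ((W t \<omega> - W s \<omega>) $ i * (W t \<omega> - W s \<omega>) $ j))"
    "(\<integral>\<omega>. \<zeta> \<omega> * ((W t \<omega> - W s \<omega>) $ i * (W t \<omega> - W s \<omega>) $ j) \<partial>M)
      = (if i = j then (t - s) * (\<integral>\<omega>. \<zeta> \<omega> \<partial>M) else 0)"
    by simp_all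
qed

text \<open>The inductive step of the Ito isometry. When the square is expanded componentwise,
  \<open>S\<close> times \<open>\<xi>\<close> is known at time \<open>s\<close>, so the cross terms
  have mean 0, and of the quadratic terms only the diagonal ones survive, each with weight
  \<open>t - s\<close>. Boundedness of \<open>\<xi>\<close> makes these products integrable for a
  square-integrable \<open>S\<close>.\<close>

lemma isometry_step:
  fixes S :: "'w \<Rightarrow> real^'d" and \<xi> :: "'w \<Rightarrow> real^'e^'d"
  assumes st: "0 \<le> s" "s \<le> t" "t \<le> T"
    and S: "S \<in> borel_measurable (F s)" "integrable M (\<lambda>\<omega>. (norm (S \<omega>))\<^sup>2)"
    and \<xi>: "\<xi> \<in> borel_measurable (F s)" "\<And>\<omega>. \<omega> \<in> space M \<Longrightarrow> norm (\<xi> \<omega>) \<le> B"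
  shows "integrable M (\<lambda>\<omega>. (\<xi> \<omega> *v (W t \<omega> - W s \<omega>)) $ i)"
    and "(\<integral>\<omega>. (\<xi> \<omega> *v (W t \<omega> - W s \<omega>)) $ i \<partial>M) = 0"
    and "integrable M (\<lambda>\<omega>. (norm (S \<omega> + \<xi> \<omega> *v (W t \<omega> - W s \<omega>)))\<^sup>2)"
    and "(\<integral>\<omega>. (norm (S \<omega> + \<xi> \<omega> *v (W t \<omega> - W s \<omega>)))\<^sup>2 \<partial>M)
      = (\<integral>\<omega>. (norm (S \<omega>))\<^sup>2 \<partial>M) + (t - s) * (\<integral>\<omega>. (norm (\<xi> \<omega>))\<^sup>2 \<partial>M)"
proof -
  define w where "w \<omega> = W t \<omega> - W s \<omega>" for \<omega>
  note wE = w_def[symmetric]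
  have s: "s \<in> {0..T}" using st by auto
  have [measurable]: "S \<in> borel_measurable (F s)" "\<xi> \<in> borel_measurable (F s)" by fact+
  have [measurable]: "S \<in> borel_measurable M" "\<xi> \<in> borel_measurable M"
    using F_measurable_M[OF S(1) s] F_measurable_M[OF \<xi>(1) s] by auto
  have comp: "\<bar>\<xi> \<omega> $ i $ j\<bar> \<le> B" if "\<omega> \<in> space M" for \<omega> i j
    using \<xi>(2)[OF that] component_le_norm_cart[of "\<xi> \<omega> $ i" j] Finite_Cartesian_Product.norm_nth_le[of "\<xi> \<omega>" i] by simp
  have i1: "integrable M (\<lambda>\<omega>. \<xi> \<omega> $ i $ j)" for i j
    by (rule integrable_const_bound[of _ B]) (use comp in auto)
  have i2: "integrable M (\<lambda>\<omega>. \<xi> \<omega> $ i $ j * \<xi> \<omega> $ i $ k)" for i j k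
  proof (rule integrable_const_bound[of _ "B * B"])
    show "AE \<omega> in M. norm (\<xi> \<omega> $ i $ j * \<xi> \<omega> $ i $ k) \<le> B * B"
    proof (rule AE_I2)
      fix \<omega> assume w: "\<omega> \<in> space M"
      then have "0 \<le> B" using comp[OF w, of i j] by linarith
      then show "norm (\<xi> \<omega> $ i $ j * \<xi> \<omega> $ i $ k) \<le> B * B"
        using comp[OF w] by (simp add: abs_mult mult_mono)
    qed
  qed simp
  have i3: "integrable M (\<lambda>\<omega>. S \<omega> $ i * \<xi> \<omega> $ i $ j)" for i j
  proof (rule Bochner_Integration.integrable_bound[of _ "\<lambda>\<omega>. B * (1 + (norm (S \<omega>))\<^sup>2)"])
    show "AE \<omega> in M. norm (S \<omega> $ i * \<xi> \<omega> $ i $ j) \<le> norm (B * (1 + (norm (S \<omega>))\<^sup>2))"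
    proof (rule AE_I2)
      fix \<omega> assume w: "\<omega> \<in> space M"
      have "2 * norm (S \<omega>) \<le> 1 + (norm (S \<omega>))\<^sup>2"
        using sum_squares_bound[of 1 "norm (S \<omega>)"] by simp
      then have "\<bar>S \<omega> $ i\<bar> \<le> 1 + (norm (S \<omega>))\<^sup>2"
        using component_le_norm_cart[of "S \<omega>" i] norm_ge_zero[of "S \<omega>"] by linarith
      then show "norm (S \<omega> $ i * \<xi> \<omega> $ i $ j) \<le> norm (B * (1 + (norm (S \<omega>))\<^sup>2))"
        using comp[OF w, of i j] mult_mono[of "\<bar>\<xi> \<omega> $ i $ j\<bar>" B "\<bar>S \<omega> $ i\<bar>" "1 + (norm (S \<omega>))\<^sup>2"]
        by (simp add: abs_mult mult.commute)
    qed
    show "integrable M (\<lambda>\<omega>. B * (1 + (norm (S \<omega>))\<^sup>2))" using S(2) by simp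
  qed measurable
  have m1: "(\<lambda>\<omega>. \<xi> \<omega> $ i $ j) \<in> borel_measurable (F s)" for i j by measurable
  have m2: "(\<lambda>\<omega>. \<xi> \<omega> $ i $ j * \<xi> \<omega> $ i $ k) \<in> borel_measurable (F s)" for i j k by measurable
  have m3: "(\<lambda>\<omega>. S \<omega> $ i * \<xi> \<omega> $ i $ j) \<in> borel_measurable (F s)" for i j by measurable
  note o1 = increment_orthogonal(1,2)[OF st m1 i1, unfolded wE]
  note o2 = increment_orthogonal(3,4)[OF st m2 i2, unfolded wE]
  note o3 = increment_orthogonal(1,2)[OF st m3 i3, unfolded wE]
  have vec: "(\<xi> \<omega> *v w \<omega>) $ i = (\<Sum>j\<in>UNIV. \<xi> \<omega> $ i $ j * w \<omega> $ j)" for \<omega> i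
    by (simp add: matrix_vector_mult_def)
  show "integrable M (\<lambda>\<omega>. (\<xi> \<omega> *v (W t \<omega> - W s \<omega>)) $ i)"
    "(\<integral>\<omega>. (\<xi> \<omega> *v (W t \<omega> - W s \<omega>)) $ i \<partial>M) = 0"
    unfolding wE vec using o1 by simp_all
  have sq: "(norm (S \<omega> + \<xi> \<omega> *v w \<omega>))\<^sup>2 = (norm (S \<omega>))\<^sup>2
      + 2 * (\<Sum>i\<in>UNIV. \<Sum>j\<in>UNIV. (S \<omega> $ i * \<xi> \<omega> $ i $ j) * w \<omega> $ j)
      + (\<Sum>i\<in>UNIV. \<Sum>j\<in>UNIV. \<Sum>k\<in>UNIV. (\<xi> \<omega> $ i $ j * \<xi> \<omega> $ i $ k) * (w \<omega> $ j * w \<omega> $ k))" for \<omega>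
  proof -
    have "(norm (S \<omega> + \<xi> \<omega> *v w \<omega>))\<^sup>2
        = (norm (S \<omega>))\<^sup>2 + 2 * (S \<omega> \<bullet> (\<xi> \<omega> *v w \<omega>)) + (\<xi> \<omega> *v w \<omega>) \<bullet> (\<xi> \<omega> *v w \<omega>)"
      by (simp add: power2_norm_eq_inner inner_add_left inner_add_right inner_commute)
    then show ?thesis
      by (simp add: inner_vec_def vec sum_distrib_left sum_distrib_right sum_product ac_simps)
  qed
  show "integrable M (\<lambda>\<omega>. (norm (S \<omega> + \<xi> \<omega> *v (W t \<omega> - W s \<omega>)))\<^sup>2)"
    unfolding wE sq using S(2) o2 o3 by simp
  have n2: "(norm (\<xi> \<omega>))\<^sup>2 = (\<Sum>i\<in>UNIV. \<Sum>j\<in>UNIV. \<xi> \<omega> $ i $ j * \<xi> \<omega> $ i $ j)" for \<omega>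
    by (simp add: power2_norm_eq_inner inner_vec_def)
  have "(\<integral>\<omega>. (norm (S \<omega> + \<xi> \<omega> *v w \<omega>))\<^sup>2 \<partial>M) = (\<integral>\<omega>. (norm (S \<omega>))\<^sup>2 \<partial>M)
      + (\<Sum>i\<in>UNIV. \<Sum>j\<in>UNIV. \<Sum>k\<in>UNIV. if j = k then (t - s) * (\<integral>\<omega>. \<xi> \<omega> $ i $ j * \<xi> \<omega> $ i $ k \<partial>M) else 0)"
    unfolding sq using S(2) o2 o3 by simp
  also have "\<dots> = (\<integral>\<omega>. (norm (S \<omega>))\<^sup>2 \<partial>M) + (t - s) * (\<integral>\<omega>. (norm (\<xi> \<omega>))\<^sup>2 \<partial>M)"
    unfolding n2 using i2 by (simp add: sum_distrib_left)
  finally show "(\<integral>\<omega>. (norm (S \<omega> + \<xi> \<omega> *v (W t \<omega> - W s \<omega>)))\<^sup>2 \<partial>M)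
      = (\<integral>\<omega>. (norm (S \<omega>))\<^sup>2 \<partial>M) + (t - s) * (\<integral>\<omega>. (norm (\<xi> \<omega>))\<^sup>2 \<partial>M)"
    by (simp add: w_def)
qed

section \<open>Elementary integrals\<close>

text \<open>The pathwise integral of the squared norm of an elementary process. Regarded as a
  function of \<open>n\<close>, it is the running quadratic variation at the grid points.\<close>

definition elementary_qv :: "nat \<Rightarrow> (nat \<Rightarrow> real) \<Rightarrow> (nat \<Rightarrow> 'w \<Rightarrow> real^'e^'d) \<Rightarrow> 'w \<Rightarrow> real" where
  "elementary_qv n \<tau> \<xi> \<omega> = (\<Sum>k<n. (\<tau> (Suc k) - \<tau> k) * (norm (\<xi> k \<omega>))\<^sup>2)"

lemma elementary_integrandD:
  assumes "elementary_integrand F T n \<tau> \<xi>"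
  shows "k \<le> n \<Longrightarrow> 0 \<le> \<tau> k" "k \<le> n \<Longrightarrow> \<tau> k \<le> T" "k < n \<Longrightarrow> \<tau> k \<le> \<tau> (Suc k)"
    "k < n \<Longrightarrow> \<xi> k \<in> borel_measurable (F (\<tau> k))"
    "k < n \<Longrightarrow> \<xi> k \<in> borel_measurable M"
    "k < n \<Longrightarrow> \<exists>B. \<forall>\<omega>\<in>space M. norm (\<xi> k \<omega>) \<le> B"
proof -
  show "k \<le> n \<Longrightarrow> 0 \<le> \<tau> k" "k \<le> n \<Longrightarrow> \<tau> k \<le> T" "k < n \<Longrightarrow> \<tau> k \<le> \<tau> (Suc k)"
    and 1: "k < n \<Longrightarrow> \<xi> k \<in> borel_measurable (F (\<tau> k))"
    using assms by (auto simp: elementary_integrand_def)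
  have t: "k < n \<Longrightarrow> \<tau> k \<in> {0..T}" using assms by (auto simp: elementary_integrand_def)
  then show "k < n \<Longrightarrow> \<xi> k \<in> borel_measurable M" using 1 F_measurable_M by blast
  show "k < n \<Longrightarrow> \<exists>B. \<forall>\<omega>\<in>space M. norm (\<xi> k \<omega>) \<le> B"
    using assms t space_F by (auto simp: elementary_integrand_def bounded_iff)
qed

lemma elementary_grid_mono:
  assumes "elementary_integrand F T n \<tau> \<xi>" "i \<le> j" "j \<le> n"
  shows "\<tau> i \<le> \<tau> j"
  using assms(2,3)
proof (induction rule: dec_induct)
  case (step m)
  then show ?case using elementary_integrandD(3)[OF assms(1), of m] by simp
qed simp

lemma elementary_integral_T:
  assumes "elementary_integrand F T n \<tau> \<xi>"
  shows "elementary_integral W n \<tau> \<xi> T \<omega> = (\<Sum>k<n. \<xi> k \<omega> *v (W (\<tau> (Suc k)) \<omega> - W (\<tau> k) \<omega>))"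
  unfolding elementary_integral_def
  using elementary_integrandD(2)[OF assms] by (intro sum.cong) (auto simp: min_def intro!: antisym)

text \<open>Induction over the intervals. Measurability of the partial sum with respect to
  \<open>F (\<tau> m)\<close> is carried along, since it is what makes the next increment orthogonal
  to it.\<close>

lemma elementary_isometry:
  fixes \<xi> :: "nat \<Rightarrow> 'w \<Rightarrow> real^'e^'d"
  assumes e: "elementary_integrand F T n \<tau> \<xi>"
  shows "elementary_integral W n \<tau> \<xi> T \<in> borel_measurable M"
    and "integrable M (\<lambda>\<omega>. (norm (elementary_integral W n \<tau> \<xi> T \<omega>))\<^sup>2)"
    and "(\<integral>\<omega>. (norm (elementary_integral W n \<tau> \<xi> T \<omega>))\<^sup>2 \<partial>M) = (\<integral>\<omega>. elementary_qv n \<tau> \<xi> \<omega> \<partial>M)"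
    and "integrable M (elementary_qv n \<tau> \<xi>)"
    and "integrable M (\<lambda>\<omega>. elementary_integral W n \<tau> \<xi> T \<omega> $ i)"
    and "(\<integral>\<omega>. elementary_integral W n \<tau> \<xi> T \<omega> $ i \<partial>M) = 0"
proof -
  note eD = elementary_integrandD[OF e]
  define S where "S m \<omega> = (\<Sum>k<m. \<xi> k \<omega> *v (W (\<tau> (Suc k)) \<omega> - W (\<tau> k) \<omega>))" for m \<omega>
  have *: "S m \<in> borel_measurable (F (\<tau> m)) \<and> integrable M (\<lambda>\<omega>. (norm (S m \<omega>))\<^sup>2) \<and>
     integrable M (elementary_qv m \<tau> \<xi>) \<and>
     (\<integral>\<omega>. (norm (S m \<omega>))\<^sup>2 \<partial>M) = (\<integral>\<omega>. elementary_qv m \<tau> \<xi> \<omega> \<partial>M) \<and>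
     (\<forall>i. integrable M (\<lambda>\<omega>. S m \<omega> $ i) \<and> (\<integral>\<omega>. S m \<omega> $ i \<partial>M) = 0)" if "m \<le> n" for m
    using that
  proof (induction m)
    case 0
    then show ?case by (simp add: S_def elementary_qv_def)
  next
    case (Suc m)
    then have m: "m < n" by simp
    note IH = Suc.IH[OF less_imp_le[OF m]]
    obtain B where B: "\<And>\<omega>. \<omega> \<in> space M \<Longrightarrow> norm (\<xi> m \<omega>) \<le> B" using eD(6)[OF m] by auto
    have st: "0 \<le> \<tau> m" "\<tau> m \<le> \<tau> (Suc m)" "\<tau> (Suc m) \<le> T" using eD m by auto
    have SS: "S (Suc m) \<omega> = S m \<omega> + \<xi> m \<omega> *v (W (\<tau> (Suc m)) \<omega> - W (\<tau> m) \<omega>)" for \<omega>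
      by (simp add: S_def)
    have QQ: "elementary_qv (Suc m) \<tau> \<xi> \<omega> = elementary_qv m \<tau> \<xi> \<omega>
        + (\<tau> (Suc m) - \<tau> m) * (norm (\<xi> m \<omega>))\<^sup>2" for \<omega>
      by (simp add: elementary_qv_def)
    note st1 = isometry_step[OF st conjunct1[OF IH] _ eD(4)[OF m] B]
    have [measurable]: "S m \<in> borel_measurable (F (\<tau> (Suc m)))" "\<xi> m \<in> borel_measurable (F (\<tau> (Suc m)))"
      "W (\<tau> (Suc m)) \<in> borel_measurable (F (\<tau> (Suc m)))" "W (\<tau> m) \<in> borel_measurable (F (\<tau> (Suc m)))"
      using IH eD(4)[OF m] st W_adapted[of "\<tau> m"] by (auto intro: F_measurable_mono W_adapted)
    have m1: "S (Suc m) \<in> borel_measurable (F (\<tau> (Suc m)))"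
      unfolding SS[abs_def] by measurable
    have [measurable]: "\<xi> m \<in> borel_measurable M" by (rule eD(5)[OF m])
    have q: "integrable M (\<lambda>\<omega>. (norm (\<xi> m \<omega>))\<^sup>2)"
      by (rule integrable_const_bound[of _ "B\<^sup>2"]) (use B in \<open>auto intro!: power_mono\<close>)
    have "integrable M (elementary_qv (Suc m) \<tau> \<xi>)"
      unfolding QQ[abs_def] using IH q by simp
    moreover have "(\<integral>\<omega>. elementary_qv (Suc m) \<tau> \<xi> \<omega> \<partial>M)
        = (\<integral>\<omega>. elementary_qv m \<tau> \<xi> \<omega> \<partial>M) + (\<tau> (Suc m) - \<tau> m) * (\<integral>\<omega>. (norm (\<xi> m \<omega>))\<^sup>2 \<partial>M)"
      unfolding QQ using IH q by simp
    moreover have "integrable M (\<lambda>\<omega>. S (Suc m) \<omega> $ i)" "(\<integral>\<omega>. S (Suc m) \<omega> $ i \<partial>M) = 0" for i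
      unfolding SS vector_add_component using IH st1(1,2)[of i] by auto
    moreover have "integrable M (\<lambda>\<omega>. (norm (S (Suc m) \<omega>))\<^sup>2)"
      unfolding SS using st1(3) IH by blast
    moreover have "(\<integral>\<omega>. (norm (S (Suc m) \<omega>))\<^sup>2 \<partial>M)
        = (\<integral>\<omega>. (norm (S m \<omega>))\<^sup>2 \<partial>M) + (\<tau> (Suc m) - \<tau> m) * (\<integral>\<omega>. (norm (\<xi> m \<omega>))\<^sup>2 \<partial>M)"
      unfolding SS using st1(4) IH by blast
    ultimately show ?case
      using m1 IH by simp
  qed
  have eq: "elementary_integral W n \<tau> \<xi> T = S n"
    using elementary_integral_T[OF e] by (simp add: fun_eq_iff S_def)
  have "\<tau> n \<in> {0..T}" using eD by simp
  then show "elementary_integral W n \<tau> \<xi> T \<in> borel_measurable M"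
    unfolding eq using *[of n] F_measurable_M by blast
  show "integrable M (\<lambda>\<omega>. (norm (elementary_integral W n \<tau> \<xi> T \<omega>))\<^sup>2)"
    "(\<integral>\<omega>. (norm (elementary_integral W n \<tau> \<xi> T \<omega>))\<^sup>2 \<partial>M) = (\<integral>\<omega>. elementary_qv n \<tau> \<xi> \<omega> \<partial>M)"
    "integrable M (elementary_qv n \<tau> \<xi>)"
    "integrable M (\<lambda>\<omega>. elementary_integral W n \<tau> \<xi> T \<omega> $ i)"
    "(\<integral>\<omega>. elementary_integral W n \<tau> \<xi> T \<omega> $ i \<partial>M) = 0"
    unfolding eq using *[of n] by auto
qed

end

lemma measurable_time_indicator [measurable]:
  "A \<in> sets borel \<Longrightarrow> (indicator A :: real \<Rightarrow> 'b::{topological_space, zero_neq_one}) \<in> borel_measurable (time_measure T)"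
proof -
  assume A: "A \<in> sets borel"
  have "(\<lambda>s. indicator A s :: 'b) \<in> borel_measurable (restrict_space borel {0..T})"
    using A by (intro measurable_restrict_space1 borel_measurable_indicator)
  then show ?thesis by (simp add: measurable_cong_sets[OF sets_time_measure refl])
qed

lemma measurable_time_indicator_fst [measurable (raw)]:
  "A \<in> sets borel \<Longrightarrow> (\<lambda>z. indicator A (fst z) :: 'b::{topological_space, zero_neq_one})
    \<in> borel_measurable (time_measure T \<Otimes>\<^sub>M N)"
  by (rule measurable_compose[OF measurable_fst measurable_time_indicator])

section \<open>Closure properties of elementary integrands\<close>

lemma sum_eq_single:
  assumes "finite A" "k0 \<in> A" "\<And>k. k \<in> A \<Longrightarrow> k \<noteq> k0 \<Longrightarrow> h k = (0 :: 'c::comm_monoid_add)"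
  shows "sum h A = h k0"
  using assms by (subst sum.remove[of A k0]) (auto intro!: sum.neutral)

context wiener_space
begin

text \<open>The half-open intervals of a monotone grid are disjoint, so at each time at most one
  summand is nonzero and no cross terms arise.\<close>

lemma elementary_process_norm:
  fixes \<xi> :: "nat \<Rightarrow> 'w \<Rightarrow> real^'e^'d"
  assumes e: "elementary_integrand F T n \<tau> \<xi>"
  shows "(norm (elementary_process n \<tau> \<xi> s \<omega>))\<^sup>2
    = (\<Sum>k<n. indicator {\<tau> k<..\<tau> (Suc k)} s * (norm (\<xi> k \<omega>))\<^sup>2)"
proof (cases "\<exists>k0<n. s \<in> {\<tau> k0<..\<tau> (Suc k0)}")
  case True
  then obtain k0 where k0: "k0 < n" "s \<in> {\<tau> k0<..\<tau> (Suc k0)}" by auto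
  have off: "indicator {\<tau> k<..\<tau> (Suc k)} s = (0::real)" if "k < n" "k \<noteq> k0" for k
  proof (cases "k < k0")
    case True
    then have "\<tau> (Suc k) \<le> \<tau> k0" using k0 by (intro elementary_grid_mono[OF e]) auto
    then show ?thesis using k0 by (auto simp: indicator_def)
  next
    case False
    then have "\<tau> (Suc k0) \<le> \<tau> k" using that by (intro elementary_grid_mono[OF e]) auto
    then show ?thesis using k0 by (auto simp: indicator_def)
  qed
  have "elementary_process n \<tau> \<xi> s \<omega> = indicator {\<tau> k0<..\<tau> (Suc k0)} s *\<^sub>R \<xi> k0 \<omega>"
    unfolding elementary_process_def using k0 off by (intro sum_eq_single) auto
  moreover have "(\<Sum>k<n. indicator {\<tau> k<..\<tau> (Suc k)} s * (norm (\<xi> k \<omega>))\<^sup>2)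
      = indicator {\<tau> k0<..\<tau> (Suc k0)} s * (norm (\<xi> k0 \<omega>))\<^sup>2"
    using k0 off by (intro sum_eq_single) auto
  ultimately show ?thesis using k0 by simp
next
  case False
  then have "indicator {\<tau> k<..\<tau> (Suc k)} s = (0::real)" if "k < n" for k
    using that by (auto simp: indicator_def)
  then show ?thesis by (simp add: elementary_process_def)
qed

lemma elementary_qv_nonneg:
  assumes e: "elementary_integrand F T n \<tau> \<xi>"
  shows "0 \<le> elementary_qv n \<tau> \<xi> \<omega>"
  unfolding elementary_qv_def using elementary_integrandD(3)[OF e]
  by (intro sum_nonneg) auto

lemma nn_integral_elementary_process:
  fixes \<xi> :: "nat \<Rightarrow> 'w \<Rightarrow> real^'e^'d"
  assumes e: "elementary_integrand F T n \<tau> \<xi>"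
  shows "(\<integral>\<^sup>+s. ennreal ((norm (elementary_process n \<tau> \<xi> s \<omega>))\<^sup>2) \<partial>time_measure T)
    = ennreal (elementary_qv n \<tau> \<xi> \<omega>)"
proof -
  note eD = elementary_integrandD[OF e]
  have m: "emeasure (time_measure T) {\<tau> k<..\<tau> (Suc k)} = ennreal (\<tau> (Suc k) - \<tau> k)" if "k < n" for k
  proof -
    have "{\<tau> k<..\<tau> (Suc k)} \<subseteq> {0..T}" using eD(1,2)[of k] eD(1,2)[of "Suc k"] that by auto
    then show ?thesis unfolding time_measure_def using eD(3)[OF that]
      by (subst emeasure_restrict_space) auto
  qed
  have s: "{\<tau> k<..\<tau> (Suc k)} \<in> sets (time_measure T)" if "k < n" for k
  proof -
    have "{\<tau> k<..\<tau> (Suc k)} \<inter> {0..T} = {\<tau> k<..\<tau> (Suc k)}"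
      using eD(1,2)[of k] eD(1,2)[of "Suc k"] that by auto
    then show ?thesis using borel_set_in_time_measure[of "{\<tau> k<..\<tau> (Suc k)}" T] by simp
  qed
  have "(\<integral>\<^sup>+s. ennreal ((norm (elementary_process n \<tau> \<xi> s \<omega>))\<^sup>2) \<partial>time_measure T)
    = (\<integral>\<^sup>+s. (\<Sum>k<n. ennreal ((norm (\<xi> k \<omega>))\<^sup>2) * indicator {\<tau> k<..\<tau> (Suc k)} s) \<partial>time_measure T)"
    unfolding elementary_process_norm[OF e]
    by (intro nn_integral_cong) (simp add: sum_ennreal[symmetric] indicator_def del: sum_ennreal)
  also have "\<dots> = (\<Sum>k<n. ennreal ((norm (\<xi> k \<omega>))\<^sup>2) * ennreal (\<tau> (Suc k) - \<tau> k))"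
    using s m by (subst nn_integral_sum) (auto simp: nn_integral_cmult_indicator)
  also have "\<dots> = (\<Sum>k<n. ennreal ((\<tau> (Suc k) - \<tau> k) * (norm (\<xi> k \<omega>))\<^sup>2))"
    using eD(3) by (intro sum.cong) (auto simp: ennreal_mult'[symmetric] mult.commute)
  also have "\<dots> = ennreal (elementary_qv n \<tau> \<xi> \<omega>)"
    unfolding elementary_qv_def using eD(3) by (intro sum_ennreal) auto
  finally show ?thesis .
qed

lemma measurable_elementary_process:
  fixes \<xi> :: "nat \<Rightarrow> 'w \<Rightarrow> real^'e^'d"
  assumes e: "elementary_integrand F T n \<tau> \<xi>"
  shows "case_prod (elementary_process n \<tau> \<xi>) \<in> borel_measurable (time_measure T \<Otimes>\<^sub>M M)"
proof -
  have [measurable]: "k < n \<Longrightarrow> \<xi> k \<in> borel_measurable M" for k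
    using elementary_integrandD(5)[OF e] .
  show ?thesis
    unfolding elementary_process_def split_beta'
  proof (rule borel_measurable_sum)
    fix k assume "k \<in> {..<n}"
    then have [measurable]: "\<xi> k \<in> borel_measurable M" by simp
    show "(\<lambda>x. indicator {\<tau> k<..\<tau> (Suc k)} (fst x) *\<^sub>R \<xi> k (snd x))
        \<in> borel_measurable (time_measure T \<Otimes>\<^sub>M M)"
      by measurable
  qed
qed

text \<open>Stopping on the grid: the coefficient is dropped from the first interval on whose
  quadratic variation would exceed \<open>R\<close>; this needs no stopping times.\<close>

definition truncate_coeffs ::
  "real \<Rightarrow> (nat \<Rightarrow> real) \<Rightarrow> (nat \<Rightarrow> 'w \<Rightarrow> real^'e^'d) \<Rightarrow> nat \<Rightarrow> 'w \<Rightarrow> real^'e^'d" where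
  "truncate_coeffs R \<tau> \<xi> k \<omega> = (if elementary_qv (Suc k) \<tau> \<xi> \<omega> \<le> R then \<xi> k \<omega> else 0)"

text \<open>Adaptedness survives because \<open>elementary_qv (Suc k)\<close>, the quadratic
  variation at the end of the \<open>k\<close>-th interval, involves only \<open>\<xi> 0\<close> to
  \<open>\<xi> k\<close> and is already known at its start \<open>\<tau> k\<close>. The decision to
  drop a coefficient never looks ahead.\<close>

lemma elementary_truncate:
  fixes \<xi> :: "nat \<Rightarrow> 'w \<Rightarrow> real^'e^'d"
  assumes e: "elementary_integrand F T n \<tau> \<xi>"
  shows "elementary_integrand F T n \<tau> (truncate_coeffs R \<tau> \<xi>)"
  unfolding elementary_integrand_def
proof (intro conjI allI impI)
  note eD = elementary_integrandD[OF e]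
  fix k
  show "k \<le> n \<Longrightarrow> \<tau> k \<in> {0..T}" using eD by simp
  assume k: "k < n"
  show "\<tau> k \<le> \<tau> (Suc k)" using eD k by simp
  have [measurable]: "\<xi> j \<in> borel_measurable (F (\<tau> k))" if "j \<le> k" for j
    using that k eD elementary_grid_mono[OF e that]
    by (intro F_measurable_mono[OF eD(4)[of j]]) auto
  have [measurable]: "elementary_qv (Suc k) \<tau> \<xi> \<in> borel_measurable (F (\<tau> k))"
    unfolding elementary_qv_def[abs_def] by (intro borel_measurable_sum) auto
  show "truncate_coeffs R \<tau> \<xi> k \<in> borel_measurable (F (\<tau> k))"
    unfolding truncate_coeffs_def[abs_def] by measurable
  obtain B where "\<forall>\<omega>\<in>space M. norm (\<xi> k \<omega>) \<le> B" using eD(6)[OF k] by auto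
  then show "bounded (truncate_coeffs R \<tau> \<xi> k ` space (F (\<tau> k)))"
    using space_F[of "\<tau> k"] eD(1,2)[of k] k
    by (auto simp: bounded_iff truncate_coeffs_def intro!: exI[of _ "max B 0"])
qed

lemma elementary_qv_Suc:
  "elementary_qv (Suc m) \<tau> \<xi> \<omega> = elementary_qv m \<tau> \<xi> \<omega> + (\<tau> (Suc m) - \<tau> m) * (norm (\<xi> m \<omega>))\<^sup>2"
  by (simp add: elementary_qv_def)

lemma elementary_qv_mono:
  assumes e: "elementary_integrand F T n \<tau> \<xi>" and "i \<le> j" "j \<le> n"
  shows "elementary_qv i \<tau> \<xi> \<omega> \<le> elementary_qv j \<tau> \<xi> \<omega>"
  using assms(2,3)
proof (induction rule: dec_induct)
  case (step m)
  then have "0 \<le> (\<tau> (Suc m) - \<tau> m) * (norm (\<xi> m \<omega>))\<^sup>2"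
    using elementary_integrandD(3)[OF e, of m] by simp
  then show ?case using step by (simp add: elementary_qv_Suc)
qed simp

text \<open>Induction on the grid: an interval is kept only if the full quadratic variation at its
  end is at most \<open>R\<close>, and up to there the truncated one is no larger; a dropped
  interval adds nothing.\<close>

lemma elementary_qv_truncate:
  assumes e: "elementary_integrand F T n \<tau> \<xi>" and R: "0 \<le> R"
  shows "elementary_qv n \<tau> (truncate_coeffs R \<tau> \<xi>) \<omega> \<le> min (elementary_qv n \<tau> \<xi> \<omega>) R"
proof -
  have "elementary_qv m \<tau> (truncate_coeffs R \<tau> \<xi>) \<omega> \<le> min (elementary_qv m \<tau> \<xi> \<omega>) R" if "m \<le> n" for m
    using that
  proof (induction m)
    case 0
    then show ?case using R by (simp add: elementary_qv_def)
  next
    case (Suc m)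
    then have IH: "elementary_qv m \<tau> (truncate_coeffs R \<tau> \<xi>) \<omega> \<le> min (elementary_qv m \<tau> \<xi> \<omega>) R"
      and "elementary_qv m \<tau> \<xi> \<omega> \<le> elementary_qv (Suc m) \<tau> \<xi> \<omega>"
      using elementary_qv_mono[OF e, of m "Suc m"] by auto
    moreover have "elementary_qv (Suc m) \<tau> (truncate_coeffs R \<tau> \<xi>) \<omega>
        = elementary_qv m \<tau> (truncate_coeffs R \<tau> \<xi>) \<omega>
          + (if elementary_qv (Suc m) \<tau> \<xi> \<omega> \<le> R then (\<tau> (Suc m) - \<tau> m) * (norm (\<xi> m \<omega>))\<^sup>2 else 0)"
      by (subst elementary_qv_Suc) (simp add: truncate_coeffs_def)
    ultimately show ?case
      using elementary_qv_Suc[of m \<tau> \<xi> \<omega>] by (auto split: if_splits)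
  qed
  then show ?thesis by simp
qed

text \<open>By monotonicity of the quadratic variation, a path whose total is at most
  \<open>R\<close> never triggers the truncation. On such paths the truncated integral may stand in
  for the original one.\<close>

lemma truncate_coeffs_eq:
  assumes e: "elementary_integrand F T n \<tau> \<xi>" and q: "elementary_qv n \<tau> \<xi> \<omega> \<le> R"
  shows "k < n \<Longrightarrow> truncate_coeffs R \<tau> \<xi> k \<omega> = \<xi> k \<omega>"
    and "elementary_process n \<tau> (truncate_coeffs R \<tau> \<xi>) s \<omega> = elementary_process n \<tau> \<xi> s \<omega>"
    and "elementary_integral W n \<tau> (truncate_coeffs R \<tau> \<xi>) t \<omega> = elementary_integral W n \<tau> \<xi> t \<omega>"
proof -
  show *: "truncate_coeffs R \<tau> \<xi> k \<omega> = \<xi> k \<omega>" if "k < n" for k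
    using q elementary_qv_mono[OF e, of "Suc k" n \<omega>] that by (simp add: truncate_coeffs_def)
  then show "elementary_process n \<tau> (truncate_coeffs R \<tau> \<xi>) s \<omega> = elementary_process n \<tau> \<xi> s \<omega>"
    and "elementary_integral W n \<tau> (truncate_coeffs R \<tau> \<xi>) t \<omega> = elementary_integral W n \<tau> \<xi> t \<omega>"
    by (simp_all add: elementary_process_def elementary_integral_def)
qed

text \<open>Multiplying the integrand by the indicator of \<open>A\<close> and of
  \<open>(s, t]\<close> amounts to clamping the grid to \<open>[s, t]\<close>. A coefficient whose
  interval starts before \<open>s\<close> is moved forward to \<open>s\<close>, where both it and
  \<open>A\<close> are known. One that starts after \<open>t\<close> would be moved backward to
  \<open>t\<close>, where it need not be known; it is set to 0, which changes nothing since its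
  clamped interval has length 0.\<close>

lemma elementary_restrict:
  fixes \<xi> :: "nat \<Rightarrow> 'w \<Rightarrow> real^'e^'d"
  assumes e: "elementary_integrand F T n \<tau> \<xi>" and st: "0 \<le> s" "s \<le> t" "t \<le> T" and A: "A \<in> sets (F s)"
  defines "\<tau>' \<equiv> \<lambda>k. min t (max s (\<tau> k))"
    and "\<xi>' \<equiv> \<lambda>k \<omega>. if \<tau> k < t then indicator A \<omega> *\<^sub>R \<xi> k \<omega> else 0"
  shows "elementary_integrand F T n \<tau>' \<xi>'"
    and "elementary_process n \<tau>' \<xi>' r \<omega>
      = (indicator A \<omega> * indicator {s<..t} r) *\<^sub>R elementary_process n \<tau> \<xi> r \<omega>"
    and "elementary_integral W n \<tau>' \<xi>' T \<omega>
      = indicator A \<omega> *\<^sub>R (elementary_integral W n \<tau> \<xi> t \<omega> - elementary_integral W n \<tau> \<xi> s \<omega>)"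
proof -
  note eD = elementary_integrandD[OF e]
  show "elementary_integrand F T n \<tau>' \<xi>'"
    unfolding elementary_integrand_def
  proof (intro conjI allI impI)
    fix k
    show *: "\<tau>' k \<in> {0..T}" using st by (auto simp: \<tau>'_def min_le_iff_disj le_max_iff_disj)
    assume k: "k < n"
    show "\<tau>' k \<le> \<tau>' (Suc k)" using eD(3)[OF k] by (auto simp: \<tau>'_def)
    have A': "A \<in> sets (F (\<tau>' k))" by (rule F_sets_mono[OF A]) (use st in \<open>auto simp: \<tau>'_def\<close>)
    show "\<xi>' k \<in> borel_measurable (F (\<tau>' k))"
    proof (cases "\<tau> k < t")
      case True
      have [measurable]: "\<xi> k \<in> borel_measurable (F (\<tau>' k))"
        by (rule F_measurable_mono[OF eD(4)[OF k]]) (use True st eD(1)[of k] k in \<open>auto simp: \<tau>'_def\<close>)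
      have "(\<lambda>\<omega>. indicator A \<omega> *\<^sub>R \<xi> k \<omega>) \<in> borel_measurable (F (\<tau>' k))"
        using A' by measurable
      then show ?thesis using True by (simp add: \<xi>'_def)
    qed (simp add: \<xi>'_def)
    obtain B where "\<forall>\<omega>\<in>space M. norm (\<xi> k \<omega>) \<le> B" using eD(6)[OF k] by auto
    then show "bounded (\<xi>' k ` space (F (\<tau>' k)))"
      using space_F[OF *] by (auto simp: bounded_iff \<xi>'_def indicator_def intro!: exI[of _ "max B 0"])
  qed
  show "elementary_process n \<tau>' \<xi>' r \<omega>
      = (indicator A \<omega> * indicator {s<..t} r) *\<^sub>R elementary_process n \<tau> \<xi> r \<omega>"
    unfolding elementary_process_def scaleR_sum_right
    by (intro sum.cong refl) (use st in \<open>auto simp: indicator_def \<tau>'_def \<xi>'_def\<close>)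
  have "elementary_integral W n \<tau>' \<xi>' T \<omega> = (\<Sum>k<n. indicator A \<omega> *\<^sub>R
      (\<xi> k \<omega> *v (W (min (\<tau> (Suc k)) t) \<omega> - W (min (\<tau> k) t) \<omega>)
      - \<xi> k \<omega> *v (W (min (\<tau> (Suc k)) s) \<omega> - W (min (\<tau> k) s) \<omega>)))"
    unfolding elementary_integral_def
  proof (intro sum.cong refl)
    fix k assume "k \<in> {..<n}"
    then have k: "k < n" by simp
    have le: "\<tau> k \<le> \<tau> (Suc k)" using eD(3)[OF k] .
    have cases: "\<not> \<tau> k < t \<or> (\<tau> k < t \<and> \<tau> k \<le> s \<and> \<tau> (Suc k) \<le> s) \<or>
      (\<tau> k < t \<and> \<tau> k \<le> s \<and> s < \<tau> (Suc k)) \<or> (\<tau> k < t \<and> s < \<tau> k)" by linarith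
    show "\<xi>' k \<omega> *v (W (min (\<tau>' (Suc k)) T) \<omega> - W (min (\<tau>' k) T) \<omega>) = indicator A \<omega> *\<^sub>R
      (\<xi> k \<omega> *v (W (min (\<tau> (Suc k)) t) \<omega> - W (min (\<tau> k) t) \<omega>)
      - \<xi> k \<omega> *v (W (min (\<tau> (Suc k)) s) \<omega> - W (min (\<tau> k) s) \<omega>))"
    proof (cases "t \<le> \<tau> k")
      case True
      then have "min (\<tau> (Suc k)) t = t" "min (\<tau> k) t = t" "min (\<tau> (Suc k)) s = s" "min (\<tau> k) s = s"
        using le st by auto
      then show ?thesis using True by (simp add: \<xi>'_def)
    qed (use cases le st in \<open>elim disjE\<close>, auto simp: \<tau>'_def \<xi>'_def min_def max_def indicator_def
          matrix_vector_mult_diff_distrib)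
  qed
  then show "elementary_integral W n \<tau>' \<xi>' T \<omega>
      = indicator A \<omega> *\<^sub>R (elementary_integral W n \<tau> \<xi> t \<omega> - elementary_integral W n \<tau> \<xi> s \<omega>)"
    by (simp add: elementary_integral_def sum_subtractf scaleR_sum_right scaleR_diff_right)
qed

end

text \<open>The coarse coefficient in force on the fine interval that starts at
  \<open>\<rho> j\<close>. Including the left and excluding the right endpoint of
  \<open>[\<tau> k, \<tau> (k + 1))\<close> assigns a shared grid point to one interval only and
  skips coarse intervals of length 0.\<close>

definition refine_coeffs ::
  "nat \<Rightarrow> (nat \<Rightarrow> real) \<Rightarrow> (nat \<Rightarrow> 'w \<Rightarrow> 'b::real_normed_vector) \<Rightarrow> (nat \<Rightarrow> real) \<Rightarrow> nat \<Rightarrow> 'w \<Rightarrow> 'b" where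
  "refine_coeffs n \<tau> \<xi> \<rho> j \<omega> = (\<Sum>k<n. if \<tau> k \<le> \<rho> j \<and> \<rho> j < \<tau> (Suc k) then \<xi> k \<omega> else 0)"

text \<open>The fine increments inside one coarse interval telescope. An arbitrary bounded bilinear
  \<open>op\<close> and an arbitrary \<open>G\<close> let the same computation handle the elementary
  process, with an indicator as increment, and the elementary integral, with an increment of
  \<open>W\<close>.\<close>

lemma sum_refine_coeffs:
  fixes op :: "'b::real_normed_vector \<Rightarrow> 'c::real_normed_vector \<Rightarrow> 'r::real_normed_vector"
  assumes op: "bounded_bilinear op"
    and \<rho>: "\<And>i j. i < j \<Longrightarrow> j \<le> N \<Longrightarrow> \<rho> i < \<rho> j"
    and mono: "\<And>k. k < n \<Longrightarrow> \<tau> k \<le> \<tau> (Suc k)"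
    and on: "\<And>k. k \<le> n \<Longrightarrow> \<tau> k \<in> \<rho> ` {..N}"
  shows "(\<Sum>j<N. op (refine_coeffs n \<tau> \<xi> \<rho> j \<omega>) (G (\<rho> (Suc j)) - G (\<rho> j)))
    = (\<Sum>k<n. op (\<xi> k \<omega>) (G (\<tau> (Suc k)) - G (\<tau> k)))"
proof -
  interpret bounded_bilinear op by (rule op)
  have inj: "\<rho> i < \<rho> j \<longleftrightarrow> i < j" if "i \<le> N" "j \<le> N" for i j
    using \<rho>[of i j] \<rho>[of j i] that by (metis less_asym linorder_neqE_nat)
  have tel: "(\<Sum>j<N. if \<tau> k \<le> \<rho> j \<and> \<rho> j < \<tau> (Suc k) then G (\<rho> (Suc j)) - G (\<rho> j) else 0)
      = G (\<tau> (Suc k)) - G (\<tau> k)" if k: "k < n" for k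
  proof -
    obtain \<alpha> \<beta> where ab: "\<tau> k = \<rho> \<alpha>" "\<tau> (Suc k) = \<rho> \<beta>" "\<alpha> \<le> N" "\<beta> \<le> N"
      using on[of k] on[of "Suc k"] k by auto
    have le: "\<alpha> \<le> \<beta>" using mono[OF k] inj[of \<beta> \<alpha>] ab by linarith
    have "(\<Sum>j<N. if \<tau> k \<le> \<rho> j \<and> \<rho> j < \<tau> (Suc k) then G (\<rho> (Suc j)) - G (\<rho> j) else 0)
        = (\<Sum>j\<in>{j\<in>{..<N}. \<tau> k \<le> \<rho> j \<and> \<rho> j < \<tau> (Suc k)}. G (\<rho> (Suc j)) - G (\<rho> j))"
      by (subst sum.inter_filter) auto
    also have "{j\<in>{..<N}. \<tau> k \<le> \<rho> j \<and> \<rho> j < \<tau> (Suc k)} = {\<alpha>..<\<beta>}"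
      unfolding ab(1,2) using inj ab(3,4) by (auto simp: not_less[symmetric])
    also have "(\<Sum>j=\<alpha>..<\<beta>. G (\<rho> (Suc j)) - G (\<rho> j)) = G (\<rho> \<beta>) - G (\<rho> \<alpha>)"
      using sum_Suc_diff'[OF le, of "\<lambda>j. G (\<rho> j)"] .
    finally show ?thesis using ab by simp
  qed
  have "(\<Sum>j<N. op (refine_coeffs n \<tau> \<xi> \<rho> j \<omega>) (G (\<rho> (Suc j)) - G (\<rho> j)))
     = (\<Sum>j<N. \<Sum>k<n. op (\<xi> k \<omega>) (if \<tau> k \<le> \<rho> j \<and> \<rho> j < \<tau> (Suc k) then G (\<rho> (Suc j)) - G (\<rho> j) else 0))"
    unfolding refine_coeffs_def sum_left by (intro sum.cong refl) (auto simp: zero_left zero_right)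
  also have "\<dots> = (\<Sum>k<n. op (\<xi> k \<omega>) (\<Sum>j<N. if \<tau> k \<le> \<rho> j \<and> \<rho> j < \<tau> (Suc k) then G (\<rho> (Suc j)) - G (\<rho> j) else 0))"
    by (subst sum.swap) (simp add: sum_right)
  also have "\<dots> = (\<Sum>k<n. op (\<xi> k \<omega>) (G (\<tau> (Suc k)) - G (\<tau> k)))"
    using tel by simp
  finally show ?thesis .
qed

text \<open>The Frobenius norm dominates the operator norm, whence the constant 1.\<close>

lemma bounded_bilinear_matrix_vector_mult:
  "bounded_bilinear (\<lambda>(A::real^'e^'d) v. A *v v)"
proof
  fix A A' :: "real^'e^'d" and v v' :: "real^'e" and r :: real
  show "(A + A') *v v = A *v v + A' *v v" by (simp add: matrix_vector_mult_add_rdistrib)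
  show "A *v (v + v') = A *v v + A *v v'" by (simp add: matrix_vector_right_distrib)
  show "(r *\<^sub>R A) *v v = r *\<^sub>R (A *v v)" by (simp add: scaleR_matrix_vector_assoc)
  show "A *v (r *\<^sub>R v) = r *\<^sub>R (A *v v)" by (simp add: matrix_vector_mult_scaleR)
  show "\<exists>K. \<forall>(A::real^'e^'d) v. norm (A *v v) \<le> norm A * norm v * K"
  proof (intro exI[of _ 1] allI)
    fix A :: "real^'e^'d" and v :: "real^'e"
    have "norm (A *v v) \<le> L2_set (\<lambda>i. norm (A $ i) * norm v) UNIV"
      unfolding norm_vec_def[of "A *v v"]
      by (intro L2_set_mono) (auto simp: matrix_mult_dot Cauchy_Schwarz_ineq2)
    also have "\<dots> = norm A * norm v * 1"
      by (simp add: L2_set_left_distrib norm_vec_def[of A])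
    finally show "norm (A *v v) \<le> norm A * norm v * 1" .
  qed
qed

context wiener_space
begin

lemma refine_coeffs_props:
  fixes \<xi> :: "nat \<Rightarrow> 'w \<Rightarrow> real^'e^'d"
  assumes e: "elementary_integrand F T n \<tau> \<xi>"
    and \<rho>: "\<And>i j. i < j \<Longrightarrow> j \<le> N \<Longrightarrow> \<rho> i < \<rho> j" "\<And>i. i \<le> N \<Longrightarrow> \<rho> i \<in> {0..T}"
    and on: "\<And>k. k \<le> n \<Longrightarrow> \<tau> k \<in> \<rho> ` {..N}"
  shows "j \<le> N \<Longrightarrow> refine_coeffs n \<tau> \<xi> \<rho> j \<in> borel_measurable (F (\<rho> j))"
    and "\<exists>B. \<forall>\<omega>\<in>space M. norm (refine_coeffs n \<tau> \<xi> \<rho> j \<omega>) \<le> B"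
    and "elementary_process N \<rho> (refine_coeffs n \<tau> \<xi> \<rho>) s \<omega> = elementary_process n \<tau> \<xi> s \<omega>"
    and "(\<Sum>k<N. refine_coeffs n \<tau> \<xi> \<rho> k \<omega> *v (W (\<rho> (Suc k)) \<omega> - W (\<rho> k) \<omega>))
      = elementary_integral W n \<tau> \<xi> T \<omega>"
proof -
  note eD = elementary_integrandD[OF e]
  show "refine_coeffs n \<tau> \<xi> \<rho> j \<in> borel_measurable (F (\<rho> j))" if j: "j \<le> N"
    unfolding refine_coeffs_def[abs_def]
  proof (rule borel_measurable_sum)
    fix k assume "k \<in> {..<n}"
    then have k: "k < n" by simp
    show "(\<lambda>\<omega>. if \<tau> k \<le> \<rho> j \<and> \<rho> j < \<tau> (Suc k) then \<xi> k \<omega> else 0) \<in> borel_measurable (F (\<rho> j))"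
    proof (cases "\<tau> k \<le> \<rho> j \<and> \<rho> j < \<tau> (Suc k)")
      case True
      have "\<xi> k \<in> borel_measurable (F (\<rho> j))"
        using True \<rho>(2)[OF j] eD(1)[of k] k by (intro F_measurable_mono[OF eD(4)[OF k]]) auto
      then show ?thesis using True by simp
    next
      case False
      then show ?thesis by (simp only: if_False) simp
    qed
  qed
  have "\<forall>k. \<exists>B. k < n \<longrightarrow> (\<forall>\<omega>\<in>space M. norm (\<xi> k \<omega>) \<le> B)" using eD(6) by blast
  then obtain B where B: "\<And>k \<omega>. k < n \<Longrightarrow> \<omega> \<in> space M \<Longrightarrow> norm (\<xi> k \<omega>) \<le> B k" by metis
  have "norm (refine_coeffs n \<tau> \<xi> \<rho> j \<omega>) \<le> (\<Sum>k<n. max 0 (B k))" if "\<omega> \<in> space M" for \<omega>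
    unfolding refine_coeffs_def using B that
    by (intro sum_norm_le) (auto simp: le_max_iff_disj)
  then show "\<exists>B. \<forall>\<omega>\<in>space M. norm (refine_coeffs n \<tau> \<xi> \<rho> j \<omega>) \<le> B" by blast
  have \<rho>le: "\<rho> j \<le> \<rho> (Suc j)" if "j < N" for j using \<rho>(1)[of j "Suc j"] that by simp
  \<comment> \<open>The step function \<open>1{s \<le> r}\<close> of the endpoint \<open>r\<close>
    has the indicator of \<open>(a, b]\<close> at \<open>s\<close> as its increment from
    \<open>a\<close> to \<open>b\<close>, which puts the process into the form of the telescoping
    lemma.\<close>
  let ?G = "\<lambda>r::real. if s \<le> r then 1 else 0 :: real"
  have ind: "indicator {a<..b} s = ?G b - ?G a" if "a \<le> b" for a b
    using that by (auto simp: indicator_def)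
  have "elementary_process N \<rho> (refine_coeffs n \<tau> \<xi> \<rho>) s \<omega>
      = (\<Sum>j<N. (\<lambda>x r. r *\<^sub>R x) (refine_coeffs n \<tau> \<xi> \<rho> j \<omega>) (?G (\<rho> (Suc j)) - ?G (\<rho> j)))"
    unfolding elementary_process_def using ind \<rho>le by (intro sum.cong refl) simp
  also have "\<dots> = (\<Sum>k<n. (\<lambda>x r. r *\<^sub>R x) (\<xi> k \<omega>) (?G (\<tau> (Suc k)) - ?G (\<tau> k)))"
    by (rule sum_refine_coeffs[OF bounded_bilinear.flip[OF bounded_bilinear_scaleR] \<rho>(1) _ on])
       (use eD in auto)
  also have "\<dots> = elementary_process n \<tau> \<xi> s \<omega>"
    unfolding elementary_process_def using ind eD(3) by (intro sum.cong refl) simp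
  finally show "elementary_process N \<rho> (refine_coeffs n \<tau> \<xi> \<rho>) s \<omega> = elementary_process n \<tau> \<xi> s \<omega>" .
  show "(\<Sum>k<N. refine_coeffs n \<tau> \<xi> \<rho> k \<omega> *v (W (\<rho> (Suc k)) \<omega> - W (\<rho> k) \<omega>))
      = elementary_integral W n \<tau> \<xi> T \<omega>"
    unfolding elementary_integral_T[OF e]
    by (rule sum_refine_coeffs[OF bounded_bilinear_matrix_vector_mult \<rho>(1) _ on, where G="\<lambda>r. W r \<omega>"])
       (use eD in auto)
qed

text \<open>Both integrands are rewritten on the union of their grids, sorted without repetition,
  and the coefficients are then combined interval by interval.\<close>

lemma elementary_linear:
  fixes \<xi>1 \<xi>2 :: "nat \<Rightarrow> 'w \<Rightarrow> real^'e^'d"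
  assumes e1: "elementary_integrand F T n1 \<tau>1 \<xi>1" and e2: "elementary_integrand F T n2 \<tau>2 \<xi>2"
  shows "\<exists>n \<tau> \<xi>. elementary_integrand F T n \<tau> \<xi> \<and>
    (\<forall>s \<omega>. elementary_process n \<tau> \<xi> s \<omega>
      = elementary_process n1 \<tau>1 \<xi>1 s \<omega> + c *\<^sub>R elementary_process n2 \<tau>2 \<xi>2 s \<omega>) \<and>
    (\<forall>\<omega>. elementary_integral W n \<tau> \<xi> T \<omega>
      = elementary_integral W n1 \<tau>1 \<xi>1 T \<omega> + c *\<^sub>R elementary_integral W n2 \<tau>2 \<xi>2 T \<omega>)"
proof -
  define S where "S = \<tau>1 ` {..n1} \<union> \<tau>2 ` {..n2}"
  have S: "finite S" "S \<noteq> {}" "S \<subseteq> {0..T}"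
    using elementary_integrandD(1,2)[OF e1] elementary_integrandD(1,2)[OF e2] by (auto simp: S_def)
  define xs where "xs = sorted_list_of_set S"
  \<comment> \<open>\<open>card S\<close> grid points bound one interval fewer.\<close>
  define N where "N = card S - 1"
  define \<rho> where "\<rho> k = xs ! k" for k
  have len: "length xs = Suc N" using S by (simp add: xs_def N_def card_gt_0_iff)
  have set: "set xs = S" using S by (simp add: xs_def)
  have img: "\<rho> ` {..N} = S"
    unfolding set[symmetric] \<rho>_def using len by (auto simp: in_set_conv_nth image_iff less_Suc_eq_le)
  have \<rho>: "\<rho> i < \<rho> j" if "i < j" "j \<le> N" for i j
    using that len strict_sorted_list_of_set[of S] unfolding \<rho>_def xs_def
    by (intro sorted_wrt_nth_less[of "(<)"]) auto
  have \<rho>T: "\<rho> i \<in> {0..T}" if "i \<le> N" for i using img S that by auto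
  have on1: "\<And>k. k \<le> n1 \<Longrightarrow> \<tau>1 k \<in> \<rho> ` {..N}" and on2: "\<And>k. k \<le> n2 \<Longrightarrow> \<tau>2 k \<in> \<rho> ` {..N}"
    unfolding img S_def by auto
  note r1 = refine_coeffs_props[OF e1 \<rho> \<rho>T on1] and r2 = refine_coeffs_props[OF e2 \<rho> \<rho>T on2]
  define \<xi> where "\<xi> k \<omega> = refine_coeffs n1 \<tau>1 \<xi>1 \<rho> k \<omega> + c *\<^sub>R refine_coeffs n2 \<tau>2 \<xi>2 \<rho> k \<omega>" for k \<omega>
  have e: "elementary_integrand F T N \<rho> \<xi>"
    unfolding elementary_integrand_def
  proof (intro conjI allI impI)
    fix k
    show "k \<le> N \<Longrightarrow> \<rho> k \<in> {0..T}" by (rule \<rho>T)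
    assume k: "k < N"
    show "\<rho> k \<le> \<rho> (Suc k)" using \<rho>[of k "Suc k"] k by simp
    have [measurable]: "refine_coeffs n1 \<tau>1 \<xi>1 \<rho> k \<in> borel_measurable (F (\<rho> k))"
      "refine_coeffs n2 \<tau>2 \<xi>2 \<rho> k \<in> borel_measurable (F (\<rho> k))"
      using r1(1)[of k] r2(1)[of k] k by auto
    show "\<xi> k \<in> borel_measurable (F (\<rho> k))" unfolding \<xi>_def[abs_def] by measurable
    obtain B1 B2 where B: "\<forall>\<omega>\<in>space M. norm (refine_coeffs n1 \<tau>1 \<xi>1 \<rho> k \<omega>) \<le> B1"
        "\<forall>\<omega>\<in>space M. norm (refine_coeffs n2 \<tau>2 \<xi>2 \<rho> k \<omega>) \<le> B2"
      using r1(2)[of k] r2(2)[of k] by auto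
    have "norm (\<xi> k \<omega>) \<le> B1 + \<bar>c\<bar> * B2" if "\<omega> \<in> space M" for \<omega>
      unfolding \<xi>_def using B that
      by (intro order_trans[OF norm_triangle_ineq]) (auto intro!: add_mono mult_left_mono)
    then show "bounded (\<xi> k ` space (F (\<rho> k)))"
      using space_F[OF \<rho>T[of k]] k by (auto simp: bounded_iff)
  qed
  have "elementary_process N \<rho> \<xi> s \<omega> = elementary_process n1 \<tau>1 \<xi>1 s \<omega> + c *\<^sub>R elementary_process n2 \<tau>2 \<xi>2 s \<omega>" for s \<omega>
  proof -
    have "elementary_process N \<rho> \<xi> s \<omega> = elementary_process N \<rho> (refine_coeffs n1 \<tau>1 \<xi>1 \<rho>) s \<omega>
        + c *\<^sub>R elementary_process N \<rho> (refine_coeffs n2 \<tau>2 \<xi>2 \<rho>) s \<omega>"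
      unfolding elementary_process_def \<xi>_def scaleR_sum_right sum.distrib[symmetric]
      by (intro sum.cong refl) (simp add: scaleR_add_right mult.commute)
    then show ?thesis using r1(3) r2(3) by simp
  qed
  moreover have "elementary_integral W N \<rho> \<xi> T \<omega>
      = elementary_integral W n1 \<tau>1 \<xi>1 T \<omega> + c *\<^sub>R elementary_integral W n2 \<tau>2 \<xi>2 T \<omega>" for \<omega>
    using r1(4)[of \<omega>] r2(4)[of \<omega>] unfolding elementary_integral_T[OF e]
    by (simp add: \<xi>_def sum.distrib matrix_vector_mult_add_rdistrib
        scaleR_matrix_vector_assoc[symmetric] scaleR_sum_right[symmetric])
  ultimately show ?thesis using e by blast
qed

end

section \<open>Convergence lemmas\<close>

text \<open>Young's inequality with a free weight. For \<open>\<delta> = 1\<close> it gives the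
  usual factor 2; for small \<open>\<delta>\<close> the factor of \<open>|y|^2\<close> is close to
  1, which is what convergence of squared norms requires.\<close>

lemma norm_square_weighted:
  fixes x y :: "'b::real_normed_vector"
  assumes "0 < \<delta>"
  shows "(norm x)\<^sup>2 \<le> (1 + \<delta>) * (norm y)\<^sup>2 + (1 + 1 / \<delta>) * (norm (x - y))\<^sup>2"
proof -
  let ?p = "norm y" and ?q = "norm (x - y)"
  have "norm x \<le> ?p + ?q" using norm_triangle_ineq[of y "x - y"] by simp
  then have "(norm x)\<^sup>2 \<le> (?p + ?q)\<^sup>2" by (intro power_mono) auto
  moreover have "0 \<le> (\<delta> * ?p - ?q)\<^sup>2 / \<delta>" using assms by simp
  then have "2 * ?p * ?q \<le> \<delta> * ?p\<^sup>2 + ?q\<^sup>2 / \<delta>"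
    using assms by (simp add: power2_eq_square field_simps)
  ultimately show ?thesis by (simp add: power2_sum algebra_simps)
qed

lemma norm_square_add_le:
  fixes x y :: "'b::real_normed_vector"
  shows "(norm (x + y))\<^sup>2 \<le> 2 * (norm x)\<^sup>2 + 2 * (norm y)\<^sup>2"
  using norm_square_weighted[of 1 "x + y" x] by simp

lemma norm_square_diff_le:
  fixes x y :: "'b::real_normed_vector"
  shows "(norm (x - y))\<^sup>2 \<le> 2 * (norm x)\<^sup>2 + 2 * (norm y)\<^sup>2"
  using norm_square_add_le[of x "- y"] by simp

lemma nn_integral_square_weighted:
  fixes h k :: "'c \<Rightarrow> 'b::{real_normed_vector, second_countable_topology}"
  assumes [measurable]: "h \<in> borel_measurable N" "k \<in> borel_measurable N" and \<delta>: "0 < \<delta>"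
  shows "(\<integral>\<^sup>+s. ennreal ((norm (h s))\<^sup>2) \<partial>N) \<le> ennreal (1 + \<delta>) * (\<integral>\<^sup>+s. ennreal ((norm (k s))\<^sup>2) \<partial>N)
    + ennreal (1 + 1 / \<delta>) * (\<integral>\<^sup>+s. ennreal ((norm (h s - k s))\<^sup>2) \<partial>N)"
proof -
  have "(\<integral>\<^sup>+s. ennreal ((norm (h s))\<^sup>2) \<partial>N)
    \<le> (\<integral>\<^sup>+s. ennreal (1 + \<delta>) * ennreal ((norm (k s))\<^sup>2) + ennreal (1 + 1 / \<delta>) * ennreal ((norm (h s - k s))\<^sup>2) \<partial>N)"
    using norm_square_weighted[OF \<delta>] \<delta>
    by (intro nn_integral_mono) (simp add: ennreal_mult[symmetric] ennreal_plus[symmetric] ennreal_leI del: ennreal_plus)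
  also have "\<dots> = ennreal (1 + \<delta>) * (\<integral>\<^sup>+s. ennreal ((norm (k s))\<^sup>2) \<partial>N)
    + ennreal (1 + 1 / \<delta>) * (\<integral>\<^sup>+s. ennreal ((norm (h s - k s))\<^sup>2) \<partial>N)"
    by (simp add: nn_integral_add nn_integral_cmult)
  finally show ?thesis .
qed

text \<open>Convergence in mean square implies convergence of the squared norms. The weighted
  inequality is applied in both directions between \<open>hm m\<close> and \<open>h\<close>;
  \<open>\<delta>\<close> is fixed in advance, and the term with the large factor
  \<open>1 + 1 / \<delta>\<close> then tends to 0.\<close>

lemma nn_integral_square_tendsto:
  fixes h :: "'c \<Rightarrow> 'b::{real_normed_vector, second_countable_topology}"
  assumes hm: "\<And>m. hm m \<in> borel_measurable N" and h: "h \<in> borel_measurable N"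
    and fm: "\<And>m. (\<integral>\<^sup>+s. ennreal ((norm (hm m s))\<^sup>2) \<partial>N) < \<infinity>"
    and f: "(\<integral>\<^sup>+s. ennreal ((norm (h s))\<^sup>2) \<partial>N) < \<infinity>"
    and lim: "(\<lambda>m::nat. \<integral>\<^sup>+s. ennreal ((norm (hm m s - h s))\<^sup>2) \<partial>N) \<longlonglongrightarrow> 0"
  shows "(\<lambda>m. \<integral>\<^sup>+s. ennreal ((norm (hm m s))\<^sup>2) \<partial>N) \<longlonglongrightarrow> (\<integral>\<^sup>+s. ennreal ((norm (h s))\<^sup>2) \<partial>N)"
proof -
  note [measurable] = hm h
  obtain A where A: "(\<integral>\<^sup>+s. ennreal ((norm (h s))\<^sup>2) \<partial>N) = ennreal A" "0 \<le> A"
    using f by (cases "\<integral>\<^sup>+s. ennreal ((norm (h s))\<^sup>2) \<partial>N") auto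
  define B where "B m = enn2real (\<integral>\<^sup>+s. ennreal ((norm (hm m s))\<^sup>2) \<partial>N)" for m
  have B: "(\<integral>\<^sup>+s. ennreal ((norm (hm m s))\<^sup>2) \<partial>N) = ennreal (B m)" "0 \<le> B m" for m
    using fm[of m] by (auto simp: B_def less_top)
  define D where "D m = enn2real (\<integral>\<^sup>+s. ennreal ((norm (hm m s - h s))\<^sup>2) \<partial>N)" for m
  have "(\<integral>\<^sup>+s. ennreal ((norm (hm m s - h s))\<^sup>2) \<partial>N) < \<infinity>" for m
    using nn_integral_square_weighted[of "\<lambda>s. hm m s - h s" N "hm m" 1] A B(1)[of m]
    by (simp add: ennreal_mult[symmetric] le_less_trans ennreal_mult_less_top)
  then have D: "(\<integral>\<^sup>+s. ennreal ((norm (hm m s - h s))\<^sup>2) \<partial>N) = ennreal (D m)" "0 \<le> D m" for m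
    by (auto simp: D_def less_top)
  have D': "(\<integral>\<^sup>+s. ennreal ((norm (h s - hm m s))\<^sup>2) \<partial>N) = ennreal (D m)" for m
    using D(1)[of m] by (simp add: norm_minus_commute)
  have le: "B m \<le> (1 + \<delta>) * A + (1 + 1 / \<delta>) * D m" "A \<le> (1 + \<delta>) * B m + (1 + 1 / \<delta>) * D m" if "0 < \<delta>" for \<delta> m
    using nn_integral_square_weighted[OF hm[of m] h that] nn_integral_square_weighted[OF h hm[of m] that]
      that A(2) B(2)[of m] D(2)[of m] unfolding A(1) B(1) D(1) D'
    by (auto simp: ennreal_mult[symmetric] ennreal_plus[symmetric] simp del: ennreal_plus)
  have D0: "D \<longlonglongrightarrow> 0"
  proof (rule tendsto_ennrealD)
    show "(\<lambda>m. ennreal (D m)) \<longlonglongrightarrow> ennreal 0" using lim unfolding D(1) by simp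
  qed (use D(2) in auto)
  have "B \<longlonglongrightarrow> A"
  proof (rule LIMSEQ_I)
    fix \<epsilon> :: real assume \<epsilon>: "0 < \<epsilon>"
    \<comment> \<open>The bound \<open>\<epsilon> / (4 (A + 1))\<close> keeps the error
      \<open>2 \<delta> A\<close> below \<open>\<epsilon> / 2\<close>, with \<open>A + 1\<close>
      avoiding a division by 0; the cap 1 allows \<open>\<delta>^2 A\<close> to be estimated by
      \<open>\<delta> A\<close>.\<close>
    define \<delta> where "\<delta> = min 1 (\<epsilon> / (4 * (A + 1)))"
    have \<delta>: "0 < \<delta>" "\<delta> \<le> 1" using \<epsilon> A(2) by (auto simp: \<delta>_def)
    have "\<delta> * (4 * (A + 1)) \<le> \<epsilon>"
    proof -
      have "\<delta> * (4 * (A + 1)) \<le> \<epsilon> / (4 * (A + 1)) * (4 * (A + 1))"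
        using A(2) by (intro mult_right_mono) (auto simp: \<delta>_def)
      then show ?thesis using A(2) by simp
    qed
    then have dA: "2 * (\<delta> * A) < \<epsilon> / 2" using \<delta> by (simp add: algebra_simps)
    have "(\<lambda>m. 2 * (1 + 1 / \<delta>) * D m) \<longlonglongrightarrow> 2 * (1 + 1 / \<delta>) * 0"
      by (intro tendsto_intros D0)
    then have "eventually (\<lambda>m. 2 * (1 + 1 / \<delta>) * D m < \<epsilon> / 2) sequentially"
      using \<epsilon> by (intro order_tendstoD(2)) auto
    then obtain m0 where m0: "\<And>m. m0 \<le> m \<Longrightarrow> 2 * (1 + 1 / \<delta>) * D m < \<epsilon> / 2"
      by (auto simp: eventually_sequentially)
    have "norm (B m - A) < \<epsilon>" if "m0 \<le> m" for m
    proof -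
      let ?E = "(1 + 1 / \<delta>) * D m"
      have E: "0 \<le> ?E" "2 * ?E < \<epsilon> / 2"
        using D(2)[of m] \<delta> m0[OF that] by (simp, simp only: mult.assoc)
      have 1: "B m \<le> A + \<delta> * A + ?E" and 2: "A \<le> B m + \<delta> * B m + ?E"
        using le[OF \<delta>(1), of m] by (auto simp: algebra_simps)
      have "\<delta> * B m \<le> \<delta> * (A + \<delta> * A + ?E)" using 1 \<delta> by (intro mult_left_mono) auto
      also have "\<dots> \<le> \<delta> * A + \<delta> * A + ?E"
      proof -
        have "\<delta> * (\<delta> * A) \<le> \<delta> * A" "\<delta> * ?E \<le> ?E"
          using \<delta> A(2) E(1) by (intro mult_left_le_one_le; simp)+
        then show ?thesis unfolding distrib_left by linarith
      qed
      finally have 3: "\<delta> * B m \<le> \<delta> * A + \<delta> * A + ?E" .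
      have 4: "0 \<le> \<delta> * A" using \<delta> A(2) by simp
      show ?thesis using 1 2 3 4 E dA unfolding real_norm_def abs_less_iff by linarith
    qed
    then show "\<exists>m0. \<forall>m\<ge>m0. norm (B m - A) < \<epsilon>" by blast
  qed
  then show ?thesis unfolding A(1) B(1) by (rule tendsto_ennrealI)
qed

text \<open>Convergence in measure of \<open>ennreal\<close>-valued functions is reduced to
  \<open>L1\<close> convergence of the real truncations \<open>min (f m) 1\<close>, which yields an
  almost everywhere convergent subsequence. Below level 1 the truncation is \<open>f\<close> itself,
  so the null limit is also that of \<open>f\<close>.\<close>

lemma (in finite_measure) AE_convergent_subsequence:
  fixes f :: "nat \<Rightarrow> 'a \<Rightarrow> ennreal"
  assumes [measurable]: "\<And>m. f m \<in> borel_measurable M"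
    and lim: "\<And>\<epsilon>. 0 < \<epsilon> \<Longrightarrow> (\<lambda>m. measure M {\<omega>\<in>space M. ennreal \<epsilon> < f m \<omega>}) \<longlonglongrightarrow> 0"
  shows "\<exists>r. strict_mono r \<and> (AE \<omega> in M. (\<lambda>m. f (r m) \<omega>) \<longlonglongrightarrow> 0)"
proof -
  define u where "u m \<omega> = enn2real (min (f m \<omega>) 1)" for m \<omega>
  have u01: "0 \<le> u m \<omega>" "u m \<omega> \<le> 1" for m \<omega>
    by (auto simp: u_def enn2real_leI)
  have [measurable]: "u m \<in> borel_measurable M" for m unfolding u_def[abs_def] by measurable
  have iu: "integrable M (u m)" for m
    by (rule integrable_const_bound[of _ 1]) (use u01 in auto)
  have "(\<lambda>m. \<integral>\<omega>. norm (u m \<omega>) \<partial>M) \<longlonglongrightarrow> 0"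
  proof (rule LIMSEQ_I)
    fix \<epsilon> :: real assume \<epsilon>: "0 < \<epsilon>"
    define c where "c = measure M (space M) + 1"
    have c: "0 < c" by (simp add: c_def add_nonneg_pos)
    define \<delta> where "\<delta> = \<epsilon> / (2 * c)"
    have \<delta>: "0 < \<delta>" using \<epsilon> c by (simp add: \<delta>_def)
    have "eventually (\<lambda>m. measure M {\<omega>\<in>space M. ennreal \<delta> < f m \<omega>} < \<epsilon> / 2) sequentially"
      using lim[OF \<delta>] \<epsilon> by (intro order_tendstoD(2)) auto
    then obtain m0 where m0: "\<And>m. m0 \<le> m \<Longrightarrow> measure M {\<omega>\<in>space M. ennreal \<delta> < f m \<omega>} < \<epsilon> / 2"
      by (auto simp: eventually_sequentially)
    have "norm ((\<integral>\<omega>. norm (u m \<omega>) \<partial>M) - 0) < \<epsilon>" if m: "m0 \<le> m" for m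
    proof -
      let ?S = "{\<omega>\<in>space M. ennreal \<delta> < f m \<omega>}"
      have "(\<integral>\<omega>. norm (u m \<omega>) \<partial>M) \<le> (\<integral>\<omega>. \<delta> + indicator ?S \<omega> \<partial>M)"
      proof (rule integral_mono)
        fix \<omega> assume w: "\<omega> \<in> space M"
        show "norm (u m \<omega>) \<le> \<delta> + indicator ?S \<omega>"
        proof (cases "ennreal \<delta> < f m \<omega>")
          case True
          then show ?thesis using u01[of m \<omega>] w \<delta> by simp
        next
          case False
          then have "u m \<omega> \<le> \<delta>" unfolding u_def using \<delta> by (intro enn2real_leI) (auto simp: min_le_iff_disj)
          then show ?thesis using u01[of m \<omega>] by (simp add: indicator_def)
        qed
      next
        show "integrable M (\<lambda>\<omega>. \<delta> + indicator ?S \<omega>)"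
          by (intro Bochner_Integration.integrable_add integrable_real_indicator)
             (auto simp: less_top[symmetric])
      qed (use iu in auto)
      also have "\<dots> = \<delta> * measure M (space M) + measure M ?S"
        by (subst Bochner_Integration.integral_add) (auto simp: less_top[symmetric] mult.commute)
      also have "\<delta> * measure M (space M) \<le> \<epsilon> / 2"
      proof -
        have "\<delta> * measure M (space M) \<le> \<delta> * c" using \<delta> by (intro mult_left_mono) (auto simp: c_def)
        also have "\<dots> = \<epsilon> / 2" using c by (simp add: \<delta>_def)
        finally show ?thesis .
      qed
      finally show ?thesis using m0[OF m] u01 by (simp add: abs_of_nonneg)
    qed
    then show "\<exists>m0. \<forall>m\<ge>m0. norm ((\<integral>\<omega>. norm (u m \<omega>) \<partial>M) - 0) < \<epsilon>" by blast
  qed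
  from tendsto_L1_AE_subseq[OF iu this]
  obtain r where r: "strict_mono r" "AE \<omega> in M. (\<lambda>m. u (r m) \<omega>) \<longlonglongrightarrow> 0" by auto
  have "(\<lambda>m. f (r m) \<omega>) \<longlonglongrightarrow> 0" if "(\<lambda>m. u (r m) \<omega>) \<longlonglongrightarrow> 0" for \<omega>
  proof -
    have "(\<lambda>m. ennreal (u (r m) \<omega>)) \<longlonglongrightarrow> ennreal 0" by (rule tendsto_ennrealI[OF that])
    moreover have "eventually (\<lambda>m. u (r m) \<omega> < 1) sequentially"
      using that by (intro order_tendstoD(2)) auto
    then have "eventually (\<lambda>m. ennreal (u (r m) \<omega>) = f (r m) \<omega>) sequentially"
    proof eventually_elim
      case (elim m)
      have eq: "ennreal (u (r m) \<omega>) = min (f (r m) \<omega>) 1"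
        unfolding u_def by (rule ennreal_enn2real) (simp add: min_less_iff_disj)
      have "ennreal (u (r m) \<omega>) < 1" using elim u01(1)[of "r m" \<omega>] by (simp add: ennreal_less_iff flip: ennreal_1)
      then show ?case unfolding eq by (auto simp: min_def split: if_splits)
    qed
    ultimately show ?thesis using tendsto_cong by force
  qed
  then show ?thesis using r by (intro exI[of _ r]) auto
qed

section \<open>Ito integrals over the whole interval\<close>

context wiener_space
begin

sublocale TM: finite_measure "time_measure T" by simp

sublocale TP: pair_sigma_finite "time_measure T" M ..

text \<open>For an integrand of \<open>W\<close> this is the quadratic variation at
  \<open>T\<close>. Its values lie in \<open>ennreal\<close>, so Tonelli's theorem applies before
  any integrability is established.\<close>

definition energy :: "(real \<Rightarrow> 'w \<Rightarrow> 'b::real_normed_vector) \<Rightarrow> 'w \<Rightarrow> ennreal" where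
  "energy H \<omega> = (\<integral>\<^sup>+s. ennreal ((norm (H s \<omega>))\<^sup>2) \<partial>time_measure T)"

lemma energy_measurable:
  fixes H :: "real \<Rightarrow> 'w \<Rightarrow> 'b::{real_normed_vector, second_countable_topology}"
  assumes [measurable]: "case_prod H \<in> borel_measurable (time_measure T \<Otimes>\<^sub>M M)"
  shows "energy H \<in> borel_measurable M"
  unfolding energy_def[abs_def] by measurable

lemma section_measurable:
  assumes "case_prod H \<in> measurable (time_measure T \<Otimes>\<^sub>M M) N" "\<omega> \<in> space M"
  shows "(\<lambda>s. H s \<omega>) \<in> measurable (time_measure T) N"
  using measurable_compose[OF measurable_Pair2'[OF assms(2)] assms(1)] by simp

lemma energy_elementary:
  fixes \<xi> :: "nat \<Rightarrow> 'w \<Rightarrow> real^'e^'d"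
  assumes "elementary_integrand F T n \<tau> \<xi>"
  shows "energy (elementary_process n \<tau> \<xi>) \<omega> = ennreal (elementary_qv n \<tau> \<xi> \<omega>)"
  unfolding energy_def by (rule nn_integral_elementary_process[OF assms])

lemma progressive_joint:
  assumes "progressively_measurable F T X"
  shows "case_prod X \<in> borel_measurable (time_measure T \<Otimes>\<^sub>M M)"
proof -
  have 1: "(\<lambda>(s, \<omega>). X s \<omega>) \<in> borel_measurable (restrict_space borel {0..T} \<Otimes>\<^sub>M F T)"
    using assms T_pos by (simp add: progressively_measurable_def)
  have id: "(\<lambda>\<omega>. \<omega>) \<in> measurable M (F T)"
    using subalgebra_F[of T] T_pos by (auto intro!: measurableI simp: subalgebra_def sets.Int_space_eq2)
  have id2: "(\<lambda>s. s) \<in> measurable (time_measure T) (restrict_space borel {0..T})"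
    by (simp add: measurable_cong_sets[OF sets_time_measure refl])
  have "(\<lambda>z. (fst z, snd z)) \<in> measurable (time_measure T \<Otimes>\<^sub>M M) (restrict_space borel {0..T} \<Otimes>\<^sub>M F T)"
    by (intro measurable_Pair measurable_compose[OF measurable_fst id2] measurable_compose[OF measurable_snd id])
  from measurable_compose[OF this 1] show ?thesis by (simp add: split_beta')
qed

text \<open>The relation \<open>\<eta> = \<integral> H dW\<close> over the whole interval. Integrals
  over \<open>(s, t]\<close>, restricted to an event, are expressed by indicators inside
  \<open>H\<close>, so time disappears from the relation. Approximation is almost sure instead of in
  probability: such limits combine directly in sums and feed Fatou's lemma, and passing to a
  subsequence provides them.\<close>

definition ito_var :: "(real \<Rightarrow> 'w \<Rightarrow> real^'e^'d) \<Rightarrow> ('w \<Rightarrow> real^'d) \<Rightarrow> bool" where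
  "ito_var H \<eta> \<longleftrightarrow>
     case_prod H \<in> borel_measurable (time_measure T \<Otimes>\<^sub>M M) \<and> \<eta> \<in> borel_measurable M \<and>
     (AE \<omega> in M. energy H \<omega> < \<infinity>) \<and>
     (\<exists>n \<tau> \<xi>. (\<forall>m::nat. elementary_integrand F T (n m) (\<tau> m) (\<xi> m)) \<and>
        (AE \<omega> in M. (\<lambda>m. energy (\<lambda>s \<omega>. elementary_process (n m) (\<tau> m) (\<xi> m) s \<omega> - H s \<omega>) \<omega>) \<longlonglongrightarrow> 0 \<and>
           (\<lambda>m. elementary_integral W (n m) (\<tau> m) (\<xi> m) T \<omega>) \<longlonglongrightarrow> \<eta> \<omega>))"

lemma ito_varD:
  assumes "ito_var H \<eta>"
  shows "case_prod H \<in> borel_measurable (time_measure T \<Otimes>\<^sub>M M)" "\<eta> \<in> borel_measurable M"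
    "AE \<omega> in M. energy H \<omega> < \<infinity>"
  using assms by (auto simp: ito_var_def)

lemma ito_var_elementary:
  fixes \<xi> :: "nat \<Rightarrow> 'w \<Rightarrow> real^'e^'d"
  assumes e: "elementary_integrand F T n \<tau> \<xi>"
  shows "ito_var (elementary_process n \<tau> \<xi>) (elementary_integral W n \<tau> \<xi> T)"
  unfolding ito_var_def
proof (intro conjI exI)
  show "\<forall>m::nat. elementary_integrand F T ((\<lambda>_. n) m) ((\<lambda>_. \<tau>) m) ((\<lambda>_. \<xi>) m)" using e by simp
qed (use measurable_elementary_process[OF e] elementary_isometry(1)[OF e] in
  \<open>auto simp: energy_elementary[OF e], simp_all add: energy_def\<close>)

text \<open>The approximants are combined on a common grid. The energy of a sum is at most a
  weighted sum of the two energies, so the approximation errors vanish together.\<close>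

lemma ito_var_linear:
  fixes H1 H2 :: "real \<Rightarrow> 'w \<Rightarrow> real^'e^'d"
  assumes 1: "ito_var H1 \<eta>1" and 2: "ito_var H2 \<eta>2"
  shows "ito_var (\<lambda>s \<omega>. H1 s \<omega> + c *\<^sub>R H2 s \<omega>) (\<lambda>\<omega>. \<eta>1 \<omega> + c *\<^sub>R \<eta>2 \<omega>)"
proof -
  note [measurable] = ito_varD(1,2)[OF 1] ito_varD(1,2)[OF 2]
  have en: "energy (\<lambda>s \<omega>. G1 s \<omega> + c *\<^sub>R G2 s \<omega>) \<omega> \<le> 2 * energy G1 \<omega> + ennreal (2 * c\<^sup>2) * energy G2 \<omega>"
    if [measurable]: "(\<lambda>s. G1 s \<omega>) \<in> borel_measurable (time_measure T)" "(\<lambda>s. G2 s \<omega>) \<in> borel_measurable (time_measure T)"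
    for G1 G2 :: "real \<Rightarrow> 'w \<Rightarrow> real^'e^'d" and \<omega>
  proof -
    have "energy (\<lambda>s \<omega>. G1 s \<omega> + c *\<^sub>R G2 s \<omega>) \<omega>
        \<le> (\<integral>\<^sup>+s. 2 * ennreal ((norm (G1 s \<omega>))\<^sup>2) + ennreal (2 * c\<^sup>2) * ennreal ((norm (G2 s \<omega>))\<^sup>2) \<partial>time_measure T)"
      unfolding energy_def
    proof (rule nn_integral_mono)
      fix s
      have "ennreal ((norm (G1 s \<omega> + c *\<^sub>R G2 s \<omega>))\<^sup>2)
          \<le> ennreal (2 * (norm (G1 s \<omega>))\<^sup>2 + 2 * c\<^sup>2 * (norm (G2 s \<omega>))\<^sup>2)"
        using norm_square_add_le[of "G1 s \<omega>" "c *\<^sub>R G2 s \<omega>"]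
        by (intro ennreal_leI) (simp add: power_mult_distrib)
      also have "\<dots> = 2 * ennreal ((norm (G1 s \<omega>))\<^sup>2) + ennreal (2 * c\<^sup>2) * ennreal ((norm (G2 s \<omega>))\<^sup>2)"
        by (simp add: ennreal_mult)
      finally show "ennreal ((norm (G1 s \<omega> + c *\<^sub>R G2 s \<omega>))\<^sup>2)
        \<le> 2 * ennreal ((norm (G1 s \<omega>))\<^sup>2) + ennreal (2 * c\<^sup>2) * ennreal ((norm (G2 s \<omega>))\<^sup>2)" .
    qed
    also have "\<dots> = 2 * energy G1 \<omega> + ennreal (2 * c\<^sup>2) * energy G2 \<omega>"
      by (simp add: energy_def nn_integral_add nn_integral_cmult)
    finally show ?thesis .
  qed
  obtain n1 \<tau>1 \<xi>1 where e1: "\<And>m::nat. elementary_integrand F T (n1 m) (\<tau>1 m) (\<xi>1 m)"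
    and l1: "AE \<omega> in M. (\<lambda>m. energy (\<lambda>s \<omega>. elementary_process (n1 m) (\<tau>1 m) (\<xi>1 m) s \<omega> - H1 s \<omega>) \<omega>) \<longlonglongrightarrow> 0 \<and>
           (\<lambda>m. elementary_integral W (n1 m) (\<tau>1 m) (\<xi>1 m) T \<omega>) \<longlonglongrightarrow> \<eta>1 \<omega>"
    using 1 unfolding ito_var_def by blast
  obtain n2 \<tau>2 \<xi>2 where e2: "\<And>m::nat. elementary_integrand F T (n2 m) (\<tau>2 m) (\<xi>2 m)"
    and l2: "AE \<omega> in M. (\<lambda>m. energy (\<lambda>s \<omega>. elementary_process (n2 m) (\<tau>2 m) (\<xi>2 m) s \<omega> - H2 s \<omega>) \<omega>) \<longlonglongrightarrow> 0 \<and>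
           (\<lambda>m. elementary_integral W (n2 m) (\<tau>2 m) (\<xi>2 m) T \<omega>) \<longlonglongrightarrow> \<eta>2 \<omega>"
    using 2 unfolding ito_var_def by blast
  have "\<forall>m. \<exists>n \<tau> \<xi>. elementary_integrand F T n \<tau> \<xi> \<and>
    (\<forall>s \<omega>. elementary_process n \<tau> \<xi> s \<omega>
      = elementary_process (n1 m) (\<tau>1 m) (\<xi>1 m) s \<omega> + c *\<^sub>R elementary_process (n2 m) (\<tau>2 m) (\<xi>2 m) s \<omega>) \<and>
    (\<forall>\<omega>. elementary_integral W n \<tau> \<xi> T \<omega>
      = elementary_integral W (n1 m) (\<tau>1 m) (\<xi>1 m) T \<omega> + c *\<^sub>R elementary_integral W (n2 m) (\<tau>2 m) (\<xi>2 m) T \<omega>)"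
    using elementary_linear[OF e1 e2] by blast
  then obtain n \<tau> \<xi> where e: "\<And>m. elementary_integrand F T (n m) (\<tau> m) (\<xi> m)"
    and p: "\<And>m s \<omega>. elementary_process (n m) (\<tau> m) (\<xi> m) s \<omega>
      = elementary_process (n1 m) (\<tau>1 m) (\<xi>1 m) s \<omega> + c *\<^sub>R elementary_process (n2 m) (\<tau>2 m) (\<xi>2 m) s \<omega>"
    and i: "\<And>m \<omega>. elementary_integral W (n m) (\<tau> m) (\<xi> m) T \<omega>
      = elementary_integral W (n1 m) (\<tau>1 m) (\<xi>1 m) T \<omega> + c *\<^sub>R elementary_integral W (n2 m) (\<tau>2 m) (\<xi>2 m) T \<omega>"
    by metis
  show ?thesis unfolding ito_var_def
  proof (intro conjI exI)
    show "case_prod (\<lambda>s \<omega>. H1 s \<omega> + c *\<^sub>R H2 s \<omega>) \<in> borel_measurable (time_measure T \<Otimes>\<^sub>M M)" by measurable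
    show "(\<lambda>\<omega>. \<eta>1 \<omega> + c *\<^sub>R \<eta>2 \<omega>) \<in> borel_measurable M" by measurable
    show "AE \<omega> in M. energy (\<lambda>s \<omega>. H1 s \<omega> + c *\<^sub>R H2 s \<omega>) \<omega> < \<infinity>"
      using ito_varD(3)[OF 1] ito_varD(3)[OF 2] AE_space
    proof eventually_elim
      case (elim \<omega>)
      have "energy (\<lambda>s \<omega>. H1 s \<omega> + c *\<^sub>R H2 s \<omega>) \<omega> \<le> 2 * energy H1 \<omega> + ennreal (2 * c\<^sup>2) * energy H2 \<omega>"
        using elim section_measurable[OF ito_varD(1)[OF 1]] section_measurable[OF ito_varD(1)[OF 2]]
        by (intro en) auto
      also have "\<dots> < \<infinity>" using elim by (simp add: ennreal_mult_less_top)
      finally show ?case .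
    qed
    show "\<forall>m. elementary_integrand F T (n m) (\<tau> m) (\<xi> m)" using e by blast
    show "AE \<omega> in M. (\<lambda>m. energy (\<lambda>s \<omega>. elementary_process (n m) (\<tau> m) (\<xi> m) s \<omega> - (H1 s \<omega> + c *\<^sub>R H2 s \<omega>)) \<omega>) \<longlonglongrightarrow> 0 \<and>
           (\<lambda>m. elementary_integral W (n m) (\<tau> m) (\<xi> m) T \<omega>) \<longlonglongrightarrow> \<eta>1 \<omega> + c *\<^sub>R \<eta>2 \<omega>"
      using l1 l2 AE_space
    proof eventually_elim
      case (elim \<omega>)
      let ?G1 = "\<lambda>m s \<omega>. elementary_process (n1 m) (\<tau>1 m) (\<xi>1 m) s \<omega> - H1 s \<omega>"
      let ?G2 = "\<lambda>m s \<omega>. elementary_process (n2 m) (\<tau>2 m) (\<xi>2 m) s \<omega> - H2 s \<omega>"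
      have eq: "(\<lambda>s \<omega>. elementary_process (n m) (\<tau> m) (\<xi> m) s \<omega> - (H1 s \<omega> + c *\<^sub>R H2 s \<omega>))
          = (\<lambda>s \<omega>. ?G1 m s \<omega> + c *\<^sub>R ?G2 m s \<omega>)" for m
        by (auto simp: p algebra_simps fun_eq_iff)
      have m: "(\<lambda>s. ?G1 m s \<omega>) \<in> borel_measurable (time_measure T)" "(\<lambda>s. ?G2 m s \<omega>) \<in> borel_measurable (time_measure T)" for m
        using elim section_measurable[OF ito_varD(1)[OF 1]] section_measurable[OF ito_varD(1)[OF 2]]
          section_measurable[OF measurable_elementary_process[OF e1[of m]]]
          section_measurable[OF measurable_elementary_process[OF e2[of m]]] by auto
      have lim0: "(\<lambda>m. 2 * energy (?G1 m) \<omega> + ennreal (2 * c\<^sup>2) * energy (?G2 m) \<omega>) \<longlonglongrightarrow> 2 * 0 + ennreal (2 * c\<^sup>2) * 0"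
        using elim by (intro tendsto_add ennreal_tendsto_cmult) auto
      have en_m: "energy (\<lambda>s \<omega>. ?G1 m s \<omega> + c *\<^sub>R ?G2 m s \<omega>) \<omega>
          \<le> 2 * energy (?G1 m) \<omega> + ennreal (2 * c\<^sup>2) * energy (?G2 m) \<omega>" for m
        by (rule en) (rule m)+
      have "(\<lambda>m. energy (\<lambda>s \<omega>. ?G1 m s \<omega> + c *\<^sub>R ?G2 m s \<omega>) \<omega>) \<longlonglongrightarrow> 0"
      proof (rule tendsto_sandwich[OF _ _ tendsto_const])
        show "(\<lambda>m. 2 * energy (?G1 m) \<omega> + ennreal (2 * c\<^sup>2) * energy (?G2 m) \<omega>) \<longlonglongrightarrow> 0"
          using lim0 by simp
        show "eventually (\<lambda>m. energy (\<lambda>s \<omega>. ?G1 m s \<omega> + c *\<^sub>R ?G2 m s \<omega>) \<omega>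
            \<le> 2 * energy (?G1 m) \<omega> + ennreal (2 * c\<^sup>2) * energy (?G2 m) \<omega>) sequentially"
          by (rule always_eventually) (rule allI, rule en_m)
      qed simp
      moreover have "(\<lambda>m. elementary_integral W (n m) (\<tau> m) (\<xi> m) T \<omega>) \<longlonglongrightarrow> \<eta>1 \<omega> + c *\<^sub>R \<eta>2 \<omega>"
        unfolding i using elim by (intro tendsto_intros) auto
      ultimately show ?case unfolding eq by simp
    qed
  qed
qed

lemma ito_var_diff:
  fixes H1 H2 :: "real \<Rightarrow> 'w \<Rightarrow> real^'e^'d"
  assumes "ito_var H1 \<eta>1" "ito_var H2 \<eta>2"
  shows "ito_var (\<lambda>s \<omega>. H1 s \<omega> - H2 s \<omega>) (\<lambda>\<omega>. \<eta>1 \<omega> - \<eta>2 \<omega>)"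
  using ito_var_linear[OF assms, of "-1"] by simp

text \<open>On the event in the integrand the integral agrees with the truncated one, whose second
  moment equals, by the isometry, the mean of the truncated quadratic variation; that is at most the
  minimum on the right.\<close>

lemma elementary_truncated_bound:
  fixes \<xi> :: "nat \<Rightarrow> 'w \<Rightarrow> real^'e^'d"
  assumes e: "elementary_integrand F T n \<tau> \<xi>" and R: "0 \<le> R"
  shows "(\<integral>\<^sup>+\<omega>. indicator {\<omega>. elementary_qv n \<tau> \<xi> \<omega> \<le> R} \<omega> * ennreal ((norm (elementary_integral W n \<tau> \<xi> T \<omega>))\<^sup>2) \<partial>M)
    \<le> (\<integral>\<^sup>+\<omega>. min (ennreal (elementary_qv n \<tau> \<xi> \<omega>)) (ennreal R) \<partial>M)"
proof -
  let ?\<xi> = "truncate_coeffs R \<tau> \<xi>"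
  note t = elementary_truncate[OF e, of R]
  have "(\<integral>\<^sup>+\<omega>. indicator {\<omega>. elementary_qv n \<tau> \<xi> \<omega> \<le> R} \<omega> * ennreal ((norm (elementary_integral W n \<tau> \<xi> T \<omega>))\<^sup>2) \<partial>M)
     \<le> (\<integral>\<^sup>+\<omega>. ennreal ((norm (elementary_integral W n \<tau> ?\<xi> T \<omega>))\<^sup>2) \<partial>M)"
    using truncate_coeffs_eq(3)[OF e] by (intro nn_integral_mono) (auto simp: indicator_def)
  also have "\<dots> = ennreal (\<integral>\<omega>. (norm (elementary_integral W n \<tau> ?\<xi> T \<omega>))\<^sup>2 \<partial>M)"
    by (rule nn_integral_eq_integral[OF elementary_isometry(2)[OF t]]) simp
  also have "\<dots> = ennreal (\<integral>\<omega>. elementary_qv n \<tau> ?\<xi> \<omega> \<partial>M)"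
    using elementary_isometry(3)[OF t] by simp
  also have "\<dots> = (\<integral>\<^sup>+\<omega>. ennreal (elementary_qv n \<tau> ?\<xi> \<omega>) \<partial>M)"
    by (rule nn_integral_eq_integral[OF elementary_isometry(4)[OF t], symmetric])
      (simp add: elementary_qv_nonneg[OF t])
  also have "\<dots> \<le> (\<integral>\<^sup>+\<omega>. min (ennreal (elementary_qv n \<tau> \<xi> \<omega>)) (ennreal R) \<partial>M)"
    using elementary_qv_truncate[OF e R] by (intro nn_integral_mono) (auto intro!: ennreal_leI)
  finally show ?thesis .
qed

text \<open>Adds to the definition that the quadratic variations of the approximants converge to the
  energy of \<open>H\<close>; this relates the truncation event of \<open>H\<close> to those of its
  approximants.\<close>

lemma ito_var_approx:
  fixes H :: "real \<Rightarrow> 'w \<Rightarrow> real^'e^'d"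
  assumes "ito_var H \<eta>"
  obtains n \<tau> \<xi> where "\<And>m::nat. elementary_integrand F T (n m) (\<tau> m) (\<xi> m)"
    "AE \<omega> in M. (\<lambda>m. energy (\<lambda>s \<omega>. elementary_process (n m) (\<tau> m) (\<xi> m) s \<omega> - H s \<omega>) \<omega>) \<longlonglongrightarrow> 0 \<and>
       (\<lambda>m. elementary_integral W (n m) (\<tau> m) (\<xi> m) T \<omega>) \<longlonglongrightarrow> \<eta> \<omega> \<and>
       (\<lambda>m. ennreal (elementary_qv (n m) (\<tau> m) (\<xi> m) \<omega>)) \<longlonglongrightarrow> energy H \<omega>"
proof -
  obtain n \<tau> \<xi> where e: "\<And>m::nat. elementary_integrand F T (n m) (\<tau> m) (\<xi> m)"
    and l: "AE \<omega> in M. (\<lambda>m. energy (\<lambda>s \<omega>. elementary_process (n m) (\<tau> m) (\<xi> m) s \<omega> - H s \<omega>) \<omega>) \<longlonglongrightarrow> 0 \<and>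
       (\<lambda>m. elementary_integral W (n m) (\<tau> m) (\<xi> m) T \<omega>) \<longlonglongrightarrow> \<eta> \<omega>"
    using assms unfolding ito_var_def by blast
  have "AE \<omega> in M. (\<lambda>m. energy (\<lambda>s \<omega>. elementary_process (n m) (\<tau> m) (\<xi> m) s \<omega> - H s \<omega>) \<omega>) \<longlonglongrightarrow> 0 \<and>
       (\<lambda>m. elementary_integral W (n m) (\<tau> m) (\<xi> m) T \<omega>) \<longlonglongrightarrow> \<eta> \<omega> \<and>
       (\<lambda>m. ennreal (elementary_qv (n m) (\<tau> m) (\<xi> m) \<omega>)) \<longlonglongrightarrow> energy H \<omega>"
    using l ito_varD(3)[OF assms] AE_space
  proof eventually_elim
    case (elim \<omega>)
    have "(\<lambda>m. energy (elementary_process (n m) (\<tau> m) (\<xi> m)) \<omega>) \<longlonglongrightarrow> energy H \<omega>"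
      unfolding energy_def
    proof (rule nn_integral_square_tendsto)
      show "(\<lambda>s. elementary_process (n m) (\<tau> m) (\<xi> m) s \<omega>) \<in> borel_measurable (time_measure T)" for m
        using section_measurable[OF measurable_elementary_process[OF e[of m]]] elim by simp
      show "(\<lambda>s. H s \<omega>) \<in> borel_measurable (time_measure T)"
        using section_measurable[OF ito_varD(1)[OF assms]] elim by simp
    qed (use elim nn_integral_elementary_process[OF e] in \<open>auto simp: energy_def\<close>)
    then show ?case using elim by (simp add: energy_elementary[OF e])
  qed
  with e show ?thesis by (rule that)
qed

text \<open>Fatou's lemma on the left and dominated convergence, with the constant \<open>R\<close>
  as majorant, on the right carry the bound from elementary integrands to \<open>H\<close>. The
  strict inequality in the event matters: it is an open condition, hence eventually satisfied by the
  approximants, while at level \<open>R\<close> itself their quadratic variations could approach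
  from above.\<close>

lemma ito_var_truncated_bound:
  fixes H :: "real \<Rightarrow> 'w \<Rightarrow> real^'e^'d"
  assumes H: "ito_var H \<eta>" and R: "0 \<le> R"
  shows "(\<integral>\<^sup>+\<omega>. indicator {\<omega>. energy H \<omega> < ennreal R} \<omega> * ennreal ((norm (\<eta> \<omega>))\<^sup>2) \<partial>M)
    \<le> (\<integral>\<^sup>+\<omega>. min (energy H \<omega>) (ennreal R) \<partial>M)"
proof -
  obtain n \<tau> \<xi> where e: "\<And>m::nat. elementary_integrand F T (n m) (\<tau> m) (\<xi> m)"
    and l: "AE \<omega> in M. (\<lambda>m. energy (\<lambda>s \<omega>. elementary_process (n m) (\<tau> m) (\<xi> m) s \<omega> - H s \<omega>) \<omega>) \<longlonglongrightarrow> 0 \<and>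
       (\<lambda>m. elementary_integral W (n m) (\<tau> m) (\<xi> m) T \<omega>) \<longlonglongrightarrow> \<eta> \<omega> \<and>
       (\<lambda>m. ennreal (elementary_qv (n m) (\<tau> m) (\<xi> m) \<omega>)) \<longlonglongrightarrow> energy H \<omega>"
    using ito_var_approx[OF H] by blast
  let ?q = "\<lambda>m. elementary_qv (n m) (\<tau> m) (\<xi> m)"
  let ?i = "\<lambda>m. elementary_integral W (n m) (\<tau> m) (\<xi> m) T"
  let ?u = "\<lambda>m \<omega>. indicator {\<omega>. ?q m \<omega> \<le> R} \<omega> * ennreal ((norm (?i m \<omega>))\<^sup>2)"
  have [measurable]: "?q m \<in> borel_measurable M" "?i m \<in> borel_measurable M" for m
    using elementary_isometry(1)[OF e] elementary_isometry(4)[OF e] by auto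
  have [measurable]: "\<eta> \<in> borel_measurable M" "energy H \<in> borel_measurable M"
    using ito_varD[OF H] energy_measurable by auto
  have "(\<integral>\<^sup>+\<omega>. indicator {\<omega>. energy H \<omega> < ennreal R} \<omega> * ennreal ((norm (\<eta> \<omega>))\<^sup>2) \<partial>M)
      \<le> (\<integral>\<^sup>+\<omega>. liminf (\<lambda>m. ?u m \<omega>) \<partial>M)"
  proof (rule nn_integral_mono_AE)
    show "AE \<omega> in M. indicator {\<omega>. energy H \<omega> < ennreal R} \<omega> * ennreal ((norm (\<eta> \<omega>))\<^sup>2) \<le> liminf (\<lambda>m. ?u m \<omega>)"
      using l
    proof eventually_elim
      case (elim \<omega>)
      show ?case
      proof (cases "energy H \<omega> < ennreal R")
        case True
        have "(\<lambda>m. ennreal ((norm (?i m \<omega>))\<^sup>2)) \<longlonglongrightarrow> ennreal ((norm (\<eta> \<omega>))\<^sup>2)"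
          using elim by (intro tendsto_intros) auto
        moreover have "eventually (\<lambda>m. ennreal (?q m \<omega>) < ennreal R) sequentially"
          using elim True by (intro order_tendstoD(2)) auto
        then have "eventually (\<lambda>m. ennreal ((norm (?i m \<omega>))\<^sup>2) = ?u m \<omega>) sequentially"
          by eventually_elim (auto simp: indicator_def ennreal_less_iff elementary_qv_nonneg[OF e])
        ultimately have "(\<lambda>m. ?u m \<omega>) \<longlonglongrightarrow> ennreal ((norm (\<eta> \<omega>))\<^sup>2)"
          by (rule Lim_transform_eventually)
        then have "liminf (\<lambda>m. ?u m \<omega>) = ennreal ((norm (\<eta> \<omega>))\<^sup>2)"
          by (intro lim_imp_Liminf) auto
        then show ?thesis by (simp add: indicator_def)
      qed simp
    qed
  qed
  also have "\<dots> \<le> liminf (\<lambda>m. \<integral>\<^sup>+\<omega>. ?u m \<omega> \<partial>M)"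
    by (rule nn_integral_liminf) measurable
  also have "\<dots> \<le> liminf (\<lambda>m. \<integral>\<^sup>+\<omega>. min (ennreal (?q m \<omega>)) (ennreal R) \<partial>M)"
    using elementary_truncated_bound[OF e R] by (intro Liminf_mono always_eventually) auto
  also have "(\<lambda>m. \<integral>\<^sup>+\<omega>. min (ennreal (?q m \<omega>)) (ennreal R) \<partial>M) \<longlonglongrightarrow> (\<integral>\<^sup>+\<omega>. min (energy H \<omega>) (ennreal R) \<partial>M)"
  proof (rule nn_integral_dominated_convergence[where w="\<lambda>_. ennreal R"])
    show "AE \<omega> in M. (\<lambda>m. min (ennreal (?q m \<omega>)) (ennreal R)) \<longlonglongrightarrow> min (energy H \<omega>) (ennreal R)"
      using l by eventually_elim (intro tendsto_min, auto)
  qed (auto simp: emeasure_space_1)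
  then have "liminf (\<lambda>m. \<integral>\<^sup>+\<omega>. min (ennreal (?q m \<omega>)) (ennreal R) \<partial>M) = (\<integral>\<^sup>+\<omega>. min (energy H \<omega>) (ennreal R) \<partial>M)"
    by (intro lim_imp_Liminf) auto
  finally show ?thesis .
qed

text \<open>The truncated bound at level \<open>m\<close>, followed by Fatou's lemma as
  \<open>m\<close> grows; the energy is almost surely finite, so almost every path is eventually
  counted.\<close>

lemma ito_var_square_le:
  fixes H :: "real \<Rightarrow> 'w \<Rightarrow> real^'e^'d"
  assumes H: "ito_var H \<eta>"
  shows "(\<integral>\<^sup>+\<omega>. ennreal ((norm (\<eta> \<omega>))\<^sup>2) \<partial>M) \<le> (\<integral>\<^sup>+\<omega>. energy H \<omega> \<partial>M)"
proof -
  have [measurable]: "\<eta> \<in> borel_measurable M" "energy H \<in> borel_measurable M"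
    using ito_varD[OF H] energy_measurable by auto
  let ?u = "\<lambda>m \<omega>. indicator {\<omega>. energy H \<omega> < ennreal (real m)} \<omega> * ennreal ((norm (\<eta> \<omega>))\<^sup>2)"
  have "(\<integral>\<^sup>+\<omega>. ennreal ((norm (\<eta> \<omega>))\<^sup>2) \<partial>M) \<le> (\<integral>\<^sup>+\<omega>. liminf (\<lambda>m. ?u m \<omega>) \<partial>M)"
  proof (rule nn_integral_mono_AE)
    show "AE \<omega> in M. ennreal ((norm (\<eta> \<omega>))\<^sup>2) \<le> liminf (\<lambda>m. ?u m \<omega>)"
      using ito_varD(3)[OF H]
    proof eventually_elim
      case (elim \<omega>)
      obtain N where N: "energy H \<omega> < ennreal (real N)"
        using elim by (metis ennreal_Ex_less_of_nat infinity_ennreal_def ennreal_of_nat_eq_real_of_nat)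
      have "?u m \<omega> = ennreal ((norm (\<eta> \<omega>))\<^sup>2)" if "N \<le> m" for m
      proof -
        have "energy H \<omega> < ennreal (real m)"
          using N that by (meson ennreal_leI less_le_trans of_nat_mono)
        then show ?thesis by simp
      qed
      then have "eventually (\<lambda>m. ?u m \<omega> = ennreal ((norm (\<eta> \<omega>))\<^sup>2)) sequentially"
        by (auto simp: eventually_sequentially)
      then have "liminf (\<lambda>m. ?u m \<omega>) = ennreal ((norm (\<eta> \<omega>))\<^sup>2)"
        by (intro lim_imp_Liminf tendsto_eventually) auto
      then show ?case by simp
    qed
  qed
  also have "\<dots> \<le> liminf (\<lambda>m. \<integral>\<^sup>+\<omega>. ?u m \<omega> \<partial>M)"
    by (rule nn_integral_liminf) measurable
  also have "\<dots> \<le> liminf (\<lambda>m::nat. \<integral>\<^sup>+\<omega>. energy H \<omega> \<partial>M)"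
  proof (intro Liminf_mono always_eventually allI)
    fix m :: nat
    have "(\<integral>\<^sup>+\<omega>. ?u m \<omega> \<partial>M) \<le> (\<integral>\<^sup>+\<omega>. min (energy H \<omega>) (ennreal (real m)) \<partial>M)"
      by (rule ito_var_truncated_bound[OF H]) simp
    also have "\<dots> \<le> (\<integral>\<^sup>+\<omega>. energy H \<omega> \<partial>M)" by (intro nn_integral_mono) simp
    finally show "(\<integral>\<^sup>+\<omega>. ?u m \<omega> \<partial>M) \<le> (\<integral>\<^sup>+\<omega>. energy H \<omega> \<partial>M)" .
  qed
  finally show ?thesis by (simp add: Liminf_const)
qed

end

lemma integrable_inner_square:
  fixes f g :: "'c \<Rightarrow> 'b::euclidean_space"
  assumes [measurable]: "f \<in> borel_measurable N" "g \<in> borel_measurable N"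
    and "integrable N (\<lambda>x. (norm (f x))\<^sup>2)" "integrable N (\<lambda>x. (norm (g x))\<^sup>2)"
  shows "integrable N (\<lambda>x. f x \<bullet> g x)"
proof (rule Bochner_Integration.integrable_bound)
  show "integrable N (\<lambda>x. (norm (f x))\<^sup>2 + (norm (g x))\<^sup>2)" using assms by simp
  show "AE x in N. norm (f x \<bullet> g x) \<le> norm ((norm (f x))\<^sup>2 + (norm (g x))\<^sup>2)"
  proof (rule AE_I2)
    fix x
    have "\<bar>f x \<bullet> g x\<bar> \<le> norm (f x) * norm (g x)" by (rule Cauchy_Schwarz_ineq2)
    also have "\<dots> \<le> (norm (f x))\<^sup>2 + (norm (g x))\<^sup>2"
      using sum_squares_bound[of "norm (f x)" "norm (g x)"] mult_nonneg_nonneg[OF norm_ge_zero norm_ge_zero, of "f x" "g x"]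
      unfolding mult.assoc by linarith
    finally show "norm (f x \<bullet> g x) \<le> norm ((norm (f x))\<^sup>2 + (norm (g x))\<^sup>2)" by simp
  qed
qed measurable

lemma ennreal_tendsto_0_le:
  fixes f g :: "nat \<Rightarrow> ennreal"
  assumes "\<And>m. g m \<le> f m" "f \<longlonglongrightarrow> 0"
  shows "g \<longlonglongrightarrow> 0"
  by (rule tendsto_sandwich[OF _ _ tendsto_const assms(2)]) (auto simp: assms(1))

text \<open>The integrand on the square of times is symmetric and the diagonal is null, so the
  region \<open>r < q\<close> carries half of the total. This is the integrated chain rule for the
  squared norm of a tail integral, obtained without differentiating.\<close>

lemma ordered_double_integral:
  fixes \<gamma> :: "real \<Rightarrow> 'b::euclidean_space"
  assumes \<gamma>: "integrable (time_measure T) \<gamma>"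
  shows "(\<integral>r. (\<integral>q. indicator {r<..} q *\<^sub>R \<gamma> q \<partial>time_measure T) \<bullet> \<gamma> r \<partial>time_measure T)
    = (norm (\<integral>q. \<gamma> q \<partial>time_measure T))\<^sup>2 / 2"
proof -
  let ?L = "time_measure T"
  interpret L: finite_measure ?L by simp
  interpret LL: pair_sigma_finite ?L ?L ..
  note measurable_ident_time_measure [measurable]
  have [measurable]: "\<gamma> \<in> borel_measurable ?L" using \<gamma> by simp
  let ?f = "\<lambda>z. \<gamma> (snd z) \<bullet> \<gamma> (fst z)"
  have f: "integrable (?L \<Otimes>\<^sub>M ?L) ?f"
  proof (rule LL.Fubini_integrable)
    show "AE x in ?L. integrable ?L (\<lambda>y. ?f (x, y))" using \<gamma> by simp
    have m: "integrable ?L (\<lambda>x. \<integral>y. norm (\<gamma> y) * norm (\<gamma> x) \<partial>?L)" using \<gamma> by simp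
    show "integrable ?L (\<lambda>x. \<integral>y. norm (?f (x, y)) \<partial>?L)"
    proof (rule Bochner_Integration.integrable_bound[OF m])
      show "AE x in ?L. norm (\<integral>y. norm (?f (x, y)) \<partial>?L) \<le> norm (\<integral>y. norm (\<gamma> y) * norm (\<gamma> x) \<partial>?L)"
      proof (rule AE_I2)
        fix x
        have "(\<integral>y. norm (?f (x, y)) \<partial>?L) \<le> (\<integral>y. norm (\<gamma> y) * norm (\<gamma> x) \<partial>?L)"
          using \<gamma> by (intro integral_mono) (auto simp: Cauchy_Schwarz_ineq2)
        moreover have "0 \<le> (\<integral>y. norm (?f (x, y)) \<partial>?L)" by simp
        ultimately show "norm (\<integral>y. norm (?f (x, y)) \<partial>?L) \<le> norm (\<integral>y. norm (\<gamma> y) * norm (\<gamma> x) \<partial>?L)"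
          by simp
      qed
    qed measurable
  qed measurable
  have total: "(\<integral>z. ?f z \<partial>(?L \<Otimes>\<^sub>M ?L)) = (norm (\<integral>q. \<gamma> q \<partial>?L))\<^sup>2"
    using LL.integral_fst'[OF f] \<gamma> by (simp add: power2_norm_eq_inner)
  let ?u = "\<lambda>z. (if fst z < snd z then 1 else 0) * ?f z" and ?v = "\<lambda>z. (if snd z < fst z then 1 else 0) * ?f z"
  have iu: "integrable (?L \<Otimes>\<^sub>M ?L) ?u"
    by (rule Bochner_Integration.integrable_bound[OF f]) auto
  have iv: "integrable (?L \<Otimes>\<^sub>M ?L) ?v"
    by (rule Bochner_Integration.integrable_bound[OF f]) auto
  have swap: "(\<integral>z. ?v z \<partial>(?L \<Otimes>\<^sub>M ?L)) = (\<integral>z. ?u z \<partial>(?L \<Otimes>\<^sub>M ?L))"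
    using LL.integral_product_swap[of ?u] by (simp add: split_beta' inner_commute)
  have null: "AE y in ?L. y \<noteq> x" for x
  proof -
    have "AE y in lborel. y \<noteq> x" by (rule AE_lborel_singleton)
    then show ?thesis unfolding time_measure_def by (subst AE_restrict_space_iff) auto
  qed
  have diag: "AE z in ?L \<Otimes>\<^sub>M ?L. ?f z = ?u z + ?v z"
  proof -
    have "AE x in ?L. AE y in ?L. ?f (x, y) = ?u (x, y) + ?v (x, y)"
    proof (rule AE_I2)
      fix x
      show "AE y in ?L. ?f (x, y) = ?u (x, y) + ?v (x, y)"
        using null[of x] by eventually_elim auto
    qed
    moreover have "{z \<in> space (?L \<Otimes>\<^sub>M ?L). ?f z = ?u z + ?v z} \<in> sets (?L \<Otimes>\<^sub>M ?L)"
    proof (rule borel_measurable_eq)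
      show "?f \<in> borel_measurable (?L \<Otimes>\<^sub>M ?L)" using f by simp
      show "(\<lambda>z. ?u z + ?v z) \<in> borel_measurable (?L \<Otimes>\<^sub>M ?L)"
        using iu iv by (intro borel_measurable_add) simp_all
    qed
    ultimately show ?thesis by (rule LL.AE_pair_measure[rotated])
  qed
  have "(norm (\<integral>q. \<gamma> q \<partial>?L))\<^sup>2 = (\<integral>z. ?u z + ?v z \<partial>(?L \<Otimes>\<^sub>M ?L))"
    unfolding total[symmetric] 
  proof (rule integral_cong_AE[OF _ _ diag])
    show "?f \<in> borel_measurable (?L \<Otimes>\<^sub>M ?L)" using f by simp
    show "(\<lambda>z. ?u z + ?v z) \<in> borel_measurable (?L \<Otimes>\<^sub>M ?L)"
      using iu iv by (intro borel_measurable_add) simp_all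
  qed
  also have "\<dots> = 2 * (\<integral>z. ?u z \<partial>(?L \<Otimes>\<^sub>M ?L))" using iu iv swap by simp
  also have "(\<integral>z. ?u z \<partial>(?L \<Otimes>\<^sub>M ?L)) = (\<integral>r. (\<integral>q. ?u (r, q) \<partial>?L) \<partial>?L)"
    using LL.integral_fst'[OF iu] by simp
  also have "\<dots> = (\<integral>r. (\<integral>q. indicator {r<..} q *\<^sub>R \<gamma> q \<partial>?L) \<bullet> \<gamma> r \<partial>?L)"
  proof (rule Bochner_Integration.integral_cong[OF refl])
    fix r
    have "integrable ?L (\<lambda>q. indicator {r<..} q *\<^sub>R \<gamma> q)"
      by (rule Bochner_Integration.integrable_bound[OF \<gamma>]) (auto simp: indicator_def)
    then have "(\<integral>q. indicator {r<..} q *\<^sub>R \<gamma> q \<partial>?L) \<bullet> \<gamma> r = (\<integral>q. (indicator {r<..} q *\<^sub>R \<gamma> q) \<bullet> \<gamma> r \<partial>?L)"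
      by (intro integral_inner_left[symmetric])
    also have "\<dots> = (\<integral>q. ?u (r, q) \<partial>?L)"
      by (intro Bochner_Integration.integral_cong) (auto simp: indicator_def)
    finally show "(\<integral>q. ?u (r, q) \<partial>?L) = (\<integral>q. indicator {r<..} q *\<^sub>R \<gamma> q \<partial>?L) \<bullet> \<gamma> r" ..
  qed
  finally show ?thesis by simp
qed

context wiener_space
begin

section \<open>Square-integrable integrands\<close>

lemma nn_integral_energy:
  fixes H :: "real \<Rightarrow> 'w \<Rightarrow> 'b::{real_normed_vector, second_countable_topology}"
  assumes [measurable]: "case_prod H \<in> borel_measurable (time_measure T \<Otimes>\<^sub>M M)"
  shows "(\<integral>\<^sup>+\<omega>. energy H \<omega> \<partial>M)
    = (\<integral>\<^sup>+z. ennreal ((norm (H (fst z) (snd z)))\<^sup>2) \<partial>(time_measure T \<Otimes>\<^sub>M M))"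
proof -
  have "(\<lambda>z. ennreal ((norm (H (fst z) (snd z)))\<^sup>2)) \<in> borel_measurable (time_measure T \<Otimes>\<^sub>M M)"
    by measurable
  from TP.nn_integral_snd[OF this] show ?thesis by (simp add: energy_def)
qed

lemma integrable_energy:
  fixes H :: "real \<Rightarrow> 'w \<Rightarrow> 'b::{real_normed_vector, second_countable_topology}"
  assumes [measurable]: "case_prod H \<in> borel_measurable (time_measure T \<Otimes>\<^sub>M M)"
    and "(\<integral>\<^sup>+\<omega>. energy H \<omega> \<partial>M) < \<infinity>"
  shows "integrable (time_measure T \<Otimes>\<^sub>M M) (\<lambda>z. (norm (H (fst z) (snd z)))\<^sup>2)"
  using assms(2) unfolding nn_integral_energy[OF assms(1)] by (intro integrableI_bounded) auto

text \<open>Almost sure convergence of the energies is upgraded to convergence in mean. Truncation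
  at level \<open>N\<close> bounds the energies of the approximants by \<open>N\<close>. On
  \<open>energy H < N\<close> the truncation is eventually inactive and dominated convergence
  applies; on the complement the energy of the difference is at most \<open>4 energy H\<close>,
  whose tail expectation is small for large \<open>N\<close>.\<close>

lemma ito_var_L2_approx:
  fixes H :: "real \<Rightarrow> 'w \<Rightarrow> real^'e^'d"
  assumes H: "ito_var H \<eta>" and fin: "(\<integral>\<^sup>+\<omega>. energy H \<omega> \<partial>M) < \<infinity>" and \<epsilon>: "0 < \<epsilon>"
  shows "\<exists>n \<tau> \<xi>. elementary_integrand F T n \<tau> \<xi> \<and>
    (\<integral>\<^sup>+\<omega>. energy (\<lambda>s \<omega>. elementary_process n \<tau> \<xi> s \<omega> - H s \<omega>) \<omega> \<partial>M) < ennreal \<epsilon>"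
proof -
  obtain n \<tau> \<xi> where e: "\<And>m::nat. elementary_integrand F T (n m) (\<tau> m) (\<xi> m)"
    and l: "AE \<omega> in M. (\<lambda>m. energy (\<lambda>s \<omega>. elementary_process (n m) (\<tau> m) (\<xi> m) s \<omega> - H s \<omega>) \<omega>) \<longlonglongrightarrow> 0 \<and>
       (\<lambda>m. elementary_integral W (n m) (\<tau> m) (\<xi> m) T \<omega>) \<longlonglongrightarrow> \<eta> \<omega> \<and>
       (\<lambda>m. ennreal (elementary_qv (n m) (\<tau> m) (\<xi> m) \<omega>)) \<longlonglongrightarrow> energy H \<omega>"
    using ito_var_approx[OF H] by blast
  note Hm = ito_varD(1)[OF H]
  note [measurable] = Hm energy_measurable[OF Hm]
  have fin_pt: "AE \<omega> in M. energy H \<omega> < \<infinity>" by (rule ito_varD(3)[OF H])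
  \<comment> \<open>The factor 4 bounds \<open>2 N + 2 energy H\<close> on the event where
    \<open>N\<close> is at most the energy.\<close>
  let ?tail = "\<lambda>N::nat. \<integral>\<^sup>+\<omega>. 4 * energy H \<omega> * indicator {\<omega>. ennreal (real N) \<le> energy H \<omega>} \<omega> \<partial>M"
  have "?tail \<longlonglongrightarrow> (\<integral>\<^sup>+\<omega>. 0 \<partial>M)"
  proof (rule nn_integral_dominated_convergence[where w="\<lambda>\<omega>. 4 * energy H \<omega>"])
    show "(\<integral>\<^sup>+\<omega>. 4 * energy H \<omega> \<partial>M) < \<infinity>"
      using fin by (simp add: nn_integral_cmult ennreal_mult_less_top)
    show "AE \<omega> in M. 4 * energy H \<omega> * indicator {\<omega>. ennreal (real j) \<le> energy H \<omega>} \<omega> \<le> 4 * energy H \<omega>" for j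
      by (auto simp: indicator_def)
    show "AE \<omega> in M. (\<lambda>N. 4 * energy H \<omega> * indicator {\<omega>. ennreal (real N) \<le> energy H \<omega>} \<omega>) \<longlonglongrightarrow> 0"
      using fin_pt
    proof eventually_elim
      case (elim \<omega>)
      obtain N where N: "energy H \<omega> < ennreal (real N)"
        using elim by (metis ennreal_Ex_less_of_nat infinity_ennreal_def ennreal_of_nat_eq_real_of_nat)
      have "4 * energy H \<omega> * indicator {\<omega>. ennreal (real m) \<le> energy H \<omega>} \<omega> = 0" if "N \<le> m" for m
      proof -
        have "energy H \<omega> < ennreal (real m)"
          using N that by (meson ennreal_leI less_le_trans of_nat_mono)
        then show ?thesis by (simp add: not_le)
      qed
      then show ?case by (intro tendsto_eventually) (auto simp: eventually_sequentially)
    qed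
  qed measurable
  then have "eventually (\<lambda>N. ?tail N < ennreal (\<epsilon> / 2)) sequentially"
    using \<epsilon> by (intro order_tendstoD(2)) auto
  then obtain N where N: "?tail N < ennreal (\<epsilon> / 2)" by (auto simp: eventually_sequentially)
  let ?\<xi> = "\<lambda>m. truncate_coeffs (real N) (\<tau> m) (\<xi> m)"
  have te: "elementary_integrand F T (n m) (\<tau> m) (?\<xi> m)" for m by (rule elementary_truncate[OF e])
  let ?D = "\<lambda>m. energy (\<lambda>s \<omega>. elementary_process (n m) (\<tau> m) (?\<xi> m) s \<omega> - H s \<omega>)"
  have [measurable]: "case_prod (elementary_process (n m) (\<tau> m) (?\<xi> m)) \<in> borel_measurable (time_measure T \<Otimes>\<^sub>M M)" for m
    by (rule measurable_elementary_process[OF te])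
  have [measurable]: "?D m \<in> borel_measurable M" for m
    by (rule energy_measurable) measurable
  have D: "?D m \<omega> \<le> 2 * ennreal (real N) + 2 * energy H \<omega>" if "\<omega> \<in> space M" for m \<omega>
  proof -
    have [measurable]: "(\<lambda>s. elementary_process (n m) (\<tau> m) (?\<xi> m) s \<omega>) \<in> borel_measurable (time_measure T)"
      "(\<lambda>s. H s \<omega>) \<in> borel_measurable (time_measure T)"
      using that section_measurable[OF Hm] section_measurable[OF measurable_elementary_process[OF te[of m]]] by auto
    have "?D m \<omega> \<le> (\<integral>\<^sup>+s. 2 * ennreal ((norm (elementary_process (n m) (\<tau> m) (?\<xi> m) s \<omega>))\<^sup>2)
        + 2 * ennreal ((norm (H s \<omega>))\<^sup>2) \<partial>time_measure T)"
      unfolding energy_def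
    proof (rule nn_integral_mono)
      fix s
      let ?x = "elementary_process (n m) (\<tau> m) (?\<xi> m) s \<omega>"
      have "ennreal ((norm (?x - H s \<omega>))\<^sup>2) \<le> ennreal (2 * (norm ?x)\<^sup>2 + 2 * (norm (H s \<omega>))\<^sup>2)"
        by (intro ennreal_leI norm_square_diff_le)
      then show "ennreal ((norm (?x - H s \<omega>))\<^sup>2) \<le> 2 * ennreal ((norm ?x)\<^sup>2) + 2 * ennreal ((norm (H s \<omega>))\<^sup>2)"
        by (simp add: ennreal_mult)
    qed
    also have "\<dots> = 2 * energy (elementary_process (n m) (\<tau> m) (?\<xi> m)) \<omega> + 2 * energy H \<omega>"
      by (simp add: energy_def nn_integral_add nn_integral_cmult)
    also have "energy (elementary_process (n m) (\<tau> m) (?\<xi> m)) \<omega> \<le> ennreal (real N)"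
      unfolding energy_elementary[OF te]
      using elementary_qv_truncate[OF e, of "real N" m \<omega>] by (intro ennreal_leI) simp
    finally show ?thesis by (simp add: add_right_mono mult_left_mono)
  qed
  let ?S = "{\<omega>. energy H \<omega> < ennreal (real N)}"
  have "(\<lambda>m. \<integral>\<^sup>+\<omega>. ?D m \<omega> * indicator ?S \<omega> \<partial>M) \<longlonglongrightarrow> (\<integral>\<^sup>+\<omega>. 0 \<partial>M)"
  proof (rule nn_integral_dominated_convergence[where w="\<lambda>\<omega>. 2 * ennreal (real N) + 2 * energy H \<omega>"])
    show "(\<integral>\<^sup>+\<omega>. 2 * ennreal (real N) + 2 * energy H \<omega> \<partial>M) < \<infinity>"
      using fin by (simp add: nn_integral_add nn_integral_cmult ennreal_mult_less_top emeasure_space_1)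
    show "AE \<omega> in M. ?D j \<omega> * indicator ?S \<omega> \<le> 2 * ennreal (real N) + 2 * energy H \<omega>" for j
    proof (rule AE_I2)
      fix \<omega> assume "\<omega> \<in> space M"
      from D[OF this, of j] show "?D j \<omega> * indicator ?S \<omega> \<le> 2 * ennreal (real N) + 2 * energy H \<omega>"
        by (cases "\<omega> \<in> ?S") (auto simp del: mem_Collect_eq)
    qed
    show "AE \<omega> in M. (\<lambda>m. ?D m \<omega> * indicator ?S \<omega>) \<longlonglongrightarrow> 0"
      using l
    proof eventually_elim
      case (elim \<omega>)
      show ?case
      proof (cases "\<omega> \<in> ?S")
        case True
        then have "eventually (\<lambda>m. ennreal (elementary_qv (n m) (\<tau> m) (\<xi> m) \<omega>) < ennreal (real N)) sequentially"
          using elim by (intro order_tendstoD(2)) auto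
        then have "eventually (\<lambda>m. energy (\<lambda>s \<omega>. elementary_process (n m) (\<tau> m) (\<xi> m) s \<omega> - H s \<omega>) \<omega>
            = ?D m \<omega> * indicator ?S \<omega>) sequentially"
        proof eventually_elim
          case (elim m)
          then have "elementary_qv (n m) (\<tau> m) (\<xi> m) \<omega> \<le> real N"
            by (simp add: ennreal_less_iff elementary_qv_nonneg[OF e])
          from truncate_coeffs_eq(2)[OF e this] show ?case using True by (simp add: energy_def)
        qed
        with elim show ?thesis by (blast intro: Lim_transform_eventually)
      qed simp
    qed
  qed measurable
  then have "eventually (\<lambda>m. (\<integral>\<^sup>+\<omega>. ?D m \<omega> * indicator ?S \<omega> \<partial>M) < ennreal (\<epsilon> / 2)) sequentially"
    using \<epsilon> by (intro order_tendstoD(2)) auto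
  then obtain m where m: "(\<integral>\<^sup>+\<omega>. ?D m \<omega> * indicator ?S \<omega> \<partial>M) < ennreal (\<epsilon> / 2)"
    by (auto simp: eventually_sequentially)
  have "(\<integral>\<^sup>+\<omega>. ?D m \<omega> \<partial>M) \<le> (\<integral>\<^sup>+\<omega>. ?D m \<omega> * indicator ?S \<omega>
      + 4 * energy H \<omega> * indicator {\<omega>. ennreal (real N) \<le> energy H \<omega>} \<omega> \<partial>M)"
  proof (rule nn_integral_mono)
    fix \<omega> assume w: "\<omega> \<in> space M"
    show "?D m \<omega> \<le> ?D m \<omega> * indicator ?S \<omega>
      + 4 * energy H \<omega> * indicator {\<omega>. ennreal (real N) \<le> energy H \<omega>} \<omega>"
    proof (cases "energy H \<omega> < ennreal (real N)")
      case False
      have "?D m \<omega> \<le> 2 * ennreal (real N) + 2 * energy H \<omega>" by (rule D[OF w])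
      also have "\<dots> \<le> 2 * energy H \<omega> + 2 * energy H \<omega>"
        using False by (intro add_right_mono mult_left_mono) auto
      also have "\<dots> = 4 * energy H \<omega>" by (simp flip: distrib_right)
      finally show ?thesis using False by (simp add: not_less)
    qed simp
  qed
  also have "\<dots> = (\<integral>\<^sup>+\<omega>. ?D m \<omega> * indicator ?S \<omega> \<partial>M) + ?tail N"
    by (rule nn_integral_add) measurable
  also have "\<dots> < ennreal (\<epsilon> / 2) + ennreal (\<epsilon> / 2)"
    using m N by (rule add_strict_mono)
  also have "\<dots> = ennreal \<epsilon>" using \<epsilon> by (simp flip: ennreal_plus)
  finally show ?thesis using te[of m] by blast
qed

text \<open>With approximants that converge in mean square, the inequality for second moments,
  applied to the difference of an approximant and \<open>H\<close>, gives \<open>L2\<close>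
  convergence of the integrals. Both sides of the elementary isometry then converge, and mean 0
  passes to the limit.\<close>

lemma ito_var_isometry:
  fixes H :: "real \<Rightarrow> 'w \<Rightarrow> real^'e^'d"
  assumes H: "ito_var H \<eta>" and fin: "(\<integral>\<^sup>+\<omega>. energy H \<omega> \<partial>M) < \<infinity>"
  shows "(\<integral>\<^sup>+\<omega>. ennreal ((norm (\<eta> \<omega>))\<^sup>2) \<partial>M) = (\<integral>\<^sup>+\<omega>. energy H \<omega> \<partial>M)"
    and "integrable M (\<lambda>\<omega>. \<eta> \<omega> $ i)" and "(\<integral>\<omega>. \<eta> \<omega> $ i \<partial>M) = 0"
proof -
  note Hm = ito_varD(1)[OF H]
  note [measurable] = ito_varD(1,2)[OF H] energy_measurable[OF Hm]
  have "\<forall>m::nat. \<exists>n \<tau> \<xi>. elementary_integrand F T n \<tau> \<xi> \<and>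
    (\<integral>\<^sup>+\<omega>. energy (\<lambda>s \<omega>. elementary_process n \<tau> \<xi> s \<omega> - H s \<omega>) \<omega> \<partial>M) < ennreal (inverse (real (Suc m)))"
    using ito_var_L2_approx[OF H fin] by simp
  from this[unfolded choice_iff] obtain n \<tau> \<xi> where e: "\<And>m. elementary_integrand F T (n m) (\<tau> m) (\<xi> m)"
    and D: "\<And>m. (\<integral>\<^sup>+\<omega>. energy (\<lambda>s \<omega>. elementary_process (n m) (\<tau> m) (\<xi> m) s \<omega> - H s \<omega>) \<omega> \<partial>M)
      < ennreal (inverse (real (Suc m)))"
    by blast
  let ?p = "\<lambda>m. elementary_process (n m) (\<tau> m) (\<xi> m)" and ?i = "\<lambda>m. elementary_integral W (n m) (\<tau> m) (\<xi> m) T"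
  have [measurable]: "case_prod (?p m) \<in> borel_measurable (time_measure T \<Otimes>\<^sub>M M)" "?i m \<in> borel_measurable M" for m
    using measurable_elementary_process[OF e] elementary_isometry(1)[OF e] by auto
  have inv: "(\<lambda>m. ennreal (inverse (real (Suc m)))) \<longlonglongrightarrow> 0"
    using tendsto_ennrealI[OF LIMSEQ_inverse_real_of_nat] by simp
  have l1: "(\<lambda>m. \<integral>\<^sup>+\<omega>. energy (\<lambda>s \<omega>. ?p m s \<omega> - H s \<omega>) \<omega> \<partial>M) \<longlonglongrightarrow> 0"
    by (rule ennreal_tendsto_0_le[OF less_imp_le[OF D] inv])
  have le: "(\<integral>\<^sup>+\<omega>. ennreal ((norm (?i m \<omega> - \<eta> \<omega>))\<^sup>2) \<partial>M)
      \<le> (\<integral>\<^sup>+\<omega>. energy (\<lambda>s \<omega>. ?p m s \<omega> - H s \<omega>) \<omega> \<partial>M)" for m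
    by (rule ito_var_square_le[OF ito_var_diff[OF ito_var_elementary[OF e] H]])
  have l2: "(\<lambda>m. \<integral>\<^sup>+\<omega>. ennreal ((norm (?i m \<omega> - \<eta> \<omega>))\<^sup>2) \<partial>M) \<longlonglongrightarrow> 0"
    by (rule ennreal_tendsto_0_le[OF le l1])
  have \<eta>fin: "(\<integral>\<^sup>+\<omega>. ennreal ((norm (\<eta> \<omega>))\<^sup>2) \<partial>M) < \<infinity>"
    using ito_var_square_le[OF H] fin by (rule le_less_trans)
  have ei: "(\<integral>\<^sup>+\<omega>. ennreal ((norm (?i m \<omega>))\<^sup>2) \<partial>M) = ennreal (\<integral>\<omega>. elementary_qv (n m) (\<tau> m) (\<xi> m) \<omega> \<partial>M)" for m
    using nn_integral_eq_integral[OF elementary_isometry(2)[OF e[of m]]] elementary_isometry(3)[OF e[of m]] by simp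
  have ep: "(\<integral>\<^sup>+\<omega>. energy (?p m) \<omega> \<partial>M) = ennreal (\<integral>\<omega>. elementary_qv (n m) (\<tau> m) (\<xi> m) \<omega> \<partial>M)" for m
    unfolding energy_elementary[OF e]
    by (rule nn_integral_eq_integral[OF elementary_isometry(4)[OF e]]) (simp add: elementary_qv_nonneg[OF e])
  have 1: "(\<lambda>m. \<integral>\<^sup>+\<omega>. ennreal ((norm (?i m \<omega>))\<^sup>2) \<partial>M) \<longlonglongrightarrow> (\<integral>\<^sup>+\<omega>. ennreal ((norm (\<eta> \<omega>))\<^sup>2) \<partial>M)"
    using l2 \<eta>fin by (intro nn_integral_square_tendsto) (auto simp: ei)
  have 2: "(\<lambda>m. \<integral>\<^sup>+z. ennreal ((norm (?p m (fst z) (snd z)))\<^sup>2) \<partial>(time_measure T \<Otimes>\<^sub>M M))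
      \<longlonglongrightarrow> (\<integral>\<^sup>+z. ennreal ((norm (H (fst z) (snd z)))\<^sup>2) \<partial>(time_measure T \<Otimes>\<^sub>M M))"
  proof (rule nn_integral_square_tendsto)
    have "case_prod (\<lambda>s \<omega>. ?p m s \<omega> - H s \<omega>) \<in> borel_measurable (time_measure T \<Otimes>\<^sub>M M)" for m by measurable
    from l1[unfolded nn_integral_energy[OF this]]
    show "(\<lambda>m. \<integral>\<^sup>+z. ennreal ((norm (?p m (fst z) (snd z) - H (fst z) (snd z)))\<^sup>2) \<partial>(time_measure T \<Otimes>\<^sub>M M)) \<longlonglongrightarrow> 0" .
    show "(\<integral>\<^sup>+z. ennreal ((norm (?p m (fst z) (snd z)))\<^sup>2) \<partial>(time_measure T \<Otimes>\<^sub>M M)) < \<infinity>" for m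
      using ep[of m] nn_integral_energy[of "?p m"] by simp
    show "(\<integral>\<^sup>+z. ennreal ((norm (H (fst z) (snd z)))\<^sup>2) \<partial>(time_measure T \<Otimes>\<^sub>M M)) < \<infinity>"
      using fin unfolding nn_integral_energy[OF Hm] .
  qed measurable
  show "(\<integral>\<^sup>+\<omega>. ennreal ((norm (\<eta> \<omega>))\<^sup>2) \<partial>M) = (\<integral>\<^sup>+\<omega>. energy H \<omega> \<partial>M)"
  proof (rule LIMSEQ_unique[OF 1])
    show "(\<lambda>m. \<integral>\<^sup>+\<omega>. ennreal ((norm (?i m \<omega>))\<^sup>2) \<partial>M) \<longlonglongrightarrow> (\<integral>\<^sup>+\<omega>. energy H \<omega> \<partial>M)"
      using 2 unfolding nn_integral_energy[OF Hm] ei ep[symmetric] by (simp add: nn_integral_energy)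
  qed
  have sqi: "integrable M (\<lambda>\<omega>. (norm (\<eta> \<omega>))\<^sup>2)"
    using \<eta>fin by (intro integrableI_bounded) auto
  show \<eta>i: "integrable M (\<lambda>\<omega>. \<eta> \<omega> $ i)"
  proof (rule Bochner_Integration.integrable_bound)
    show "integrable M (\<lambda>\<omega>. 1 + (norm (\<eta> \<omega>))\<^sup>2)" using sqi by simp
    show "AE \<omega> in M. norm (\<eta> \<omega> $ i) \<le> norm (1 + (norm (\<eta> \<omega>))\<^sup>2)"
    proof (rule AE_I2)
      fix \<omega>
      have "2 * norm (\<eta> \<omega>) \<le> 1 + (norm (\<eta> \<omega>))\<^sup>2"
        using sum_squares_bound[of 1 "norm (\<eta> \<omega>)"] by simp
      then show "norm (\<eta> \<omega> $ i) \<le> norm (1 + (norm (\<eta> \<omega>))\<^sup>2)"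
        using component_le_norm_cart[of "\<eta> \<omega>" i] norm_ge_zero[of "\<eta> \<omega>"]
        unfolding real_norm_def by linarith
    qed
  qed measurable
  \<comment> \<open>The approximants have mean 0, so the mean of \<open>\<eta>\<close> is, up to
    sign, that of the difference and is bounded by its \<open>L2\<close> norm.\<close>
  have "ennreal ((\<integral>\<omega>. \<eta> \<omega> $ i \<partial>M)\<^sup>2) \<le> ennreal (inverse (real (Suc m)))" for m
  proof -
    have "(\<integral>\<omega>. (?i m \<omega> - \<eta> \<omega>) $ i \<partial>M) = - (\<integral>\<omega>. \<eta> \<omega> $ i \<partial>M)"
      using \<eta>i elementary_isometry(5,6)[OF e[of m], of i] by simp
    then have "ennreal ((\<integral>\<omega>. \<eta> \<omega> $ i \<partial>M)\<^sup>2) = ennreal ((norm (\<integral>\<omega>. (?i m \<omega> - \<eta> \<omega>) $ i \<partial>M))\<^sup>2)" by simp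
    also have "\<dots> \<le> ennreal (measure M (space M)) * (\<integral>\<^sup>+\<omega>. ennreal ((norm ((?i m \<omega> - \<eta> \<omega>) $ i))\<^sup>2) \<partial>M)"
      by (rule square_integral_le) (auto simp: prob_space finite_measure_axioms)
    also have "\<dots> \<le> (\<integral>\<^sup>+\<omega>. ennreal ((norm (?i m \<omega> - \<eta> \<omega>))\<^sup>2) \<partial>M)"
      using component_le_norm_cart[of "?i m _ - \<eta> _" i]
      by (simp add: prob_space) (intro nn_integral_mono ennreal_leI, simp add: abs_le_square_iff[symmetric])
    also have "\<dots> \<le> ennreal (inverse (real (Suc m)))" using le[of m] D[of m] by simp
    finally show ?thesis .
  qed
  then have "ennreal ((\<integral>\<omega>. \<eta> \<omega> $ i \<partial>M)\<^sup>2) \<le> 0"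
    by (intro LIMSEQ_le_const[OF inv]) auto
  then show "(\<integral>\<omega>. \<eta> \<omega> $ i \<partial>M) = 0"
    by (simp add: ennreal_eq_0_iff)
qed

lemma ito_integralD:
  fixes H :: "real \<Rightarrow> 'w \<Rightarrow> real^'e^'d"
  assumes "ito_integral M F T W H I"
  shows "progressively_measurable F T H"
    and "AE \<omega> in M. energy H \<omega> < \<infinity>"
    and "t \<in> {0..T} \<Longrightarrow> I t \<in> borel_measurable M"
    and "\<exists>n \<tau> \<xi>. (\<forall>m. elementary_integrand F T (n m) (\<tau> m) (\<xi> m)) \<and>
        (\<forall>\<epsilon>>0. (\<lambda>m. measure M {\<omega>\<in>space M. ennreal \<epsilon> <
              energy (\<lambda>s \<omega>. elementary_process (n m) (\<tau> m) (\<xi> m) s \<omega> - H s \<omega>) \<omega>}) \<longlonglongrightarrow> 0) \<and>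
        (\<forall>t\<in>{0..T}. \<forall>\<epsilon>>0. (\<lambda>m. measure M {\<omega>\<in>space M.
              \<epsilon> < norm (elementary_integral W (n m) (\<tau> m) (\<xi> m) t \<omega> - I t \<omega>)}) \<longlonglongrightarrow> 0)"
  unfolding energy_def nn_integral_time_measure
  by (rule assms[unfolded ito_integral_def, THEN conjunct1],
      rule assms[unfolded ito_integral_def, THEN conjunct2, THEN conjunct1],
      rule assms[unfolded ito_integral_def, THEN conjunct2, THEN conjunct2, THEN conjunct1, THEN bspec], assumption,
      rule assms[unfolded ito_integral_def, THEN conjunct2, THEN conjunct2, THEN conjunct2, THEN conjunct2])

text \<open>The passage from convergence in probability to the almost sure relation. Restricting
  each approximant to \<open>A\<close> and \<open>(s, t]\<close> turns its integral over the whole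
  interval into its increment between \<open>s\<close> and \<open>t\<close> on \<open>A\<close>, so
  the limits at the two times \<open>s\<close> and \<open>t\<close> determine the limit.\<close>

lemma ito_integral_restrict:
  fixes H :: "real \<Rightarrow> 'w \<Rightarrow> real^'e^'d"
  assumes I: "ito_integral M F T W H I" and st: "0 \<le> s" "s \<le> t" "t \<le> T" and A: "A \<in> sets (F s)"
  shows "ito_var (\<lambda>r \<omega>. (indicator A \<omega> * indicator {s<..t} r) *\<^sub>R H r \<omega>)
    (\<lambda>\<omega>. indicator A \<omega> *\<^sub>R (I t \<omega> - I s \<omega>))"
proof -
  have s: "s \<in> {0..T}" and t: "t \<in> {0..T}" using st by auto
  have [measurable]: "A \<in> sets M" by (rule F_sets_M[OF A s])
  note ID = ito_integralD[OF I]
  have Hm[measurable]: "case_prod H \<in> borel_measurable (time_measure T \<Otimes>\<^sub>M M)"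
    by (rule progressive_joint[OF ID(1)])
  have [measurable]: "I s \<in> borel_measurable M" "I t \<in> borel_measurable M"
    by (rule ID(3)[OF s], rule ID(3)[OF t])
  note Hfin = ID(2)
  obtain n \<tau> \<xi> where conv: "(\<forall>m. elementary_integrand F T (n m) (\<tau> m) (\<xi> m)) \<and>
        (\<forall>\<epsilon>>0. (\<lambda>m. measure M {\<omega>\<in>space M. ennreal \<epsilon> <
              energy (\<lambda>s \<omega>. elementary_process (n m) (\<tau> m) (\<xi> m) s \<omega> - H s \<omega>) \<omega>}) \<longlonglongrightarrow> 0) \<and>
        (\<forall>t\<in>{0..T}. \<forall>\<epsilon>>0. (\<lambda>m. measure M {\<omega>\<in>space M.
              \<epsilon> < norm (elementary_integral W (n m) (\<tau> m) (\<xi> m) t \<omega> - I t \<omega>)}) \<longlonglongrightarrow> 0)"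
    using ID(4) by (elim exE)
  note e = conjunct1[OF conv, rule_format] and l1 = conjunct1[OF conjunct2[OF conv], rule_format]
    and l2 = conjunct2[OF conjunct2[OF conv], rule_format]
  let ?p = "\<lambda>m. elementary_process (n m) (\<tau> m) (\<xi> m)" and ?i = "\<lambda>m. elementary_integral W (n m) (\<tau> m) (\<xi> m)"
  have [measurable]: "case_prod (?p m) \<in> borel_measurable (time_measure T \<Otimes>\<^sub>M M)" for m
    using measurable_elementary_process[OF e] .
  have im: "?i m u \<in> borel_measurable M" if "u \<in> {0..T}" for m u
    unfolding elementary_integral_def[abs_def]
  proof (rule borel_measurable_sum)
    fix k assume "k \<in> {..<n m}"
    then have k: "k < n m" by simp
    have [measurable]: "\<xi> m k \<in> borel_measurable M" by (rule elementary_integrandD(5)[OF e k])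
    have "min (\<tau> m (Suc k)) u \<in> {0..T}" "min (\<tau> m k) u \<in> {0..T}"
      using that k elementary_integrandD(1)[OF e[of m]] by (auto simp: min_le_iff_disj)
    then have [measurable]: "W (min (\<tau> m (Suc k)) u) \<in> borel_measurable M" "W (min (\<tau> m k) u) \<in> borel_measurable M"
      using W_measurable by auto
    show "(\<lambda>\<omega>. \<xi> m k \<omega> *v (W (min (\<tau> m (Suc k)) u) \<omega> - W (min (\<tau> m k) u) \<omega>)) \<in> borel_measurable M"
      by measurable
  qed
  have [measurable]: "?i m s \<in> borel_measurable M" "?i m t \<in> borel_measurable M" for m
    using im s t by auto
  let ?d = "\<lambda>m \<omega>. energy (\<lambda>s \<omega>. ?p m s \<omega> - H s \<omega>) \<omega>"
  \<comment> \<open>The maximum of the three errors tends to 0 in probability because each of them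
    does, and one subsequence then serves the energy and both times at once.\<close>
  let ?f = "\<lambda>m \<omega>. max (?d m \<omega>) (max (ennreal (norm (?i m s \<omega> - I s \<omega>))) (ennreal (norm (?i m t \<omega> - I t \<omega>))))"
  have [measurable]: "?d m \<in> borel_measurable M" for m by (rule energy_measurable) measurable
  have "\<exists>r. strict_mono r \<and> (AE \<omega> in M. (\<lambda>m. ?f (r m) \<omega>) \<longlonglongrightarrow> 0)"
  proof (rule AE_convergent_subsequence)
    show "?f m \<in> borel_measurable M" for m by measurable
    fix \<epsilon> :: real assume \<epsilon>: "0 < \<epsilon>"
    let ?P = "\<lambda>m. measure M {\<omega>\<in>space M. ennreal \<epsilon> < ?d m \<omega>}"
    let ?Q = "\<lambda>u m. measure M {\<omega>\<in>space M. \<epsilon> < norm (?i m u \<omega> - I u \<omega>)}"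
    have lim: "(\<lambda>m. ?P m + (?Q s m + ?Q t m)) \<longlonglongrightarrow> 0"
      using tendsto_add[OF l1[OF \<epsilon>] tendsto_add[OF l2[OF s \<epsilon>] l2[OF t \<epsilon>]]]
      by (simp only: add_0)
    have le: "measure M {\<omega>\<in>space M. ennreal \<epsilon> < ?f m \<omega>} \<le> ?P m + (?Q s m + ?Q t m)" for m
    proof -
      let ?A = "{\<omega>\<in>space M. ennreal \<epsilon> < ?d m \<omega>}" and ?B = "\<lambda>u. {\<omega>\<in>space M. \<epsilon> < norm (?i m u \<omega> - I u \<omega>)}"
      have eq: "{\<omega>\<in>space M. ennreal \<epsilon> < ?f m \<omega>} = ?A \<union> (?B s \<union> ?B t)"
        using \<epsilon> by (auto simp: less_max_iff_disj ennreal_less_iff)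
      have "measure M (?A \<union> (?B s \<union> ?B t)) \<le> measure M ?A + measure M (?B s \<union> ?B t)"
        by (rule measure_Un_le) measurable
      also have "measure M (?B s \<union> ?B t) \<le> measure M (?B s) + measure M (?B t)"
        by (rule measure_Un_le) measurable
      finally show ?thesis unfolding eq by simp
    qed
    show "(\<lambda>m. measure M {\<omega>\<in>space M. ennreal \<epsilon> < ?f m \<omega>}) \<longlonglongrightarrow> 0"
    proof (rule tendsto_sandwich[OF _ _ tendsto_const lim])
      show "eventually (\<lambda>m. measure M {\<omega>\<in>space M. ennreal \<epsilon> < ?f m \<omega>} \<le> ?P m + (?Q s m + ?Q t m)) sequentially"
        by (rule always_eventually[OF allI[OF le]])
    qed simp
  qed
  then obtain r where r: "AE \<omega> in M. (\<lambda>m. ?f (r m) \<omega>) \<longlonglongrightarrow> 0" by blast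
  define \<tau>' where "\<tau>' m k = min t (max s (\<tau> m k))" for m k
  define \<xi>' where "\<xi>' m k \<omega> = (if \<tau> m k < t then indicator A \<omega> *\<^sub>R \<xi> m k \<omega> else 0)" for m k \<omega>
  note er = elementary_restrict[OF e st A, folded \<tau>'_def \<xi>'_def]
  show ?thesis unfolding ito_var_def
  proof (intro conjI exI)
    show "case_prod (\<lambda>r \<omega>. (indicator A \<omega> * indicator {s<..t} r) *\<^sub>R H r \<omega>) \<in> borel_measurable (time_measure T \<Otimes>\<^sub>M M)"
      unfolding split_beta' by measurable
    show "(\<lambda>\<omega>. indicator A \<omega> *\<^sub>R (I t \<omega> - I s \<omega>)) \<in> borel_measurable M" by measurable
    show "AE \<omega> in M. energy (\<lambda>r \<omega>. (indicator A \<omega> * indicator {s<..t} r) *\<^sub>R H r \<omega>) \<omega> < \<infinity>"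
      using Hfin
    proof eventually_elim
      case (elim \<omega>)
      have "energy (\<lambda>r \<omega>. (indicator A \<omega> * indicator {s<..t} r) *\<^sub>R H r \<omega>) \<omega> \<le> energy H \<omega>"
        unfolding energy_def by (intro nn_integral_mono) (auto simp: indicator_def)
      then show ?case using elim by (rule le_less_trans)
    qed
    show "\<forall>m. elementary_integrand F T (n (r m)) (\<tau>' (r m)) (\<xi>' (r m))"
      using er(1) by (simp add: \<tau>'_def[abs_def] \<xi>'_def[abs_def])
    show "AE \<omega> in M. (\<lambda>m. energy (\<lambda>u \<omega>. elementary_process (n (r m)) (\<tau>' (r m)) (\<xi>' (r m)) u \<omega>
          - (indicator A \<omega> * indicator {s<..t} u) *\<^sub>R H u \<omega>) \<omega>) \<longlonglongrightarrow> 0 \<and>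
        (\<lambda>m. elementary_integral W (n (r m)) (\<tau>' (r m)) (\<xi>' (r m)) T \<omega>) \<longlonglongrightarrow> indicator A \<omega> *\<^sub>R (I t \<omega> - I s \<omega>)"
      using r
    proof eventually_elim
      case (elim \<omega>)
      have lim: "(\<lambda>m. g m) \<longlonglongrightarrow> 0" if "\<And>m. g m \<le> ?f (r m) \<omega>" for g :: "nat \<Rightarrow> ennreal"
        by (rule ennreal_tendsto_0_le[OF that elim])
      have "energy (\<lambda>u \<omega>. elementary_process (n m) (\<tau>' m) (\<xi>' m) u \<omega>
          - (indicator A \<omega> * indicator {s<..t} u) *\<^sub>R H u \<omega>) \<omega> \<le> ?d m \<omega>" for m
        using er(2)[of m] unfolding energy_def \<tau>'_def[abs_def] \<xi>'_def[abs_def]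
        by (intro nn_integral_mono) (auto simp: indicator_def)
      then have 1: "(\<lambda>m. energy (\<lambda>u \<omega>. elementary_process (n (r m)) (\<tau>' (r m)) (\<xi>' (r m)) u \<omega>
          - (indicator A \<omega> * indicator {s<..t} u) *\<^sub>R H u \<omega>) \<omega>) \<longlonglongrightarrow> 0"
        by (intro lim) (auto simp: le_max_iff_disj)
      have "(\<lambda>m. ennreal (norm (?i (r m) u \<omega> - I u \<omega>))) \<longlonglongrightarrow> ennreal 0" if "u = s \<or> u = t" for u
        unfolding ennreal_0 by (rule lim) (use that in \<open>auto simp: le_max_iff_disj\<close>)
      then have "(\<lambda>m. norm (?i (r m) u \<omega> - I u \<omega>)) \<longlonglongrightarrow> 0" if "u = s \<or> u = t" for u
        using that by (intro tendsto_ennrealD) auto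
      then have "(\<lambda>m. ?i (r m) u \<omega>) \<longlonglongrightarrow> I u \<omega>" if "u = s \<or> u = t" for u
        using that by (simp add: LIM_zero_iff tendsto_norm_zero_iff)
      then have "(\<lambda>m. indicator A \<omega> *\<^sub>R (?i (r m) t \<omega> - ?i (r m) s \<omega>)) \<longlonglongrightarrow> indicator A \<omega> *\<^sub>R (I t \<omega> - I s \<omega>)"
        by (intro tendsto_intros) auto
      moreover have "elementary_integral W (n m) (\<tau>' m) (\<xi>' m) T \<omega> = indicator A \<omega> *\<^sub>R (?i m t \<omega> - ?i m s \<omega>)" for m
        using er(3)[of m] by (simp add: \<tau>'_def[abs_def] \<xi>'_def[abs_def])
      ultimately show ?case using 1 by simp
    qed
  qed
qed


section \<open>The product formula\<close>

text \<open>\<open>N s\<close> plays the role of the increment \<open>\<integral>\<^sub>s\<^sup>T H dW\<close>.\<close>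

definition ito_increments :: "(real \<Rightarrow> 'w \<Rightarrow> real^'e^'d) \<Rightarrow> (real \<Rightarrow> 'w \<Rightarrow> real^'d) \<Rightarrow> bool" where
  "ito_increments H N \<longleftrightarrow> case_prod H \<in> borel_measurable (time_measure T \<Otimes>\<^sub>M M) \<and>
    (\<forall>s\<in>{0..T}. \<forall>A\<in>sets (F s).
      ito_var (\<lambda>r \<omega>. (indicator A \<omega> * indicator {s<..T} r) *\<^sub>R H r \<omega>) (\<lambda>\<omega>. indicator A \<omega> *\<^sub>R N s \<omega>))"

lemma ito_incrementsD:
  "ito_increments H N \<Longrightarrow> case_prod H \<in> borel_measurable (time_measure T \<Otimes>\<^sub>M M)"
  "ito_increments H N \<Longrightarrow> s \<in> {0..T} \<Longrightarrow> A \<in> sets (F s) \<Longrightarrow>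
      ito_var (\<lambda>r \<omega>. (indicator A \<omega> * indicator {s<..T} r) *\<^sub>R H r \<omega>) (\<lambda>\<omega>. indicator A \<omega> *\<^sub>R N s \<omega>)"
  by (auto simp: ito_increments_def)

lemma ito_integral_increments:
  fixes H :: "real \<Rightarrow> 'w \<Rightarrow> real^'e^'d"
  assumes "ito_integral M F T W H I"
  shows "ito_increments H (\<lambda>s \<omega>. I T \<omega> - I s \<omega>)"
  unfolding ito_increments_def
  using progressive_joint[OF ito_integralD(1)[OF assms]] ito_integral_restrict[OF assms] by auto

lemma ito_increments_linear:
  fixes H1 H2 :: "real \<Rightarrow> 'w \<Rightarrow> real^'e^'d"
  assumes 1: "ito_increments H1 N1" and 2: "ito_increments H2 N2"
  shows "ito_increments (\<lambda>s \<omega>. H1 s \<omega> + c *\<^sub>R H2 s \<omega>) (\<lambda>s \<omega>. N1 s \<omega> + c *\<^sub>R N2 s \<omega>)"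
  unfolding ito_increments_def
proof (intro conjI ballI)
  note [measurable] = ito_incrementsD(1)[OF 1] ito_incrementsD(1)[OF 2]
  show "case_prod (\<lambda>s \<omega>. H1 s \<omega> + c *\<^sub>R H2 s \<omega>) \<in> borel_measurable (time_measure T \<Otimes>\<^sub>M M)" by measurable
  fix s A assume "s \<in> {0..T}" "A \<in> sets (F s)"
  from ito_var_linear[OF ito_incrementsD(2)[OF 1 this] ito_incrementsD(2)[OF 2 this], of c]
  show "ito_var (\<lambda>r \<omega>. (indicator A \<omega> * indicator {s<..T} r) *\<^sub>R (H1 r \<omega> + c *\<^sub>R H2 r \<omega>))
      (\<lambda>\<omega>. indicator A \<omega> *\<^sub>R (N1 s \<omega> + c *\<^sub>R N2 s \<omega>))"
    by (simp add: scaleR_add_right ac_simps)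
qed

lemma ito_increments_measurable:
  fixes H :: "real \<Rightarrow> 'w \<Rightarrow> real^'e^'d"
  assumes N: "ito_increments H N" and s: "s \<in> {0..T}"
  shows "N s \<in> borel_measurable M"
proof -
  have "space M \<in> sets (F s)" using sets.top[of "F s"] space_F[OF s] by simp
  then have "(\<lambda>\<omega>. indicator (space M) \<omega> *\<^sub>R N s \<omega>) \<in> borel_measurable M"
    using ito_varD(2) ito_incrementsD(2)[OF N s] by blast
  then show ?thesis by (subst measurable_cong[of M "N s" "\<lambda>\<omega>. indicator (space M) \<omega> *\<^sub>R N s \<omega>"]) auto
qed

text \<open>Each item is the isometry for the restricted integrand, on \<open>A\<close> or on the
  whole space. The third is phrased over the product measure so that it merges with the drift terms
  of the product formula.\<close>

lemma ito_increments_isometry: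
  fixes H :: "real \<Rightarrow> 'w \<Rightarrow> real^'e^'d"
  assumes N: "ito_increments H N" and fin: "(\<integral>\<^sup>+\<omega>. energy H \<omega> \<partial>M) < \<infinity>"
    and s: "s \<in> {0..T}" and A: "A \<in> sets (F s)"
  shows "integrable M (\<lambda>\<omega>. (norm (N s \<omega>))\<^sup>2)"
    and "integrable M (\<lambda>\<omega>. indicator A \<omega> * (norm (N s \<omega>))\<^sup>2)"
    and "(\<integral>\<omega>. indicator A \<omega> * (norm (N s \<omega>))\<^sup>2 \<partial>M)
      = (\<integral>z. (indicator A (snd z) * indicator {s<..} (fst z)) * (norm (H (fst z) (snd z)))\<^sup>2 \<partial>(time_measure T \<Otimes>\<^sub>M M))"
    and "(\<integral>\<^sup>+\<omega>. ennreal ((norm (N s \<omega>))\<^sup>2) \<partial>M) \<le> (\<integral>\<^sup>+\<omega>. energy H \<omega> \<partial>M)"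
    and "integrable M (\<lambda>\<omega>. indicator A \<omega> * N s \<omega> $ i)"
    and "(\<integral>\<omega>. indicator A \<omega> * N s \<omega> $ i \<partial>M) = 0"
proof -
  note Hm[measurable] = ito_incrementsD(1)[OF N]
  have Nm[measurable]: "N s \<in> borel_measurable M" by (rule ito_increments_measurable[OF N s])
  let ?H = "\<lambda>A r \<omega>. (indicator A \<omega> * indicator {s<..T} r) *\<^sub>R H r \<omega>"
  have iso: "(\<integral>\<^sup>+\<omega>. energy (?H A) \<omega> \<partial>M) \<le> (\<integral>\<^sup>+\<omega>. energy H \<omega> \<partial>M) \<and>
    (\<integral>\<^sup>+\<omega>. ennreal ((norm (indicator A \<omega> *\<^sub>R N s \<omega>))\<^sup>2) \<partial>M) = (\<integral>\<^sup>+\<omega>. energy (?H A) \<omega> \<partial>M) \<and>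
    integrable M (\<lambda>\<omega>. (indicator A \<omega> *\<^sub>R N s \<omega>) $ i) \<and> (\<integral>\<omega>. (indicator A \<omega> *\<^sub>R N s \<omega>) $ i \<partial>M) = 0"
    if A: "A \<in> sets (F s)" for A
  proof -
    have le: "(\<integral>\<^sup>+\<omega>. energy (?H A) \<omega> \<partial>M) \<le> (\<integral>\<^sup>+\<omega>. energy H \<omega> \<partial>M)"
      unfolding energy_def by (intro nn_integral_mono) (auto simp: indicator_def)
    then have f: "(\<integral>\<^sup>+\<omega>. energy (?H A) \<omega> \<partial>M) < \<infinity>" using fin by (rule le_less_trans)
    show ?thesis
      using le ito_var_isometry[OF ito_incrementsD(2)[OF N s A] f] by blast
  qed
  have sp: "space M \<in> sets (F s)" using sets.top[of "F s"] space_F[OF s] by simp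
  have "(\<integral>\<^sup>+\<omega>. ennreal ((norm (indicator (space M) \<omega> *\<^sub>R N s \<omega>))\<^sup>2) \<partial>M) = (\<integral>\<^sup>+\<omega>. ennreal ((norm (N s \<omega>))\<^sup>2) \<partial>M)"
    by (intro nn_integral_cong) simp
  then show le: "(\<integral>\<^sup>+\<omega>. ennreal ((norm (N s \<omega>))\<^sup>2) \<partial>M) \<le> (\<integral>\<^sup>+\<omega>. energy H \<omega> \<partial>M)"
    using iso[OF sp] by simp
  show i: "integrable M (\<lambda>\<omega>. (norm (N s \<omega>))\<^sup>2)"
    using le_less_trans[OF le fin] by (intro integrableI_bounded) auto
  have [measurable]: "A \<in> sets M" by (rule F_sets_M[OF A s])
  show iA: "integrable M (\<lambda>\<omega>. indicator A \<omega> * (norm (N s \<omega>))\<^sup>2)"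
    by (rule Bochner_Integration.integrable_bound[OF i]) (auto simp: indicator_def)
  have Hi: "integrable (time_measure T \<Otimes>\<^sub>M M) (\<lambda>z. (norm (H (fst z) (snd z)))\<^sup>2)"
    by (rule integrable_energy[OF Hm fin])
  have Hi2: "integrable (time_measure T \<Otimes>\<^sub>M M)
      (\<lambda>z. (indicator A (snd z) * indicator {s<..} (fst z)) * (norm (H (fst z) (snd z)))\<^sup>2)"
  proof (rule Bochner_Integration.integrable_bound[OF Hi])
    show "AE z in time_measure T \<Otimes>\<^sub>M M. norm (indicator A (snd z) * indicator {s<..} (fst z) * (norm (H (fst z) (snd z)))\<^sup>2)
        \<le> norm ((norm (H (fst z) (snd z)))\<^sup>2)"
      by (rule AE_I2) (auto simp: indicator_def)
  qed measurable
  have m: "case_prod (?H A) \<in> borel_measurable (time_measure T \<Otimes>\<^sub>M M)"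
    unfolding split_beta' by measurable
  have "ennreal (\<integral>\<omega>. indicator A \<omega> * (norm (N s \<omega>))\<^sup>2 \<partial>M) = (\<integral>\<^sup>+\<omega>. ennreal (indicator A \<omega> * (norm (N s \<omega>))\<^sup>2) \<partial>M)"
    by (rule nn_integral_eq_integral[OF iA, symmetric]) simp
  also have "\<dots> = (\<integral>\<^sup>+\<omega>. ennreal ((norm (indicator A \<omega> *\<^sub>R N s \<omega>))\<^sup>2) \<partial>M)"
    by (intro nn_integral_cong) (simp add: indicator_def)
  also have "\<dots> = (\<integral>\<^sup>+\<omega>. energy (?H A) \<omega> \<partial>M)" using iso[OF A] by blast
  also have "\<dots> = (\<integral>\<^sup>+z. ennreal ((norm (?H A (fst z) (snd z)))\<^sup>2) \<partial>(time_measure T \<Otimes>\<^sub>M M))"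
    by (rule nn_integral_energy[OF m])
  also have "\<dots> = (\<integral>\<^sup>+z. ennreal ((indicator A (snd z) * indicator {s<..} (fst z)) * (norm (H (fst z) (snd z)))\<^sup>2)
      \<partial>(time_measure T \<Otimes>\<^sub>M M))"
    by (intro nn_integral_cong) (auto simp: indicator_def space_pair_measure)
  also have "\<dots> = ennreal (\<integral>z. (indicator A (snd z) * indicator {s<..} (fst z)) * (norm (H (fst z) (snd z)))\<^sup>2
      \<partial>(time_measure T \<Otimes>\<^sub>M M))"
    by (rule nn_integral_eq_integral[OF Hi2]) simp
  finally show "(\<integral>\<omega>. indicator A \<omega> * (norm (N s \<omega>))\<^sup>2 \<partial>M)
      = (\<integral>z. (indicator A (snd z) * indicator {s<..} (fst z)) * (norm (H (fst z) (snd z)))\<^sup>2 \<partial>(time_measure T \<Otimes>\<^sub>M M))"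
    by (subst (asm) ennreal_inj) auto
  show "integrable M (\<lambda>\<omega>. indicator A \<omega> * N s \<omega> $ i)" "(\<integral>\<omega>. indicator A \<omega> * N s \<omega> $ i \<partial>M) = 0"
    using iso[OF A] by simp_all
qed

text \<open>\<open>N s\<close> has mean 0 on every event of \<open>F s\<close>, so each component
  has conditional expectation 0 given \<open>F s\<close>, and the factor \<open>\<zeta>\<close> can
  be taken out.\<close>

lemma ito_increments_orthogonal:
  fixes H :: "real \<Rightarrow> 'w \<Rightarrow> real^'e^'d"
  assumes N: "ito_increments H N" and fin: "(\<integral>\<^sup>+\<omega>. energy H \<omega> \<partial>M) < \<infinity>" and s: "s \<in> {0..T}"
    and \<zeta>: "\<zeta> \<in> borel_measurable (F s)" "integrable M (\<lambda>\<omega>. (norm (\<zeta> \<omega>))\<^sup>2)"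
  shows "integrable M (\<lambda>\<omega>. \<zeta> \<omega> \<bullet> N s \<omega>)" and "(\<integral>\<omega>. \<zeta> \<omega> \<bullet> N s \<omega> \<partial>M) = 0"
proof -
  note sub = subalgebra_F[OF s]
  have [measurable]: "\<zeta> \<in> borel_measurable (F s)" by fact
  have [measurable]: "\<zeta> \<in> borel_measurable M" "N s \<in> borel_measurable M"
    using F_measurable_M[OF \<zeta>(1) s] ito_increments_measurable[OF N s] by auto
  have sp: "space M \<in> sets (F s)" using sets.top[of "F s"] space_F[OF s] by simp
  note iso = ito_increments_isometry[OF N fin s]
  interpret S: sigma_finite_subalgebra M "F s"
  proof (rule finite_measure_subalgebra_is_sigma_finite)
    show "finite_measure_subalgebra M (F s)"
      by (simp add: finite_measure_subalgebra_def finite_measure_subalgebra_axioms_def finite_measure_axioms sub)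
  qed
  have comp: "integrable M (\<lambda>\<omega>. \<zeta> \<omega> $ i * N s \<omega> $ i) \<and> (\<integral>\<omega>. \<zeta> \<omega> $ i * N s \<omega> $ i \<partial>M) = 0" for i
  proof -
    have Ni: "integrable M (\<lambda>\<omega>. N s \<omega> $ i)"
    proof -
      have "integrable M (\<lambda>\<omega>. indicator (space M) \<omega> * N s \<omega> $ i)" by (rule iso(5)[OF sp])
      then show ?thesis by (subst (asm) Bochner_Integration.integrable_cong[OF refl, of M _ "\<lambda>\<omega>. N s \<omega> $ i"]) auto
    qed
    have "AE \<omega> in M. real_cond_exp M (F s) (\<lambda>\<omega>. N s \<omega> $ i) \<omega> = 0"
    proof (rule S.real_cond_exp_charact)
      fix A assume A: "A \<in> sets (F s)"
      show "set_lebesgue_integral M A (\<lambda>\<omega>. N s \<omega> $ i) = set_lebesgue_integral M A (\<lambda>\<omega>. 0)"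
        using iso(6)[OF A, of i] by (simp add: set_lebesgue_integral_def)
    qed (use Ni in auto)
    then have z: "AE \<omega> in M. \<zeta> \<omega> $ i * real_cond_exp M (F s) (\<lambda>\<omega>. N s \<omega> $ i) \<omega> = 0"
      by eventually_elim simp
    have prod: "integrable M (\<lambda>\<omega>. \<zeta> \<omega> $ i * N s \<omega> $ i)"
    proof (rule Bochner_Integration.integrable_bound)
      show "integrable M (\<lambda>\<omega>. (norm (\<zeta> \<omega>))\<^sup>2 + (norm (N s \<omega>))\<^sup>2)" using \<zeta>(2) iso(1)[OF sp] by simp
      show "AE \<omega> in M. norm (\<zeta> \<omega> $ i * N s \<omega> $ i) \<le> norm ((norm (\<zeta> \<omega>))\<^sup>2 + (norm (N s \<omega>))\<^sup>2)"
      proof (rule AE_I2)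
        fix \<omega>
        have "\<bar>\<zeta> \<omega> $ i\<bar> * \<bar>N s \<omega> $ i\<bar> \<le> norm (\<zeta> \<omega>) * norm (N s \<omega>)"
          by (intro mult_mono component_le_norm_cart) auto
        moreover have "2 * norm (\<zeta> \<omega>) * norm (N s \<omega>) \<le> (norm (\<zeta> \<omega>))\<^sup>2 + (norm (N s \<omega>))\<^sup>2"
          by (rule sum_squares_bound)
        moreover have "0 \<le> norm (\<zeta> \<omega>) * norm (N s \<omega>)" by simp
        ultimately show "norm (\<zeta> \<omega> $ i * N s \<omega> $ i) \<le> norm ((norm (\<zeta> \<omega>))\<^sup>2 + (norm (N s \<omega>))\<^sup>2)"
          unfolding real_norm_def abs_mult mult.assoc by linarith
      qed
    qed measurable
    have "(\<integral>\<omega>. \<zeta> \<omega> $ i * N s \<omega> $ i \<partial>M) = (\<integral>\<omega>. \<zeta> \<omega> $ i * real_cond_exp M (F s) (\<lambda>\<omega>. N s \<omega> $ i) \<omega> \<partial>M)"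
      by (rule S.real_cond_exp_intg(2)[OF prod, symmetric]) measurable
    also have "\<dots> = 0" using z by (subst integral_cong_AE[of _ _ "\<lambda>_. 0"]) auto
    finally show ?thesis using prod by simp
  qed
  show "integrable M (\<lambda>\<omega>. \<zeta> \<omega> \<bullet> N s \<omega>)" "(\<integral>\<omega>. \<zeta> \<omega> \<bullet> N s \<omega> \<partial>M) = 0"
    unfolding inner_vec_def using comp by simp_all
qed

lemma measurable_tail_integral:
  fixes \<beta> :: "real \<Rightarrow> 'w \<Rightarrow> 'b::euclidean_space"
  assumes [measurable]: "case_prod \<beta> \<in> borel_measurable (time_measure T \<Otimes>\<^sub>M M)"
  shows "(\<lambda>z. \<integral>q. indicator {fst z<..} q *\<^sub>R \<beta> q (snd z) \<partial>time_measure T) \<in> borel_measurable (time_measure T \<Otimes>\<^sub>M M)"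
proof -
  have "(\<lambda>p. (if fst (fst p) < snd p then 1 else 0 :: real) *\<^sub>R \<beta> (snd p) (snd (fst p)))
      \<in> borel_measurable ((time_measure T \<Otimes>\<^sub>M M) \<Otimes>\<^sub>M time_measure T)"
  proof (rule borel_measurable_scaleR)
    have a: "(\<lambda>p. fst (fst p)) \<in> borel_measurable ((time_measure T \<Otimes>\<^sub>M M) \<Otimes>\<^sub>M time_measure T)"
      by (rule measurable_compose[OF measurable_fst measurable_compose[OF measurable_fst measurable_ident_time_measure]])
    have b: "(\<lambda>p. snd p) \<in> borel_measurable ((time_measure T \<Otimes>\<^sub>M M) \<Otimes>\<^sub>M time_measure T)"
      by (rule measurable_compose[OF measurable_snd measurable_ident_time_measure])
    show "(\<lambda>p. if fst (fst p) < snd p then 1 else 0 :: real) \<in> borel_measurable ((time_measure T \<Otimes>\<^sub>M M) \<Otimes>\<^sub>M time_measure T)"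
      by (intro measurable_If borel_measurable_const borel_measurable_less[OF a b])
    have c: "(\<lambda>p. (snd p, snd (fst p))) \<in> measurable ((time_measure T \<Otimes>\<^sub>M M) \<Otimes>\<^sub>M time_measure T) (time_measure T \<Otimes>\<^sub>M M)"
      by (rule measurable_Pair[OF measurable_snd measurable_compose[OF measurable_fst measurable_snd]])
    from measurable_compose[OF c assms]
    show "(\<lambda>p. \<beta> (snd p) (snd (fst p))) \<in> borel_measurable ((time_measure T \<Otimes>\<^sub>M M) \<Otimes>\<^sub>M time_measure T)" by simp
  qed
  then have "(\<lambda>z. \<integral>q. (if fst z < q then 1 else 0 :: real) *\<^sub>R \<beta> q (snd z) \<partial>time_measure T)
      \<in> borel_measurable (time_measure T \<Otimes>\<^sub>M M)"
    by (intro TM.borel_measurable_lebesgue_integral) (simp add: split_beta')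
  moreover have "(if a < q then 1 else 0 :: real) = indicator {a<..} q" for a q :: real by (simp add: indicator_def)
  ultimately show ?thesis by simp
qed

text \<open>Stated for any Borel set of times, so that it serves both for the drift after
  \<open>r\<close> and for the drift up to \<open>t\<close>.\<close>

lemma norm_tail_integral_le:
  fixes \<beta> :: "real \<Rightarrow> 'w \<Rightarrow> 'b::euclidean_space"
  assumes "case_prod \<beta> \<in> borel_measurable (time_measure T \<Otimes>\<^sub>M M)" and w: "\<omega> \<in> space M"
    and A: "A \<in> sets borel"
  shows "ennreal ((norm (\<integral>q. indicator A q *\<^sub>R \<beta> q \<omega> \<partial>time_measure T))\<^sup>2)
    \<le> ennreal T * (\<integral>\<^sup>+q\<in>A. ennreal ((norm (\<beta> q \<omega>))\<^sup>2) \<partial>time_measure T)"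
proof -
  have mT: "measure (time_measure T) (space (time_measure T)) = T"
    using T_pos emeasure_time_measure[of T] by (simp add: measure_def)
  have [measurable]: "(\<lambda>q. \<beta> q \<omega>) \<in> borel_measurable (time_measure T)" by (rule section_measurable[OF assms(1) w])
  have "ennreal ((norm (\<integral>q. indicator A q *\<^sub>R \<beta> q \<omega> \<partial>time_measure T))\<^sup>2)
    \<le> ennreal (measure (time_measure T) (space (time_measure T))) *
      (\<integral>\<^sup>+q. ennreal ((norm (indicator A q *\<^sub>R \<beta> q \<omega>))\<^sup>2) \<partial>time_measure T)"
    using T_pos mT A by (intro square_integral_le) auto
  also have "(\<integral>\<^sup>+q. ennreal ((norm (indicator A q *\<^sub>R \<beta> q \<omega>))\<^sup>2) \<partial>time_measure T)
      = (\<integral>\<^sup>+q\<in>A. ennreal ((norm (\<beta> q \<omega>))\<^sup>2) \<partial>time_measure T)"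
    by (intro nn_integral_cong) (simp add: indicator_def)
  finally show ?thesis unfolding mT .
qed

lemma energy_finite_section:
  fixes \<beta> :: "real \<Rightarrow> 'w \<Rightarrow> 'b::euclidean_space"
  assumes m: "case_prod \<beta> \<in> borel_measurable (time_measure T \<Otimes>\<^sub>M M)" and w: "\<omega> \<in> space M"
    and fin: "energy \<beta> \<omega> < \<infinity>"
  shows "integrable (time_measure T) (\<lambda>q. \<beta> q \<omega>)"
proof -
  have [measurable]: "(\<lambda>q. \<beta> q \<omega>) \<in> borel_measurable (time_measure T)" by (rule section_measurable[OF m w])
  have "integrable (time_measure T) (\<lambda>q. (norm (\<beta> q \<omega>))\<^sup>2)"
    using fin unfolding energy_def by (intro integrableI_bounded) auto
  then have "integrable (time_measure T) (\<lambda>q. norm (\<beta> q \<omega>))"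
    by (rule TM.square_integrable_imp_integrable[rotated]) measurable
  then show ?thesis by (subst (asm) integrable_norm_iff) auto
qed

lemma ennreal_norm_square_add3:
  fixes x y z :: "'b::real_normed_vector"
  shows "ennreal ((norm (x + y + z))\<^sup>2)
    \<le> 3 * (ennreal ((norm x)\<^sup>2) + ennreal ((norm y)\<^sup>2) + ennreal ((norm z)\<^sup>2))"
proof -
  have "norm (x + y + z) \<le> norm x + norm y + norm z"
    by (intro order_trans[OF norm_triangle_ineq] add_mono norm_triangle_ineq order_refl)
  then have "(norm (x + y + z))\<^sup>2 \<le> (norm x + norm y + norm z)\<^sup>2" by (intro power_mono) auto
  also have "\<dots> \<le> 3 * ((norm x)\<^sup>2 + (norm y)\<^sup>2 + (norm z)\<^sup>2)"
    using sum_squares_bound[of "norm x" "norm y"] sum_squares_bound[of "norm x" "norm z"]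
      sum_squares_bound[of "norm y" "norm z"]
    by (simp add: power2_sum algebra_simps power2_eq_square)
  finally have "ennreal ((norm (x + y + z))\<^sup>2) \<le> ennreal (3 * ((norm x)\<^sup>2 + (norm y)\<^sup>2 + (norm z)\<^sup>2))"
    by (rule ennreal_leI)
  also have "\<dots> = 3 * (ennreal ((norm x)\<^sup>2) + ennreal ((norm y)\<^sup>2) + ennreal ((norm z)\<^sup>2))"
    by (simp add: ennreal_mult)
  finally show ?thesis .
qed

text \<open>Solving the equation for \<open>P r\<close> bounds it by the terminal value, the drift
  and an increment, all with second moments bounded uniformly in \<open>r\<close>. The bound
  \<open>B\<close> supplies the finiteness that the backward Gronwall inequality asks for.\<close>

lemma ito_process_square_integrable:
  fixes P \<beta> :: "real \<Rightarrow> 'w \<Rightarrow> real^'d" and H :: "real \<Rightarrow> 'w \<Rightarrow> real^'e^'d"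
  assumes N: "ito_increments H N" and fin: "(\<integral>\<^sup>+\<omega>. energy H \<omega> \<partial>M) < \<infinity>"
    and Pm: "case_prod P \<in> borel_measurable (time_measure T \<Otimes>\<^sub>M M)"
    and PM: "\<And>r. r \<in> {0..T} \<Longrightarrow> P r \<in> borel_measurable M"
    and \<beta>m: "case_prod \<beta> \<in> borel_measurable (time_measure T \<Otimes>\<^sub>M M)"
    and \<beta>fin: "(\<integral>\<^sup>+\<omega>. energy \<beta> \<omega> \<partial>M) < \<infinity>"
    and PT: "integrable M (\<lambda>\<omega>. (norm (P T \<omega>))\<^sup>2)"
    and eq: "\<And>r. r \<in> {0..T} \<Longrightarrow>
      AE \<omega> in M. P T \<omega> = P r \<omega> + (\<integral>q. indicator {r<..} q *\<^sub>R \<beta> q \<omega> \<partial>time_measure T) + N r \<omega>"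
  shows "r \<in> {0..T} \<Longrightarrow> integrable M (\<lambda>\<omega>. (norm (P r \<omega>))\<^sup>2)"
    and "(\<integral>\<^sup>+\<omega>. energy P \<omega> \<partial>M) < \<infinity>"
    and "\<exists>B<\<infinity>. \<forall>r\<in>{0..T}. (\<integral>\<^sup>+\<omega>. ennreal ((norm (P r \<omega>))\<^sup>2) \<partial>M) \<le> B"
proof -
  note [measurable] = Pm \<beta>m energy_measurable[OF \<beta>m]
  define B where "B = 3 * ((\<integral>\<^sup>+\<omega>. ennreal ((norm (P T \<omega>))\<^sup>2) \<partial>M)
    + ennreal T * (\<integral>\<^sup>+\<omega>. energy \<beta> \<omega> \<partial>M) + (\<integral>\<^sup>+\<omega>. energy H \<omega> \<partial>M))"
  have "(\<integral>\<^sup>+\<omega>. ennreal ((norm (P T \<omega>))\<^sup>2) \<partial>M) < \<infinity>"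
    using PT by (subst nn_integral_eq_integral) auto
  then have Bfin: "B < \<infinity>"
    using fin \<beta>fin by (simp add: B_def ennreal_mult_less_top)
  have bound: "(\<integral>\<^sup>+\<omega>. ennreal ((norm (P r \<omega>))\<^sup>2) \<partial>M) \<le> B" if r: "r \<in> {0..T}" for r
  proof -
    have [measurable]: "P r \<in> borel_measurable M" "P T \<in> borel_measurable M" "N r \<in> borel_measurable M"
      using PM[OF r] PM[of T] T_pos ito_increments_measurable[OF N r] by auto
    have sp: "space M \<in> sets (F r)" using sets.top[of "F r"] space_F[OF r] by simp
    have "(\<integral>\<^sup>+\<omega>. ennreal ((norm (P r \<omega>))\<^sup>2) \<partial>M)
      \<le> (\<integral>\<^sup>+\<omega>. 3 * (ennreal ((norm (P T \<omega>))\<^sup>2) + ennreal T * energy \<beta> \<omega> + ennreal ((norm (N r \<omega>))\<^sup>2)) \<partial>M)"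
    proof (rule nn_integral_mono_AE)
      show "AE \<omega> in M. ennreal ((norm (P r \<omega>))\<^sup>2)
        \<le> 3 * (ennreal ((norm (P T \<omega>))\<^sup>2) + ennreal T * energy \<beta> \<omega> + ennreal ((norm (N r \<omega>))\<^sup>2))"
        using eq[OF r] AE_space
      proof eventually_elim
        case (elim \<omega>)
        let ?b = "\<integral>q. indicator {r<..} q *\<^sub>R \<beta> q \<omega> \<partial>time_measure T"
        have "ennreal ((norm (P r \<omega>))\<^sup>2) = ennreal ((norm (P T \<omega> + (- ?b) + (- N r \<omega>)))\<^sup>2)"
          using elim by simp
        also have "\<dots> \<le> 3 * (ennreal ((norm (P T \<omega>))\<^sup>2) + ennreal ((norm ?b)\<^sup>2) + ennreal ((norm (N r \<omega>))\<^sup>2))"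
          using ennreal_norm_square_add3[of "P T \<omega>" "- ?b" "- N r \<omega>"] by simp
        also have "ennreal ((norm ?b)\<^sup>2) \<le> ennreal T * energy \<beta> \<omega>"
        proof -
          have "ennreal ((norm ?b)\<^sup>2) \<le> ennreal T * (\<integral>\<^sup>+q\<in>{r<..}. ennreal ((norm (\<beta> q \<omega>))\<^sup>2) \<partial>time_measure T)"
            using elim by (intro norm_tail_integral_le \<beta>m) auto
          also have "\<dots> \<le> ennreal T * energy \<beta> \<omega>"
            unfolding energy_def by (intro mult_left_mono nn_integral_mono) (auto simp: indicator_def)
          finally show ?thesis .
        qed
        finally show ?case by (simp add: add_left_mono add_right_mono mult_left_mono)
      qed
    qed
    also have "\<dots> = 3 * ((\<integral>\<^sup>+\<omega>. ennreal ((norm (P T \<omega>))\<^sup>2) \<partial>M)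
        + ennreal T * (\<integral>\<^sup>+\<omega>. energy \<beta> \<omega> \<partial>M) + (\<integral>\<^sup>+\<omega>. ennreal ((norm (N r \<omega>))\<^sup>2) \<partial>M))"
      by (simp add: nn_integral_cmult nn_integral_add)
    also have "\<dots> \<le> B"
      unfolding B_def using ito_increments_isometry(4)[OF N fin r sp]
      by (intro mult_left_mono add_left_mono) auto
    finally show ?thesis .
  qed
  then show "\<exists>B<\<infinity>. \<forall>r\<in>{0..T}. (\<integral>\<^sup>+\<omega>. ennreal ((norm (P r \<omega>))\<^sup>2) \<partial>M) \<le> B" using Bfin by blast
  show "integrable M (\<lambda>\<omega>. (norm (P r \<omega>))\<^sup>2)" if r: "r \<in> {0..T}" for r
  proof -
    have [measurable]: "P r \<in> borel_measurable M" by (rule PM[OF r])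
    show ?thesis using le_less_trans[OF bound[OF r] Bfin] by (intro integrableI_bounded) auto
  qed
  have "(\<integral>\<^sup>+\<omega>. energy P \<omega> \<partial>M) = (\<integral>\<^sup>+r. (\<integral>\<^sup>+\<omega>. ennreal ((norm (P r \<omega>))\<^sup>2) \<partial>M) \<partial>time_measure T)"
    unfolding energy_def by (rule TP.Fubini') measurable
  also have "\<dots> \<le> (\<integral>\<^sup>+r. B \<partial>time_measure T)" using bound by (intro nn_integral_mono) auto
  also have "\<dots> = B * ennreal T" using T_pos emeasure_time_measure[of T] by simp
  also have "\<dots> < \<infinity>" using Bfin by (simp add: ennreal_mult_less_top)
  finally show "(\<integral>\<^sup>+\<omega>. energy P \<omega> \<partial>M) < \<infinity>" .
qed

text \<open>With \<open>B\<close> the drift integral over \<open>(s, T]\<close>, the variable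
  \<open>P T - B = P s + N s\<close> is squared in two ways. On the right, \<open>N s\<close> is
  orthogonal to \<open>P s\<close>. On the left appears \<open>E [P T \<bullet> B]\<close>, the time
  integral of \<open>E [P T \<bullet> \<beta> r]\<close>; here \<open>P T\<close> is split at time
  \<open>r\<close> into \<open>P r\<close>, the drift still to come, and \<open>N r\<close>. The
  future drift against \<open>\<beta> r\<close> integrates to \<open>|B|^2 / 2\<close>, which
  cancels the square of \<open>B\<close>. All expectations are restricted to
  \<open>A\<close>.\<close>

lemma product_formula:
  fixes P \<beta> :: "real \<Rightarrow> 'w \<Rightarrow> real^'d" and H :: "real \<Rightarrow> 'w \<Rightarrow> real^'e^'d"
  assumes N: "ito_increments H N" and fin: "(\<integral>\<^sup>+\<omega>. energy H \<omega> \<partial>M) < \<infinity>"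
    and Pm: "case_prod P \<in> borel_measurable (time_measure T \<Otimes>\<^sub>M M)"
    and PF: "\<And>r. r \<in> {0..T} \<Longrightarrow> P r \<in> borel_measurable (F r)"
    and \<beta>m: "case_prod \<beta> \<in> borel_measurable (time_measure T \<Otimes>\<^sub>M M)"
    and \<beta>F: "\<And>r. r \<in> {0..T} \<Longrightarrow> \<beta> r \<in> borel_measurable (F r)"
    and \<beta>fin: "(\<integral>\<^sup>+\<omega>. energy \<beta> \<omega> \<partial>M) < \<infinity>"
    and PT: "integrable M (\<lambda>\<omega>. (norm (P T \<omega>))\<^sup>2)"
    and eq: "\<And>r. r \<in> {0..T} \<Longrightarrow>
      AE \<omega> in M. P T \<omega> = P r \<omega> + (\<integral>q. indicator {r<..} q *\<^sub>R \<beta> q \<omega> \<partial>time_measure T) + N r \<omega>"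
    and s: "s \<in> {0..T}" and A: "A \<in> sets (F s)"
  shows "(\<integral>\<omega>. indicator A \<omega> * (norm (P T \<omega>))\<^sup>2 \<partial>M) = (\<integral>\<omega>. indicator A \<omega> * (norm (P s \<omega>))\<^sup>2 \<partial>M)
    + (\<integral>z. (indicator A (snd z) * indicator {s<..} (fst z)) *
        (2 * (P (fst z) (snd z) \<bullet> \<beta> (fst z) (snd z)) + (norm (H (fst z) (snd z)))\<^sup>2) \<partial>(time_measure T \<Otimes>\<^sub>M M))"
proof -
  let ?L = "time_measure T"
  let ?Q = "?L \<Otimes>\<^sub>M M"
  have PM: "P r \<in> borel_measurable M" and \<beta>M: "\<beta> r \<in> borel_measurable M" if "r \<in> {0..T}" for r
    using F_measurable_M[OF PF[OF that] that] F_measurable_M[OF \<beta>F[OF that] that] by auto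
  note Hm = ito_incrementsD(1)[OF N]
  have Tin: "T \<in> {0..T}" using T_pos by simp
  have AM[measurable]: "A \<in> sets M" by (rule F_sets_M[OF A s])
  note [measurable] = Pm \<beta>m Hm PM[OF s] PM[OF Tin] ito_increments_measurable[OF N s]
  have sq: "r \<in> {0..T} \<Longrightarrow> integrable M (\<lambda>\<omega>. (norm (P r \<omega>))\<^sup>2)" "(\<integral>\<^sup>+\<omega>. energy P \<omega> \<partial>M) < \<infinity>" for r
    by (rule ito_process_square_integrable(1)[OF N fin Pm PM \<beta>m \<beta>fin PT eq]; assumption)
       (rule ito_process_square_integrable(2)[OF N fin Pm PM \<beta>m \<beta>fin PT eq]; assumption)
  define b where "b z = (\<integral>q. indicator {fst z<..} q *\<^sub>R \<beta> q (snd z) \<partial>?L)" for z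
  define B where "B \<omega> = (\<integral>q. indicator {s<..} q *\<^sub>R \<beta> q \<omega> \<partial>?L)" for \<omega>
  define a where "a z = (indicator A (snd z) * indicator {s<..} (fst z) :: real)" for z :: "real \<times> 'w"
  have bm[measurable]: "b \<in> borel_measurable ?Q"
    unfolding b_def[abs_def] by (rule measurable_tail_integral[OF \<beta>m])
  have am[measurable]: "a \<in> borel_measurable ?Q" unfolding a_def[abs_def] by measurable
  have a01: "\<bar>a z\<bar> \<le> 1" for z by (simp add: a_def indicator_def)
  have Bm[measurable]: "B \<in> borel_measurable M"
  proof -
    have "(\<lambda>\<omega>. b (s, \<omega>)) \<in> borel_measurable M"
      using measurable_compose[OF measurable_Pair1' bm] s by simp
    then show ?thesis by (simp add: b_def B_def[abs_def])
  qed
  have ai: "integrable ?Q (\<lambda>z. a z * g z)" if "integrable ?Q g" for g :: "real \<times> 'w \<Rightarrow> real"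
  proof (rule Bochner_Integration.integrable_bound[OF that])
    show "AE z in ?Q. norm (a z * g z) \<le> norm (g z)"
      by (rule AE_I2) (auto simp: a_def indicator_def)
    show "(\<lambda>z. a z * g z) \<in> borel_measurable ?Q" using that by simp
  qed
  have Ai: "integrable M (\<lambda>\<omega>. indicator A \<omega> * g \<omega>)" if "integrable M g" for g :: "'w \<Rightarrow> real"
  proof (rule Bochner_Integration.integrable_bound[OF that])
    show "AE \<omega> in M. norm (indicator A \<omega> * g \<omega>) \<le> norm (g \<omega>)"
      by (rule AE_I2) (auto simp: indicator_def)
    show "(\<lambda>\<omega>. indicator A \<omega> * g \<omega>) \<in> borel_measurable M" using that by simp
  qed
  have \<beta>sq: "integrable ?Q (\<lambda>z. (norm (\<beta> (fst z) (snd z)))\<^sup>2)" by (rule integrable_energy[OF \<beta>m \<beta>fin])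
  have Psq: "integrable ?Q (\<lambda>z. (norm (P (fst z) (snd z)))\<^sup>2)" by (rule integrable_energy[OF Pm sq(2)])
  have Hsq: "integrable ?Q (\<lambda>z. (norm (H (fst z) (snd z)))\<^sup>2)" by (rule integrable_energy[OF Hm fin])
  have lift: "integrable ?Q (\<lambda>z. g (snd z))" if g: "integrable M g" for g :: "'w \<Rightarrow> real"
  proof (rule TP.Fubini_integrable)
    show "(\<lambda>z. g (snd z)) \<in> borel_measurable ?Q"
      using measurable_compose[OF measurable_snd borel_measurable_integrable[OF g]] .
  qed (use g in auto)
  have en_b: "ennreal ((norm (b z))\<^sup>2) \<le> ennreal T * energy \<beta> (snd z)" if z: "snd z \<in> space M" for z
  proof -
    have "ennreal ((norm (b z))\<^sup>2) \<le> ennreal T * (\<integral>\<^sup>+q\<in>{fst z<..}. ennreal ((norm (\<beta> q (snd z)))\<^sup>2) \<partial>?L)"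
      unfolding b_def by (intro norm_tail_integral_le \<beta>m z) auto
    also have "\<dots> \<le> ennreal T * energy \<beta> (snd z)"
      unfolding energy_def by (intro mult_left_mono nn_integral_mono) (auto simp: indicator_def)
    finally show ?thesis .
  qed
  have enr: "(\<integral>\<^sup>+\<omega>. ennreal T * energy \<beta> \<omega> \<partial>M) < \<infinity>"
    using \<beta>fin energy_measurable[OF \<beta>m] by (simp add: nn_integral_cmult ennreal_mult_less_top)
  have Bsq: "integrable M (\<lambda>\<omega>. (norm (B \<omega>))\<^sup>2)"
  proof (rule integrableI_bounded)
    have "(\<integral>\<^sup>+\<omega>. ennreal (norm ((norm (B \<omega>))\<^sup>2)) \<partial>M) \<le> (\<integral>\<^sup>+\<omega>. ennreal T * energy \<beta> \<omega> \<partial>M)"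
      using en_b[of "(s, _)"] by (intro nn_integral_mono) (simp add: b_def B_def)
    then show "(\<integral>\<^sup>+\<omega>. ennreal (norm ((norm (B \<omega>))\<^sup>2)) \<partial>M) < \<infinity>" using enr by (rule le_less_trans)
  qed measurable
  have bsq: "integrable ?Q (\<lambda>z. (norm (b z))\<^sup>2)"
  proof (rule integrableI_bounded)
    have "(\<integral>\<^sup>+z. ennreal (norm ((norm (b z))\<^sup>2)) \<partial>?Q) = (\<integral>\<^sup>+r. (\<integral>\<^sup>+\<omega>. ennreal ((norm (b (r, \<omega>)))\<^sup>2) \<partial>M) \<partial>?L)"
      by (subst nn_integral_fst[symmetric]) auto
    also have "\<dots> \<le> (\<integral>\<^sup>+r. (\<integral>\<^sup>+\<omega>. ennreal T * energy \<beta> \<omega> \<partial>M) \<partial>?L)"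
      using en_b[of "(_, _)"] by (intro nn_integral_mono) auto
    also have "\<dots> = (\<integral>\<^sup>+\<omega>. ennreal T * energy \<beta> \<omega> \<partial>M) * ennreal T"
      using emeasure_time_measure[of T] T_pos by simp
    also have "\<dots> < \<infinity>" using enr by (simp add: ennreal_mult_less_top)
    finally show "(\<integral>\<^sup>+z. ennreal (norm ((norm (b z))\<^sup>2)) \<partial>?Q) < \<infinity>" .
  qed measurable
  have sndM: "(\<lambda>z. P T (snd z)) \<in> borel_measurable ?Q"
    by (rule measurable_compose[OF measurable_snd PM[OF Tin]])
  note [measurable] = sndM
  have PTsq: "integrable ?Q (\<lambda>z. (norm (P T (snd z)))\<^sup>2)" by (rule lift[OF PT])
  have \<beta>'[measurable]: "(\<lambda>z. \<beta> (fst z) (snd z)) \<in> borel_measurable ?Q"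
    "(\<lambda>z. P (fst z) (snd z)) \<in> borel_measurable ?Q" by measurable
  note i_Pb = ai[OF integrable_inner_square[OF \<beta>'(2) \<beta>'(1) Psq \<beta>sq]]
  note i_Tb = ai[OF integrable_inner_square[OF sndM \<beta>'(1) PTsq \<beta>sq]]
  note i_bb = ai[OF integrable_inner_square[OF bm \<beta>'(1) bsq \<beta>sq]]
  have \<beta>sec: "AE \<omega> in M. integrable ?L (\<lambda>q. \<beta> q \<omega>)"
  proof -
    have "AE \<omega> in M. energy \<beta> \<omega> \<noteq> \<infinity>"
      using \<beta>fin by (intro nn_integral_PInf_AE energy_measurable[OF \<beta>m]) auto
    then show ?thesis using AE_space
      by eventually_elim (auto intro!: energy_finite_section[OF \<beta>m] simp: less_top)
  qed
  \<comment> \<open>Fubini in \<open>\<omega>\<close> first: the increment \<open>N r\<close> is orthogonal to \<open>\<beta> r\<close>.\<close>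
  have X2: "(\<integral>z. a z * (P T (snd z) \<bullet> \<beta> (fst z) (snd z)) \<partial>?Q)
      - (\<integral>z. a z * (P (fst z) (snd z) \<bullet> \<beta> (fst z) (snd z)) \<partial>?Q)
      = (\<integral>z. a z * (b z \<bullet> \<beta> (fst z) (snd z)) \<partial>?Q)"
  proof -
    let ?g = "\<lambda>z. a z * (P T (snd z) \<bullet> \<beta> (fst z) (snd z)) - a z * (P (fst z) (snd z) \<bullet> \<beta> (fst z) (snd z))
      - a z * (b z \<bullet> \<beta> (fst z) (snd z))"
    have ig: "integrable ?Q ?g" using i_Pb i_Tb i_bb by simp
    have "(\<integral>z. ?g z \<partial>?Q) = (\<integral>r. (\<integral>\<omega>. ?g (r, \<omega>) \<partial>M) \<partial>?L)"
      by (rule TP.integral_fst'[OF ig, symmetric])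
    also have "\<dots> = (\<integral>r. 0 \<partial>?L)"
    proof (rule integral_cong_AE)
      have "AE r in ?L. integrable M (\<lambda>\<omega>. (norm (\<beta> r \<omega>))\<^sup>2)"
        using TP.AE_integrable_fst'[OF \<beta>sq] by simp
      then show "AE r in ?L. (\<integral>\<omega>. ?g (r, \<omega>) \<partial>M) = 0"
        using AE_space
      proof eventually_elim
        case (elim r)
        then have r: "r \<in> {0..T}" by simp
        show ?case
        proof (cases "s < r")
          case False
          then show ?thesis by (simp add: a_def)
        next
          case True
          have Ar: "A \<in> sets (F r)" using True r s by (intro F_sets_mono[OF A]) auto
          have [measurable]: "\<beta> r \<in> borel_measurable (F r)" by (rule \<beta>F[OF r])
          have \<zeta>m: "(\<lambda>\<omega>. indicator A \<omega> *\<^sub>R \<beta> r \<omega>) \<in> borel_measurable (F r)" using Ar by measurable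
          have [measurable]: "\<beta> r \<in> borel_measurable M" by (rule \<beta>M[OF r])
          have \<zeta>i: "integrable M (\<lambda>\<omega>. (norm (indicator A \<omega> *\<^sub>R \<beta> r \<omega>))\<^sup>2)"
            by (rule Bochner_Integration.integrable_bound[OF elim(1)]) (auto simp: indicator_def)
          have gm: "(\<lambda>\<omega>. ?g (r, \<omega>)) \<in> borel_measurable M"
            using measurable_compose[OF measurable_Pair1' borel_measurable_integrable[OF ig]] r by simp
          have "(\<integral>\<omega>. ?g (r, \<omega>) \<partial>M) = (\<integral>\<omega>. (indicator A \<omega> *\<^sub>R \<beta> r \<omega>) \<bullet> N r \<omega> \<partial>M)"
          proof (rule integral_cong_AE[OF gm])
            show "(\<lambda>\<omega>. (indicator A \<omega> *\<^sub>R \<beta> r \<omega>) \<bullet> N r \<omega>) \<in> borel_measurable M"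
              using ito_increments_measurable[OF N r] by measurable
            show "AE \<omega> in M. ?g (r, \<omega>) = (indicator A \<omega> *\<^sub>R \<beta> r \<omega>) \<bullet> N r \<omega>"
              using eq[OF r]
              by eventually_elim (use True in \<open>simp add: a_def b_def inner_add_left inner_commute algebra_simps\<close>)
          qed
          also have "\<dots> = 0" by (rule ito_increments_orthogonal(2)[OF N fin r \<zeta>m \<zeta>i])
          finally show ?thesis .
        qed
      qed
      show "(\<lambda>r. \<integral>\<omega>. ?g (r, \<omega>) \<partial>M) \<in> borel_measurable ?L"
        using TP.integrable_fst'[OF ig] by simp
    qed simp
    finally show ?thesis using i_Pb i_Tb i_bb by simp
  qed
  \<comment> \<open>Fubini in the other order: for a fixed path the integral over ordered pairs of
    times is half a square, with the drift before \<open>s\<close> cut off by the indicator.\<close>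
  have X3: "(\<integral>z. a z * (b z \<bullet> \<beta> (fst z) (snd z)) \<partial>?Q) = (\<integral>\<omega>. indicator A \<omega> * ((norm (B \<omega>))\<^sup>2 / 2) \<partial>M)"
  proof -
    have "(\<integral>z. a z * (b z \<bullet> \<beta> (fst z) (snd z)) \<partial>?Q) = (\<integral>\<omega>. (\<integral>r. a (r, \<omega>) * (b (r, \<omega>) \<bullet> \<beta> r \<omega>) \<partial>?L) \<partial>M)"
      using TP.integral_snd[of "\<lambda>r \<omega>. a (r, \<omega>) * (b (r, \<omega>) \<bullet> \<beta> r \<omega>)"] i_bb by (simp add: split_beta')
    also have "\<dots> = (\<integral>\<omega>. indicator A \<omega> * ((norm (B \<omega>))\<^sup>2 / 2) \<partial>M)"
    proof (rule integral_cong_AE)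
      show "AE \<omega> in M. (\<integral>r. a (r, \<omega>) * (b (r, \<omega>) \<bullet> \<beta> r \<omega>) \<partial>?L) = indicator A \<omega> * ((norm (B \<omega>))\<^sup>2 / 2)"
        using \<beta>sec
      proof eventually_elim
        case (elim \<omega>)
        let ?\<gamma> = "\<lambda>q. indicator {s<..} q *\<^sub>R \<beta> q \<omega>"
        have m\<beta>: "(\<lambda>q. \<beta> q \<omega>) \<in> borel_measurable ?L" using elim by simp
        have "integrable ?L ?\<gamma>"
        proof (rule Bochner_Integration.integrable_bound[OF elim])
          show "?\<gamma> \<in> borel_measurable ?L" using m\<beta> by measurable
        qed (auto simp: indicator_def)
        from ordered_double_integral[OF this]
        have *: "(\<integral>r. (\<integral>q. indicator {r<..} q *\<^sub>R ?\<gamma> q \<partial>?L) \<bullet> ?\<gamma> r \<partial>?L) = (norm (B \<omega>))\<^sup>2 / 2"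
          unfolding B_def .
        have "(\<integral>r. a (r, \<omega>) * (b (r, \<omega>) \<bullet> \<beta> r \<omega>) \<partial>?L)
            = (\<integral>r. indicator A \<omega> * ((\<integral>q. indicator {r<..} q *\<^sub>R ?\<gamma> q \<partial>?L) \<bullet> ?\<gamma> r) \<partial>?L)"
        proof (rule Bochner_Integration.integral_cong[OF refl])
          fix r
          show "a (r, \<omega>) * (b (r, \<omega>) \<bullet> \<beta> r \<omega>)
            = indicator A \<omega> * ((\<integral>q. indicator {r<..} q *\<^sub>R ?\<gamma> q \<partial>?L) \<bullet> ?\<gamma> r)"
          proof (cases "s < r")
            case True
            have "b (r, \<omega>) = (\<integral>q. indicator {r<..} q *\<^sub>R ?\<gamma> q \<partial>?L)"
              unfolding b_def using True by (intro Bochner_Integration.integral_cong) (auto simp: indicator_def)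
            then show ?thesis using True by (simp add: a_def)
          qed (simp add: a_def)
        qed
        also have "\<dots> = indicator A \<omega> * ((norm (B \<omega>))\<^sup>2 / 2)" by (simp only: * integral_mult_right_zero)
        finally show ?case .
      qed
      show "(\<lambda>\<omega>. \<integral>r. a (r, \<omega>) * (b (r, \<omega>) \<bullet> \<beta> r \<omega>) \<partial>?L) \<in> borel_measurable M"
        using TP.integrable_snd[of "\<lambda>r \<omega>. a (r, \<omega>) * (b (r, \<omega>) \<bullet> \<beta> r \<omega>)"] i_bb by (simp add: split_beta')
    qed measurable
    finally show ?thesis .
  qed
  have X4: "(\<integral>z. a z * (P T (snd z) \<bullet> \<beta> (fst z) (snd z)) \<partial>?Q) = (\<integral>\<omega>. indicator A \<omega> * (P T \<omega> \<bullet> B \<omega>) \<partial>M)"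
  proof -
    have "(\<integral>z. a z * (P T (snd z) \<bullet> \<beta> (fst z) (snd z)) \<partial>?Q) = (\<integral>\<omega>. (\<integral>r. a (r, \<omega>) * (P T \<omega> \<bullet> \<beta> r \<omega>) \<partial>?L) \<partial>M)"
      using TP.integral_snd[of "\<lambda>r \<omega>. a (r, \<omega>) * (P T \<omega> \<bullet> \<beta> r \<omega>)"] i_Tb by (simp add: split_beta')
    also have "\<dots> = (\<integral>\<omega>. indicator A \<omega> * (P T \<omega> \<bullet> B \<omega>) \<partial>M)"
    proof (rule integral_cong_AE)
      show "AE \<omega> in M. (\<integral>r. a (r, \<omega>) * (P T \<omega> \<bullet> \<beta> r \<omega>) \<partial>?L) = indicator A \<omega> * (P T \<omega> \<bullet> B \<omega>)"
        using \<beta>sec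
      proof eventually_elim
        case (elim \<omega>)
        let ?\<gamma> = "\<lambda>q. indicator {s<..} q *\<^sub>R \<beta> q \<omega>"
        have m\<beta>: "(\<lambda>q. \<beta> q \<omega>) \<in> borel_measurable ?L" using elim by simp
        have \<gamma>: "integrable ?L ?\<gamma>"
        proof (rule Bochner_Integration.integrable_bound[OF elim])
          show "?\<gamma> \<in> borel_measurable ?L" using m\<beta> by measurable
        qed (auto simp: indicator_def)
        have "(\<integral>r. a (r, \<omega>) * (P T \<omega> \<bullet> \<beta> r \<omega>) \<partial>?L) = (\<integral>r. indicator A \<omega> * (P T \<omega> \<bullet> ?\<gamma> r) \<partial>?L)"
          by (intro Bochner_Integration.integral_cong) (auto simp: a_def)
        also have "\<dots> = indicator A \<omega> * (P T \<omega> \<bullet> B \<omega>)"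
          unfolding B_def integral_mult_right_zero by (subst integral_inner_right[OF \<gamma>]) (rule refl)
        finally show ?case .
      qed
      show "(\<lambda>\<omega>. \<integral>r. a (r, \<omega>) * (P T \<omega> \<bullet> \<beta> r \<omega>) \<partial>?L) \<in> borel_measurable M"
        using TP.integrable_snd[of "\<lambda>r \<omega>. a (r, \<omega>) * (P T \<omega> \<bullet> \<beta> r \<omega>)"] i_Tb by (simp add: split_beta')
    qed measurable
    finally show ?thesis .
  qed
  have i_TB: "integrable M (\<lambda>\<omega>. indicator A \<omega> * (P T \<omega> \<bullet> B \<omega>))"
    by (rule Ai[OF integrable_inner_square[OF PM[OF Tin] Bm PT Bsq]])
  note i_T = Ai[OF PT] and i_s = Ai[OF sq(1)[OF s]] and i_B = Ai[OF Bsq]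
  note iN = ito_increments_isometry[OF N fin s A]
  \<comment> \<open>The mixed term of the square of \<open>P s + N s\<close> vanishes because
    \<open>P s\<close> on \<open>A\<close> is known at time \<open>s\<close>.\<close>
  have X1: "(\<integral>\<omega>. indicator A \<omega> * (norm (P T \<omega> - B \<omega>))\<^sup>2 \<partial>M)
      = (\<integral>\<omega>. indicator A \<omega> * (norm (P s \<omega>))\<^sup>2 \<partial>M) + (\<integral>\<omega>. indicator A \<omega> * (norm (N s \<omega>))\<^sup>2 \<partial>M)"
  proof -
    have \<zeta>m: "(\<lambda>\<omega>. indicator A \<omega> *\<^sub>R P s \<omega>) \<in> borel_measurable (F s)"
      using A PF[OF s] by measurable
    have \<zeta>i: "integrable M (\<lambda>\<omega>. (norm (indicator A \<omega> *\<^sub>R P s \<omega>))\<^sup>2)"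
      by (rule Bochner_Integration.integrable_bound[OF sq(1)[OF s]]) (auto simp: indicator_def)
    note o = ito_increments_orthogonal[OF N fin s \<zeta>m \<zeta>i]
    have "(\<integral>\<omega>. indicator A \<omega> * (norm (P T \<omega> - B \<omega>))\<^sup>2 \<partial>M)
      = (\<integral>\<omega>. indicator A \<omega> * (norm (P s \<omega>))\<^sup>2 + 2 * ((indicator A \<omega> *\<^sub>R P s \<omega>) \<bullet> N s \<omega>)
          + indicator A \<omega> * (norm (N s \<omega>))\<^sup>2 \<partial>M)"
    proof (rule integral_cong_AE)
      show "AE \<omega> in M. indicator A \<omega> * (norm (P T \<omega> - B \<omega>))\<^sup>2
        = indicator A \<omega> * (norm (P s \<omega>))\<^sup>2 + 2 * ((indicator A \<omega> *\<^sub>R P s \<omega>) \<bullet> N s \<omega>)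
          + indicator A \<omega> * (norm (N s \<omega>))\<^sup>2"
        using eq[OF s]
      proof eventually_elim
        case (elim \<omega>)
        then have "P T \<omega> - B \<omega> = P s \<omega> + N s \<omega>" by (simp add: B_def)
        then show ?case
          by (simp add: power2_norm_eq_inner inner_add_left inner_add_right inner_commute algebra_simps)
      qed
    qed measurable
    also have "\<dots> = (\<integral>\<omega>. indicator A \<omega> * (norm (P s \<omega>))\<^sup>2 \<partial>M) + (\<integral>\<omega>. indicator A \<omega> * (norm (N s \<omega>))\<^sup>2 \<partial>M)"
      using i_s iN(2) o by simp
    finally show ?thesis .
  qed
  have X1': "(\<integral>\<omega>. indicator A \<omega> * (norm (P T \<omega> - B \<omega>))\<^sup>2 \<partial>M)
      = (\<integral>\<omega>. indicator A \<omega> * (norm (P T \<omega>))\<^sup>2 \<partial>M) - 2 * (\<integral>\<omega>. indicator A \<omega> * (P T \<omega> \<bullet> B \<omega>) \<partial>M)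
        + (\<integral>\<omega>. indicator A \<omega> * (norm (B \<omega>))\<^sup>2 \<partial>M)"
  proof -
    have "(\<integral>\<omega>. indicator A \<omega> * (norm (P T \<omega> - B \<omega>))\<^sup>2 \<partial>M)
      = (\<integral>\<omega>. indicator A \<omega> * (norm (P T \<omega>))\<^sup>2 - 2 * (indicator A \<omega> * (P T \<omega> \<bullet> B \<omega>))
          + indicator A \<omega> * (norm (B \<omega>))\<^sup>2 \<partial>M)"
      by (intro Bochner_Integration.integral_cong refl)
        (simp add: power2_norm_eq_inner inner_diff_left inner_diff_right inner_commute algebra_simps)
    then show ?thesis using i_T i_TB i_B by simp
  qed
  have "(\<integral>z. a z * (2 * (P (fst z) (snd z) \<bullet> \<beta> (fst z) (snd z)) + (norm (H (fst z) (snd z)))\<^sup>2) \<partial>?Q)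
      = (\<integral>z. 2 * (a z * (P (fst z) (snd z) \<bullet> \<beta> (fst z) (snd z))) + a z * (norm (H (fst z) (snd z)))\<^sup>2 \<partial>?Q)"
    by (intro Bochner_Integration.integral_cong refl) (simp add: algebra_simps)
  also have "\<dots> = 2 * (\<integral>z. a z * (P (fst z) (snd z) \<bullet> \<beta> (fst z) (snd z)) \<partial>?Q)
      + (\<integral>z. a z * (norm (H (fst z) (snd z)))\<^sup>2 \<partial>?Q)"
    using i_Pb ai[OF Hsq] by simp
  also have "(\<integral>z. a z * (norm (H (fst z) (snd z)))\<^sup>2 \<partial>?Q) = (\<integral>\<omega>. indicator A \<omega> * (norm (N s \<omega>))\<^sup>2 \<partial>M)"
    unfolding iN(3) a_def by simp
  finally have "(\<integral>z. a z * (2 * (P (fst z) (snd z) \<bullet> \<beta> (fst z) (snd z)) + (norm (H (fst z) (snd z)))\<^sup>2) \<partial>?Q)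
      = 2 * (\<integral>z. a z * (P (fst z) (snd z) \<bullet> \<beta> (fst z) (snd z)) \<partial>?Q)
        + (\<integral>\<omega>. indicator A \<omega> * (norm (N s \<omega>))\<^sup>2 \<partial>M)" .
  moreover have "(\<integral>\<omega>. indicator A \<omega> * ((norm (B \<omega>))\<^sup>2 / 2) \<partial>M) = (\<integral>\<omega>. indicator A \<omega> * (norm (B \<omega>))\<^sup>2 \<partial>M) / 2"
    by simp
  ultimately show ?thesis
    using X1 X1' X2 X3 X4 unfolding a_def by simp
qed

end

section \<open>A priori estimates\<close>

text \<open>The left-hand side is the quadratic variation stopped at level \<open>R\<close>.\<close>

lemma min_energy_le_stopped:
  fixes h :: "real \<Rightarrow> ennreal"
  assumes T: "0 < T" and hm[measurable]: "h \<in> borel_measurable (time_measure T)"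
    and fin: "(\<integral>\<^sup>+r. h r \<partial>time_measure T) < \<infinity>" and t: "t \<in> {0..T}"
  defines "A \<equiv> \<lambda>t. \<integral>\<^sup>+r\<in>{0<..t}. h r \<partial>time_measure T"
  shows "min (A t) (ennreal R) \<le> (\<integral>\<^sup>+r\<in>{0<..t}. (indicator {r. A r < ennreal R} r * h r) \<partial>time_measure T)"
proof -
  have mono: "A r \<le> A r'" if "r \<le> r'" for r r'
    unfolding A_def using that by (intro nn_integral_mono) (auto simp: indicator_def)
  show ?thesis
  proof (cases "A t < ennreal R")
    case True
    have "A r < ennreal R" if "r \<le> t" for r using mono[OF that] True by (rule le_less_trans)
    then have "A t = (\<integral>\<^sup>+r\<in>{0<..t}. (indicator {r. A r < ennreal R} r * h r) \<partial>time_measure T)"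
      by (subst A_def, intro nn_integral_cong) (auto simp: indicator_def)
    then show ?thesis by simp
  next
    case False
    \<comment> \<open>\<open>s0\<close> marks the end of the times at which the accumulated value
      stays below \<open>R\<close>; 0 is inserted to keep the set nonempty.\<close>
    define S where "S = insert 0 {r. 0 < r \<and> r \<le> t \<and> A r < ennreal R}"
    define s0 where "s0 = Sup S"
    have Sne: "S \<noteq> {}" "bdd_above S" using t by (auto simp: S_def intro!: bdd_aboveI[of _ t])
    have s0: "0 \<le> s0" "s0 \<le> t"
      unfolding s0_def using Sne t by (auto intro!: cSup_upper cSup_least simp: S_def)
    have below: "A r < ennreal R" if r: "0 < r" "r < s0" for r
    proof -
      obtain r' where "r' \<in> S" "r < r'" using less_cSupD[OF Sne(1), of r] r by (auto simp: s0_def)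
      then show ?thesis using r mono[of r r'] by (auto simp: S_def intro: le_less_trans)
    qed
    have above: "ennreal R \<le> A r" if r: "s0 < r" "r \<le> t" for r
    proof (rule ccontr)
      assume "\<not> ennreal R \<le> A r"
      then have "r \<in> S" using r s0 by (auto simp: S_def)
      then have "r \<le> s0" unfolding s0_def by (rule cSup_upper[OF _ Sne(2)])
      then show False using r by simp
    qed
    \<comment> \<open>Right continuity of \<open>A\<close> at \<open>s0\<close>: at every later time
      up to \<open>t\<close> the level is reached, and the times \<open>s n\<close> decrease to
      \<open>s0\<close>, so it is reached at \<open>s0\<close> already.\<close>
    have As0: "ennreal R \<le> A s0"
    proof (cases "s0 = t")
      case True
      then show ?thesis using False by simp
    next
      case ne: False
      define s where "s n = s0 + (t - s0) * inverse (real (Suc n))" for n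
      have s: "s0 < s n" "s n \<le> t" for n
      proof -
        have "inverse (real (Suc n)) \<le> 1" by (simp add: field_simps)
        then have "(t - s0) * inverse (real (Suc n)) \<le> (t - s0) * 1"
          using s0 by (intro mult_left_mono) auto
        then show "s n \<le> t" by (simp add: s_def)
        show "s0 < s n" using s0 ne by (simp add: s_def)
      qed
      have "s \<longlonglongrightarrow> s0 + (t - s0) * 0"
        unfolding s_def[abs_def] by (intro tendsto_intros LIMSEQ_inverse_real_of_nat)
      then have slim: "s \<longlonglongrightarrow> s0" by simp
      have "(\<lambda>n. A (s n)) \<longlonglongrightarrow> A s0"
        unfolding A_def
      proof (rule nn_integral_dominated_convergence[where w=h])
        show "AE r in time_measure T. (\<lambda>n. h r * indicator {0<..s n} r) \<longlonglongrightarrow> h r * indicator {0<..s0} r"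
        proof (rule AE_I2)
          fix r
          have "eventually (\<lambda>n. h r * indicator {0<..s n} r = h r * indicator {0<..s0} r) sequentially"
          proof (cases "s0 < r")
            case True
            have "eventually (\<lambda>n. s n < r) sequentially" using slim True by (rule order_tendstoD(2))
            then show ?thesis by eventually_elim (use True in \<open>auto simp: indicator_def\<close>)
          next
            case False
            then have "r \<le> s n" for n using s[of n] by simp
            then show ?thesis using False by (intro always_eventually) (auto simp: indicator_def)
          qed
          then show "(\<lambda>n. h r * indicator {0<..s n} r) \<longlonglongrightarrow> h r * indicator {0<..s0} r"
            by (rule tendsto_eventually)
        qed
        show "AE r in time_measure T. h r * indicator {0<..s j} r \<le> h r" for j
          by (rule AE_I2) (auto simp: indicator_def)
        show "(\<integral>\<^sup>+r. h r \<partial>time_measure T) < \<infinity>" by (rule fin)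
        show "(\<lambda>r. h r * indicator {0<..s i} r) \<in> borel_measurable (time_measure T)" for i by measurable
      qed measurable
      then show ?thesis using above[OF s] by (intro LIMSEQ_le_const) auto
    qed
    \<comment> \<open>\<open>A\<close> is known to be below \<open>R\<close> only strictly before
      \<open>s0\<close>; the single time \<open>s0\<close> has measure 0.\<close>
    have null: "AE r in time_measure T. r \<noteq> s0"
    proof -
      have "AE y in lborel. y \<noteq> s0" by (rule AE_lborel_singleton)
      then show ?thesis unfolding time_measure_def by (subst AE_restrict_space_iff) auto
    qed
    have "min (A t) (ennreal R) \<le> A s0" using As0 by (simp add: min.coboundedI2)
    also have "A s0 = (\<integral>\<^sup>+r\<in>{0<..s0}. h r \<partial>time_measure T)" by (simp add: A_def)
    also have "\<dots> \<le> (\<integral>\<^sup>+r\<in>{0<..t}. (indicator {r. A r < ennreal R} r * h r) \<partial>time_measure T)"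
    proof (rule nn_integral_mono_AE)
      show "AE r in time_measure T. h r * indicator {0<..s0} r
        \<le> indicator {r. A r < ennreal R} r * h r * indicator {0<..t} r"
        using null
      proof eventually_elim
        case (elim r)
        then show ?case using below[of r] s0 by (auto simp: indicator_def)
      qed
    qed
    finally show ?thesis .
  qed
qed

text \<open>The constants of two nested applications of Gronwall's inequality: \<open>c\<close>,
  \<open>E\<close>, \<open>C1\<close> come from the pathwise one, \<open>c'\<close> and
  \<open>E'\<close> from the one for the truncated second moment of the martingale part. The last
  line substitutes the second bound into the first.\<close>

definition moment_constant :: "real \<Rightarrow> real \<Rightarrow> real" where
  "moment_constant K T = (
     let c = 4 * T * K\<^sup>2 + 1; E = 2 * exp (2 * c * T); C1 = c * E * (4 * T * T) + 4 * T;
         c' = 2 * K\<^sup>2 * (2 + c * E * 2 * T) + 1; E' = 2 * exp (2 * c' * T)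
     in (2 + c * E * 2 * T) * (E' * (2 * K\<^sup>2 * (T * C1) + 2)) + C1)"

lemma moment_constant_nonneg: "0 \<le> T \<Longrightarrow> 0 \<le> moment_constant K T"
  unfolding moment_constant_def Let_def by (intro add_nonneg_nonneg mult_nonneg_nonneg) auto

context wiener_space
begin

text \<open>Removes the truncation by Fatou's lemma: the bound \<open>B\<close> is the same at every
  level, and almost every path lies below some level.\<close>

lemma nn_integral_truncation_limit:
  assumes [measurable]: "h \<in> borel_measurable M" "e \<in> borel_measurable M"
    and fin: "AE \<omega> in M. e \<omega> < (\<infinity>::ennreal)"
    and le: "\<And>m::nat. (\<integral>\<^sup>+\<omega>. indicator {\<omega>. e \<omega> < ennreal (real m)} \<omega> * h \<omega> \<partial>M) \<le> B"
  shows "(\<integral>\<^sup>+\<omega>. h \<omega> \<partial>M) \<le> B"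
proof -
  let ?u = "\<lambda>m \<omega>. indicator {\<omega>. e \<omega> < ennreal (real m)} \<omega> * h \<omega>"
  have "(\<integral>\<^sup>+\<omega>. h \<omega> \<partial>M) \<le> (\<integral>\<^sup>+\<omega>. liminf (\<lambda>m. ?u m \<omega>) \<partial>M)"
  proof (rule nn_integral_mono_AE)
    show "AE \<omega> in M. h \<omega> \<le> liminf (\<lambda>m. ?u m \<omega>)"
      using fin
    proof eventually_elim
      case (elim \<omega>)
      obtain N where N: "e \<omega> < ennreal (real N)"
        using elim by (metis ennreal_Ex_less_of_nat infinity_ennreal_def ennreal_of_nat_eq_real_of_nat)
      have "?u m \<omega> = h \<omega>" if "N \<le> m" for m
      proof -
        have "e \<omega> < ennreal (real m)"
          using N that by (meson ennreal_leI less_le_trans of_nat_mono)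
        then show ?thesis by simp
      qed
      then have "eventually (\<lambda>m. ?u m \<omega> = h \<omega>) sequentially"
        by (auto simp: eventually_sequentially)
      then have "liminf (\<lambda>m. ?u m \<omega>) = h \<omega>"
        by (intro lim_imp_Liminf tendsto_eventually) auto
      then show ?case by simp
    qed
  qed
  also have "\<dots> \<le> liminf (\<lambda>m. \<integral>\<^sup>+\<omega>. ?u m \<omega> \<partial>M)"
    by (rule nn_integral_liminf) measurable
  also have "\<dots> \<le> liminf (\<lambda>m::nat. B)"
    using le by (intro Liminf_mono always_eventually) auto
  finally show ?thesis by (simp add: Liminf_const)
qed

text \<open>The drift part of \<open>U\<close> is eliminated path by path. For a fixed path
  \<open>energy U\<close> is finite, so Gronwall's inequality applies before any moment of
  \<open>U\<close> is known; what remains on the right is the martingale part \<open>j\<close> and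
  the perturbation \<open>p\<close>.\<close>

lemma pathwise_growth:
  fixes U \<beta> p :: "real \<Rightarrow> 'w \<Rightarrow> real^'d"
  assumes Um: "case_prod U \<in> borel_measurable (time_measure T \<Otimes>\<^sub>M M)"
    and \<beta>m: "case_prod \<beta> \<in> borel_measurable (time_measure T \<Otimes>\<^sub>M M)"
    and pm: "case_prod p \<in> borel_measurable (time_measure T \<Otimes>\<^sub>M M)"
    and w: "\<omega> \<in> space M" and Ufin: "energy U \<omega> < \<infinity>" and t: "t \<in> {0..T}"
    and jm: "(\<lambda>t. j t \<omega>) \<in> borel_measurable (time_measure T)"
    and U: "\<And>t. t \<in> {0..T} \<Longrightarrow>
      U t \<omega> = (\<integral>r. indicator {..t} r *\<^sub>R \<beta> r \<omega> \<partial>time_measure T) + j t \<omega>"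
    and \<beta>: "\<And>r. r \<in> {0..T} \<Longrightarrow> norm (\<beta> r \<omega>) \<le> K * norm (U r \<omega>) + norm (p r \<omega>)"
  defines "c \<equiv> 4 * T * K\<^sup>2 + 1"
  defines "E \<equiv> 2 * exp (2 * c * T)"
  defines "C1 \<equiv> c * E * (4 * T * T) + 4 * T"
  shows "ennreal ((norm (U t \<omega>))\<^sup>2) \<le> 2 * ennreal ((norm (j t \<omega>))\<^sup>2)
    + ennreal (c * E * 2) * (\<integral>\<^sup>+r\<in>{..t}. ennreal ((norm (j r \<omega>))\<^sup>2) \<partial>time_measure T)
    + ennreal C1 * energy p \<omega>"
proof -
  let ?L = "time_measure T"
  let ?u = "\<lambda>r. ennreal ((norm (U r \<omega>))\<^sup>2)"
  let ?j = "\<lambda>r. ennreal ((norm (j r \<omega>))\<^sup>2)"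
  have [measurable]: "(\<lambda>r. U r \<omega>) \<in> borel_measurable ?L" "(\<lambda>r. \<beta> r \<omega>) \<in> borel_measurable ?L"
    "(\<lambda>r. p r \<omega>) \<in> borel_measurable ?L"
    using section_measurable[OF Um w] section_measurable[OF \<beta>m w] section_measurable[OF pm w] by auto
  note jm[measurable]
  have c: "0 < c" "4 * T * K\<^sup>2 \<le> c" using T_pos by (auto simp: c_def add_nonneg_pos)
  have E: "0 \<le> E" by (simp add: E_def)
  \<comment> \<open>Gronwall's inequality is applied to the integrated function \<open>v\<close>,
    which is bounded by the finite \<open>energy U\<close>, and not to \<open>U\<close>
    itself.\<close>
  define v where "v t = (\<integral>\<^sup>+r\<in>{..t}. ?u r \<partial>?L)" for t
  have step: "?u t \<le> 2 * ?j t + (ennreal c * v t + ennreal (4 * T) * energy p \<omega>)" if t: "t \<in> {0..T}" for t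
  proof -
    let ?b = "\<integral>r. indicator {..t} r *\<^sub>R \<beta> r \<omega> \<partial>?L"
    have b2: "ennreal ((norm (\<beta> r \<omega>))\<^sup>2) \<le> ennreal (2 * K\<^sup>2) * ?u r + 2 * ennreal ((norm (p r \<omega>))\<^sup>2)" if "r \<in> {0..T}" for r
    proof -
      have "(norm (\<beta> r \<omega>))\<^sup>2 \<le> (K * norm (U r \<omega>) + norm (p r \<omega>))\<^sup>2"
        using \<beta>[OF that] by (intro power_mono) auto
      also have "\<dots> \<le> 2 * K\<^sup>2 * (norm (U r \<omega>))\<^sup>2 + 2 * (norm (p r \<omega>))\<^sup>2"
        using sum_squares_bound[of "K * norm (U r \<omega>)" "norm (p r \<omega>)"]
        by (simp add: power2_sum power_mult_distrib)
      finally have "ennreal ((norm (\<beta> r \<omega>))\<^sup>2) \<le> ennreal (2 * K\<^sup>2 * (norm (U r \<omega>))\<^sup>2 + 2 * (norm (p r \<omega>))\<^sup>2)"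
        by (rule ennreal_leI)
      then show ?thesis by (simp add: ennreal_mult)
    qed
    have "ennreal ((norm ?b)\<^sup>2) \<le> ennreal T * (\<integral>\<^sup>+r\<in>{..t}. ennreal ((norm (\<beta> r \<omega>))\<^sup>2) \<partial>?L)"
      by (rule norm_tail_integral_le[OF \<beta>m w]) simp
    also have "(\<integral>\<^sup>+r\<in>{..t}. ennreal ((norm (\<beta> r \<omega>))\<^sup>2) \<partial>?L)
        \<le> (\<integral>\<^sup>+r. ennreal (2 * K\<^sup>2) * (?u r * indicator {..t} r) + 2 * ennreal ((norm (p r \<omega>))\<^sup>2) \<partial>?L)"
      using b2 by (intro nn_integral_mono) (auto simp: indicator_def)
    also have "\<dots> = ennreal (2 * K\<^sup>2) * v t + 2 * energy p \<omega>"
      by (simp add: nn_integral_add nn_integral_cmult v_def energy_def)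
    finally have b3: "ennreal ((norm ?b)\<^sup>2) \<le> ennreal T * (ennreal (2 * K\<^sup>2) * v t + 2 * energy p \<omega>)"
      by (simp add: mult_left_mono)
    have "?u t \<le> ennreal (2 * (norm ?b)\<^sup>2 + 2 * (norm (j t \<omega>))\<^sup>2)"
      unfolding U[OF t] by (intro ennreal_leI norm_square_add_le)
    also have "\<dots> = 2 * ennreal ((norm ?b)\<^sup>2) + 2 * ?j t" by (simp add: ennreal_mult)
    also have "\<dots> \<le> 2 * (ennreal T * (ennreal (2 * K\<^sup>2) * v t + 2 * energy p \<omega>)) + 2 * ?j t"
      by (intro add_right_mono mult_left_mono b3) simp
    also have "\<dots> = 2 * ?j t + (ennreal (4 * T * K\<^sup>2) * v t + ennreal (4 * T) * energy p \<omega>)"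
      using T_pos by (simp add: ennreal_mult distrib_left ac_simps mult_numeral_left_semiring_numeral)
    also have "\<dots> \<le> 2 * ?j t + (ennreal c * v t + ennreal (4 * T) * energy p \<omega>)"
      using c by (intro add_left_mono add_right_mono mult_right_mono ennreal_leI) auto
    finally show ?thesis .
  qed
  let ?a = "2 * (\<integral>\<^sup>+r\<in>{..t}. ?j r \<partial>?L) + ennreal (4 * T * T) * energy p \<omega>"
  have vt: "v t \<le> ennreal E * ?a"
  proof -
    \<comment> \<open>Cutting \<open>v\<close> off after the fixed time \<open>t\<close> lets the
      integral of \<open>j\<close> stop at \<open>t\<close>, so that the inhomogeneity is constant
      in the running time.\<close>
    let ?v = "\<lambda>r. v r * indicator {..t} r"
    have "?v t \<le> 2 * ennreal (exp (2 * c * T)) * ?a"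
    proof (rule gronwall_forward[where w="?v" and B="energy U \<omega>" and a="?a", OF _ Ufin c(1) _ t])
      show "?v r \<le> energy U \<omega>" for r
        unfolding v_def energy_def by (auto simp: indicator_def intro!: nn_integral_mono)
      fix r assume r: "r \<in> {0..T}"
      show "?v r \<le> ?a + ennreal c * (\<integral>\<^sup>+q\<in>{..r}. ?v q \<partial>?L)"
      proof (cases "r \<le> t")
        case True
        have vm: "v \<in> borel_measurable ?L"
        proof -
          have "case_prod (\<lambda>r q. ?u q * indicator {..r} q) \<in> borel_measurable (?L \<Otimes>\<^sub>M ?L)"
          proof -
            have "{z \<in> space (?L \<Otimes>\<^sub>M ?L). snd z \<le> fst z} \<in> sets (?L \<Otimes>\<^sub>M ?L)"
              by (rule borel_measurable_le[OF measurable_compose[OF measurable_snd measurable_ident_time_measure]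
                    measurable_compose[OF measurable_fst measurable_ident_time_measure]])
            then have "(\<lambda>z. ?u (snd z) * indicator {z \<in> space (?L \<Otimes>\<^sub>M ?L). snd z \<le> fst z} z) \<in> borel_measurable (?L \<Otimes>\<^sub>M ?L)"
              by measurable
            then show ?thesis
              by (rule measurable_cong[THEN iffD1, rotated]) (auto simp: indicator_def space_pair_measure)
          qed
          then show ?thesis unfolding v_def[abs_def] by (rule TM.borel_measurable_nn_integral)
        qed
        have "v r \<le> (\<integral>\<^sup>+q\<in>{..r}. (2 * ?j q + (ennreal c * v q + ennreal (4 * T) * energy p \<omega>)) \<partial>?L)"
          unfolding v_def[of r] using step by (intro nn_integral_mono) (auto simp: indicator_def)
        also have "\<dots> \<le> (\<integral>\<^sup>+q. 2 * (?j q * indicator {..t} q) + (ennreal c * (?v q * indicator {..r} q) + ennreal (4 * T) * energy p \<omega>) \<partial>?L)"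
          using True by (intro nn_integral_mono) (auto simp: indicator_def)
        also have "\<dots> = 2 * (\<integral>\<^sup>+q\<in>{..t}. ?j q \<partial>?L) + (ennreal c * (\<integral>\<^sup>+q\<in>{..r}. ?v q \<partial>?L) + ennreal (4 * T) * energy p \<omega> * ennreal T)"
          using vm emeasure_time_measure[of T] T_pos by (simp add: nn_integral_add nn_integral_cmult)
        also have "\<dots> = ?a + ennreal c * (\<integral>\<^sup>+q\<in>{..r}. ?v q \<partial>?L)"
          using T_pos by (simp add: ennreal_mult ac_simps)
        finally show ?thesis using True by simp
      qed simp
    qed
    then show ?thesis by (simp add: E_def ennreal_mult)
  qed
  have "?u t \<le> 2 * ?j t + (ennreal c * v t + ennreal (4 * T) * energy p \<omega>)" by (rule step[OF t])
  also have "\<dots> \<le> 2 * ?j t + (ennreal c * (ennreal E * ?a) + ennreal (4 * T) * energy p \<omega>)"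
    by (intro add_left_mono add_right_mono mult_left_mono vt) simp
  also have "\<dots> = 2 * ?j t + ennreal (c * E * 2) * (\<integral>\<^sup>+r\<in>{..t}. ?j r \<partial>?L) + ennreal C1 * energy p \<omega>"
    using T_pos c E unfolding C1_def
    by (simp add: ennreal_mult ennreal_plus distrib_left distrib_right ac_simps)
  finally show ?thesis .
qed

lemma measurable_head_indicator:
  "(\<lambda>p. indicator {..fst (fst p)} (snd p) :: 'b::{topological_space, zero_neq_one})
    \<in> borel_measurable ((time_measure T \<Otimes>\<^sub>M N) \<Otimes>\<^sub>M time_measure T)"
proof -
  have "(\<lambda>p. if snd p \<le> fst (fst p) then 1 else 0 :: 'b)
      \<in> borel_measurable ((time_measure T \<Otimes>\<^sub>M N) \<Otimes>\<^sub>M time_measure T)"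
    by (intro measurable_If borel_measurable_const
        borel_measurable_le[OF measurable_compose[OF measurable_snd measurable_ident_time_measure]
          measurable_compose[OF measurable_fst measurable_compose[OF measurable_fst measurable_ident_time_measure]]])
  then show ?thesis by (simp add: indicator_def of_bool_def)
qed

lemma measurable_swap_section:
  assumes "case_prod \<beta> \<in> measurable (time_measure T \<Otimes>\<^sub>M M) N"
  shows "(\<lambda>p. \<beta> (snd p) (snd (fst p))) \<in> measurable ((time_measure T \<Otimes>\<^sub>M M) \<Otimes>\<^sub>M time_measure T) N"
  using measurable_compose[OF measurable_Pair[OF measurable_snd measurable_compose[OF measurable_fst measurable_snd]] assms]
  by simp

text \<open>Two inequalities are closed into one. By the truncated isometry the martingale part
  \<open>j\<close> is controlled by the time integral of \<open>U\<close>, and pathwise growth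
  controls \<open>U\<close> by \<open>j\<close>. Both are weighted with the indicator
  \<open>\<psi>\<close> of the event that the running quadratic variation \<open>A\<close> is below
  \<open>R\<close>; this makes the second moment of \<open>j\<close> at most \<open>R\<close> and so
  opens the way to Gronwall's inequality, whose constant is free of \<open>R\<close>.\<close>

lemma moment_estimate:
  fixes U \<beta> p :: "real \<Rightarrow> 'w \<Rightarrow> real^'d" and H q :: "real \<Rightarrow> 'w \<Rightarrow> real^'e^'d"
  assumes Um: "case_prod U \<in> borel_measurable (time_measure T \<Otimes>\<^sub>M M)"
    and UM: "\<And>t. t \<in> {0..T} \<Longrightarrow> U t \<in> borel_measurable M"
    and \<beta>m: "case_prod \<beta> \<in> borel_measurable (time_measure T \<Otimes>\<^sub>M M)"
    and pm: "case_prod p \<in> borel_measurable (time_measure T \<Otimes>\<^sub>M M)"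
    and Hm: "case_prod H \<in> borel_measurable (time_measure T \<Otimes>\<^sub>M M)"
    and qm: "case_prod q \<in> borel_measurable (time_measure T \<Otimes>\<^sub>M M)"
    and Ufin: "AE \<omega> in M. energy U \<omega> < \<infinity>" and Hfin: "AE \<omega> in M. energy H \<omega> < \<infinity>"
    and U: "AE \<omega> in M. \<forall>t\<in>{0..T}. U t \<omega> = (\<integral>r. indicator {..t} r *\<^sub>R \<beta> r \<omega> \<partial>time_measure T) + J t \<omega>"
    and J: "\<And>t. t \<in> {0..T} \<Longrightarrow> ito_var (\<lambda>r \<omega>. indicator {0<..t} r *\<^sub>R H r \<omega>) (J t)"
    and \<beta>: "\<And>r \<omega>. r \<in> {0..T} \<Longrightarrow> \<omega> \<in> space M \<Longrightarrow> norm (\<beta> r \<omega>) \<le> K * norm (U r \<omega>) + norm (p r \<omega>)"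
    and H: "\<And>r \<omega>. r \<in> {0..T} \<Longrightarrow> \<omega> \<in> space M \<Longrightarrow> norm (H r \<omega>) \<le> K * norm (U r \<omega>) + norm (q r \<omega>)"
    and t: "t \<in> {0..T}"
  shows "(\<integral>\<^sup>+\<omega>. ennreal ((norm (U t \<omega>))\<^sup>2) \<partial>M)
    \<le> ennreal (moment_constant K T) * ((\<integral>\<^sup>+\<omega>. energy p \<omega> \<partial>M) + (\<integral>\<^sup>+\<omega>. energy q \<omega> \<partial>M))"
proof -
  let ?L = "time_measure T"
  let ?Ep = "\<integral>\<^sup>+\<omega>. energy p \<omega> \<partial>M" and ?Eq = "\<integral>\<^sup>+\<omega>. energy q \<omega> \<partial>M"
  note [measurable] = Um pm Hm qm energy_measurable[OF pm] energy_measurable[OF qm] energy_measurable[OF Hm]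
  \<comment> \<open>\<open>J t\<close> is given for each \<open>t\<close> separately. The process
    \<open>j\<close>, almost surely equal to it, is jointly measurable and can be integrated in
    time.\<close>
  define j where "j t \<omega> = U t \<omega> - (\<integral>r. indicator {..t} r *\<^sub>R \<beta> r \<omega> \<partial>?L)" for t \<omega>
  define A where "A t \<omega> = (\<integral>\<^sup>+r\<in>{0<..t}. ennreal ((norm (H r \<omega>))\<^sup>2) \<partial>?L)" for t \<omega>
  have "(\<lambda>z. \<integral>r. indicator {..fst z} r *\<^sub>R \<beta> r (snd z) \<partial>?L) \<in> borel_measurable (?L \<Otimes>\<^sub>M M)"
    by (rule TM.borel_measurable_lebesgue_integral)
       (simp add: split_beta' borel_measurable_scaleR measurable_head_indicator measurable_swap_section[OF \<beta>m])
  then have jm[measurable]: "case_prod j \<in> borel_measurable (?L \<Otimes>\<^sub>M M)"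
    unfolding j_def split_beta' by measurable
  have Am[measurable]: "case_prod A \<in> borel_measurable (?L \<Otimes>\<^sub>M M)"
  proof -
    have "(\<lambda>p. ennreal ((norm (H (snd p) (snd (fst p))))\<^sup>2) * (indicator {0<..} (snd p) * indicator {..fst (fst p)} (snd p)))
        \<in> borel_measurable ((?L \<Otimes>\<^sub>M M) \<Otimes>\<^sub>M ?L)"
    proof (intro borel_measurable_times_ennreal measurable_head_indicator)
      show "(\<lambda>p. ennreal ((norm (H (snd p) (snd (fst p))))\<^sup>2)) \<in> borel_measurable ((?L \<Otimes>\<^sub>M M) \<Otimes>\<^sub>M ?L)"
        using measurable_swap_section[OF Hm] by measurable
      show "(\<lambda>p. indicator {0<..} (snd p) :: ennreal) \<in> borel_measurable ((?L \<Otimes>\<^sub>M M) \<Otimes>\<^sub>M ?L)"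
        by (rule measurable_compose[OF measurable_snd measurable_time_indicator]) simp
    qed
    then have "(\<lambda>z. \<integral>\<^sup>+r. ennreal ((norm (H r (snd z)))\<^sup>2) * (indicator {0<..} r * indicator {..fst z} r) \<partial>?L)
        \<in> borel_measurable (?L \<Otimes>\<^sub>M M)"
      by (intro TM.borel_measurable_nn_integral) (simp add: split_beta')
    moreover have "indicator {0<..} r * indicator {..s} r = (indicator {0<..s} r :: ennreal)" for r s :: real
      by (auto simp: indicator_def)
    ultimately show ?thesis by (simp add: A_def split_beta')
  qed
  have AM[measurable]: "A t \<in> borel_measurable M" and jM[measurable]: "j t \<in> borel_measurable M" if "t \<in> {0..T}" for t
    using measurable_compose[OF measurable_Pair1' Am, of t] measurable_compose[OF measurable_Pair1' jm, of t] that
    by auto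
  have Amono: "A r \<omega> \<le> A r' \<omega>" if "r \<le> r'" for r r' \<omega>
    unfolding A_def using that by (intro nn_integral_mono) (auto simp: indicator_def)
  have Ale: "A r \<omega> \<le> energy H \<omega>" for r \<omega>
    unfolding A_def energy_def by (intro nn_integral_mono) (auto simp: indicator_def)
  have enA: "energy (\<lambda>r \<omega>. indicator {0<..t} r *\<^sub>R H r \<omega>) \<omega> = A t \<omega>" for t \<omega>
    unfolding energy_def A_def by (intro nn_integral_cong) (auto simp: indicator_def)
  define c where "c = 4 * T * K\<^sup>2 + 1"
  define E where "E = 2 * exp (2 * c * T)"
  define C1 where "C1 = c * E * (4 * T * T) + 4 * T"
  define c' where "c' = 2 * K\<^sup>2 * (2 + c * E * 2 * T) + 1"
  define E' where "E' = 2 * exp (2 * c' * T)"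
  have pos: "0 \<le> T" "0 \<le> c" "0 \<le> E" "0 \<le> C1" "0 \<le> E'" "0 < c'" "0 \<le> K\<^sup>2" "0 \<le> c * E * 2 * T"
  proof -
    show *: "0 \<le> T" "0 \<le> c" "0 \<le> E" using T_pos by (auto simp: c_def E_def)
    then show **: "0 \<le> c * E * 2 * T" by (intro mult_nonneg_nonneg) auto
    show "0 \<le> C1" unfolding C1_def using * by (intro add_nonneg_nonneg mult_nonneg_nonneg) auto
    show "0 < c'" unfolding c'_def using * ** by (intro add_nonneg_pos mult_nonneg_nonneg add_nonneg_nonneg) auto
  qed (auto simp: E'_def)
  have trunc: "(\<integral>\<^sup>+\<omega>. indicator {\<omega>. A t \<omega> < ennreal R} \<omega> * ennreal ((norm (U t \<omega>))\<^sup>2) \<partial>M)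
      \<le> ennreal (moment_constant K T) * (?Ep + ?Eq)" if R: "0 \<le> R" for R
  proof -
    define \<psi> :: "real \<Rightarrow> 'w \<Rightarrow> ennreal" where "\<psi> t \<omega> = indicator {\<omega>. A t \<omega> < ennreal R} \<omega>" for t \<omega>
    have \<psi>m[measurable]: "case_prod \<psi> \<in> borel_measurable (?L \<Otimes>\<^sub>M M)"
      unfolding \<psi>_def split_beta' indicator_def by measurable
    have \<psi>M[measurable]: "t \<in> {0..T} \<Longrightarrow> \<psi> t \<in> borel_measurable M" for t
      using measurable_compose[OF measurable_Pair1' \<psi>m, of t] by auto
    have \<psi>mono: "\<psi> r' \<omega> \<le> \<psi> r \<omega>" if "r \<le> r'" for r r' \<omega>
      using Amono[OF that, of \<omega>] by (auto simp: \<psi>_def indicator_def intro: le_less_trans)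
    define w where "w t = (\<integral>\<^sup>+\<omega>. \<psi> t \<omega> * ennreal ((norm (j t \<omega>))\<^sup>2) \<partial>M)" for t
    define u where "u t = (\<integral>\<^sup>+\<omega>. \<psi> t \<omega> * ennreal ((norm (U t \<omega>))\<^sup>2) \<partial>M)" for t
    have wm[measurable]: "w \<in> borel_measurable ?L" "u \<in> borel_measurable ?L"
      unfolding w_def[abs_def] u_def[abs_def] by measurable
    \<comment> \<open>The truncated bound for stochastic integrals on \<open>(0, t]\<close>, where
      the energy is \<open>A t\<close>. It also yields \<open>w t \<le> R\<close>, the finiteness
      required by Gronwall's inequality.\<close>
    have a: "w t \<le> (\<integral>\<^sup>+\<omega>. min (A t \<omega>) (ennreal R) \<partial>M)" if t: "t \<in> {0..T}" for t
    proof -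
      have "w t = (\<integral>\<^sup>+\<omega>. indicator {\<omega>. A t \<omega> < ennreal R} \<omega> * ennreal ((norm (J t \<omega>))\<^sup>2) \<partial>M)"
        unfolding w_def
      proof (rule nn_integral_cong_AE)
        show "AE \<omega> in M. \<psi> t \<omega> * ennreal ((norm (j t \<omega>))\<^sup>2)
          = indicator {\<omega>. A t \<omega> < ennreal R} \<omega> * ennreal ((norm (J t \<omega>))\<^sup>2)"
          using U by eventually_elim (use t in \<open>simp add: j_def \<psi>_def\<close>)
      qed
      also have "\<dots> \<le> (\<integral>\<^sup>+\<omega>. min (A t \<omega>) (ennreal R) \<partial>M)"
        using ito_var_truncated_bound[OF J[OF t] R] unfolding enA .
      finally show ?thesis .
    qed
    \<comment> \<open>The minimum of \<open>A t\<close> and \<open>R\<close> is at most the integral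
      of \<open>|H|^2\<close> over the times at which \<open>A\<close> is still below
      \<open>R\<close>. This moves the weight \<open>\<psi>\<close> inside the time integral, where
      the growth bound on \<open>H\<close> brings in \<open>u\<close>.\<close>
    have b: "w t \<le> ennreal (2 * K\<^sup>2) * (\<integral>\<^sup>+r\<in>{..t}. u r \<partial>?L) + 2 * ?Eq" if t: "t \<in> {0..T}" for t
    proof -
      let ?h = "\<lambda>r \<omega>. ennreal ((norm (H r \<omega>))\<^sup>2)"
      have "w t \<le> (\<integral>\<^sup>+\<omega>. (\<integral>\<^sup>+r. \<psi> r \<omega> * ?h r \<omega> * indicator {0<..t} r \<partial>?L) \<partial>M)"
      proof (rule order_trans[OF a[OF t]], rule nn_integral_mono_AE)
        show "AE \<omega> in M. min (A t \<omega>) (ennreal R) \<le> (\<integral>\<^sup>+r. \<psi> r \<omega> * ?h r \<omega> * indicator {0<..t} r \<partial>?L)"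
          using Hfin AE_space
        proof eventually_elim
          case (elim \<omega>)
          have [measurable]: "(\<lambda>r. H r \<omega>) \<in> borel_measurable ?L" by (rule section_measurable[OF Hm elim(2)])
          have "(\<lambda>r. ?h r \<omega>) \<in> borel_measurable ?L" by measurable
          from min_energy_le_stopped[OF T_pos this _ t, of R] elim
          show ?case by (simp add: energy_def A_def \<psi>_def indicator_def)
        qed
      qed
      also have "\<dots> = (\<integral>\<^sup>+r. (\<integral>\<^sup>+\<omega>. \<psi> r \<omega> * ?h r \<omega> * indicator {0<..t} r \<partial>M) \<partial>?L)"
      proof (rule TP.Fubini')
        show "(\<lambda>(r, \<omega>). \<psi> r \<omega> * ?h r \<omega> * indicator {0<..t} r) \<in> borel_measurable (?L \<Otimes>\<^sub>M M)"
          unfolding split_beta' by measurable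
      qed
      also have "\<dots> \<le> (\<integral>\<^sup>+r. ennreal (2 * K\<^sup>2) * (u r * indicator {..t} r) + 2 * (\<integral>\<^sup>+\<omega>. ennreal ((norm (q r \<omega>))\<^sup>2) \<partial>M) \<partial>?L)"
      proof (rule nn_integral_mono)
        fix r assume "r \<in> space ?L"
        then have r: "r \<in> {0..T}" by simp
        have [measurable]: "U r \<in> borel_measurable M" by (rule UM[OF r])
        have [measurable]: "\<psi> r \<in> borel_measurable M" by (rule \<psi>M[OF r])
        have [measurable]: "q r \<in> borel_measurable M"
          using measurable_compose[OF measurable_Pair1' qm, of r] r by simp
        have "(\<integral>\<^sup>+\<omega>. \<psi> r \<omega> * ?h r \<omega> * indicator {0<..t} r \<partial>M)
            \<le> (\<integral>\<^sup>+\<omega>. ennreal (2 * K\<^sup>2) * indicator {..t} r * (\<psi> r \<omega> * ennreal ((norm (U r \<omega>))\<^sup>2))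
                + 2 * ennreal ((norm (q r \<omega>))\<^sup>2) \<partial>M)"
        proof (rule nn_integral_mono)
          fix \<omega> assume w: "\<omega> \<in> space M"
          have "(norm (H r \<omega>))\<^sup>2 \<le> (K * norm (U r \<omega>) + norm (q r \<omega>))\<^sup>2"
            using H[OF r w] by (intro power_mono) auto
          also have "\<dots> \<le> 2 * K\<^sup>2 * (norm (U r \<omega>))\<^sup>2 + 2 * (norm (q r \<omega>))\<^sup>2"
            using sum_squares_bound[of "K * norm (U r \<omega>)" "norm (q r \<omega>)"]
            by (simp add: power2_sum power_mult_distrib)
          finally have "?h r \<omega> \<le> ennreal (2 * K\<^sup>2 * (norm (U r \<omega>))\<^sup>2 + 2 * (norm (q r \<omega>))\<^sup>2)"
            by (rule ennreal_leI)
          then have "?h r \<omega> \<le> ennreal (2 * K\<^sup>2) * ennreal ((norm (U r \<omega>))\<^sup>2) + 2 * ennreal ((norm (q r \<omega>))\<^sup>2)"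
            by (simp add: ennreal_mult)
          then show "\<psi> r \<omega> * ?h r \<omega> * indicator {0<..t} r
            \<le> ennreal (2 * K\<^sup>2) * indicator {..t} r * (\<psi> r \<omega> * ennreal ((norm (U r \<omega>))\<^sup>2)) + 2 * ennreal ((norm (q r \<omega>))\<^sup>2)"
            by (auto simp: \<psi>_def indicator_def)
        qed
        also have "\<dots> = ennreal (2 * K\<^sup>2) * (u r * indicator {..t} r) + 2 * (\<integral>\<^sup>+\<omega>. ennreal ((norm (q r \<omega>))\<^sup>2) \<partial>M)"
          by (simp add: nn_integral_add nn_integral_cmult u_def) (simp add: ac_simps)
        finally show "(\<integral>\<^sup>+\<omega>. \<psi> r \<omega> * ?h r \<omega> * indicator {0<..t} r \<partial>M)
          \<le> ennreal (2 * K\<^sup>2) * (u r * indicator {..t} r) + 2 * (\<integral>\<^sup>+\<omega>. ennreal ((norm (q r \<omega>))\<^sup>2) \<partial>M)" .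
      qed
      also have "\<dots> = ennreal (2 * K\<^sup>2) * (\<integral>\<^sup>+r\<in>{..t}. u r \<partial>?L) + 2 * (\<integral>\<^sup>+r. (\<integral>\<^sup>+\<omega>. ennreal ((norm (q r \<omega>))\<^sup>2) \<partial>M) \<partial>?L)"
        by (simp add: nn_integral_add nn_integral_cmult)
      also have "(\<integral>\<^sup>+r. (\<integral>\<^sup>+\<omega>. ennreal ((norm (q r \<omega>))\<^sup>2) \<partial>M) \<partial>?L) = ?Eq"
        unfolding energy_def by (rule TP.Fubini'[symmetric]) measurable
      finally show ?thesis .
    qed
    have cc: "u t \<le> 2 * w t + ennreal (c * E * 2) * (\<integral>\<^sup>+r\<in>{..t}. w r \<partial>?L) + ennreal C1 * ?Ep" if t: "t \<in> {0..T}" for t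
    proof -
      have [measurable]: "j t \<in> borel_measurable M" "\<psi> t \<in> borel_measurable M"
        using jM[OF t] \<psi>M[OF t] by auto
      have jj: "(\<lambda>\<omega>. \<integral>\<^sup>+r. \<psi> r \<omega> * ennreal ((norm (j r \<omega>))\<^sup>2) * indicator {..t} r \<partial>?L) \<in> borel_measurable M"
        by measurable
      have "u t \<le> (\<integral>\<^sup>+\<omega>. 2 * (\<psi> t \<omega> * ennreal ((norm (j t \<omega>))\<^sup>2))
          + ennreal (c * E * 2) * (\<integral>\<^sup>+r. \<psi> r \<omega> * ennreal ((norm (j r \<omega>))\<^sup>2) * indicator {..t} r \<partial>?L)
          + ennreal C1 * energy p \<omega> \<partial>M)"
        unfolding u_def
      proof (rule nn_integral_mono_AE)
        show "AE \<omega> in M. \<psi> t \<omega> * ennreal ((norm (U t \<omega>))\<^sup>2) \<le> 2 * (\<psi> t \<omega> * ennreal ((norm (j t \<omega>))\<^sup>2))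
          + ennreal (c * E * 2) * (\<integral>\<^sup>+r. \<psi> r \<omega> * ennreal ((norm (j r \<omega>))\<^sup>2) * indicator {..t} r \<partial>?L)
          + ennreal C1 * energy p \<omega>"
          using Ufin AE_space
        proof eventually_elim
          case (elim \<omega>)
          show ?case
          proof (cases "A t \<omega> < ennreal R")
            case True
            have "ennreal ((norm (U t \<omega>))\<^sup>2) \<le> 2 * ennreal ((norm (j t \<omega>))\<^sup>2)
              + ennreal (c * E * 2) * (\<integral>\<^sup>+r\<in>{..t}. ennreal ((norm (j r \<omega>))\<^sup>2) \<partial>?L)
              + ennreal C1 * energy p \<omega>"
              unfolding C1_def E_def c_def
            proof (rule pathwise_growth[OF Um \<beta>m pm elim(2) elim(1) t])
              show "(\<lambda>t. j t \<omega>) \<in> borel_measurable ?L" by (rule section_measurable[OF jm elim(2)])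
            qed (use \<beta> elim in \<open>auto simp: j_def\<close>)
            \<comment> \<open>\<open>A\<close> is nondecreasing in time, so a path with
              \<open>A t < R\<close> has \<open>A r < R\<close> for all \<open>r \<le> t\<close>,
              and the weight may be inserted at the earlier times.\<close>
            also have "(\<integral>\<^sup>+r\<in>{..t}. ennreal ((norm (j r \<omega>))\<^sup>2) \<partial>?L)
                = (\<integral>\<^sup>+r. \<psi> r \<omega> * ennreal ((norm (j r \<omega>))\<^sup>2) * indicator {..t} r \<partial>?L)"
              using True Amono[of _ t \<omega>]
              by (intro nn_integral_cong) (auto simp: \<psi>_def indicator_def dest: le_less_trans)
            finally show ?thesis using True by (simp add: \<psi>_def)
          qed (simp add: \<psi>_def)
        qed
      qed
      also have "\<dots> = 2 * w t + ennreal (c * E * 2) * (\<integral>\<^sup>+\<omega>. (\<integral>\<^sup>+r. \<psi> r \<omega> * ennreal ((norm (j r \<omega>))\<^sup>2) * indicator {..t} r \<partial>?L) \<partial>M) + ennreal C1 * ?Ep"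
        using jj by (simp add: nn_integral_add nn_integral_cmult w_def)
      also have "(\<integral>\<^sup>+\<omega>. (\<integral>\<^sup>+r. \<psi> r \<omega> * ennreal ((norm (j r \<omega>))\<^sup>2) * indicator {..t} r \<partial>?L) \<partial>M)
          = (\<integral>\<^sup>+r. (\<integral>\<^sup>+\<omega>. \<psi> r \<omega> * ennreal ((norm (j r \<omega>))\<^sup>2) * indicator {..t} r \<partial>M) \<partial>?L)"
      proof (rule TP.Fubini')
        show "(\<lambda>(r, \<omega>). \<psi> r \<omega> * ennreal ((norm (j r \<omega>))\<^sup>2) * indicator {..t} r) \<in> borel_measurable (?L \<Otimes>\<^sub>M M)"
          unfolding split_beta' by measurable
      qed
      also have "\<dots> = (\<integral>\<^sup>+r\<in>{..t}. w r \<partial>?L)"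
        unfolding w_def by (intro nn_integral_cong) (auto simp: indicator_def)
      finally show ?thesis .
    qed
    define a' where "a' = ennreal (2 * K\<^sup>2 * (T * C1)) * ?Ep + 2 * ?Eq"
    \<comment> \<open>The bound for \<open>u\<close> is inserted into that for \<open>w\<close>;
      enlarging the inner time integral of \<open>w\<close> to \<open>[0, t]\<close> leaves a linear
      integral inequality for \<open>w\<close> alone.\<close>
    have d: "w t \<le> a' + ennreal c' * (\<integral>\<^sup>+r\<in>{..t}. w r \<partial>?L)" if t: "t \<in> {0..T}" for t
    proof -
      let ?W = "\<integral>\<^sup>+r\<in>{..t}. w r \<partial>?L"
      have "(\<integral>\<^sup>+r\<in>{..t}. u r \<partial>?L)
          \<le> (\<integral>\<^sup>+r. 2 * (w r * indicator {..t} r) + (ennreal (c * E * 2) * ?W + ennreal C1 * ?Ep) \<partial>?L)"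
      proof (rule nn_integral_mono)
        fix r assume "r \<in> space ?L"
        then have r: "r \<in> {0..T}" by simp
        show "u r * indicator {..t} r \<le> 2 * (w r * indicator {..t} r) + (ennreal (c * E * 2) * ?W + ennreal C1 * ?Ep)"
        proof (cases "r \<le> t")
          case True
          have "u r \<le> 2 * w r + ennreal (c * E * 2) * (\<integral>\<^sup>+q\<in>{..r}. w q \<partial>?L) + ennreal C1 * ?Ep" by (rule cc[OF r])
          also have "\<dots> \<le> 2 * w r + ennreal (c * E * 2) * ?W + ennreal C1 * ?Ep"
            using True by (intro add_right_mono add_left_mono mult_left_mono nn_integral_mono) (auto simp: indicator_def)
          finally show ?thesis using True by (simp add: add.assoc)
        qed simp
      qed
      also have "\<dots> = 2 * ?W + (ennreal (c * E * 2) * ?W + ennreal C1 * ?Ep) * ennreal T"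
        using emeasure_time_measure[of T] T_pos by (simp add: nn_integral_add nn_integral_cmult)
      also have "\<dots> = ennreal (2 + c * E * 2 * T) * ?W + ennreal (T * C1) * ?Ep"
        using pos by (simp add: ennreal_mult ennreal_plus distrib_left distrib_right ac_simps)
      finally have "w t \<le> ennreal (2 * K\<^sup>2) * (ennreal (2 + c * E * 2 * T) * ?W + ennreal (T * C1) * ?Ep) + 2 * ?Eq"
        using b[OF t] by (meson add_right_mono mult_left_mono order_trans zero_le)
      also have "\<dots> = a' + ennreal (2 * K\<^sup>2 * (2 + c * E * 2 * T)) * ?W"
        unfolding a'_def using pos by (simp add: ennreal_mult distrib_left ac_simps)
      also have "\<dots> \<le> a' + ennreal c' * ?W"
        unfolding c'_def by (intro add_left_mono mult_right_mono ennreal_leI) auto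
      finally show ?thesis .
    qed
    have e: "w t \<le> ennreal E' * a'" if t: "t \<in> {0..T}" for t
    proof -
      have "w t \<le> 2 * ennreal (exp (2 * c' * T)) * a'"
      proof (rule gronwall_forward[where B="ennreal R", OF _ _ _ d t])
        fix t assume t: "t \<in> {0..T}"
        have "w t \<le> (\<integral>\<^sup>+\<omega>. min (A t \<omega>) (ennreal R) \<partial>M)" by (rule a[OF t])
        also have "\<dots> \<le> (\<integral>\<^sup>+\<omega>. ennreal R \<partial>M)" by (intro nn_integral_mono) simp
        finally show "w t \<le> ennreal R" by (simp add: emeasure_space_1)
      qed (use pos in auto)
      then show ?thesis by (simp add: E'_def ennreal_mult)
    qed
    have "u t \<le> 2 * w t + ennreal (c * E * 2) * (\<integral>\<^sup>+r\<in>{..t}. w r \<partial>?L) + ennreal C1 * ?Ep" by (rule cc[OF t])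
    also have "(\<integral>\<^sup>+r\<in>{..t}. w r \<partial>?L) \<le> (\<integral>\<^sup>+r. ennreal E' * a' \<partial>?L)"
      using e by (intro nn_integral_mono) (auto simp: indicator_def)
    also have "\<dots> = ennreal E' * a' * ennreal T"
      using emeasure_time_measure[of T] T_pos by simp
    also have "2 * w t \<le> 2 * (ennreal E' * a')" by (intro mult_left_mono e t) simp
    finally have "u t \<le> 2 * (ennreal E' * a') + ennreal (c * E * 2) * (ennreal E' * a' * ennreal T) + ennreal C1 * ?Ep"
      by (simp add: add_left_mono add_right_mono mult_left_mono)
    also have "\<dots> = ennreal ((2 + c * E * 2 * T) * E') * a' + ennreal C1 * ?Ep"
      using pos by (simp add: ennreal_mult ennreal_plus distrib_left distrib_right ac_simps)
    also have "\<dots> \<le> ennreal ((2 + c * E * 2 * T) * E') * (ennreal (2 * K\<^sup>2 * (T * C1) + 2) * (?Ep + ?Eq)) + ennreal C1 * (?Ep + ?Eq)"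
    proof (intro add_mono mult_left_mono)
      have "a' \<le> ennreal (2 * K\<^sup>2 * (T * C1)) * (?Ep + ?Eq) + 2 * (?Ep + ?Eq)"
        unfolding a'_def by (intro add_mono mult_left_mono) auto
      also have "\<dots> = ennreal (2 * K\<^sup>2 * (T * C1) + 2) * (?Ep + ?Eq)"
        using pos by (simp add: ennreal_plus distrib_right)
      finally show "a' \<le> ennreal (2 * K\<^sup>2 * (T * C1) + 2) * (?Ep + ?Eq)" .
    qed auto
    also have "\<dots> = ennreal (moment_constant K T) * (?Ep + ?Eq)"
    proof -
      define X where "X = (2 + c * E * 2 * T) * E'"
      define Y where "Y = 2 * K\<^sup>2 * (T * C1) + 2"
      have XY: "0 \<le> X" "0 \<le> Y" using pos by (auto simp: X_def Y_def)
      have "moment_constant K T = X * Y + C1"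
        unfolding moment_constant_def Let_def c_def E_def C1_def c'_def E'_def X_def Y_def by (simp only: mult.assoc)
      then have "ennreal (moment_constant K T) = ennreal X * ennreal Y + ennreal C1"
        using XY pos by (simp add: ennreal_plus ennreal_mult)
      then show ?thesis unfolding X_def[symmetric] Y_def[symmetric] by (simp only: distrib_right mult.assoc)
    qed
    finally show ?thesis unfolding u_def \<psi>_def .
  qed
  have [measurable]: "U t \<in> borel_measurable M" "A t \<in> borel_measurable M" by (rule UM[OF t], rule AM[OF t])
  show ?thesis
  proof (rule nn_integral_truncation_limit[of _ "A t"])
    show "AE \<omega> in M. A t \<omega> < \<infinity>" using Hfin by eventually_elim (use Ale in \<open>auto intro: le_less_trans\<close>)
  qed (use trunc in auto)
qed


section \<open>Square-integrable Ito processes\<close>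

text \<open>The dynamics are written from \<open>r\<close> to \<open>T\<close>, because the
  increments after \<open>r\<close> are what is orthogonal to \<open>F r\<close>. The equation is
  asked for at each \<open>r\<close> outside a null set of its own, which suits a calculus of
  expectations.\<close>

definition ito_process ::
  "(real \<Rightarrow> 'w \<Rightarrow> real^'d) \<Rightarrow> (real \<Rightarrow> 'w \<Rightarrow> real^'d) \<Rightarrow> (real \<Rightarrow> 'w \<Rightarrow> real^'e^'d) \<Rightarrow> bool" where
  "ito_process P \<beta> H \<longleftrightarrow>
     case_prod P \<in> borel_measurable (time_measure T \<Otimes>\<^sub>M M) \<and> (\<forall>r\<in>{0..T}. P r \<in> borel_measurable (F r)) \<and>
     case_prod \<beta> \<in> borel_measurable (time_measure T \<Otimes>\<^sub>M M) \<and> (\<forall>r\<in>{0..T}. \<beta> r \<in> borel_measurable (F r)) \<and>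
     (\<integral>\<^sup>+\<omega>. energy \<beta> \<omega> \<partial>M) < \<infinity> \<and> (\<integral>\<^sup>+\<omega>. energy H \<omega> \<partial>M) < \<infinity> \<and>
     integrable M (\<lambda>\<omega>. (norm (P T \<omega>))\<^sup>2) \<and>
     (\<exists>N. ito_increments H N \<and> (\<forall>r\<in>{0..T}. AE \<omega> in M.
        P T \<omega> = P r \<omega> + (\<integral>q. indicator {r<..} q *\<^sub>R \<beta> q \<omega> \<partial>time_measure T) + N r \<omega>))"

lemma ito_processD:
  assumes "ito_process P \<beta> H"
  shows "case_prod P \<in> borel_measurable (time_measure T \<Otimes>\<^sub>M M)"
    and "r \<in> {0..T} \<Longrightarrow> P r \<in> borel_measurable (F r)"
    and "r \<in> {0..T} \<Longrightarrow> P r \<in> borel_measurable M"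
    and "case_prod \<beta> \<in> borel_measurable (time_measure T \<Otimes>\<^sub>M M)"
    and "r \<in> {0..T} \<Longrightarrow> \<beta> r \<in> borel_measurable (F r)"
    and "(\<integral>\<^sup>+\<omega>. energy \<beta> \<omega> \<partial>M) < \<infinity>" and "(\<integral>\<^sup>+\<omega>. energy H \<omega> \<partial>M) < \<infinity>"
    and "integrable M (\<lambda>\<omega>. (norm (P T \<omega>))\<^sup>2)"
    and "case_prod H \<in> borel_measurable (time_measure T \<Otimes>\<^sub>M M)"
proof -
  show 1: "r \<in> {0..T} \<Longrightarrow> P r \<in> borel_measurable (F r)" using assms by (auto simp: ito_process_def)
  then show "r \<in> {0..T} \<Longrightarrow> P r \<in> borel_measurable M" using F_measurable_M by blast
qed (use assms ito_incrementsD(1) in \<open>auto simp: ito_process_def\<close>)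

lemma ito_process_formula:
  assumes P: "ito_process P \<beta> H" and s: "s \<in> {0..T}" and A: "A \<in> sets (F s)"
  shows "(\<integral>\<omega>. indicator A \<omega> * (norm (P T \<omega>))\<^sup>2 \<partial>M) = (\<integral>\<omega>. indicator A \<omega> * (norm (P s \<omega>))\<^sup>2 \<partial>M)
    + (\<integral>z. (indicator A (snd z) * indicator {s<..} (fst z)) *
        (2 * (P (fst z) (snd z) \<bullet> \<beta> (fst z) (snd z)) + (norm (H (fst z) (snd z)))\<^sup>2) \<partial>(time_measure T \<Otimes>\<^sub>M M))"
proof -
  note D = ito_processD[OF P]
  obtain N where N: "ito_increments H N" "\<And>r. r \<in> {0..T} \<Longrightarrow> AE \<omega> in M.
        P T \<omega> = P r \<omega> + (\<integral>q. indicator {r<..} q *\<^sub>R \<beta> q \<omega> \<partial>time_measure T) + N r \<omega>"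
    using P unfolding ito_process_def by blast
  show ?thesis
    by (rule product_formula[OF N(1) D(7) D(1) D(2) D(4) D(5) D(6) D(8) N(2) s A])
qed

lemma ito_process_L2:
  assumes P: "ito_process P \<beta> H"
  shows "r \<in> {0..T} \<Longrightarrow> integrable M (\<lambda>\<omega>. (norm (P r \<omega>))\<^sup>2)"
    and "(\<integral>\<^sup>+\<omega>. energy P \<omega> \<partial>M) < \<infinity>"
    and "\<exists>B<\<infinity>. \<forall>r\<in>{0..T}. (\<integral>\<^sup>+\<omega>. ennreal ((norm (P r \<omega>))\<^sup>2) \<partial>M) \<le> B"
proof -
  note D = ito_processD[OF P]
  obtain N where N: "ito_increments H N" "\<And>r. r \<in> {0..T} \<Longrightarrow> AE \<omega> in M.
        P T \<omega> = P r \<omega> + (\<integral>q. indicator {r<..} q *\<^sub>R \<beta> q \<omega> \<partial>time_measure T) + N r \<omega>"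
    using P unfolding ito_process_def by blast
  note L = ito_process_square_integrable[OF N(1) D(7) D(1) D(3) D(4) D(6) D(8) N(2)]
  show "r \<in> {0..T} \<Longrightarrow> integrable M (\<lambda>\<omega>. (norm (P r \<omega>))\<^sup>2)" by (rule L(1))
  show "(\<integral>\<^sup>+\<omega>. energy P \<omega> \<partial>M) < \<infinity>" by (rule L(2))
  show "\<exists>B<\<infinity>. \<forall>r\<in>{0..T}. (\<integral>\<^sup>+\<omega>. ennreal ((norm (P r \<omega>))\<^sup>2) \<partial>M) \<le> B" by (rule L(3))
qed

lemma energy_add_finite:
  fixes H1 H2 :: "real \<Rightarrow> 'w \<Rightarrow> 'b::{real_normed_vector, second_countable_topology}"
  assumes [measurable]: "case_prod H1 \<in> borel_measurable (time_measure T \<Otimes>\<^sub>M M)"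
      "case_prod H2 \<in> borel_measurable (time_measure T \<Otimes>\<^sub>M M)"
    and f: "(\<integral>\<^sup>+\<omega>. energy H1 \<omega> \<partial>M) < \<infinity>" "(\<integral>\<^sup>+\<omega>. energy H2 \<omega> \<partial>M) < \<infinity>"
  shows "(\<integral>\<^sup>+\<omega>. energy (\<lambda>s \<omega>. H1 s \<omega> + H2 s \<omega>) \<omega> \<partial>M) < \<infinity>"
proof -
  let ?Q = "time_measure T \<Otimes>\<^sub>M M"
  have m: "case_prod (\<lambda>s \<omega>. H1 s \<omega> + H2 s \<omega>) \<in> borel_measurable ?Q" by measurable
  have "(\<integral>\<^sup>+\<omega>. energy (\<lambda>s \<omega>. H1 s \<omega> + H2 s \<omega>) \<omega> \<partial>M)
    \<le> (\<integral>\<^sup>+z. 2 * ennreal ((norm (H1 (fst z) (snd z)))\<^sup>2) + 2 * ennreal ((norm (H2 (fst z) (snd z)))\<^sup>2) \<partial>?Q)"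
    unfolding nn_integral_energy[OF m]
  proof (rule nn_integral_mono)
    fix z
    have "ennreal ((norm (H1 (fst z) (snd z) + H2 (fst z) (snd z)))\<^sup>2)
      \<le> ennreal (2 * (norm (H1 (fst z) (snd z)))\<^sup>2 + 2 * (norm (H2 (fst z) (snd z)))\<^sup>2)"
      by (intro ennreal_leI norm_square_add_le)
    then show "ennreal ((norm (H1 (fst z) (snd z) + H2 (fst z) (snd z)))\<^sup>2)
      \<le> 2 * ennreal ((norm (H1 (fst z) (snd z)))\<^sup>2) + 2 * ennreal ((norm (H2 (fst z) (snd z)))\<^sup>2)"
      by (simp add: ennreal_mult)
  qed
  also have "\<dots> = 2 * (\<integral>\<^sup>+\<omega>. energy H1 \<omega> \<partial>M) + 2 * (\<integral>\<^sup>+\<omega>. energy H2 \<omega> \<partial>M)"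
    by (simp add: nn_integral_add nn_integral_cmult nn_integral_energy)
  also have "\<dots> < \<infinity>" using f by (simp add: ennreal_mult_less_top)
  finally show ?thesis .
qed

text \<open>Closure under sums is the prerequisite for polarising the formula for
  \<open>|P|^2\<close>.\<close>

lemma ito_process_add:
  assumes 1: "ito_process P1 \<beta>1 H1" and 2: "ito_process P2 \<beta>2 H2"
  shows "ito_process (\<lambda>s \<omega>. P1 s \<omega> + P2 s \<omega>) (\<lambda>s \<omega>. \<beta>1 s \<omega> + \<beta>2 s \<omega>) (\<lambda>s \<omega>. H1 s \<omega> + H2 s \<omega>)"
proof -
  note D1 = ito_processD[OF 1] and D2 = ito_processD[OF 2]
  note [measurable] = D1(1,4,9) D2(1,4,9)
  have Tin: "T \<in> {0..T}" using T_pos by simp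
  obtain N1 where N1: "ito_increments H1 N1" "\<And>r. r \<in> {0..T} \<Longrightarrow> AE \<omega> in M.
        P1 T \<omega> = P1 r \<omega> + (\<integral>q. indicator {r<..} q *\<^sub>R \<beta>1 q \<omega> \<partial>time_measure T) + N1 r \<omega>"
    using 1 unfolding ito_process_def by blast
  obtain N2 where N2: "ito_increments H2 N2" "\<And>r. r \<in> {0..T} \<Longrightarrow> AE \<omega> in M.
        P2 T \<omega> = P2 r \<omega> + (\<integral>q. indicator {r<..} q *\<^sub>R \<beta>2 q \<omega> \<partial>time_measure T) + N2 r \<omega>"
    using 2 unfolding ito_process_def by blast
  have sec: "AE \<omega> in M. integrable (time_measure T) (\<lambda>q. \<beta> q \<omega>)"
    if m: "case_prod \<beta> \<in> borel_measurable (time_measure T \<Otimes>\<^sub>M M)" and f: "(\<integral>\<^sup>+\<omega>. energy \<beta> \<omega> \<partial>M) < \<infinity>"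
    for \<beta> :: "real \<Rightarrow> 'w \<Rightarrow> real^'b"
  proof -
    have "AE \<omega> in M. energy \<beta> \<omega> \<noteq> \<infinity>"
      using f by (intro nn_integral_PInf_AE energy_measurable[OF m]) auto
    then show ?thesis using AE_space
      by eventually_elim (auto intro!: energy_finite_section[OF m] simp: less_top)
  qed
  show ?thesis
    unfolding ito_process_def
  proof (intro conjI ballI exI)
    show "ito_increments (\<lambda>s \<omega>. H1 s \<omega> + H2 s \<omega>) (\<lambda>s \<omega>. N1 s \<omega> + N2 s \<omega>)"
      using ito_increments_linear[OF N1(1) N2(1), of 1] by simp
    show "case_prod (\<lambda>s \<omega>. P1 s \<omega> + P2 s \<omega>) \<in> borel_measurable (time_measure T \<Otimes>\<^sub>M M)" by measurable
    show "case_prod (\<lambda>s \<omega>. \<beta>1 s \<omega> + \<beta>2 s \<omega>) \<in> borel_measurable (time_measure T \<Otimes>\<^sub>M M)" by measurable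
    show "(\<integral>\<^sup>+\<omega>. energy (\<lambda>s \<omega>. \<beta>1 s \<omega> + \<beta>2 s \<omega>) \<omega> \<partial>M) < \<infinity>"
      by (rule energy_add_finite[OF D1(4) D2(4) D1(6) D2(6)])
    show "(\<integral>\<^sup>+\<omega>. energy (\<lambda>s \<omega>. H1 s \<omega> + H2 s \<omega>) \<omega> \<partial>M) < \<infinity>"
      by (rule energy_add_finite[OF D1(9) D2(9) D1(7) D2(7)])
    show "integrable M (\<lambda>\<omega>. (norm (P1 T \<omega> + P2 T \<omega>))\<^sup>2)"
    proof (rule Bochner_Integration.integrable_bound)
      show "integrable M (\<lambda>\<omega>. 2 * (norm (P1 T \<omega>))\<^sup>2 + 2 * (norm (P2 T \<omega>))\<^sup>2)" using D1(8) D2(8) by simp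
      show "AE \<omega> in M. norm ((norm (P1 T \<omega> + P2 T \<omega>))\<^sup>2) \<le> norm (2 * (norm (P1 T \<omega>))\<^sup>2 + 2 * (norm (P2 T \<omega>))\<^sup>2)"
        using norm_square_add_le by (intro AE_I2) auto
      show "(\<lambda>\<omega>. (norm (P1 T \<omega> + P2 T \<omega>))\<^sup>2) \<in> borel_measurable M"
        using D1(3)[OF Tin] D2(3)[OF Tin] by measurable
    qed
    fix r assume r: "r \<in> {0..T}"
    show "(\<lambda>\<omega>. P1 r \<omega> + P2 r \<omega>) \<in> borel_measurable (F r)" "(\<lambda>\<omega>. \<beta>1 r \<omega> + \<beta>2 r \<omega>) \<in> borel_measurable (F r)"
      using D1(2)[OF r] D2(2)[OF r] D1(5)[OF r] D2(5)[OF r] by measurable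
    show "AE \<omega> in M. P1 T \<omega> + P2 T \<omega> = P1 r \<omega> + P2 r \<omega>
        + (\<integral>q. indicator {r<..} q *\<^sub>R (\<beta>1 q \<omega> + \<beta>2 q \<omega>) \<partial>time_measure T) + (N1 r \<omega> + N2 r \<omega>)"
      using N1(2)[OF r] N2(2)[OF r] sec[OF D1(4) D1(6)] sec[OF D2(4) D2(6)]
    proof eventually_elim
      case (elim \<omega>)
      have ind: "integrable (time_measure T) (\<lambda>q. indicator {r<..} q *\<^sub>R g q)"
        if g: "integrable (time_measure T) g" for g :: "real \<Rightarrow> real^'a"
      proof (rule Bochner_Integration.integrable_bound[OF g])
        show "(\<lambda>q. indicator {r<..} q *\<^sub>R g q) \<in> borel_measurable (time_measure T)"
          using borel_measurable_integrable[OF g] by measurable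
      qed (auto simp: indicator_def)
      have "(\<integral>q. indicator {r<..} q *\<^sub>R (\<beta>1 q \<omega> + \<beta>2 q \<omega>) \<partial>time_measure T)
        = (\<integral>q. indicator {r<..} q *\<^sub>R \<beta>1 q \<omega> \<partial>time_measure T) + (\<integral>q. indicator {r<..} q *\<^sub>R \<beta>2 q \<omega> \<partial>time_measure T)"
        unfolding scaleR_add_right by (rule Bochner_Integration.integral_add[OF ind[OF elim(3)] ind[OF elim(4)]])
      then show ?case using elim(1,2) by simp
    qed
  qed
qed

text \<open>Polarisation: the formula for squared norms, taken from time 0 on the whole space, is
  applied to \<open>P1\<close>, to \<open>P2\<close> and to their sum.\<close>

lemma ito_process_bilinear:
  assumes 1: "ito_process P1 \<beta>1 H1" and 2: "ito_process P2 \<beta>2 H2"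
  shows "integrable (time_measure T \<Otimes>\<^sub>M M) (\<lambda>z. P1 (fst z) (snd z) \<bullet> \<beta>2 (fst z) (snd z)
        + P2 (fst z) (snd z) \<bullet> \<beta>1 (fst z) (snd z) + H1 (fst z) (snd z) \<bullet> H2 (fst z) (snd z))"
    and "(\<integral>\<omega>. P1 T \<omega> \<bullet> P2 T \<omega> \<partial>M) = (\<integral>\<omega>. P1 0 \<omega> \<bullet> P2 0 \<omega> \<partial>M)
      + (\<integral>z. P1 (fst z) (snd z) \<bullet> \<beta>2 (fst z) (snd z) + P2 (fst z) (snd z) \<bullet> \<beta>1 (fst z) (snd z)
          + H1 (fst z) (snd z) \<bullet> H2 (fst z) (snd z) \<partial>(time_measure T \<Otimes>\<^sub>M M))"
proof -
  let ?Q = "time_measure T \<Otimes>\<^sub>M M"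
  note D1 = ito_processD[OF 1] and D2 = ito_processD[OF 2]
  note L1 = ito_process_L2[OF 1] and L2 = ito_process_L2[OF 2]
  note 12 = ito_process_add[OF 1 2]
  have z: "0 \<in> {0..T}" and Tin: "T \<in> {0..T}" using T_pos by auto
  have sp: "space M \<in> sets (F 0)" using sets.top[of "F 0"] space_F[OF z] by simp
  note [measurable] = D1(1,4,9) D2(1,4,9)
  have split: "(\<lambda>z. X (fst z) (snd z)) \<in> borel_measurable ?Q" if "case_prod X \<in> borel_measurable ?Q"
    for X :: "real \<Rightarrow> 'w \<Rightarrow> 'b::topological_space"
    using that by (simp add: split_beta')
  note s1 = split[OF D1(1)] split[OF D1(4)] split[OF D1(9)]
  note s2 = split[OF D2(1)] split[OF D2(4)] split[OF D2(9)]
  note e1 = integrable_energy[OF D1(1) L1(2)] integrable_energy[OF D1(4) D1(6)] integrable_energy[OF D1(9) D1(7)]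
  note e2 = integrable_energy[OF D2(1) L2(2)] integrable_energy[OF D2(4) D2(6)] integrable_energy[OF D2(9) D2(7)]
  note i11 = integrable_inner_square[OF s1(1) s1(2) e1(1) e1(2)]
    and i12 = integrable_inner_square[OF s1(1) s2(2) e1(1) e2(2)]
    and i21 = integrable_inner_square[OF s2(1) s1(2) e2(1) e1(2)]
    and i22 = integrable_inner_square[OF s2(1) s2(2) e2(1) e2(2)]
    and hh = integrable_inner_square[OF s1(3) s2(3) e1(3) e2(3)]
  show "integrable ?Q (\<lambda>z. P1 (fst z) (snd z) \<bullet> \<beta>2 (fst z) (snd z)
        + P2 (fst z) (snd z) \<bullet> \<beta>1 (fst z) (snd z) + H1 (fst z) (snd z) \<bullet> H2 (fst z) (snd z))"
    using i12 i21 hh by simp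
  \<comment> \<open>The squared-norm formula integrates only over times after \<open>s = 0\<close>;
    the slice at time 0 is null.\<close>
  have null: "AE z in ?Q. 0 < fst z"
  proof -
    have "AE r in time_measure T. 0 < r"
    proof -
      have "AE y in lborel. y \<noteq> (0::real)" by (rule AE_lborel_singleton)
      then have "AE y in lborel. y \<in> {0..T} \<longrightarrow> 0 < y" by eventually_elim auto
      then show ?thesis unfolding time_measure_def by (subst AE_restrict_space_iff) auto
    qed
    then have "AE r in time_measure T. AE \<omega> in M. 0 < fst (r, \<omega>)" by eventually_elim simp
    moreover have "{z \<in> space ?Q. 0 < fst z} \<in> sets ?Q"
      by (rule borel_measurable_less[OF borel_measurable_const measurable_compose[OF measurable_fst measurable_ident_time_measure]])
    ultimately show ?thesis by (rule TP.AE_pair_measure[rotated])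
  qed
  have formula: "(\<integral>\<omega>. (norm (P T \<omega>))\<^sup>2 \<partial>M) = (\<integral>\<omega>. (norm (P 0 \<omega>))\<^sup>2 \<partial>M)
    + (\<integral>z. 2 * (P (fst z) (snd z) \<bullet> \<beta> (fst z) (snd z)) + (norm (H (fst z) (snd z)))\<^sup>2 \<partial>?Q)"
    if P: "ito_process P \<beta> H" for P \<beta> :: "real \<Rightarrow> 'w \<Rightarrow> real^'a" and H
  proof -
    note D = ito_processD[OF P]
    note [measurable] = D(1,4,9)
    have "(\<integral>z. (indicator (space M) (snd z) * indicator {0<..} (fst z)) *
        (2 * (P (fst z) (snd z) \<bullet> \<beta> (fst z) (snd z)) + (norm (H (fst z) (snd z)))\<^sup>2) \<partial>?Q)
      = (\<integral>z. 2 * (P (fst z) (snd z) \<bullet> \<beta> (fst z) (snd z)) + (norm (H (fst z) (snd z)))\<^sup>2 \<partial>?Q)"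
    proof (rule integral_cong_AE)
      show "AE z in ?Q. (indicator (space M) (snd z) * indicator {0<..} (fst z)) *
        (2 * (P (fst z) (snd z) \<bullet> \<beta> (fst z) (snd z)) + (norm (H (fst z) (snd z)))\<^sup>2)
        = 2 * (P (fst z) (snd z) \<bullet> \<beta> (fst z) (snd z)) + (norm (H (fst z) (snd z)))\<^sup>2"
        using null AE_space by eventually_elim (auto simp: space_pair_measure)
    qed measurable
    moreover have "(\<integral>\<omega>. indicator (space M) \<omega> * g \<omega> \<partial>M) = (\<integral>\<omega>. g \<omega> \<partial>M)" for g :: "'w \<Rightarrow> real"
      by (intro Bochner_Integration.integral_cong) auto
    ultimately show ?thesis using ito_process_formula[OF P z sp] by simp
  qed
  have exp: "(\<integral>\<omega>. (norm (P1 r \<omega> + P2 r \<omega>))\<^sup>2 \<partial>M)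
      = (\<integral>\<omega>. (norm (P1 r \<omega>))\<^sup>2 \<partial>M) + 2 * (\<integral>\<omega>. P1 r \<omega> \<bullet> P2 r \<omega> \<partial>M) + (\<integral>\<omega>. (norm (P2 r \<omega>))\<^sup>2 \<partial>M)"
    if r: "r \<in> {0..T}" for r
  proof -
    have "(\<integral>\<omega>. (norm (P1 r \<omega> + P2 r \<omega>))\<^sup>2 \<partial>M)
      = (\<integral>\<omega>. (norm (P1 r \<omega>))\<^sup>2 + 2 * (P1 r \<omega> \<bullet> P2 r \<omega>) + (norm (P2 r \<omega>))\<^sup>2 \<partial>M)"
      by (simp add: power2_norm_eq_inner inner_add_left inner_add_right inner_commute algebra_simps)
    then show ?thesis
      using L1(1)[OF r] L2(1)[OF r] integrable_inner_square[OF D1(3)[OF r] D2(3)[OF r] L1(1)[OF r] L2(1)[OF r]]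
      by simp
  qed
  let ?c = "\<lambda>z. P1 (fst z) (snd z) \<bullet> \<beta>2 (fst z) (snd z) + P2 (fst z) (snd z) \<bullet> \<beta>1 (fst z) (snd z)
          + H1 (fst z) (snd z) \<bullet> H2 (fst z) (snd z)"
  have "(\<integral>z. 2 * ((P1 (fst z) (snd z) + P2 (fst z) (snd z)) \<bullet> (\<beta>1 (fst z) (snd z) + \<beta>2 (fst z) (snd z)))
        + (norm (H1 (fst z) (snd z) + H2 (fst z) (snd z)))\<^sup>2 \<partial>?Q)
    = (\<integral>z. (2 * (P1 (fst z) (snd z) \<bullet> \<beta>1 (fst z) (snd z)) + (norm (H1 (fst z) (snd z)))\<^sup>2) + 2 * ?c z
        + (2 * (P2 (fst z) (snd z) \<bullet> \<beta>2 (fst z) (snd z)) + (norm (H2 (fst z) (snd z)))\<^sup>2) \<partial>?Q)"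
    by (intro Bochner_Integration.integral_cong refl)
      (simp add: power2_norm_eq_inner inner_add_left inner_add_right inner_commute algebra_simps)
  also have "\<dots> = (\<integral>z. 2 * (P1 (fst z) (snd z) \<bullet> \<beta>1 (fst z) (snd z)) + (norm (H1 (fst z) (snd z)))\<^sup>2 \<partial>?Q)
      + 2 * (\<integral>z. ?c z \<partial>?Q) + (\<integral>z. 2 * (P2 (fst z) (snd z) \<bullet> \<beta>2 (fst z) (snd z)) + (norm (H2 (fst z) (snd z)))\<^sup>2 \<partial>?Q)"
    using i11 i12 i21 i22 hh e1(3) e2(3) by simp
  finally show "(\<integral>\<omega>. P1 T \<omega> \<bullet> P2 T \<omega> \<partial>M) = (\<integral>\<omega>. P1 0 \<omega> \<bullet> P2 0 \<omega> \<partial>M) + (\<integral>z. ?c z \<partial>?Q)"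
    using formula[OF 12] formula[OF 1] formula[OF 2] exp[OF Tin] exp[OF z] by simp
qed

text \<open>The backward Gronwall factor with \<open>c = 2 \<kappa> + \<kappa>^2 + 1\<close>, times
  the contribution \<open>K^2\<close> of the terminal value plus \<open>\<kappa>^2 T\<close> from
  the constant part of the drift bound.\<close>

definition adjoint_constant :: "real \<Rightarrow> real \<Rightarrow> real" where
  "adjoint_constant \<kappa> K = 2 * exp (2 * (2 * \<kappa> + \<kappa>\<^sup>2 + 1) * T) * (K\<^sup>2 + \<kappa>\<^sup>2 * T)"

lemma adjoint_constant_nonneg: "0 \<le> adjoint_constant \<kappa> K"
  using T_pos by (simp add: adjoint_constant_def)

text \<open>A pointwise bound from an averaged one. Gronwall's inequality is run backward for
  \<open>E [1_A |Y|^2]\<close> with an arbitrary event \<open>A\<close> of \<open>F t\<close>; its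
  inhomogeneous term is proportional to the probability of \<open>A\<close>, hence so is the
  resulting bound. Taking for \<open>A\<close> the event that the bound fails shows that this event
  is null.\<close>

lemma adjoint_bound:
  fixes Y D :: "real \<Rightarrow> 'w \<Rightarrow> real^'d" and Z :: "real \<Rightarrow> 'w \<Rightarrow> real^'e^'d"
  assumes Y: "ito_process Y (\<lambda>s \<omega>. - D s \<omega>) Z"
    and \<kappa>: "0 \<le> \<kappa>"
    and YT: "AE \<omega> in M. norm (Y T \<omega>) \<le> K"
    and D: "\<And>r \<omega>. r \<in> {0..T} \<Longrightarrow> \<omega> \<in> space M \<Longrightarrow>
      norm (D r \<omega>) \<le> \<kappa> * (norm (Y r \<omega>) + norm (Z r \<omega>) + 1)"
    and t: "t \<in> {0..T}"
  shows "AE \<omega> in M. (norm (Y t \<omega>))\<^sup>2 \<le> adjoint_constant \<kappa> K"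
proof -
  let ?L = "time_measure T"
  let ?Q = "?L \<Otimes>\<^sub>M M"
  note YD = ito_processD[OF Y] and YL = ito_process_L2[OF Y]
  note [measurable] = YD(1,4,9)
  have Tin: "T \<in> {0..T}" using T_pos by simp
  define c where "c = 2 * \<kappa> + \<kappa>\<^sup>2 + 1"
  have c: "0 < c" using \<kappa> by (auto simp: c_def add_nonneg_pos)
  obtain B where B: "B < \<infinity>" "\<And>r. r \<in> {0..T} \<Longrightarrow> (\<integral>\<^sup>+\<omega>. ennreal ((norm (Y r \<omega>))\<^sup>2) \<partial>M) \<le> B"
    using YL(3) by blast
  \<comment> \<open>The term \<open>|Z|^2\<close> supplied by the product formula absorbs the part
    of the drift that is linear in \<open>Z\<close>: \<open>2 \<kappa> |Y| |Z|\<close> is at most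
    \<open>\<kappa>^2 |Y|^2 + |Z|^2\<close>. The constant part of the drift leaves the summand
    \<open>\<kappa>^2\<close>.\<close>
  have pt: "2 * (Y r \<omega> \<bullet> D r \<omega>) - (norm (Z r \<omega>))\<^sup>2 \<le> c * (norm (Y r \<omega>))\<^sup>2 + \<kappa>\<^sup>2"
    if "r \<in> {0..T}" "\<omega> \<in> space M" for r \<omega>
  proof -
    let ?y = "norm (Y r \<omega>)" and ?z = "norm (Z r \<omega>)"
    have "Y r \<omega> \<bullet> D r \<omega> \<le> ?y * norm (D r \<omega>)" by (rule norm_cauchy_schwarz)
    also have "\<dots> \<le> ?y * (\<kappa> * (?y + ?z + 1))" using D[OF that] by (intro mult_left_mono) auto
    finally have "2 * (Y r \<omega> \<bullet> D r \<omega>) \<le> 2 * \<kappa> * ?y\<^sup>2 + 2 * (\<kappa> * ?y) * ?z + 2 * ?y * \<kappa>"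
      by (simp add: power2_eq_square algebra_simps)
    moreover have "2 * (\<kappa> * ?y) * ?z \<le> \<kappa>\<^sup>2 * ?y\<^sup>2 + ?z\<^sup>2"
      using sum_squares_bound[of "\<kappa> * ?y" ?z] by (simp add: power_mult_distrib)
    moreover have "2 * ?y * \<kappa> \<le> ?y\<^sup>2 + \<kappa>\<^sup>2" by (rule sum_squares_bound)
    ultimately show ?thesis unfolding c_def by (simp add: algebra_simps)
  qed
  have est: "(\<integral>\<^sup>+\<omega>. indicator A \<omega> * ennreal ((norm (Y t \<omega>))\<^sup>2) \<partial>M) \<le> ennreal (adjoint_constant \<kappa> K * measure M A)"
    if A: "A \<in> sets (F t)" for A
  proof -
    have AM[measurable]: "A \<in> sets M" by (rule F_sets_M[OF A t])
    define w where "w s = (\<integral>\<^sup>+\<omega>. indicator A \<omega> * ennreal ((norm (Y s \<omega>))\<^sup>2) \<partial>M)" for s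
    have Aint: "integrable M (\<lambda>\<omega>. indicator A \<omega> * (norm (Y s \<omega>))\<^sup>2)" if s: "s \<in> {0..T}" for s
    proof (rule Bochner_Integration.integrable_bound[OF YL(1)[OF s]])
      show "(\<lambda>\<omega>. indicator A \<omega> * (norm (Y s \<omega>))\<^sup>2) \<in> borel_measurable M" using YD(3)[OF s] by measurable
    qed (auto simp: indicator_def)
    have w_eq: "w s = ennreal (\<integral>\<omega>. indicator A \<omega> * (norm (Y s \<omega>))\<^sup>2 \<partial>M)" if s: "s \<in> {0..T}" for s
    proof -
      have "w s = (\<integral>\<^sup>+\<omega>. ennreal (indicator A \<omega> * (norm (Y s \<omega>))\<^sup>2) \<partial>M)"
        unfolding w_def by (intro nn_integral_cong) (auto simp: indicator_def)
      also have "\<dots> = ennreal (\<integral>\<omega>. indicator A \<omega> * (norm (Y s \<omega>))\<^sup>2 \<partial>M)"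
        by (rule nn_integral_eq_integral[OF Aint[OF s]]) simp
      finally show ?thesis .
    qed
    have step: "w s \<le> ennreal ((K\<^sup>2 + \<kappa>\<^sup>2 * T) * measure M A) + ennreal c * (\<integral>\<^sup>+r\<in>{s..}. w r \<partial>?L)"
      if s: "s \<in> {t..T}" for s
    proof -
      have s0: "s \<in> {0..T}" using s t by auto
      have As: "A \<in> sets (F s)" using s t by (intro F_sets_mono[OF A]) auto
      define a where "a z = (indicator A (snd z) * indicator {s<..} (fst z) :: real)" for z :: "real \<times> 'w"
      have am[measurable]: "a \<in> borel_measurable ?Q" unfolding a_def[abs_def] by measurable
      have a01: "0 \<le> a z" "a z \<le> 1" for z by (auto simp: a_def indicator_def)
      have split: "(\<lambda>z. X (fst z) (snd z)) \<in> borel_measurable ?Q" if "case_prod X \<in> borel_measurable ?Q"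
        for X :: "real \<Rightarrow> 'w \<Rightarrow> 'b::topological_space"
        using that by (simp add: split_beta')
      note mm[measurable] = split[OF YD(1)] split[OF YD(4)] split[OF YD(9)]
      note e = integrable_energy[OF YD(1) YL(2)] integrable_energy[OF YD(4) YD(6)] integrable_energy[OF YD(9) YD(7)]
      have aint: "integrable ?Q (\<lambda>z. a z * g z)" if g: "integrable ?Q g" for g :: "real \<times> 'w \<Rightarrow> real"
      proof (rule Bochner_Integration.integrable_bound[OF g])
        show "(\<lambda>z. a z * g z) \<in> borel_measurable ?Q" using borel_measurable_integrable[OF g] by measurable
      qed (auto simp: a_def indicator_def)
      interpret Q: finite_measure ?Q
        by (rule finite_measure_pair_measure) (auto intro: TM.finite_measure_axioms finite_measure_axioms)
      let ?g = "\<lambda>z. 2 * (Y (fst z) (snd z) \<bullet> - D (fst z) (snd z)) + (norm (Z (fst z) (snd z)))\<^sup>2"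
      let ?G = "\<lambda>z. c * (norm (Y (fst z) (snd z)))\<^sup>2 + \<kappa>\<^sup>2"
      have ig: "integrable ?Q ?g"
        using integrable_inner_square[OF mm(1) mm(2) e(1) e(2)] e(3) by simp
      have iG: "integrable ?Q ?G" using e(1) by simp
      have eq: "(\<integral>\<omega>. indicator A \<omega> * (norm (Y s \<omega>))\<^sup>2 \<partial>M)
          = (\<integral>\<omega>. indicator A \<omega> * (norm (Y T \<omega>))\<^sup>2 \<partial>M) - (\<integral>z. a z * ?g z \<partial>?Q)"
        using ito_process_formula[OF Y s0 As] unfolding a_def by simp
      have "- (\<integral>z. a z * ?g z \<partial>?Q) \<le> (\<integral>z. a z * ?G z \<partial>?Q)"
        unfolding Bochner_Integration.integral_minus[symmetric]
      proof (rule integral_mono)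
        fix z assume "z \<in> space ?Q"
        then have "fst z \<in> {0..T}" "snd z \<in> space M" by (auto simp: space_pair_measure)
        from pt[OF this] have "- ?g z \<le> ?G z" by simp
        then have "a z * - ?g z \<le> a z * ?G z" using a01 by (intro mult_left_mono) auto
        then show "- (a z * ?g z) \<le> a z * ?G z" unfolding mult_minus_right .
      qed (use aint[OF ig] aint[OF iG] in auto)
      with eq have 1: "(\<integral>\<omega>. indicator A \<omega> * (norm (Y s \<omega>))\<^sup>2 \<partial>M)
          \<le> (\<integral>\<omega>. indicator A \<omega> * (norm (Y T \<omega>))\<^sup>2 \<partial>M) + (\<integral>z. a z * ?G z \<partial>?Q)" by linarith
      have 2: "(\<integral>\<omega>. indicator A \<omega> * (norm (Y T \<omega>))\<^sup>2 \<partial>M) \<le> K\<^sup>2 * measure M A"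
      proof -
        have "(\<integral>\<omega>. indicator A \<omega> * (norm (Y T \<omega>))\<^sup>2 \<partial>M) \<le> (\<integral>\<omega>. K\<^sup>2 * indicator A \<omega> \<partial>M)"
        proof (rule integral_mono_AE[OF Aint[OF Tin]])
          show "AE \<omega> in M. indicator A \<omega> * (norm (Y T \<omega>))\<^sup>2 \<le> K\<^sup>2 * indicator A \<omega>"
            using YT by eventually_elim (auto simp: indicator_def intro!: power_mono)
        qed (auto simp: less_top[symmetric])
        then show ?thesis by simp
      qed
      have 3: "ennreal (\<integral>z. a z * ?G z \<partial>?Q) \<le> ennreal c * (\<integral>\<^sup>+r\<in>{s..}. w r \<partial>?L) + ennreal (\<kappa>\<^sup>2 * T * measure M A)"
      proof -
        have "ennreal (\<integral>z. a z * ?G z \<partial>?Q) = (\<integral>\<^sup>+z. ennreal (a z * ?G z) \<partial>?Q)"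
          using a01 c by (intro nn_integral_eq_integral[symmetric] aint[OF iG]) auto
        also have "\<dots> = (\<integral>\<^sup>+r. (\<integral>\<^sup>+\<omega>. ennreal (a (r, \<omega>) * ?G (r, \<omega>)) \<partial>M) \<partial>?L)"
          by (rule nn_integral_fst[symmetric]) measurable
        also have "\<dots> \<le> (\<integral>\<^sup>+r. ennreal c * (w r * indicator {s..} r) + ennreal (\<kappa>\<^sup>2 * measure M A) \<partial>?L)"
        proof (rule nn_integral_mono)
          fix r assume "r \<in> space ?L"
          then have r: "r \<in> {0..T}" by simp
          have [measurable]: "Y r \<in> borel_measurable M" by (rule YD(3)[OF r])
          have "(\<integral>\<^sup>+\<omega>. ennreal (a (r, \<omega>) * ?G (r, \<omega>)) \<partial>M)
            \<le> (\<integral>\<^sup>+\<omega>. ennreal c * indicator {s..} r * (indicator A \<omega> * ennreal ((norm (Y r \<omega>))\<^sup>2))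
              + ennreal (\<kappa>\<^sup>2) * indicator A \<omega> \<partial>M)"
            using c by (intro nn_integral_mono)
              (auto simp: a_def indicator_def ennreal_mult ennreal_plus)
          also have "\<dots> = ennreal c * (w r * indicator {s..} r) + ennreal (\<kappa>\<^sup>2 * measure M A)"
            by (simp add: nn_integral_add nn_integral_cmult w_def nn_integral_cmult_indicator
                emeasure_eq_measure ennreal_mult) (simp add: ac_simps)
          finally show "(\<integral>\<^sup>+\<omega>. ennreal (a (r, \<omega>) * ?G (r, \<omega>)) \<partial>M)
            \<le> ennreal c * (w r * indicator {s..} r) + ennreal (\<kappa>\<^sup>2 * measure M A)" .
        qed
        also have "\<dots> = ennreal c * (\<integral>\<^sup>+r\<in>{s..}. w r \<partial>?L) + ennreal (\<kappa>\<^sup>2 * measure M A) * ennreal T"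
        proof -
          have [measurable]: "w \<in> borel_measurable ?L" unfolding w_def[abs_def] by measurable
          show ?thesis using emeasure_time_measure[of T] T_pos by (simp add: nn_integral_add nn_integral_cmult)
        qed
        also have "ennreal (\<kappa>\<^sup>2 * measure M A) * ennreal T = ennreal (\<kappa>\<^sup>2 * T * measure M A)"
          using T_pos by (simp add: ennreal_mult[symmetric] ac_simps)
        finally show ?thesis .
      qed
      have "w s \<le> ennreal (K\<^sup>2 * measure M A + (\<integral>z. a z * ?G z \<partial>?Q))"
        unfolding w_eq[OF s0] using 1 2 by (intro ennreal_leI) simp
      also have "\<dots> = ennreal (K\<^sup>2 * measure M A) + ennreal (\<integral>z. a z * ?G z \<partial>?Q)"
        using a01 c by (intro ennreal_plus integral_nonneg_AE) auto
      also have "\<dots> \<le> ennreal (K\<^sup>2 * measure M A) + (ennreal c * (\<integral>\<^sup>+r\<in>{s..}. w r \<partial>?L) + ennreal (\<kappa>\<^sup>2 * T * measure M A))"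
        by (intro add_left_mono 3)
      also have "\<dots> = ennreal ((K\<^sup>2 + \<kappa>\<^sup>2 * T) * measure M A) + ennreal c * (\<integral>\<^sup>+r\<in>{s..}. w r \<partial>?L)"
      proof -
        have "ennreal ((K\<^sup>2 + \<kappa>\<^sup>2 * T) * measure M A)
            = ennreal (K\<^sup>2 * measure M A) + ennreal (\<kappa>\<^sup>2 * T * measure M A)"
          unfolding distrib_right using T_pos by (intro ennreal_plus) auto
        then show ?thesis by (simp add: ac_simps)
      qed
      finally show ?thesis .
    qed
    have "w t \<le> 2 * ennreal (exp (2 * c * T)) * ennreal ((K\<^sup>2 + \<kappa>\<^sup>2 * T) * measure M A)"
    proof (rule gronwall_backward[OF _ B(1) c _ _ step])
      fix s assume "s \<in> {t..T}"
      then have s: "s \<in> {0..T}" using t by auto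
      have "w s \<le> (\<integral>\<^sup>+\<omega>. ennreal ((norm (Y s \<omega>))\<^sup>2) \<partial>M)"
        unfolding w_def by (intro nn_integral_mono) (auto simp: indicator_def)
      then show "w s \<le> B" using B(2)[OF s] by (rule order_trans)
    qed (use t in auto)
    also have "\<dots> = ennreal (adjoint_constant \<kappa> K * measure M A)"
      unfolding adjoint_constant_def c_def[symmetric] using T_pos
      by (simp add: ennreal_mult ac_simps)
    finally show ?thesis unfolding w_def .
  qed
  let ?C = "adjoint_constant \<kappa> K"
  \<comment> \<open>On \<open>A\<close> the difference \<open>|Y t|^2 - C\<close> is positive, yet
    the estimate makes its integral over \<open>A\<close> at most 0.\<close>
  define A where "A = {\<omega> \<in> space M. ?C < (norm (Y t \<omega>))\<^sup>2}"
  have [measurable]: "Y t \<in> borel_measurable (F t)" by (rule YD(2)[OF t])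
  have A: "A \<in> sets (F t)"
  proof -
    have "{\<omega> \<in> space (F t). ?C < (norm (Y t \<omega>))\<^sup>2} \<in> sets (F t)" by measurable
    then show ?thesis by (simp add: A_def space_F[OF t])
  qed
  have AM[measurable]: "A \<in> sets M" by (rule F_sets_M[OF A t])
  have [measurable]: "Y t \<in> borel_measurable M" by (rule YD(3)[OF t])
  have i1: "integrable M (\<lambda>\<omega>. indicator A \<omega> * (norm (Y t \<omega>))\<^sup>2)"
    by (rule Bochner_Integration.integrable_bound[OF YL(1)[OF t]]) (auto simp: indicator_def)
  have i2: "integrable M (\<lambda>\<omega>. ?C * indicator A \<omega>)" by (auto simp: less_top[symmetric])
  let ?h = "\<lambda>\<omega>. indicator A \<omega> * (norm (Y t \<omega>))\<^sup>2 - ?C * indicator A \<omega>"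
  have h0: "0 \<le> ?h \<omega>" for \<omega> by (auto simp: indicator_def A_def)
  have ih: "integrable M ?h" using i1 i2 by simp
  have "(\<integral>\<^sup>+\<omega>. indicator A \<omega> * ennreal ((norm (Y t \<omega>))\<^sup>2) \<partial>M) = ennreal (\<integral>\<omega>. indicator A \<omega> * (norm (Y t \<omega>))\<^sup>2 \<partial>M)"
    by (subst nn_integral_eq_integral[OF i1, symmetric]) (auto intro!: nn_integral_cong simp: indicator_def)
  with est[OF A] have "(\<integral>\<omega>. indicator A \<omega> * (norm (Y t \<omega>))\<^sup>2 \<partial>M) \<le> ?C * measure M A"
    using adjoint_constant_nonneg by (simp add: ennreal_le_iff)
  then have "(\<integral>\<omega>. ?h \<omega> \<partial>M) \<le> 0" using i1 i2 by simp
  moreover have "0 \<le> (\<integral>\<omega>. ?h \<omega> \<partial>M)" using h0 by (intro integral_nonneg_AE) auto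
  ultimately have "AE \<omega> in M. ?h \<omega> = 0"
    using integral_nonneg_eq_0_iff_AE[OF ih] h0 by simp
  then show ?thesis using AE_space
    by eventually_elim (auto simp: A_def indicator_def split: if_splits)
qed

lemma ito_var_cong:
  fixes H H' :: "real \<Rightarrow> 'w \<Rightarrow> real^'e^'d"
  assumes H: "ito_var H \<eta>" and eq: "\<And>s \<omega>. s \<in> {0..T} \<Longrightarrow> \<omega> \<in> space M \<Longrightarrow> H' s \<omega> = H s \<omega>"
    and \<eta>': "\<eta>' \<in> borel_measurable M" and \<eta>: "AE \<omega> in M. \<eta>' \<omega> = \<eta> \<omega>"
  shows "ito_var H' \<eta>'"
proof -
  have en: "energy (\<lambda>s \<omega>. G s \<omega> - H' s \<omega>) \<omega> = energy (\<lambda>s \<omega>. G s \<omega> - H s \<omega>) \<omega>" "energy H' \<omega> = energy H \<omega>"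
    if "\<omega> \<in> space M" for G \<omega>
    unfolding energy_def using eq that by (auto intro!: nn_integral_cong)
  obtain n \<tau> \<xi> where e: "\<forall>m::nat. elementary_integrand F T (n m) (\<tau> m) (\<xi> m)"
    and l: "AE \<omega> in M. (\<lambda>m. energy (\<lambda>s \<omega>. elementary_process (n m) (\<tau> m) (\<xi> m) s \<omega> - H s \<omega>) \<omega>) \<longlonglongrightarrow> 0 \<and>
       (\<lambda>m. elementary_integral W (n m) (\<tau> m) (\<xi> m) T \<omega>) \<longlonglongrightarrow> \<eta> \<omega>"
    using H unfolding ito_var_def by blast
  show ?thesis
    unfolding ito_var_def
  proof (intro conjI exI)
    show "case_prod H' \<in> borel_measurable (time_measure T \<Otimes>\<^sub>M M)"
      using ito_varD(1)[OF H]
      by (rule measurable_cong[THEN iffD1, rotated]) (auto simp: space_pair_measure eq)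
    show "AE \<omega> in M. energy H' \<omega> < \<infinity>"
      using ito_varD(3)[OF H] AE_space by eventually_elim (simp add: en)
    show "AE \<omega> in M. (\<lambda>m. energy (\<lambda>s \<omega>. elementary_process (n m) (\<tau> m) (\<xi> m) s \<omega> - H' s \<omega>) \<omega>) \<longlonglongrightarrow> 0 \<and>
       (\<lambda>m. elementary_integral W (n m) (\<tau> m) (\<xi> m) T \<omega>) \<longlonglongrightarrow> \<eta>' \<omega>"
      using l \<eta> AE_space by eventually_elim (simp add: en)
  qed (use e \<eta>' in auto)
qed

text \<open>\<open>ito_integral\<close> does not mention the value at time 0, but all elementary
  integrals vanish there, since their grid points are clamped to 0, and the limit in probability
  inherits this.\<close>

lemma ito_integral_0:
  fixes H :: "real \<Rightarrow> 'w \<Rightarrow> real^'e^'d"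
  assumes I: "ito_integral M F T W H I"
  shows "AE \<omega> in M. I 0 \<omega> = 0"
proof -
  note ID = ito_integralD[OF I]
  have z: "0 \<in> {0..T}" using T_pos by simp
  have [measurable]: "I 0 \<in> borel_measurable M" by (rule ID(3)[OF z])
  obtain n \<tau> \<xi> where conv: "(\<forall>m. elementary_integrand F T (n m) (\<tau> m) (\<xi> m)) \<and>
        (\<forall>\<epsilon>>0. (\<lambda>m. measure M {\<omega>\<in>space M. ennreal \<epsilon> <
              energy (\<lambda>s \<omega>. elementary_process (n m) (\<tau> m) (\<xi> m) s \<omega> - H s \<omega>) \<omega>}) \<longlonglongrightarrow> 0) \<and>
        (\<forall>t\<in>{0..T}. \<forall>\<epsilon>>0. (\<lambda>m. measure M {\<omega>\<in>space M.
              \<epsilon> < norm (elementary_integral W (n m) (\<tau> m) (\<xi> m) t \<omega> - I t \<omega>)}) \<longlonglongrightarrow> 0)"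
    using ID(4) by (elim exE)
  note e = conjunct1[OF conv, rule_format] and l2 = conjunct2[OF conjunct2[OF conv], rule_format]
  have el: "elementary_integral W (n m) (\<tau> m) (\<xi> m) 0 \<omega> = 0" for m \<omega>
    unfolding elementary_integral_def
  proof (rule sum.neutral, rule ballI)
    fix k assume "k \<in> {..<n m}"
    then have k: "k < n m" by simp
    then have "min (\<tau> m (Suc k)) 0 = 0" "min (\<tau> m k) 0 = 0"
      using elementary_integrandD(1)[OF e[of m], of "Suc k"] elementary_integrandD(1)[OF e[of m], of k] by auto
    then show "\<xi> m k \<omega> *v (W (min (\<tau> m (Suc k)) 0) \<omega> - W (min (\<tau> m k) 0) \<omega>) = 0" by simp
  qed
  have small: "AE \<omega> in M. norm (I 0 \<omega>) \<le> inverse (real (Suc k))" for k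
  proof -
    have "(\<lambda>m::nat. measure M {\<omega>\<in>space M. inverse (real (Suc k)) < norm (I 0 \<omega>)}) \<longlonglongrightarrow> 0"
      using l2[OF z, of "inverse (real (Suc k))"] unfolding el by simp
    then have "measure M {\<omega>\<in>space M. inverse (real (Suc k)) < norm (I 0 \<omega>)} = 0"
      by (simp add: LIMSEQ_const_iff)
    then have "emeasure M {\<omega>\<in>space M. inverse (real (Suc k)) < norm (I 0 \<omega>)} = 0"
      by (simp add: emeasure_eq_measure)
    then show ?thesis
      by (intro AE_I[of _ _ "{\<omega>\<in>space M. inverse (real (Suc k)) < norm (I 0 \<omega>)}"]) (auto simp: not_le)
  qed
  have "AE \<omega> in M. \<forall>k. norm (I 0 \<omega>) \<le> inverse (real (Suc k))"
    using small by (simp add: AE_all_countable)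
  then show ?thesis
  proof eventually_elim
    case (elim \<omega>)
    have "norm (I 0 \<omega>) \<le> 0"
      by (rule LIMSEQ_le_const[OF LIMSEQ_inverse_real_of_nat]) (use elim in auto)
    then show ?case by simp
  qed
qed

end

section \<open>The Hamiltonian\<close>

lemma trace_transpose_mult: "trace (transpose A ** B) = (A :: real^'e^'d) \<bullet> B"
proof -
  have "trace (transpose A ** B) = (\<Sum>i\<in>UNIV. \<Sum>k\<in>UNIV. A $ k $ i * B $ k $ i)"
    by (simp add: trace_def matrix_matrix_mult_def transpose_def)
  also have "\<dots> = (\<Sum>k\<in>UNIV. \<Sum>i\<in>UNIV. A $ k $ i * B $ k $ i)" by (rule sum.swap)
  finally show ?thesis by (simp add: inner_vec_def)
qed

lemma hamiltonian_inner: "hamiltonian b \<sigma> f t x y z a = b t x a \<bullet> y + \<sigma> t x a \<bullet> z + f t x a"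
  by (simp add: hamiltonian_def trace_transpose_mult)

text \<open>The Hamiltonian pairs \<open>b\<close>, \<open>\<sigma>\<close> and \<open>f\<close>
  with \<open>y\<close>, \<open>z\<close> and 1, so its gradient does the same with their
  derivatives. The componentwise form serves measurability and bounds, the directional form the
  Taylor expansion.\<close>

lemma inner_Dx_hamiltonian:
  fixes b :: "real \<Rightarrow> real^'d \<Rightarrow> 'a \<Rightarrow> real^'d" and \<sigma> :: "real \<Rightarrow> real^'d \<Rightarrow> 'a \<Rightarrow> real^'e^'d"
  assumes b: "(\<lambda>x. b t x a) differentiable (at x)" and \<sigma>: "(\<lambda>x. \<sigma> t x a) differentiable (at x)"
    and f: "(\<lambda>x. f t x a) differentiable (at x)"
  shows "Dx_hamiltonian b \<sigma> f t x y z a $ i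
      = Dx (\<lambda>x. b t x a) x $ i \<bullet> y + Dx (\<lambda>x. \<sigma> t x a) x $ i \<bullet> z + Dx (\<lambda>x. f t x a) x $ i"
    and "Dx_hamiltonian b \<sigma> f t x y z a \<bullet> v
      = Dx_along (\<lambda>x. b t x a) x v \<bullet> y + Dx_along (\<lambda>x. \<sigma> t x a) x v \<bullet> z + Dx_along (\<lambda>x. f t x a) x v"
proof -
  let ?D = "\<lambda>v. Dx_along (\<lambda>x. b t x a) x v \<bullet> y + Dx_along (\<lambda>x. \<sigma> t x a) x v \<bullet> z + Dx_along (\<lambda>x. f t x a) x v"
  have d: "((\<lambda>x'. hamiltonian b \<sigma> f t x' y z a) has_derivative ?D) (at x)"
    unfolding hamiltonian_inner
    by (intro has_derivative_add has_derivative_inner_left has_derivative_Dx_along b \<sigma> f)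
  have ax: "Dx_along h x (axis i 1) = Dx h x $ i" for h :: "real^'d \<Rightarrow> 'b::real_normed_vector" and i
    unfolding Dx_along_def by (simp add: axis_def if_distrib[of "\<lambda>c. c *\<^sub>R _"] cong: if_cong)
  show comp: "Dx_hamiltonian b \<sigma> f t x y z a $ i
      = Dx (\<lambda>x. b t x a) x $ i \<bullet> y + Dx (\<lambda>x. \<sigma> t x a) x $ i \<bullet> z + Dx (\<lambda>x. f t x a) x $ i" for i
    unfolding Dx_hamiltonian_def Dx_nth[OF d] by (simp add: ax)
  show "Dx_hamiltonian b \<sigma> f t x y z a \<bullet> v = ?D v"
    unfolding inner_vec_def[of "Dx_hamiltonian b \<sigma> f t x y z a"] comp Dx_along_def inner_sum_left
    by (simp add: sum.distrib[symmetric] algebra_simps)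
qed

text \<open>Each component is bounded by Cauchy-Schwarz, every entry of the arrays \<open>Dx\<close>
  having norm at most \<open>K\<close>; estimating the norm by the sum of the components produces
  the factor \<open>CARD('d)\<close>.\<close>

lemma norm_Dx_hamiltonian_le:
  fixes b :: "real \<Rightarrow> real^'d \<Rightarrow> 'a \<Rightarrow> real^'d" and \<sigma> :: "real \<Rightarrow> real^'d \<Rightarrow> 'a \<Rightarrow> real^'e^'d"
  assumes d: "(\<lambda>x. b t x a) differentiable (at x)" "(\<lambda>x. \<sigma> t x a) differentiable (at x)"
    "(\<lambda>x. f t x a) differentiable (at x)"
    and K: "norm (Dx (\<lambda>x. b t x a) x) \<le> K" "norm (Dx (\<lambda>x. \<sigma> t x a) x) \<le> K" "norm (Dx (\<lambda>x. f t x a) x) \<le> K"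
  shows "norm (Dx_hamiltonian b \<sigma> f t x y z a) \<le> real CARD('d) * K * (norm y + norm z + 1)"
proof -
  have le: "\<bar>Dx_hamiltonian b \<sigma> f t x y z a $ i\<bar> \<le> K * (norm y + norm z + 1)" for i
  proof -
    have "\<bar>Dx (\<lambda>x. b t x a) x $ i \<bullet> y\<bar> \<le> K * norm y"
      by (rule order_trans[OF Cauchy_Schwarz_ineq2])
        (intro mult_right_mono order_trans[OF Finite_Cartesian_Product.norm_nth_le K(1)] norm_ge_zero)
    moreover have "\<bar>Dx (\<lambda>x. \<sigma> t x a) x $ i \<bullet> z\<bar> \<le> K * norm z"
      by (rule order_trans[OF Cauchy_Schwarz_ineq2])
        (intro mult_right_mono order_trans[OF Finite_Cartesian_Product.norm_nth_le K(2)] norm_ge_zero)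
    moreover have "\<bar>Dx (\<lambda>x. f t x a) x $ i\<bar> \<le> K"
      using order_trans[OF Finite_Cartesian_Product.norm_nth_le K(3), of i] by simp
    ultimately show ?thesis
      unfolding inner_Dx_hamiltonian(1)[where b=b and \<sigma>=\<sigma> and f=f and t=t and a=a and x=x, OF d] by (simp add: distrib_left)
  qed
  have "norm (Dx_hamiltonian b \<sigma> f t x y z a) \<le> (\<Sum>i\<in>UNIV. \<bar>Dx_hamiltonian b \<sigma> f t x y z a $ i\<bar>)"
    by (rule norm_le_l1_cart)
  also have "\<dots> \<le> (\<Sum>i\<in>(UNIV::'d set). K * (norm y + norm z + 1))" by (intro sum_mono le)
  finally show ?thesis by simp
qed

section \<open>Measurability\<close>

lemma borel_measurable_vecI:
  fixes h :: "'c \<Rightarrow> real^'d"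
  assumes "\<And>i. (\<lambda>z. h z $ i) \<in> borel_measurable N"
  shows "h \<in> borel_measurable N"
  unfolding borel_measurable_euclidean_space[of h]
  using assms by (auto simp: Basis_vec_def inner_axis)

text \<open>A partial derivative is the limit of difference quotients with steps
  \<open>1 / (n + 1)\<close>, each of which is measurable; total differentiability gives convergence
  at every point.\<close>

lemma Dx_measurable:
  fixes h :: "real \<Rightarrow> real^'d \<Rightarrow> 'a::topological_space \<Rightarrow> 'b::euclidean_space"
  assumes h: "(\<lambda>(t, x, a). h t x a) \<in> borel_measurable (restrict_space borel {0..T} \<Otimes>\<^sub>M borel \<Otimes>\<^sub>M borel)"
    and d: "\<And>t a x. t \<in> {0..T} \<Longrightarrow> (\<lambda>x. h t x a) differentiable (at x)"
  shows "(\<lambda>(t, x, a). Dx (\<lambda>x. h t x a) x $ i)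
    \<in> borel_measurable (restrict_space borel {0..T} \<Otimes>\<^sub>M borel \<Otimes>\<^sub>M borel)"
proof (rule borel_measurable_LIMSEQ_metric)
  let ?R = "restrict_space borel {0..T} \<Otimes>\<^sub>M (borel :: (real^'d) measure) \<Otimes>\<^sub>M (borel :: 'a measure)"
  let ?e = "\<lambda>n. inverse (real (Suc n)) *\<^sub>R axis i (1::real)"
  let ?u = "\<lambda>n (t, x, a). real (Suc n) *\<^sub>R (h t (x + ?e n) a - h t x a)"
  show "?u n \<in> borel_measurable ?R" for n
  proof -
    have s: "(\<lambda>z. (fst z, fst (snd z) + ?e n, snd (snd z))) \<in> measurable ?R ?R"
      by (intro measurable_Pair measurable_fst measurable_compose[OF measurable_snd measurable_snd]
          borel_measurable_add measurable_compose[OF measurable_snd measurable_fst] borel_measurable_const)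
    have "(\<lambda>z. h (fst z) (fst (snd z) + ?e n) (snd (snd z))) \<in> borel_measurable ?R"
      using measurable_compose[OF s h] by simp
    moreover have "(\<lambda>z. h (fst z) (fst (snd z)) (snd (snd z))) \<in> borel_measurable ?R"
      using h by (simp add: split_beta')
    ultimately show ?thesis
      unfolding split_beta' by (intro borel_measurable_scaleR borel_measurable_diff borel_measurable_const)
  qed
  fix z assume "z \<in> space ?R"
  then obtain t x a where z: "z = (t, x, a)" "t \<in> {0..T}"
    by (cases z) (auto simp: space_pair_measure space_restrict_space)
  let ?h = "\<lambda>x. h t x a" and ?D = "Dx_along (\<lambda>x. h t x a) x"
  have hd: "(?h has_derivative ?D) (at x)" by (rule has_derivative_Dx_along[OF d[OF z(2)]])
  then have q: "(\<lambda>k. norm (?h (x + k) - ?h x - ?D k) / norm k) \<midarrow>0\<rightarrow> 0"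
    by (simp add: has_derivative_at)
  have e0: "filterlim ?e (at 0) sequentially"
  proof (rule filterlim_atI)
    have "?e \<longlonglongrightarrow> 0 *\<^sub>R axis i 1" by (intro tendsto_intros LIMSEQ_inverse_real_of_nat)
    then show "?e \<longlonglongrightarrow> 0" by simp
    show "eventually (\<lambda>n. ?e n \<noteq> 0) sequentially" by (intro always_eventually) (simp add: axis_eq_0_iff)
  qed
  have lim: "(\<lambda>n. norm (?h (x + ?e n) - ?h x - ?D (?e n)) / norm (?e n)) \<longlonglongrightarrow> 0"
    by (rule filterlim_compose[OF q e0])
  have De: "?D (?e n) = inverse (real (Suc n)) *\<^sub>R (Dx ?h x $ i)" for n
    using has_derivative_bounded_linear[OF hd] Dx_nth[OF hd, of i] by (simp add: linear_simps)
  have "norm (?h (x + ?e n) - ?h x - ?D (?e n)) / norm (?e n) = norm (?u n z - Dx ?h x $ i)" for n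
  proof -
    have "?u n z - Dx ?h x $ i = real (Suc n) *\<^sub>R (?h (x + ?e n) - ?h x - ?D (?e n))"
      unfolding De z by (simp add: scaleR_diff_right)
    then have "norm (?u n z - Dx ?h x $ i) = real (Suc n) * norm (?h (x + ?e n) - ?h x - ?D (?e n))" by simp
    moreover have "norm (?e n) = inverse (real (Suc n))" by (simp add: norm_axis_1)
    ultimately show ?thesis by (simp add: divide_inverse mult.commute)
  qed
  with lim have "(\<lambda>n. norm (?u n z - Dx ?h x $ i)) \<longlonglongrightarrow> 0" by simp
  then have "(\<lambda>n. ?u n z) \<longlonglongrightarrow> Dx ?h x $ i"
    by (simp only: tendsto_norm_zero_iff LIM_zero_iff)
  then show "(\<lambda>n. ?u n z) \<longlonglongrightarrow> (case z of (t, x, a) \<Rightarrow> Dx (\<lambda>x. h t x a) x $ i)" using z by simp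
qed

context wiener_space
begin

lemma progressive_adapted:
  assumes X: "progressively_measurable F T X" and t: "t \<in> {0..T}"
  shows "X t \<in> borel_measurable (F t)"
proof -
  have 1: "(\<lambda>(s, \<omega>). X s \<omega>) \<in> borel_measurable (restrict_space borel {0..t} \<Otimes>\<^sub>M F t)"
    using X t by (auto simp: progressively_measurable_def)
  have "t \<in> space (restrict_space borel {0..t})" using t by (simp add: space_restrict_space)
  from measurable_compose[OF measurable_Pair1'[OF this] 1] show ?thesis by simp
qed

lemma progressive_compose:
  fixes h :: "real \<Rightarrow> real^'d \<Rightarrow> 'a::topological_space \<Rightarrow> 'b::topological_space"
  assumes h: "(\<lambda>(t, x, a). h t x a) \<in> borel_measurable (restrict_space borel {0..T} \<Otimes>\<^sub>M borel \<Otimes>\<^sub>M borel)"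
    and X: "progressively_measurable F T X" and \<alpha>: "progressively_measurable F T \<alpha>"
  shows "progressively_measurable F T (\<lambda>s \<omega>. h s (X s \<omega>) (\<alpha> s \<omega>))"
  unfolding progressively_measurable_def
proof
  fix t assume t: "t \<in> {0..T}"
  let ?N = "restrict_space borel {0..t} \<Otimes>\<^sub>M F t"
  have i: "(\<lambda>s. s) \<in> measurable (restrict_space borel {0..t}) (restrict_space borel {0..T})"
    using t by (intro measurable_restrict_space3) auto
  have "(\<lambda>z. X (fst z) (snd z)) \<in> borel_measurable ?N" "(\<lambda>z. \<alpha> (fst z) (snd z)) \<in> borel_measurable ?N"
    using X \<alpha> t by (auto simp: progressively_measurable_def split_beta')
  then have "(\<lambda>z. (fst z, X (fst z) (snd z), \<alpha> (fst z) (snd z)))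
      \<in> measurable ?N (restrict_space borel {0..T} \<Otimes>\<^sub>M borel \<Otimes>\<^sub>M borel)"
    by (intro measurable_Pair measurable_compose[OF measurable_fst i])
  from measurable_compose[OF this h]
  show "(\<lambda>(s, \<omega>). h s (X s \<omega>) (\<alpha> s \<omega>)) \<in> borel_measurable ?N" by (simp add: split_beta')
qed

lemma progressive_binop:
  assumes X: "progressively_measurable F T X" and Y: "progressively_measurable F T Y"
    and op: "\<And>N f g. f \<in> borel_measurable N \<Longrightarrow> g \<in> borel_measurable N \<Longrightarrow>
      (\<lambda>z. opr (f z) (g z)) \<in> borel_measurable (N :: (real \<times> 'w) measure)"
  shows "progressively_measurable F T (\<lambda>s \<omega>. opr (X s \<omega>) (Y s \<omega>))"
  unfolding progressively_measurable_def
proof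
  fix t assume t: "t \<in> {0..T}"
  have "(\<lambda>z. X (fst z) (snd z)) \<in> borel_measurable (restrict_space borel {0..t} \<Otimes>\<^sub>M F t)"
    "(\<lambda>z. Y (fst z) (snd z)) \<in> borel_measurable (restrict_space borel {0..t} \<Otimes>\<^sub>M F t)"
    using X Y t by (auto simp: progressively_measurable_def split_beta')
  from op[OF this] show "(\<lambda>(s, \<omega>). opr (X s \<omega>) (Y s \<omega>)) \<in> borel_measurable (restrict_space borel {0..t} \<Otimes>\<^sub>M F t)"
    by (simp add: split_beta')
qed

lemma progressive_diff:
  fixes X Y :: "real \<Rightarrow> 'w \<Rightarrow> 'b::euclidean_space"
  assumes "progressively_measurable F T X" "progressively_measurable F T Y"
  shows "progressively_measurable F T (\<lambda>s \<omega>. X s \<omega> - Y s \<omega>)"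
  using assms by (rule progressive_binop) (rule borel_measurable_diff)

text \<open>Measurability is checked componentwise on the explicit formula for the gradient. That
  formula relies on differentiability, which is assumed at times of \<open>{0..T}\<close> only, so
  the two functions are identified on the space of the restricted measure.\<close>

lemma progressive_Dx_hamiltonian:
  fixes b :: "real \<Rightarrow> real^'d \<Rightarrow> 'a::topological_space \<Rightarrow> real^'d"
    and \<sigma> :: "real \<Rightarrow> real^'d \<Rightarrow> 'a \<Rightarrow> real^'k^'d" and f :: "real \<Rightarrow> real^'d \<Rightarrow> 'a \<Rightarrow> real"
  assumes m: "(\<lambda>(t, x, a). b t x a) \<in> borel_measurable (restrict_space borel {0..T} \<Otimes>\<^sub>M borel \<Otimes>\<^sub>M borel)"
      "(\<lambda>(t, x, a). \<sigma> t x a) \<in> borel_measurable (restrict_space borel {0..T} \<Otimes>\<^sub>M borel \<Otimes>\<^sub>M borel)"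
      "(\<lambda>(t, x, a). f t x a) \<in> borel_measurable (restrict_space borel {0..T} \<Otimes>\<^sub>M borel \<Otimes>\<^sub>M borel)"
    and d: "\<And>t a x. t \<in> {0..T} \<Longrightarrow> (\<lambda>x. b t x a) differentiable (at x)"
      "\<And>t a x. t \<in> {0..T} \<Longrightarrow> (\<lambda>x. \<sigma> t x a) differentiable (at x)"
      "\<And>t a x. t \<in> {0..T} \<Longrightarrow> (\<lambda>x. f t x a) differentiable (at x)"
    and X: "progressively_measurable F T X" and Y: "progressively_measurable F T Y"
    and Z: "progressively_measurable F T Z" and \<alpha>: "progressively_measurable F T \<alpha>"
  shows "progressively_measurable F T (\<lambda>s \<omega>. Dx_hamiltonian b \<sigma> f s (X s \<omega>) (Y s \<omega>) (Z s \<omega>) (\<alpha> s \<omega>))"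
  unfolding progressively_measurable_def
proof
  fix t assume t: "t \<in> {0..T}"
  let ?N = "restrict_space borel {0..t} \<Otimes>\<^sub>M F t"
  have pr: "(\<lambda>z. V (fst z) (snd z)) \<in> borel_measurable ?N" if "progressively_measurable F T V"
    for V :: "real \<Rightarrow> 'w \<Rightarrow> 'c::topological_space"
    using that t by (auto simp: progressively_measurable_def split_beta')
  note [measurable] = pr[OF Y] pr[OF Z]
  have "(\<lambda>z. Dx_hamiltonian b \<sigma> f (fst z) (X (fst z) (snd z)) (Y (fst z) (snd z)) (Z (fst z) (snd z)) (\<alpha> (fst z) (snd z)))
      \<in> borel_measurable ?N"
  proof (rule borel_measurable_vecI)
    fix i
    note [measurable] = pr[OF progressive_compose[OF Dx_measurable[OF m(1) d(1), where i=i] X \<alpha>]]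
      pr[OF progressive_compose[OF Dx_measurable[OF m(2) d(2), where i=i] X \<alpha>]]
      pr[OF progressive_compose[OF Dx_measurable[OF m(3) d(3), where i=i] X \<alpha>]]
    have "(\<lambda>z. Dx (\<lambda>x. b (fst z) x (\<alpha> (fst z) (snd z))) (X (fst z) (snd z)) $ i \<bullet> Y (fst z) (snd z)
       + Dx (\<lambda>x. \<sigma> (fst z) x (\<alpha> (fst z) (snd z))) (X (fst z) (snd z)) $ i \<bullet> Z (fst z) (snd z)
       + Dx (\<lambda>x. f (fst z) x (\<alpha> (fst z) (snd z))) (X (fst z) (snd z)) $ i) \<in> borel_measurable ?N"
      by measurable
    then show "(\<lambda>z. Dx_hamiltonian b \<sigma> f (fst z) (X (fst z) (snd z)) (Y (fst z) (snd z)) (Z (fst z) (snd z))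
        (\<alpha> (fst z) (snd z)) $ i) \<in> borel_measurable ?N"
    proof (rule measurable_cong[THEN iffD1, rotated])
      fix z assume "z \<in> space ?N"
      then have "fst z \<in> {0..T}" using t by (auto simp: space_pair_measure space_restrict_space)
      from inner_Dx_hamiltonian(1)[where b=b and \<sigma>=\<sigma> and f=f and t="fst z" and a="\<alpha> (fst z) (snd z)"
          and x="X (fst z) (snd z)", OF d(1)[OF this] d(2)[OF this] d(3)[OF this]]
      show "Dx (\<lambda>x. b (fst z) x (\<alpha> (fst z) (snd z))) (X (fst z) (snd z)) $ i \<bullet> Y (fst z) (snd z)
         + Dx (\<lambda>x. \<sigma> (fst z) x (\<alpha> (fst z) (snd z))) (X (fst z) (snd z)) $ i \<bullet> Z (fst z) (snd z)
         + Dx (\<lambda>x. f (fst z) x (\<alpha> (fst z) (snd z))) (X (fst z) (snd z)) $ i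
        = Dx_hamiltonian b \<sigma> f (fst z) (X (fst z) (snd z)) (Y (fst z) (snd z)) (Z (fst z) (snd z)) (\<alpha> (fst z) (snd z)) $ i"
        by simp
    qed
  qed
  then show "(\<lambda>(s, \<omega>). Dx_hamiltonian b \<sigma> f s (X s \<omega>) (Y s \<omega>) (Z s \<omega>) (\<alpha> s \<omega>)) \<in> borel_measurable ?N"
    by (simp add: split_beta')
qed

lemma mean_square_energy: "mean_square M T U = (\<integral>\<^sup>+\<omega>. energy U \<omega> \<partial>M)"
  by (simp add: mean_square_def energy_def nn_integral_time_measure)

text \<open>Turns continuity of paths, part of the notion of a state solution, into the finiteness
  required by the pathwise Gronwall argument.\<close>

lemma energy_finite_of_continuous:
  fixes U :: "real \<Rightarrow> 'w \<Rightarrow> real^'d"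
  assumes "continuous_on {0..T} (\<lambda>t. U t \<omega>)"
  shows "energy U \<omega> < \<infinity>"
proof -
  have "compact ((\<lambda>t. U t \<omega>) ` {0..T})" using assms by (rule compact_continuous_image) simp
  then obtain B where B: "\<And>t. t \<in> {0..T} \<Longrightarrow> norm (U t \<omega>) \<le> B"
    using compact_imp_bounded bounded_iff by (metis imageI)
  have "energy U \<omega> \<le> (\<integral>\<^sup>+s. ennreal (B\<^sup>2) \<partial>time_measure T)"
    unfolding energy_def using B by (intro nn_integral_mono ennreal_leI power_mono) auto
  also have "\<dots> < \<infinity>" using emeasure_time_measure[of T] T_pos by (simp add: ennreal_mult_less_top)
  finally show ?thesis .
qed

text \<open>Square integrability from linear growth; the constant term contributes the total mass of
  the product space, which is finite.\<close>

lemma energy_bound_finite: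
  fixes G :: "real \<Rightarrow> 'w \<Rightarrow> 'b::{real_normed_vector, second_countable_topology}"
    and P :: "real \<Rightarrow> 'w \<Rightarrow> 'p::euclidean_space" and Q :: "real \<Rightarrow> 'w \<Rightarrow> 'q::euclidean_space"
  assumes m: "case_prod G \<in> borel_measurable (time_measure T \<Otimes>\<^sub>M M)"
      "case_prod P \<in> borel_measurable (time_measure T \<Otimes>\<^sub>M M)"
      "case_prod Q \<in> borel_measurable (time_measure T \<Otimes>\<^sub>M M)"
    and le: "\<And>r \<omega>. r \<in> {0..T} \<Longrightarrow> \<omega> \<in> space M \<Longrightarrow> norm (G r \<omega>) \<le> k * (norm (P r \<omega>) + norm (Q r \<omega>) + 1)"
    and f: "(\<integral>\<^sup>+\<omega>. energy P \<omega> \<partial>M) < \<infinity>" "(\<integral>\<^sup>+\<omega>. energy Q \<omega> \<partial>M) < \<infinity>"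
  shows "(\<integral>\<^sup>+\<omega>. energy G \<omega> \<partial>M) < \<infinity>"
proof -
  let ?L = "time_measure T \<Otimes>\<^sub>M M"
  note [measurable] = m
  have "(\<integral>\<^sup>+\<omega>. energy G \<omega> \<partial>M) \<le> (\<integral>\<^sup>+z. ennreal (3 * k\<^sup>2) * (ennreal ((norm (P (fst z) (snd z)))\<^sup>2)
      + ennreal ((norm (Q (fst z) (snd z)))\<^sup>2) + 1) \<partial>?L)"
    unfolding nn_integral_energy[OF m(1)]
  proof (rule nn_integral_mono)
    fix z assume z: "z \<in> space ?L"
    let ?p = "norm (P (fst z) (snd z))" and ?q = "norm (Q (fst z) (snd z))"
    have "(norm (G (fst z) (snd z)))\<^sup>2 \<le> (k * (?p + ?q + 1))\<^sup>2"
      using le[of "fst z" "snd z"] z by (intro power_mono) (auto simp: space_pair_measure)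
    also have "\<dots> = k\<^sup>2 * (?p + ?q + 1)\<^sup>2" by (simp add: power_mult_distrib)
    also have "\<dots> \<le> k\<^sup>2 * (3 * (?p\<^sup>2 + ?q\<^sup>2 + 1))"
      using sum_squares_bound[of ?p ?q] sum_squares_bound[of ?p 1] sum_squares_bound[of ?q 1]
      by (intro mult_left_mono) (auto simp: power2_sum algebra_simps)
    finally have "ennreal ((norm (G (fst z) (snd z)))\<^sup>2) \<le> ennreal (3 * k\<^sup>2 * (?p\<^sup>2 + ?q\<^sup>2 + 1))"
      by (intro ennreal_leI) (simp add: algebra_simps)
    also have "\<dots> = ennreal (3 * k\<^sup>2) * (ennreal (?p\<^sup>2) + ennreal (?q\<^sup>2) + 1)"
      by (simp add: ennreal_mult ennreal_plus)
    finally show "ennreal ((norm (G (fst z) (snd z)))\<^sup>2) \<le> ennreal (3 * k\<^sup>2) * (ennreal (?p\<^sup>2) + ennreal (?q\<^sup>2) + 1)" .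
  qed
  also have "\<dots> = ennreal (3 * k\<^sup>2) * ((\<integral>\<^sup>+\<omega>. energy P \<omega> \<partial>M) + (\<integral>\<^sup>+\<omega>. energy Q \<omega> \<partial>M) + emeasure ?L (space ?L))"
    by (simp add: nn_integral_add nn_integral_cmult nn_integral_energy)
  also have "\<dots> < \<infinity>"
  proof -
    interpret Q: finite_measure ?L
      by (rule finite_measure_pair_measure) (auto intro: TM.finite_measure_axioms finite_measure_axioms)
    have "emeasure ?L (space ?L) < top" by (simp add: less_top[symmetric])
    then show ?thesis using f by (simp add: ennreal_mult_less_top)
  qed
  finally show ?thesis .
qed

text \<open>Subtracting the equation at \<open>r\<close> from the equation at \<open>T\<close>
  converts a forward equation, started from any initial value \<open>p\<close>, into the
  decomposition over \<open>(r, T]\<close>. Integrability of the drift along almost every path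
  justifies splitting its integral at \<open>r\<close>.\<close>

lemma ito_processI:
  fixes P \<beta> :: "real \<Rightarrow> 'w \<Rightarrow> real^'d" and H :: "real \<Rightarrow> 'w \<Rightarrow> real^'e^'d"
  assumes P: "progressively_measurable F T P" and \<beta>: "progressively_measurable F T \<beta>"
    and f: "(\<integral>\<^sup>+\<omega>. energy \<beta> \<omega> \<partial>M) < \<infinity>" "(\<integral>\<^sup>+\<omega>. energy H \<omega> \<partial>M) < \<infinity>"
    and PT: "integrable M (\<lambda>\<omega>. (norm (P T \<omega>))\<^sup>2)"
    and N: "ito_increments H (\<lambda>s \<omega>. I T \<omega> - I s \<omega>)"
    and eq: "AE \<omega> in M. \<forall>t\<in>{0..T}. P t \<omega> = p \<omega> + (\<integral>q. indicator {..t} q *\<^sub>R \<beta> q \<omega> \<partial>time_measure T) + I t \<omega>"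
  shows "ito_process P \<beta> H"
  unfolding ito_process_def
proof (intro conjI ballI exI)
  note \<beta>m = progressive_joint[OF \<beta>]
  fix r assume r: "r \<in> {0..T}"
  have Tin: "T \<in> {0..T}" using T_pos by simp
  have "AE \<omega> in M. energy \<beta> \<omega> \<noteq> \<infinity>"
    using f(1) by (intro nn_integral_PInf_AE energy_measurable[OF \<beta>m]) auto
  then show "AE \<omega> in M. P T \<omega> = P r \<omega> + (\<integral>q. indicator {r<..} q *\<^sub>R \<beta> q \<omega> \<partial>time_measure T) + (I T \<omega> - I r \<omega>)"
    using eq AE_space
  proof eventually_elim
    case (elim \<omega>)
    have i: "integrable (time_measure T) (\<lambda>q. \<beta> q \<omega>)"
      using elim by (intro energy_finite_section[OF \<beta>m]) (auto simp: less_top)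
    have ind: "integrable (time_measure T) (\<lambda>q. indicator A q *\<^sub>R \<beta> q \<omega>)" if A: "A \<in> sets borel" for A
    proof (rule Bochner_Integration.integrable_bound[OF i])
      show "(\<lambda>q. indicator A q *\<^sub>R \<beta> q \<omega>) \<in> borel_measurable (time_measure T)"
        using borel_measurable_integrable[OF i] A by measurable
    qed (auto simp: indicator_def)
    have "(\<integral>q. indicator {..T} q *\<^sub>R \<beta> q \<omega> \<partial>time_measure T)
      = (\<integral>q. indicator {..r} q *\<^sub>R \<beta> q \<omega> + indicator {r<..} q *\<^sub>R \<beta> q \<omega> \<partial>time_measure T)"
      by (intro Bochner_Integration.integral_cong refl) (auto simp: indicator_def)
    also have "\<dots> = (\<integral>q. indicator {..r} q *\<^sub>R \<beta> q \<omega> \<partial>time_measure T) + (\<integral>q. indicator {r<..} q *\<^sub>R \<beta> q \<omega> \<partial>time_measure T)"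
      by (rule Bochner_Integration.integral_add[OF ind ind]) auto
    finally show ?case
      using bspec[OF elim(2) Tin] bspec[OF elim(2) r] by simp
  qed
qed (use assms progressive_joint progressive_adapted in auto)

end

section \<open>Comparison of two controls\<close>

locale control_problem = wiener_space M F T W for M :: "'w measure" and F T and W :: "real \<Rightarrow> 'w \<Rightarrow> real^'e" +
  fixes K :: real
    and b :: "real \<Rightarrow> real^'d \<Rightarrow> 'a::metric_space \<Rightarrow> real^'d"
    and \<sigma> :: "real \<Rightarrow> real^'d \<Rightarrow> 'a \<Rightarrow> real^'e^'d"
    and f :: "real \<Rightarrow> real^'d \<Rightarrow> 'a \<Rightarrow> real"
    and g :: "real^'d \<Rightarrow> real"
  assumes b_meas: "(\<lambda>(t, x, a). b t x a)
      \<in> borel_measurable (restrict_space borel {0..T} \<Otimes>\<^sub>M borel \<Otimes>\<^sub>M borel)"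
    and \<sigma>_meas: "(\<lambda>(t, x, a). \<sigma> t x a)
      \<in> borel_measurable (restrict_space borel {0..T} \<Otimes>\<^sub>M borel \<Otimes>\<^sub>M borel)"
    and f_meas: "(\<lambda>(t, x, a). f t x a)
      \<in> borel_measurable (restrict_space borel {0..T} \<Otimes>\<^sub>M borel \<Otimes>\<^sub>M borel)"
    and g_meas: "g \<in> borel_measurable borel"
    and b_diff: "\<And>t a. t \<in> {0..T} \<Longrightarrow> twice_differentiable (\<lambda>x. b t x a)"
    and \<sigma>_diff: "\<And>t a. t \<in> {0..T} \<Longrightarrow> twice_differentiable (\<lambda>x. \<sigma> t x a)"
    and f_diff: "\<And>t a. t \<in> {0..T} \<Longrightarrow> twice_differentiable (\<lambda>x. f t x a)"
    and g_diff: "twice_differentiable g"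
    and K_nonneg: "0 \<le> K"
    and dynamics_bound: "\<And>t x a. t \<in> {0..T} \<Longrightarrow>
      norm (Dx (\<lambda>x. b t x a) x) + norm (Dx (\<lambda>x. \<sigma> t x a) x) + norm (Dx (Dx (\<lambda>x. b t x a)) x) \<le> K"
    and \<sigma>_affine: "\<And>t x a. t \<in> {0..T} \<Longrightarrow> Dx (Dx (\<lambda>x. \<sigma> t x a)) x = 0"
    and cost_bound: "\<And>t x a. t \<in> {0..T} \<Longrightarrow>
      norm (Dx g x) + norm (Dx (\<lambda>x. f t x a) x) + norm (Dx (Dx g) x)
        + norm (Dx (Dx (\<lambda>x. f t x a)) x) \<le> K"
begin

lemma derivative_bounds:
  assumes "t \<in> {0..T}"
  shows "norm (Dx (\<lambda>x. b t x a) x) \<le> K" "norm (Dx (\<lambda>x. \<sigma> t x a) x) \<le> K"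
    "norm (Dx (Dx (\<lambda>x. b t x a)) x) \<le> K" "norm (Dx g x) \<le> K" "norm (Dx (\<lambda>x. f t x a) x) \<le> K"
    "norm (Dx (Dx g) x) \<le> K" "norm (Dx (Dx (\<lambda>x. f t x a)) x) \<le> K"
  using dynamics_bound[where x=x and a=a, OF assms] cost_bound[where x=x and a=a, OF assms]
    norm_ge_zero[of "Dx (\<lambda>x. b t x a) x"] norm_ge_zero[of "Dx (\<lambda>x. \<sigma> t x a) x"]
    norm_ge_zero[of "Dx (Dx (\<lambda>x. b t x a)) x"] norm_ge_zero[of "Dx g x"]
    norm_ge_zero[of "Dx (\<lambda>x. f t x a) x"] norm_ge_zero[of "Dx (Dx g) x"]
    norm_ge_zero[of "Dx (Dx (\<lambda>x. f t x a)) x"]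
  by linarith+

lemma differentiable:
  assumes "t \<in> {0..T}"
  shows "(\<lambda>x. b t x a) differentiable (at x)" "(\<lambda>x. \<sigma> t x a) differentiable (at x)"
    "(\<lambda>x. f t x a) differentiable (at x)"
  using b_diff[OF assms] \<sigma>_diff[OF assms] f_diff[OF assms] by (auto simp: twice_differentiable_def)

lemma Lipschitz:
  assumes "t \<in> {0..T}"
  shows "norm (b t y a - b t x a) \<le> K * norm (y - x)" "norm (\<sigma> t y a - \<sigma> t x a) \<le> K * norm (y - x)"
    "\<bar>f t y a - f t x a\<bar> \<le> K * norm (y - x)"
proof -
  note d = differentiable[OF assms] and B = derivative_bounds[OF assms]
  show "norm (b t y a - b t x a) \<le> K * norm (y - x)"
    by (rule Dx_Lipschitz[where h="\<lambda>x. b t x a", OF d(1) B(1)])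
  show "norm (\<sigma> t y a - \<sigma> t x a) \<le> K * norm (y - x)"
    by (rule Dx_Lipschitz[where h="\<lambda>x. \<sigma> t x a", OF d(2) B(2)])
  have "norm (f t y a - f t x a) \<le> K * norm (y - x)"
    by (rule Dx_Lipschitz[where h="\<lambda>x. f t x a", OF d(3) B(5)])
  then show "\<bar>f t y a - f t x a\<bar> \<le> K * norm (y - x)" by simp
qed

lemma g_Lipschitz: "\<bar>g y - g x\<bar> \<le> K * norm (y - x)"
proof -
  have "0 \<in> {0..T}" using T_pos by simp
  from Dx_Lipschitz[OF _ derivative_bounds(4)[OF this]] g_diff
  show ?thesis by (simp add: twice_differentiable_def)
qed

lemma g_Taylor: "g y - g x \<le> Dx g x \<bullet> (y - x) + K * (norm (y - x))\<^sup>2"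
proof -
  have z: "0 \<in> {0..T}" using T_pos by simp
  have "norm (g y - g x - Dx_along g x (y - x)) \<le> K * (norm (y - x))\<^sup>2"
    by (rule Dx_Taylor[OF g_diff derivative_bounds(6)[OF z]])
  moreover have "Dx_along g x (y - x) = Dx g x \<bullet> (y - x)"
    by (simp add: Dx_along_def inner_vec_def mult.commute)
  ultimately show ?thesis by (simp add: abs_le_iff)
qed

text \<open>No term in \<open>z\<close> remains because \<open>\<sigma>\<close> is affine in \<open>x\<close>.\<close>

lemma hamiltonian_Taylor:
  assumes t: "t \<in> {0..T}"
  shows "(b t x' a - b t x a) \<bullet> y + (\<sigma> t x' a - \<sigma> t x a) \<bullet> z + (f t x' a - f t x a)
    \<le> Dx_hamiltonian b \<sigma> f t x y z a \<bullet> (x' - x) + K * (1 + norm y) * (norm (x' - x))\<^sup>2"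
proof -
  let ?v = "x' - x"
  have b1: "norm (b t x' a - b t x a - Dx_along (\<lambda>x. b t x a) x ?v) \<le> K * (norm ?v)\<^sup>2"
    by (rule Dx_Taylor[OF b_diff[OF t] derivative_bounds(3)[OF t]])
  have f1: "norm (f t x' a - f t x a - Dx_along (\<lambda>x. f t x a) x ?v) \<le> K * (norm ?v)\<^sup>2"
    by (rule Dx_Taylor[OF f_diff[OF t] derivative_bounds(7)[OF t]])
  have "norm (\<sigma> t x' a - \<sigma> t x a - Dx_along (\<lambda>x. \<sigma> t x a) x ?v) \<le> 0 * (norm ?v)\<^sup>2"
    by (rule Dx_Taylor[OF \<sigma>_diff[OF t]]) (simp add: \<sigma>_affine[OF t])
  then have s1: "\<sigma> t x' a - \<sigma> t x a = Dx_along (\<lambda>x. \<sigma> t x a) x ?v" by simp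
  have "(b t x' a - b t x a - Dx_along (\<lambda>x. b t x a) x ?v) \<bullet> y
      \<le> norm (b t x' a - b t x a - Dx_along (\<lambda>x. b t x a) x ?v) * norm y"
    by (rule norm_cauchy_schwarz)
  also have "\<dots> \<le> K * (norm ?v)\<^sup>2 * norm y" by (intro mult_right_mono b1) simp
  finally have "(b t x' a - b t x a) \<bullet> y \<le> Dx_along (\<lambda>x. b t x a) x ?v \<bullet> y + K * (norm ?v)\<^sup>2 * norm y"
    by (simp add: inner_diff_left)
  moreover have "f t x' a - f t x a \<le> Dx_along (\<lambda>x. f t x a) x ?v + K * (norm ?v)\<^sup>2"
    using f1 by (simp add: abs_le_iff)
  ultimately show ?thesis
    unfolding s1 inner_Dx_hamiltonian(2)[where b=b and \<sigma>=\<sigma> and f=f and t=t and a=a and x=x, OF differentiable[OF t]]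
    by (simp add: algebra_simps)
qed

definition adjoint_sq_bound :: real where
  "adjoint_sq_bound = adjoint_constant (real CARD('d) * K) K"

text \<open>The factor \<open>K * (1 + sqrt adjoint_sq_bound) + 1\<close> multiplies
  \<open>|U|^2\<close> under the time integral: \<open>K (1 + |Y|)\<close> from the Taylor remainder
  of the Hamiltonian and 1 from separating the product of \<open>U\<close> with the gradient
  difference. Integration in time costs \<open>T\<close>, the terminal remainder of \<open>g\<close>
  contributes the second summand, and the last 1 covers the coefficient of the mean square of the
  gradient difference.\<close>

definition comparison_constant :: real where
  "comparison_constant = (K * (1 + sqrt adjoint_sq_bound) + 1) * (T * moment_constant K T)
     + K * moment_constant K T + 1"

lemma comparison_constant_ge:
  "1 \<le> comparison_constant"
  "(K * (1 + sqrt adjoint_sq_bound) + 1) * (T * moment_constant K T) + K * moment_constant K T \<le> comparison_constant"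
  using K_nonneg T_pos moment_constant_nonneg[of T K] adjoint_constant_nonneg
  by (auto simp: comparison_constant_def adjoint_sq_bound_def)

text \<open>The duality argument when all three mean squares are finite. Pairing \<open>Y\<close>
  with the state difference \<open>U\<close> trades the terminal term
  \<open>Dx g \<bullet> U\<close> for a time integral, in which the adjoint drift, the gradient of
  the Hamiltonian at \<open>\<theta>\<close>, meets the expansion of the Hamiltonian in the state at
  the control \<open>\<phi>\<close>. Their mismatch is \<open>\<delta>D \<bullet> U\<close>, and
  what else remains is of order \<open>|U|^2\<close>.\<close>

lemma comparison:
  assumes \<phi>: "progressively_measurable F T \<phi>" and \<theta>: "progressively_measurable F T \<theta>"
    and X\<phi>: "state_solution M F T W b \<sigma> x \<phi> X\<phi>" and X\<theta>: "state_solution M F T W b \<sigma> x \<theta> X\<theta>"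
    and f\<phi>: "AE \<omega> in M. set_integrable lborel {0..T} (\<lambda>s. f s (X\<phi> s \<omega>) (\<phi> s \<omega>))"
    and f\<theta>: "AE \<omega> in M. set_integrable lborel {0..T} (\<lambda>s. f s (X\<theta> s \<omega>) (\<theta> s \<omega>))"
    and J\<phi>: "integrable M (pathwise_cost T f g X\<phi> \<phi>)" and J\<theta>: "integrable M (pathwise_cost T f g X\<theta> \<theta>)"
    and adj: "adjoint_solution M F T W b \<sigma> f g \<theta> X\<theta> Y Z"
  defines "\<delta>b \<equiv> \<lambda>s \<omega>. b s (X\<theta> s \<omega>) (\<phi> s \<omega>) - b s (X\<theta> s \<omega>) (\<theta> s \<omega>)"
    and "\<delta>\<sigma> \<equiv> \<lambda>s \<omega>. \<sigma> s (X\<theta> s \<omega>) (\<phi> s \<omega>) - \<sigma> s (X\<theta> s \<omega>) (\<theta> s \<omega>)"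
    and "\<delta>D \<equiv> \<lambda>s \<omega>. Dx_hamiltonian b \<sigma> f s (X\<theta> s \<omega>) (Y s \<omega>) (Z s \<omega>) (\<phi> s \<omega>)
      - Dx_hamiltonian b \<sigma> f s (X\<theta> s \<omega>) (Y s \<omega>) (Z s \<omega>) (\<theta> s \<omega>)"
    and "\<delta>H \<equiv> \<lambda>s \<omega>. hamiltonian b \<sigma> f s (X\<theta> s \<omega>) (Y s \<omega>) (Z s \<omega>) (\<phi> s \<omega>)
      - hamiltonian b \<sigma> f s (X\<theta> s \<omega>) (Y s \<omega>) (Z s \<omega>) (\<theta> s \<omega>)"
  assumes fin: "mean_square M T \<delta>b < \<infinity>" "mean_square M T \<delta>\<sigma> < \<infinity>" "mean_square M T \<delta>D < \<infinity>"
  shows "(\<integral>\<omega>. pathwise_cost T f g X\<phi> \<phi> \<omega> \<partial>M) - (\<integral>\<omega>. pathwise_cost T f g X\<theta> \<theta> \<omega> \<partial>M)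
    \<le> (\<integral>\<omega>. (LBINT s:{0..T}. \<delta>H s \<omega>) \<partial>M) + comparison_constant * enn2real (mean_square M T \<delta>b)
      + comparison_constant * enn2real (mean_square M T \<delta>\<sigma>) + comparison_constant * enn2real (mean_square M T \<delta>D)"
proof -
  let ?L = "time_measure T"
  let ?Q = "?L \<Otimes>\<^sub>M M"
  have z0: "0 \<in> {0..T}" and Tin: "T \<in> {0..T}" using T_pos by auto
  interpret Q: finite_measure ?Q
    by (rule finite_measure_pair_measure) (auto intro: TM.finite_measure_axioms finite_measure_axioms)

  \<comment> \<open>Processes of the comparison and their progressive measurability\<close>
  have pX\<phi>: "progressively_measurable F T X\<phi>" and pX\<theta>: "progressively_measurable F T X\<theta>"
    using X\<phi> X\<theta> by (auto simp: state_solution_def)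
  have pY: "progressively_measurable F T Y" and pZ: "progressively_measurable F T Z"
    using adj by (auto simp: adjoint_solution_def)
  define U where "U s \<omega> = X\<phi> s \<omega> - X\<theta> s \<omega>" for s \<omega>
  define \<beta> where "\<beta> s \<omega> = b s (X\<phi> s \<omega>) (\<phi> s \<omega>) - b s (X\<theta> s \<omega>) (\<theta> s \<omega>)" for s \<omega>
  define H where "H s \<omega> = \<sigma> s (X\<phi> s \<omega>) (\<phi> s \<omega>) - \<sigma> s (X\<theta> s \<omega>) (\<theta> s \<omega>)" for s \<omega>
  define D where "D s \<omega> = Dx_hamiltonian b \<sigma> f s (X\<theta> s \<omega>) (Y s \<omega>) (Z s \<omega>) (\<theta> s \<omega>)" for s \<omega>
  \<comment> \<open>The running cost is split at the mixed point, the state of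
    \<open>\<theta>\<close> with the control \<open>\<phi>\<close>. \<open>ef\<close> records only
    the change of state and is therefore of order \<open>|U|\<close>; the change of control belongs
    to the Hamiltonian difference, whose other part is \<open>G\<close>.\<close>
  define ef where "ef s \<omega> = f s (X\<phi> s \<omega>) (\<phi> s \<omega>) - f s (X\<theta> s \<omega>) (\<phi> s \<omega>)" for s \<omega>
  define G where "G s \<omega> = \<delta>b s \<omega> \<bullet> Y s \<omega> + \<delta>\<sigma> s \<omega> \<bullet> Z s \<omega>" for s \<omega>
  note pc = progressive_compose[OF b_meas] progressive_compose[OF \<sigma>_meas] progressive_compose[OF f_meas]
  have pU: "progressively_measurable F T U"
    unfolding U_def[abs_def] by (rule progressive_diff[OF pX\<phi> pX\<theta>])
  have p\<beta>: "progressively_measurable F T \<beta>"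
    unfolding \<beta>_def[abs_def] by (rule progressive_diff[OF pc(1)[OF pX\<phi> \<phi>] pc(1)[OF pX\<theta> \<theta>]])
  have pH: "progressively_measurable F T H"
    unfolding H_def[abs_def] by (rule progressive_diff[OF pc(2)[OF pX\<phi> \<phi>] pc(2)[OF pX\<theta> \<theta>]])
  have p\<delta>b: "progressively_measurable F T \<delta>b"
    unfolding \<delta>b_def by (rule progressive_diff[OF pc(1)[OF pX\<theta> \<phi>] pc(1)[OF pX\<theta> \<theta>]])
  have p\<delta>\<sigma>: "progressively_measurable F T \<delta>\<sigma>"
    unfolding \<delta>\<sigma>_def by (rule progressive_diff[OF pc(2)[OF pX\<theta> \<phi>] pc(2)[OF pX\<theta> \<theta>]])
  have pD: "progressively_measurable F T D"
    unfolding D_def[abs_def]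
    by (rule progressive_Dx_hamiltonian[OF b_meas \<sigma>_meas f_meas differentiable pX\<theta> pY pZ \<theta>])
  have p\<delta>D: "progressively_measurable F T \<delta>D"
    unfolding \<delta>D_def
    by (intro progressive_diff progressive_Dx_hamiltonian[OF b_meas \<sigma>_meas f_meas differentiable pX\<theta> pY pZ] \<phi> \<theta>)
  have pef: "progressively_measurable F T ef"
    unfolding ef_def[abs_def] by (rule progressive_diff[OF pc(3)[OF pX\<phi> \<phi>] pc(3)[OF pX\<theta> \<phi>]])
  note mU = progressive_joint[OF pU] and m\<beta> = progressive_joint[OF p\<beta>] and mH = progressive_joint[OF pH]
    and m\<delta>b = progressive_joint[OF p\<delta>b] and m\<delta>\<sigma> = progressive_joint[OF p\<delta>\<sigma>] and mD = progressive_joint[OF pD]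
    and m\<delta>D = progressive_joint[OF p\<delta>D] and mY = progressive_joint[OF pY] and mZ = progressive_joint[OF pZ]
    and mef = progressive_joint[OF pef]
  have finE: "(\<integral>\<^sup>+\<omega>. energy \<delta>b \<omega> \<partial>M) < \<infinity>" "(\<integral>\<^sup>+\<omega>. energy \<delta>\<sigma> \<omega> \<partial>M) < \<infinity>" "(\<integral>\<^sup>+\<omega>. energy \<delta>D \<omega> \<partial>M) < \<infinity>"
    "(\<integral>\<^sup>+\<omega>. energy Y \<omega> \<partial>M) < \<infinity>" "(\<integral>\<^sup>+\<omega>. energy Z \<omega> \<partial>M) < \<infinity>"
    using fin adj by (auto simp: mean_square_energy adjoint_solution_def)
  have UM: "U t \<in> borel_measurable M" if "t \<in> {0..T}" for t
    by (rule F_measurable_M[OF progressive_adapted[OF pU that] that])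

  \<comment> \<open>Second moments of the difference of the two states\<close>
  obtain I\<phi> where I\<phi>: "ito_integral M F T W (\<lambda>s \<omega>. \<sigma> s (X\<phi> s \<omega>) (\<phi> s \<omega>)) I\<phi>"
    and eq\<phi>: "AE \<omega> in M. \<forall>t\<in>{0..T}. X\<phi> t \<omega> = x + (LBINT s:{0..t}. b s (X\<phi> s \<omega>) (\<phi> s \<omega>)) + I\<phi> t \<omega>"
    using X\<phi> unfolding state_solution_def by blast
  obtain I\<theta> where I\<theta>: "ito_integral M F T W (\<lambda>s \<omega>. \<sigma> s (X\<theta> s \<omega>) (\<theta> s \<omega>)) I\<theta>"
    and eq\<theta>: "AE \<omega> in M. \<forall>t\<in>{0..T}. X\<theta> t \<omega> = x + (LBINT s:{0..t}. b s (X\<theta> s \<omega>) (\<theta> s \<omega>)) + I\<theta> t \<omega>"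
    using X\<theta> unfolding state_solution_def by blast
  define J where "J t \<omega> = I\<phi> t \<omega> - I\<theta> t \<omega>" for t \<omega>
  have bint: "AE \<omega> in M. set_integrable lborel {0..T} (\<lambda>s. b s (X\<phi> s \<omega>) (\<phi> s \<omega>))"
    "AE \<omega> in M. set_integrable lborel {0..T} (\<lambda>s. b s (X\<theta> s \<omega>) (\<theta> s \<omega>))"
    using X\<phi> X\<theta> by (auto simp: state_solution_def)
  have Ueq: "AE \<omega> in M. \<forall>t\<in>{0..T}. U t \<omega> = (\<integral>r. indicator {..t} r *\<^sub>R \<beta> r \<omega> \<partial>?L) + J t \<omega>"
    using eq\<phi> eq\<theta> bint
  proof eventually_elim
    case (elim \<omega>)
    show ?case
    proof
      fix t assume t: "t \<in> {0..T}"
      have ind: "integrable ?L (\<lambda>r. indicator {..t} r *\<^sub>R h r)" if "set_integrable lborel {0..T} h" for h :: "real \<Rightarrow> real^'d"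
      proof -
        have h: "integrable ?L h" using that by (simp add: integrable_time_measure)
        show ?thesis
        proof (rule Bochner_Integration.integrable_bound[OF h])
          show "(\<lambda>r. indicator {..t} r *\<^sub>R h r) \<in> borel_measurable ?L"
            using borel_measurable_integrable[OF h] by measurable
        qed (auto simp: indicator_def)
      qed
      have "(\<integral>r. indicator {..t} r *\<^sub>R \<beta> r \<omega> \<partial>?L)
        = (LBINT s:{0..t}. b s (X\<phi> s \<omega>) (\<phi> s \<omega>)) - (LBINT s:{0..t}. b s (X\<theta> s \<omega>) (\<theta> s \<omega>))"
        using t Bochner_Integration.integral_diff[OF ind[OF elim(3)] ind[OF elim(4)]]
        by (simp add: integral_time_measure_initial[of t T] \<beta>_def scaleR_diff_right)
      then show "U t \<omega> = (\<integral>r. indicator {..t} r *\<^sub>R \<beta> r \<omega> \<partial>?L) + J t \<omega>"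
        using bspec[OF elim(1) t] bspec[OF elim(2) t] by (simp add: U_def J_def)
    qed
  qed
  have J0: "AE \<omega> in M. J 0 \<omega> = 0"
    using ito_integral_0[OF I\<phi>] ito_integral_0[OF I\<theta>] by eventually_elim (simp add: J_def)
  have Jm: "J t \<in> borel_measurable M" if "t \<in> {0..T}" for t
    unfolding J_def[abs_def] using ito_integralD(3)[OF I\<phi> that] ito_integralD(3)[OF I\<theta> that] by measurable
  have Jito: "ito_var (\<lambda>r \<omega>. indicator {0<..t} r *\<^sub>R H r \<omega>) (J t)" if t: "t \<in> {0..T}" for t
  proof -
    have sp: "space M \<in> sets (F 0)" using sets.top[of "F 0"] space_F[OF z0] by simp
    have t': "0 \<le> (0::real)" "0 \<le> t" "t \<le> T" using t by auto
    from ito_var_diff[OF ito_integral_restrict[OF I\<phi> t' sp] ito_integral_restrict[OF I\<theta> t' sp]]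
    show ?thesis
    proof (rule ito_var_cong)
      show "AE \<omega> in M. J t \<omega> = indicator (space M) \<omega> *\<^sub>R (I\<phi> t \<omega> - I\<phi> 0 \<omega>) - indicator (space M) \<omega> *\<^sub>R (I\<theta> t \<omega> - I\<theta> 0 \<omega>)"
        using J0 AE_space by eventually_elim (simp add: J_def algebra_simps)
    qed (use Jm[OF t] in \<open>auto simp: H_def scaleR_diff_right\<close>)
  qed
  have Ufin: "AE \<omega> in M. energy U \<omega> < \<infinity>"
  proof -
    have "AE \<omega> in M. continuous_on {0..T} (\<lambda>t. X\<phi> t \<omega>)" "AE \<omega> in M. continuous_on {0..T} (\<lambda>t. X\<theta> t \<omega>)"
      using X\<phi> X\<theta> by (auto simp: state_solution_def)
    then show ?thesis
    proof eventually_elim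
      case (elim \<omega>)
      then have "continuous_on {0..T} (\<lambda>t. U t \<omega>)" unfolding U_def by (intro continuous_intros)
      then show ?case by (rule energy_finite_of_continuous)
    qed
  qed
  have \<beta>le: "norm (\<beta> r \<omega>) \<le> K * norm (U r \<omega>) + norm (\<delta>b r \<omega>)"
    and Hle: "norm (H r \<omega>) \<le> K * norm (U r \<omega>) + norm (\<delta>\<sigma> r \<omega>)"
    and efle: "\<bar>ef r \<omega>\<bar> \<le> K * norm (U r \<omega>)" if r: "r \<in> {0..T}" for r \<omega>
  proof -
    note Li = Lipschitz[OF r, of "X\<phi> r \<omega>" "\<phi> r \<omega>" "X\<theta> r \<omega>"]
    have "\<beta> r \<omega> = (b r (X\<phi> r \<omega>) (\<phi> r \<omega>) - b r (X\<theta> r \<omega>) (\<phi> r \<omega>)) + \<delta>b r \<omega>" by (simp add: \<beta>_def \<delta>b_def)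
    then show "norm (\<beta> r \<omega>) \<le> K * norm (U r \<omega>) + norm (\<delta>b r \<omega>)"
      unfolding U_def by (simp only:) (rule order_trans[OF norm_triangle_ineq add_right_mono[OF Li(1)]])
    have "H r \<omega> = (\<sigma> r (X\<phi> r \<omega>) (\<phi> r \<omega>) - \<sigma> r (X\<theta> r \<omega>) (\<phi> r \<omega>)) + \<delta>\<sigma> r \<omega>" by (simp add: H_def \<delta>\<sigma>_def)
    then show "norm (H r \<omega>) \<le> K * norm (U r \<omega>) + norm (\<delta>\<sigma> r \<omega>)"
      unfolding U_def by (simp only:) (rule order_trans[OF norm_triangle_ineq add_right_mono[OF Li(2)]])
    show "\<bar>ef r \<omega>\<bar> \<le> K * norm (U r \<omega>)" using Li(3) by (simp add: ef_def U_def)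
  qed
  \<comment> \<open>The finiteness is part of \<open>ito_var\<close> on \<open>(0, T]\<close>; the
    time 0 removed by the indicator is null.\<close>
  have Hfin: "AE \<omega> in M. energy H \<omega> < \<infinity>"
  proof -
    have "ito_var (\<lambda>r \<omega>. indicator {0<..T} r *\<^sub>R H r \<omega>) (J T)" by (rule Jito[OF Tin])
    from ito_varD(3)[OF this] show ?thesis
    proof eventually_elim
      case (elim \<omega>)
      have "AE r in ?L. r \<noteq> 0"
      proof -
        have "AE y in lborel. y \<noteq> (0::real)" by (rule AE_lborel_singleton)
        then show ?thesis unfolding time_measure_def by (subst AE_restrict_space_iff) auto
      qed
      then have "energy H \<omega> \<le> energy (\<lambda>r \<omega>. indicator {0<..T} r *\<^sub>R H r \<omega>) \<omega>"
        unfolding energy_def using AE_space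
        by (intro nn_integral_mono_AE, eventually_elim) (auto simp: indicator_def)
      then show ?case using elim by (rule le_less_trans)
    qed
  qed
  let ?m = "moment_constant K T"
  let ?Eb = "enn2real (mean_square M T \<delta>b)" and ?Es = "enn2real (mean_square M T \<delta>\<sigma>)" and ?ED = "enn2real (mean_square M T \<delta>D)"
  have m0: "0 \<le> ?m" using T_pos by (intro moment_constant_nonneg) simp
  \<comment> \<open>The Lipschitz bounds make \<open>\<delta>b\<close> and
    \<open>\<delta>\<sigma>\<close> the perturbations \<open>p\<close> and \<open>q\<close> of the
    moment estimate.\<close>
  have mom: "(\<integral>\<^sup>+\<omega>. ennreal ((norm (U t \<omega>))\<^sup>2) \<partial>M) \<le> ennreal (?m * (?Eb + ?Es))" if t: "t \<in> {0..T}" for t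
  proof -
    have "(\<integral>\<^sup>+\<omega>. ennreal ((norm (U t \<omega>))\<^sup>2) \<partial>M) \<le> ennreal ?m * (mean_square M T \<delta>b + mean_square M T \<delta>\<sigma>)"
      unfolding mean_square_energy
      by (rule moment_estimate[OF mU UM m\<beta> m\<delta>b mH m\<delta>\<sigma> Ufin Hfin Ueq Jito \<beta>le Hle t])
    also have "mean_square M T \<delta>b = ennreal ?Eb" using fin(1) by simp
    also have "mean_square M T \<delta>\<sigma> = ennreal ?Es" using fin(2) by simp
    finally show ?thesis using m0 by (simp add: ennreal_mult ennreal_plus)
  qed
  have Usq: "integrable M (\<lambda>\<omega>. (norm (U t \<omega>))\<^sup>2)" "(\<integral>\<omega>. (norm (U t \<omega>))\<^sup>2 \<partial>M) \<le> ?m * (?Eb + ?Es)"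
    if t: "t \<in> {0..T}" for t
  proof -
    note [measurable] = UM[OF t]
    show i: "integrable M (\<lambda>\<omega>. (norm (U t \<omega>))\<^sup>2)"
      using le_less_trans[OF mom[OF t]] by (intro integrableI_bounded) auto
    have "ennreal (\<integral>\<omega>. (norm (U t \<omega>))\<^sup>2 \<partial>M) \<le> ennreal (?m * (?Eb + ?Es))"
      using mom[OF t] nn_integral_eq_integral[OF i] by simp
    then show "(\<integral>\<omega>. (norm (U t \<omega>))\<^sup>2 \<partial>M) \<le> ?m * (?Eb + ?Es)"
      using m0 by (subst (asm) ennreal_le_iff) auto
  qed
  have UenB: "(\<integral>\<^sup>+\<omega>. energy U \<omega> \<partial>M) \<le> ennreal (T * (?m * (?Eb + ?Es)))"
  proof -
    have "(\<integral>\<^sup>+\<omega>. energy U \<omega> \<partial>M) = (\<integral>\<^sup>+r. (\<integral>\<^sup>+\<omega>. ennreal ((norm (U r \<omega>))\<^sup>2) \<partial>M) \<partial>?L)"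
    proof -
      note [measurable] = mU
      show ?thesis unfolding energy_def by (rule TP.Fubini') measurable
    qed
    also have "\<dots> \<le> (\<integral>\<^sup>+r. ennreal (?m * (?Eb + ?Es)) \<partial>?L)" using mom by (intro nn_integral_mono) auto
    also have "\<dots> = ennreal (T * (?m * (?Eb + ?Es)))"
      using emeasure_time_measure[of T] T_pos m0 by (simp add: ennreal_mult'[symmetric] mult.commute)
    finally show ?thesis .
  qed
  then have Ufin2: "(\<integral>\<^sup>+\<omega>. energy U \<omega> \<partial>M) < \<infinity>" by (rule le_less_trans) simp
  have \<beta>fin: "(\<integral>\<^sup>+\<omega>. energy \<beta> \<omega> \<partial>M) < \<infinity>"
  proof (rule energy_bound_finite[OF m\<beta> mU m\<delta>b _ Ufin2 finE(1)])
    fix r \<omega> assume r: "r \<in> {0..T}"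
    have "K * norm (U r \<omega>) \<le> (K + 1) * norm (U r \<omega>)" "norm (\<delta>b r \<omega>) \<le> (K + 1) * norm (\<delta>b r \<omega>)" "0 \<le> K + 1"
      using K_nonneg by (auto simp: algebra_simps)
    then show "norm (\<beta> r \<omega>) \<le> (K + 1) * (norm (U r \<omega>) + norm (\<delta>b r \<omega>) + 1)"
      using \<beta>le[OF r, of \<omega>] add_mono[of "K * norm (U r \<omega>)" "(K + 1) * norm (U r \<omega>)" "norm (\<delta>b r \<omega>)" "(K + 1) * norm (\<delta>b r \<omega>)"]
      by (simp only: distrib_left[of "K + 1"] mult_1_right)
  qed
  have Hfin2: "(\<integral>\<^sup>+\<omega>. energy H \<omega> \<partial>M) < \<infinity>"
  proof (rule energy_bound_finite[OF mH mU m\<delta>\<sigma> _ Ufin2 finE(2)])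
    fix r \<omega> assume r: "r \<in> {0..T}"
    have "K * norm (U r \<omega>) \<le> (K + 1) * norm (U r \<omega>)" "norm (\<delta>\<sigma> r \<omega>) \<le> (K + 1) * norm (\<delta>\<sigma> r \<omega>)" "0 \<le> K + 1"
      using K_nonneg by (auto simp: algebra_simps)
    then show "norm (H r \<omega>) \<le> (K + 1) * (norm (U r \<omega>) + norm (\<delta>\<sigma> r \<omega>) + 1)"
      using Hle[OF r, of \<omega>] add_mono[of "K * norm (U r \<omega>)" "(K + 1) * norm (U r \<omega>)" "norm (\<delta>\<sigma> r \<omega>)" "(K + 1) * norm (\<delta>\<sigma> r \<omega>)"]
      by (simp only: distrib_left[of "K + 1"] mult_1_right)
  qed
  \<comment> \<open>Only with the second moments of \<open>U\<close> at hand are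
    \<open>\<beta>\<close> and \<open>H\<close> seen to be square-integrable, which makes the
    product formula available for \<open>U\<close>.\<close>
  have PU: "ito_process U \<beta> H"
  proof (rule ito_processI[OF pU p\<beta> \<beta>fin Hfin2 Usq(1)[OF Tin], where I=J and p="\<lambda>_. 0"])
    have "ito_increments (\<lambda>s \<omega>. \<sigma> s (X\<phi> s \<omega>) (\<phi> s \<omega>) + (-1) *\<^sub>R \<sigma> s (X\<theta> s \<omega>) (\<theta> s \<omega>))
        (\<lambda>s \<omega>. (I\<phi> T \<omega> - I\<phi> s \<omega>) + (-1) *\<^sub>R (I\<theta> T \<omega> - I\<theta> s \<omega>))"
      by (rule ito_increments_linear[OF ito_integral_increments[OF I\<phi>] ito_integral_increments[OF I\<theta>]])
    moreover have "(\<lambda>s \<omega>. (I\<phi> T \<omega> - I\<phi> s \<omega>) + (-1) *\<^sub>R (I\<theta> T \<omega> - I\<theta> s \<omega>)) = (\<lambda>s \<omega>. J T \<omega> - J s \<omega>)"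
      by (auto simp: fun_eq_iff J_def algebra_simps)
    ultimately show "ito_increments H (\<lambda>s \<omega>. J T \<omega> - J s \<omega>)" by (simp add: H_def[abs_def])
    show "AE \<omega> in M. \<forall>t\<in>{0..T}. U t \<omega> = 0 + (\<integral>q. indicator {..t} q *\<^sub>R \<beta> q \<omega> \<partial>?L) + J t \<omega>"
      using Ueq by simp
  qed

  \<comment> \<open>The adjoint process as a bounded square-integrable Ito process\<close>
  define \<kappa> where "\<kappa> = real CARD('d) * K"
  have \<kappa>0: "0 \<le> \<kappa>" using K_nonneg by (simp add: \<kappa>_def)
  have Dle: "norm (D r \<omega>) \<le> \<kappa> * (norm (Y r \<omega>) + norm (Z r \<omega>) + 1)" if r: "r \<in> {0..T}" for r \<omega>
    unfolding D_def \<kappa>_def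
    by (rule norm_Dx_hamiltonian_le[where b=b and \<sigma>=\<sigma> and f=f and t=r and a="\<theta> r \<omega>" and x="X\<theta> r \<omega>",
          OF differentiable[OF r] derivative_bounds(1,2,5)[OF r]])
  have Dfin: "(\<integral>\<^sup>+\<omega>. energy D \<omega> \<partial>M) < \<infinity>"
    by (rule energy_bound_finite[OF mD mY mZ Dle finE(4,5)])
  have gY: "AE \<omega> in M. Y T \<omega> = Dx g (X\<theta> T \<omega>)" using adj by (auto simp: adjoint_solution_def)
  have YTle: "AE \<omega> in M. norm (Y T \<omega>) \<le> K"
    using gY by eventually_elim (simp add: derivative_bounds(4)[OF Tin])
  have YM: "Y t \<in> borel_measurable M" if "t \<in> {0..T}" for t
    by (rule F_measurable_M[OF progressive_adapted[OF pY that] that])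
  have YTsq: "integrable M (\<lambda>\<omega>. (norm (Y T \<omega>))\<^sup>2)"
  proof (rule integrable_const_bound[of _ "K\<^sup>2"])
    show "AE \<omega> in M. norm ((norm (Y T \<omega>))\<^sup>2) \<le> K\<^sup>2"
      using YTle by eventually_elim (auto intro!: power_mono)
    show "(\<lambda>\<omega>. (norm (Y T \<omega>))\<^sup>2) \<in> borel_measurable M" using YM[OF Tin] by measurable
  qed
  have PY: "ito_process Y (\<lambda>s \<omega>. - D s \<omega>) Z"
  proof -
    have "\<exists>I. ito_integral M F T W Z I \<and>
        (AE \<omega> in M. \<forall>t\<in>{0..T}. Y t \<omega> = Y 0 \<omega> - (LBINT s:{0..t}. D s \<omega>) + I t \<omega>)"
      using adj unfolding adjoint_solution_def D_def by (elim conjE)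
    then obtain I where I: "ito_integral M F T W Z I"
      and eqY: "AE \<omega> in M. \<forall>t\<in>{0..T}. Y t \<omega> = Y 0 \<omega> - (LBINT s:{0..t}. D s \<omega>) + I t \<omega>"
      by (elim exE conjE)
    have pD': "progressively_measurable F T (\<lambda>s \<omega>. - D s \<omega>)"
      by (rule progressive_binop[OF pD pD, where opr="\<lambda>x _. - x"]) (rule borel_measurable_uminus)
    have enD: "(\<integral>\<^sup>+\<omega>. energy (\<lambda>s \<omega>. - D s \<omega>) \<omega> \<partial>M) < \<infinity>" using Dfin by (simp add: energy_def)
    show ?thesis
    proof (rule ito_processI[where P=Y and \<beta>="\<lambda>s \<omega>. - D s \<omega>" and H=Z and I=I and p="Y 0",
          OF pY pD' enD finE(5) YTsq ito_integral_increments[OF I]])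
      show "AE \<omega> in M. \<forall>t\<in>{0..T}. Y t \<omega> = Y 0 \<omega> + (\<integral>q. indicator {..t} q *\<^sub>R - D q \<omega> \<partial>?L) + I t \<omega>"
        using eqY
      proof (eventually_elim, intro ballI)
        fix \<omega> t
        assume *: "\<forall>t\<in>{0..T}. Y t \<omega> = Y 0 \<omega> - (LBINT s:{0..t}. D s \<omega>) + I t \<omega>" and t: "t \<in> {0..T}"
        have "(LBINT s:{0..t}. D s \<omega>) = (\<integral>q. indicator {..t} q *\<^sub>R D q \<omega> \<partial>?L)"
          using t by (intro integral_time_measure_initial) simp
        then show "Y t \<omega> = Y 0 \<omega> + (\<integral>q. indicator {..t} q *\<^sub>R - D q \<omega> \<partial>?L) + I t \<omega>"
          using bspec[OF * t] by (simp only: scaleR_minus_right Bochner_Integration.integral_minus) simp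
      qed
    qed
  qed
  \<comment> \<open>The bound holds at each time outside a null set of its own. Joint measurability
    lets it be restated almost everywhere on the product space.\<close>
  have Ybd: "AE z in ?Q. norm (Y (fst z) (snd z)) \<le> sqrt adjoint_sq_bound"
  proof (rule TP.AE_pair_measure)
    have "(\<lambda>z. norm (Y (fst z) (snd z))) \<in> borel_measurable ?Q" using mY by (simp add: split_beta')
    then show "{z \<in> space ?Q. norm (Y (fst z) (snd z)) \<le> sqrt adjoint_sq_bound} \<in> sets ?Q"
      by (rule borel_measurable_le) simp
    show "AE r in ?L. AE \<omega> in M. norm (Y (fst (r, \<omega>)) (snd (r, \<omega>))) \<le> sqrt adjoint_sq_bound"
    proof (rule AE_I2)
      fix r assume "r \<in> space ?L"
      then have r: "r \<in> {0..T}" by simp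
      have "AE \<omega> in M. (norm (Y r \<omega>))\<^sup>2 \<le> adjoint_constant \<kappa> K"
        by (rule adjoint_bound[OF PY \<kappa>0 YTle Dle r])
      then show "AE \<omega> in M. norm (Y (fst (r, \<omega>)) (snd (r, \<omega>))) \<le> sqrt adjoint_sq_bound"
        by eventually_elim (simp add: adjoint_sq_bound_def \<kappa>_def real_le_rsqrt)
    qed
  qed

  \<comment> \<open>Integrability over time and probability, and the duality of \<open>Y\<close> and
    \<open>U\<close>\<close>
  have split: "(\<lambda>z. V (fst z) (snd z)) \<in> borel_measurable ?Q" if "case_prod V \<in> borel_measurable ?Q"
    for V :: "real \<Rightarrow> 'w \<Rightarrow> 'v::topological_space"
    using that by (simp add: split_beta')
  have iG: "integrable ?Q (\<lambda>z. G (fst z) (snd z))"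
    unfolding G_def
    by (intro Bochner_Integration.integrable_add integrable_inner_square split m\<delta>b m\<delta>\<sigma> mY mZ
        integrable_energy finE)
  have iU: "integrable ?Q (\<lambda>z. (norm (U (fst z) (snd z)))\<^sup>2)" by (rule integrable_energy[OF mU Ufin2])
  have iD: "integrable ?Q (\<lambda>z. (norm (\<delta>D (fst z) (snd z)))\<^sup>2)" by (rule integrable_energy[OF m\<delta>D finE(3)])
  have ief: "integrable ?Q (\<lambda>z. ef (fst z) (snd z))"
  proof (rule Bochner_Integration.integrable_bound)
    show "integrable ?Q (\<lambda>z. K * (1 + (norm (U (fst z) (snd z)))\<^sup>2))" using iU by simp
    show "(\<lambda>z. ef (fst z) (snd z)) \<in> borel_measurable ?Q" by (rule split[OF mef])
    show "AE z in ?Q. norm (ef (fst z) (snd z)) \<le> norm (K * (1 + (norm (U (fst z) (snd z)))\<^sup>2))"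
    proof (rule AE_I2)
      fix z assume "z \<in> space ?Q"
      then have r: "fst z \<in> {0..T}" by (auto simp: space_pair_measure)
      let ?u = "norm (U (fst z) (snd z))"
      have "2 * ?u \<le> 1 + ?u\<^sup>2" using sum_squares_bound[of 1 ?u] by simp
      then have "?u \<le> 1 + ?u\<^sup>2" using norm_ge_zero[of "U (fst z) (snd z)"] by linarith
      then have "K * ?u \<le> K * (1 + ?u\<^sup>2)" using K_nonneg by (rule mult_left_mono)
      then show "norm (ef (fst z) (snd z)) \<le> norm (K * (1 + ?u\<^sup>2))"
        using efle[OF r, of "snd z"] K_nonneg by simp
    qed
  qed
  note bil = ito_process_bilinear[OF PY PU]
  let ?bil = "\<lambda>z. Y (fst z) (snd z) \<bullet> \<beta> (fst z) (snd z) + U (fst z) (snd z) \<bullet> - D (fst z) (snd z)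
      + Z (fst z) (snd z) \<bullet> H (fst z) (snd z)"
  have U0: "AE \<omega> in M. U 0 \<omega> = 0"
    using Ueq J0 
  proof eventually_elim
    case (elim \<omega>)
    have "AE r in ?L. r \<noteq> 0"
    proof -
      have "AE y in lborel. y \<noteq> (0::real)" by (rule AE_lborel_singleton)
      then show ?thesis unfolding time_measure_def by (subst AE_restrict_space_iff) auto
    qed
    then have "AE r in ?L. indicator {..0} r *\<^sub>R \<beta> r \<omega> = 0"
      using AE_space by eventually_elim (auto simp: indicator_def)
    then have "(\<integral>r. indicator {..0} r *\<^sub>R \<beta> r \<omega> \<partial>?L) = 0" by (rule integral_eq_zero_AE)
    then show ?case using bspec[OF elim(1) z0] elim(2) by simp
  qed
  \<comment> \<open>The initial term drops out because both states start at \<open>x\<close>, so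
    \<open>U 0 = 0\<close> almost surely.\<close>
  have YU: "(\<integral>\<omega>. Y T \<omega> \<bullet> U T \<omega> \<partial>M) = (\<integral>z. ?bil z \<partial>?Q)"
  proof -
    have "AE \<omega> in M. Y 0 \<omega> \<bullet> U 0 \<omega> = 0" using U0 by eventually_elim simp
    then have "(\<integral>\<omega>. Y 0 \<omega> \<bullet> U 0 \<omega> \<partial>M) = 0" by (rule integral_eq_zero_AE)
    then show ?thesis using bil(2) by simp
  qed
  have iYU: "integrable M (\<lambda>\<omega>. Y T \<omega> \<bullet> U T \<omega>)"
    by (rule integrable_inner_square[OF YM[OF Tin] UM[OF Tin] YTsq Usq(1)[OF Tin]])

  \<comment> \<open>The running cost is integrated along paths only: its difference need not be integrable
    over \<open>?Q\<close>, whereas \<open>ef\<close> and \<open>G\<close> are.\<close>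
  define gd where "gd \<omega> = g (X\<phi> T \<omega>) - g (X\<theta> T \<omega>)" for \<omega>
  define R where "R \<omega> = pathwise_cost T f g X\<phi> \<phi> \<omega> - pathwise_cost T f g X\<theta> \<theta> \<omega> - gd \<omega>" for \<omega>
  have igd: "integrable M gd"
  proof (rule Bochner_Integration.integrable_bound)
    show "integrable M (\<lambda>\<omega>. K * (1 + (norm (U T \<omega>))\<^sup>2))" using Usq(1)[OF Tin] by simp
    have [measurable]: "X\<phi> T \<in> borel_measurable M" "X\<theta> T \<in> borel_measurable M" "g \<in> borel_measurable borel"
      using F_measurable_M[OF progressive_adapted[OF pX\<phi> Tin] Tin]
        F_measurable_M[OF progressive_adapted[OF pX\<theta> Tin] Tin] g_meas by auto
    show "gd \<in> borel_measurable M" unfolding gd_def[abs_def] by measurable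
    show "AE \<omega> in M. norm (gd \<omega>) \<le> norm (K * (1 + (norm (U T \<omega>))\<^sup>2))"
    proof (rule AE_I2)
      fix \<omega>
      let ?u = "norm (U T \<omega>)"
      have "2 * ?u \<le> 1 + ?u\<^sup>2" using sum_squares_bound[of 1 ?u] by simp
      then have "?u \<le> 1 + ?u\<^sup>2" using norm_ge_zero[of "U T \<omega>"] by linarith
      then have "K * ?u \<le> K * (1 + ?u\<^sup>2)" using K_nonneg by (rule mult_left_mono)
      then show "norm (gd \<omega>) \<le> norm (K * (1 + ?u\<^sup>2))"
        using g_Lipschitz[of "X\<phi> T \<omega>" "X\<theta> T \<omega>"] K_nonneg by (simp add: gd_def U_def)
    qed
  qed
  have iR: "integrable M R" unfolding R_def[abs_def] using J\<phi> J\<theta> igd by simp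
  have p\<delta>H: "case_prod \<delta>H \<in> borel_measurable ?Q"
  proof -
    have pf: "progressively_measurable F T (\<lambda>s \<omega>. f s (X\<theta> s \<omega>) (\<phi> s \<omega>) - f s (X\<theta> s \<omega>) (\<theta> s \<omega>))"
      by (rule progressive_diff[OF pc(3)[OF pX\<theta> \<phi>] pc(3)[OF pX\<theta> \<theta>]])
    have "(\<lambda>z. G (fst z) (snd z) + (f (fst z) (X\<theta> (fst z) (snd z)) (\<phi> (fst z) (snd z))
        - f (fst z) (X\<theta> (fst z) (snd z)) (\<theta> (fst z) (snd z)))) \<in> borel_measurable ?Q"
      using borel_measurable_integrable[OF iG] split[OF progressive_joint[OF pf]] by (rule borel_measurable_add)
    then show ?thesis
      by (simp add: split_beta' \<delta>H_def G_def \<delta>b_def \<delta>\<sigma>_def hamiltonian_inner inner_diff_left algebra_simps)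
  qed
  \<comment> \<open>\<open>R\<close> is the difference of the running costs. Along a path it differs
    from the integrated Hamiltonian difference only by \<open>ef\<close> and \<open>G\<close>, and
    both running costs are integrable there one by one.\<close>
  have path: "AE \<omega> in M. (LBINT s:{0..T}. \<delta>H s \<omega>) = R \<omega> - (\<integral>s. ef s \<omega> \<partial>?L) + (\<integral>s. G s \<omega> \<partial>?L)"
  proof -
    have "AE \<omega> in M. integrable ?L (\<lambda>s. ef s \<omega>)" "AE \<omega> in M. integrable ?L (\<lambda>s. G s \<omega>)"
      using TP.AE_integrable_snd[of ef] TP.AE_integrable_snd[of G] ief iG by (auto simp: split_beta')
    then show ?thesis using f\<phi> f\<theta>
    proof eventually_elim
      case (elim \<omega>)
      let ?f1 = "\<lambda>s. f s (X\<phi> s \<omega>) (\<phi> s \<omega>)" and ?f2 = "\<lambda>s. f s (X\<theta> s \<omega>) (\<theta> s \<omega>)"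
      have i: "integrable ?L ?f1" "integrable ?L ?f2"
        using elim by (auto simp: integrable_time_measure)
      have "(LBINT s:{0..T}. \<delta>H s \<omega>) = (\<integral>s. \<delta>H s \<omega> \<partial>?L)" by (simp add: integral_time_measure)
      also have "\<dots> = (\<integral>s. ((?f1 s - ?f2 s) - ef s \<omega>) + G s \<omega> \<partial>?L)"
        by (intro Bochner_Integration.integral_cong refl)
          (simp add: \<delta>H_def ef_def G_def \<delta>b_def \<delta>\<sigma>_def hamiltonian_inner inner_diff_left)
      also have "\<dots> = ((\<integral>s. ?f1 s \<partial>?L) - (\<integral>s. ?f2 s \<partial>?L)) - (\<integral>s. ef s \<omega> \<partial>?L) + (\<integral>s. G s \<omega> \<partial>?L)"
        using i elim(1,2) by simp
      also have "(\<integral>s. ?f1 s \<partial>?L) - (\<integral>s. ?f2 s \<partial>?L) = R \<omega>"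
        by (simp add: R_def gd_def pathwise_cost_def integral_time_measure)
      finally show ?case .
    qed
  qed
  have EH: "(\<integral>\<omega>. (LBINT s:{0..T}. \<delta>H s \<omega>) \<partial>M)
      = (\<integral>\<omega>. R \<omega> \<partial>M) - (\<integral>z. ef (fst z) (snd z) \<partial>?Q) + (\<integral>z. G (fst z) (snd z) \<partial>?Q)"
  proof -
    have ief': "integrable ?Q (case_prod ef)" and iG': "integrable ?Q (case_prod G)"
      using ief iG by (auto simp: split_beta')
    note s1 = TP.integrable_snd[OF ief'] TP.integrable_snd[OF iG']
    have "(\<integral>\<omega>. (LBINT s:{0..T}. \<delta>H s \<omega>) \<partial>M) = (\<integral>\<omega>. R \<omega> - (\<integral>s. ef s \<omega> \<partial>?L) + (\<integral>s. G s \<omega> \<partial>?L) \<partial>M)"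
    proof (rule integral_cong_AE[OF _ _ path])
      note [measurable] = p\<delta>H
      have "(\<lambda>\<omega>. \<integral>s. \<delta>H s \<omega> \<partial>?L) \<in> borel_measurable M"
        by measurable
      then show "(\<lambda>\<omega>. LBINT s:{0..T}. \<delta>H s \<omega>) \<in> borel_measurable M" by (simp add: integral_time_measure)
      show "(\<lambda>\<omega>. R \<omega> - (\<integral>s. ef s \<omega> \<partial>?L) + (\<integral>s. G s \<omega> \<partial>?L)) \<in> borel_measurable M"
        using iR s1 by simp
    qed
    also have "\<dots> = (\<integral>\<omega>. R \<omega> \<partial>M) - (\<integral>\<omega>. (\<integral>s. ef s \<omega> \<partial>?L) \<partial>M) + (\<integral>\<omega>. (\<integral>s. G s \<omega> \<partial>?L) \<partial>M)"
      using iR s1 by simp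
    finally show ?thesis
      using TP.integral_snd[OF ief'] TP.integral_snd[OF iG'] by (simp add: split_beta')
  qed
  \<comment> \<open>Second-order expansion of \<open>g\<close> at the terminal state of
    \<open>\<theta>\<close>, where the gradient is \<open>Y T\<close>.\<close>
  have gdle: "(\<integral>\<omega>. gd \<omega> \<partial>M) \<le> (\<integral>\<omega>. Y T \<omega> \<bullet> U T \<omega> \<partial>M) + K * (\<integral>\<omega>. (norm (U T \<omega>))\<^sup>2 \<partial>M)"
  proof -
    have "(\<integral>\<omega>. gd \<omega> \<partial>M) \<le> (\<integral>\<omega>. Y T \<omega> \<bullet> U T \<omega> + K * (norm (U T \<omega>))\<^sup>2 \<partial>M)"
    proof (rule integral_mono_AE[OF igd])
      show "integrable M (\<lambda>\<omega>. Y T \<omega> \<bullet> U T \<omega> + K * (norm (U T \<omega>))\<^sup>2)" using iYU Usq(1)[OF Tin] by simp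
      show "AE \<omega> in M. gd \<omega> \<le> Y T \<omega> \<bullet> U T \<omega> + K * (norm (U T \<omega>))\<^sup>2"
        using gY
      proof eventually_elim
        case (elim \<omega>)
        then show ?case using g_Taylor[of "X\<phi> T \<omega>" "X\<theta> T \<omega>"] by (simp add: gd_def U_def)
      qed
    qed
    then show ?thesis using iYU Usq(1)[OF Tin] by simp
  qed
  let ?c = "K * (1 + sqrt adjoint_sq_bound) + 1"
  have c0: "0 \<le> ?c" using K_nonneg adjoint_constant_nonneg by (simp add: adjoint_sq_bound_def)
  \<comment> \<open>The control differences in \<open>G\<close> cancel against those in
    \<open>\<beta>\<close> and \<open>H\<close>. What remains are increments of \<open>b\<close>,
    \<open>\<sigma>\<close> and \<open>f\<close> in the state alone, at the control
    \<open>\<phi>\<close>, to which the expansion of the Hamiltonian applies; the bound on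
    \<open>Y\<close> makes its remainder a multiple of \<open>|U|^2\<close>.\<close>
  have main: "(\<integral>z. ef (fst z) (snd z) - G (fst z) (snd z) + ?bil z \<partial>?Q)
      \<le> (\<integral>z. ?c * (norm (U (fst z) (snd z)))\<^sup>2 + (norm (\<delta>D (fst z) (snd z)))\<^sup>2 \<partial>?Q)"
  proof (rule integral_mono_AE)
    show "integrable ?Q (\<lambda>z. ef (fst z) (snd z) - G (fst z) (snd z) + ?bil z)"
      using ief iG bil(1) by simp
    show "integrable ?Q (\<lambda>z. ?c * (norm (U (fst z) (snd z)))\<^sup>2 + (norm (\<delta>D (fst z) (snd z)))\<^sup>2)"
      using iU iD by simp
    show "AE z in ?Q. ef (fst z) (snd z) - G (fst z) (snd z) + ?bil z
      \<le> ?c * (norm (U (fst z) (snd z)))\<^sup>2 + (norm (\<delta>D (fst z) (snd z)))\<^sup>2"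
      using Ybd AE_space
    proof eventually_elim
      case (elim z)
      define s where "s = fst z"
      define \<omega> where "\<omega> = snd z"
      have s: "s \<in> {0..T}" using elim by (auto simp: s_def space_pair_measure)
      have Yb: "norm (Y s \<omega>) \<le> sqrt adjoint_sq_bound" using elim by (simp add: s_def \<omega>_def)
      let ?D\<phi> = "Dx_hamiltonian b \<sigma> f s (X\<theta> s \<omega>) (Y s \<omega>) (Z s \<omega>) (\<phi> s \<omega>)"
      have "ef s \<omega> - G s \<omega> + (Y s \<omega> \<bullet> \<beta> s \<omega> + U s \<omega> \<bullet> - D s \<omega> + Z s \<omega> \<bullet> H s \<omega>)
        = ((b s (X\<phi> s \<omega>) (\<phi> s \<omega>) - b s (X\<theta> s \<omega>) (\<phi> s \<omega>)) \<bullet> Y s \<omega>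
          + (\<sigma> s (X\<phi> s \<omega>) (\<phi> s \<omega>) - \<sigma> s (X\<theta> s \<omega>) (\<phi> s \<omega>)) \<bullet> Z s \<omega>
          + (f s (X\<phi> s \<omega>) (\<phi> s \<omega>) - f s (X\<theta> s \<omega>) (\<phi> s \<omega>))) - D s \<omega> \<bullet> U s \<omega>"
        by (simp add: ef_def G_def \<delta>b_def \<delta>\<sigma>_def \<beta>_def H_def inner_diff_left inner_diff_right inner_commute)
      also have "\<dots> \<le> (?D\<phi> \<bullet> (X\<phi> s \<omega> - X\<theta> s \<omega>) + K * (1 + norm (Y s \<omega>)) * (norm (X\<phi> s \<omega> - X\<theta> s \<omega>))\<^sup>2) - D s \<omega> \<bullet> U s \<omega>"
        by (rule diff_right_mono[OF hamiltonian_Taylor[OF s]])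
      also have "\<dots> = \<delta>D s \<omega> \<bullet> U s \<omega> + K * (1 + norm (Y s \<omega>)) * (norm (U s \<omega>))\<^sup>2"
        by (simp add: \<delta>D_def D_def U_def inner_diff_left)
      also have "\<dots> \<le> ((norm (\<delta>D s \<omega>))\<^sup>2 + (norm (U s \<omega>))\<^sup>2) + K * (1 + sqrt adjoint_sq_bound) * (norm (U s \<omega>))\<^sup>2"
      proof (intro add_mono mult_right_mono mult_left_mono)
        have "\<delta>D s \<omega> \<bullet> U s \<omega> \<le> norm (\<delta>D s \<omega>) * norm (U s \<omega>)" by (rule norm_cauchy_schwarz)
        moreover have "2 * norm (\<delta>D s \<omega>) * norm (U s \<omega>) \<le> (norm (\<delta>D s \<omega>))\<^sup>2 + (norm (U s \<omega>))\<^sup>2"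
          by (rule sum_squares_bound)
        moreover have "0 \<le> norm (\<delta>D s \<omega>) * norm (U s \<omega>)" by simp
        ultimately show "\<delta>D s \<omega> \<bullet> U s \<omega> \<le> (norm (\<delta>D s \<omega>))\<^sup>2 + (norm (U s \<omega>))\<^sup>2"
          unfolding mult.assoc by linarith
      qed (use Yb K_nonneg in auto)
      finally show ?case unfolding s_def \<omega>_def by (simp add: distrib_right)
    qed
  qed
  have EU: "(\<integral>z. (norm (U (fst z) (snd z)))\<^sup>2 \<partial>?Q) \<le> T * (?m * (?Eb + ?Es))"
  proof -
    have "ennreal (\<integral>z. (norm (U (fst z) (snd z)))\<^sup>2 \<partial>?Q) = (\<integral>\<^sup>+\<omega>. energy U \<omega> \<partial>M)"
      unfolding nn_integral_energy[OF mU] by (rule nn_integral_eq_integral[OF iU, symmetric]) simp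
    with UenB have le: "ennreal (\<integral>z. (norm (U (fst z) (snd z)))\<^sup>2 \<partial>?Q) \<le> ennreal (T * (?m * (?Eb + ?Es)))" by (simp only:)
    have "0 \<le> T * (?m * (?Eb + ?Es))" using m0 T_pos by (intro mult_nonneg_nonneg add_nonneg_nonneg) auto
    from le[unfolded ennreal_le_iff[OF this]] show ?thesis .
  qed
  have ED: "(\<integral>z. (norm (\<delta>D (fst z) (snd z)))\<^sup>2 \<partial>?Q) = ?ED"
  proof -
    have eq: "ennreal (\<integral>z. (norm (\<delta>D (fst z) (snd z)))\<^sup>2 \<partial>?Q) = mean_square M T \<delta>D"
      unfolding mean_square_energy nn_integral_energy[OF m\<delta>D]
      by (rule nn_integral_eq_integral[OF iD, symmetric]) simp
    show ?thesis unfolding eq[symmetric] by (rule enn2real_ennreal[symmetric]) simp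
  qed
  have "(\<integral>\<omega>. pathwise_cost T f g X\<phi> \<phi> \<omega> \<partial>M) - (\<integral>\<omega>. pathwise_cost T f g X\<theta> \<theta> \<omega> \<partial>M)
      = (\<integral>\<omega>. R \<omega> \<partial>M) + (\<integral>\<omega>. gd \<omega> \<partial>M)"
    unfolding R_def using J\<phi> J\<theta> igd by simp
  also have "\<dots> \<le> (\<integral>\<omega>. R \<omega> \<partial>M) + ((\<integral>z. ?bil z \<partial>?Q) + K * (\<integral>\<omega>. (norm (U T \<omega>))\<^sup>2 \<partial>M))"
    using gdle unfolding YU by simp
  \<comment> \<open>The running costs leave the estimate here: \<open>R\<close> is replaced by the
    expected Hamiltonian difference together with the integrals of \<open>ef\<close> and of
    \<open>-G\<close>.\<close>
  also have "\<dots> = (\<integral>\<omega>. (LBINT s:{0..T}. \<delta>H s \<omega>) \<partial>M)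
      + (\<integral>z. ef (fst z) (snd z) - G (fst z) (snd z) + ?bil z \<partial>?Q) + K * (\<integral>\<omega>. (norm (U T \<omega>))\<^sup>2 \<partial>M)"
    unfolding EH using ief iG bil(1) by simp
  also have "\<dots> \<le> (\<integral>\<omega>. (LBINT s:{0..T}. \<delta>H s \<omega>) \<partial>M)
      + (?c * (T * (?m * (?Eb + ?Es))) + ?ED) + K * (?m * (?Eb + ?Es))"
  proof (intro add_mono order_refl mult_left_mono Usq(2)[OF Tin] K_nonneg)
    have "(\<integral>z. ?c * (norm (U (fst z) (snd z)))\<^sup>2 + (norm (\<delta>D (fst z) (snd z)))\<^sup>2 \<partial>?Q)
        = ?c * (\<integral>z. (norm (U (fst z) (snd z)))\<^sup>2 \<partial>?Q) + ?ED"
      using iU iD ED by simp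
    also have "\<dots> \<le> ?c * (T * (?m * (?Eb + ?Es))) + ?ED" using mult_left_mono[OF EU c0] by simp
    finally show "(\<integral>z. ef (fst z) (snd z) - G (fst z) (snd z) + ?bil z \<partial>?Q)
      \<le> ?c * (T * (?m * (?Eb + ?Es))) + ?ED" using main by linarith
  qed
  also have "\<dots> = (\<integral>\<omega>. (LBINT s:{0..T}. \<delta>H s \<omega>) \<partial>M) + (?c * (T * ?m) + K * ?m) * (?Eb + ?Es) + 1 * ?ED"
    by (simp add: algebra_simps)
  also have "\<dots> \<le> (\<integral>\<omega>. (LBINT s:{0..T}. \<delta>H s \<omega>) \<partial>M) + comparison_constant * (?Eb + ?Es) + comparison_constant * ?ED"
    by (intro add_mono order_refl mult_right_mono comparison_constant_ge) auto
  finally show ?thesis by (simp add: algebra_simps)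
qed

text \<open>Admissibility guarantees that the choices in \<open>state\<close> and
  \<open>adjoint_processes\<close> are genuine solutions. If one of the mean squares is infinite,
  the positive constant makes the right-hand side \<open>\<infinity>\<close>, since no other summand
  is \<open>-\<infinity>\<close>.\<close>

lemma comparison_ereal:
  assumes \<phi>: "\<phi> \<in> admissible M F T W b \<sigma> f g" and \<theta>: "\<theta> \<in> admissible M F T W b \<sigma> f g"
  shows "let X = state M F T W b \<sigma> x \<theta>;
        (Y, Z) = adjoint_processes M F T W b \<sigma> f g x \<theta>;
        H = hamiltonian b \<sigma> f;
        DH = Dx_hamiltonian b \<sigma> f
    in ereal (cost_functional M F T W b \<sigma> f g x \<phi>
           - cost_functional M F T W b \<sigma> f g x \<theta>) \<le>
         ereal (\<integral>\<omega>. (LBINT s:{0..T}.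
           H s (X s \<omega>) (Y s \<omega>) (Z s \<omega>) (\<phi> s \<omega>) - H s (X s \<omega>) (Y s \<omega>) (Z s \<omega>) (\<theta> s \<omega>)) \<partial>M)
         + ereal comparison_constant * enn2ereal (mean_square M T (\<lambda>s \<omega>.
             b s (X s \<omega>) (\<phi> s \<omega>) - b s (X s \<omega>) (\<theta> s \<omega>)))
         + ereal comparison_constant * enn2ereal (mean_square M T (\<lambda>s \<omega>.
             \<sigma> s (X s \<omega>) (\<phi> s \<omega>) - \<sigma> s (X s \<omega>) (\<theta> s \<omega>)))
         + ereal comparison_constant * enn2ereal (mean_square M T (\<lambda>s \<omega>.
             DH s (X s \<omega>) (Y s \<omega>) (Z s \<omega>) (\<phi> s \<omega>) - DH s (X s \<omega>) (Y s \<omega>) (Z s \<omega>) (\<theta> s \<omega>)))"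
proof -
  have adm: "progressively_measurable F T \<alpha> \<and>
      state_solution M F T W b \<sigma> x \<alpha> (state M F T W b \<sigma> x \<alpha>) \<and>
      (AE \<omega> in M. set_integrable lborel {0..T} (\<lambda>s. f s (state M F T W b \<sigma> x \<alpha> s \<omega>) (\<alpha> s \<omega>))) \<and>
      integrable M (pathwise_cost T f g (state M F T W b \<sigma> x \<alpha>) \<alpha>) \<and>
      (\<exists>Y Z. adjoint_solution M F T W b \<sigma> f g \<alpha> (state M F T W b \<sigma> x \<alpha>) Y Z)"
    if "\<alpha> \<in> admissible M F T W b \<sigma> f g" for \<alpha>
  proof -
    have "\<exists>X'. state_solution M F T W b \<sigma> x \<alpha> X'" using that by (auto simp: admissible_def Let_def)
    then have "state_solution M F T W b \<sigma> x \<alpha> (state M F T W b \<sigma> x \<alpha>)" unfolding state_def by (rule someI_ex)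
    then show ?thesis using that by (simp add: admissible_def Let_def)
  qed
  note A\<phi> = adm[OF \<phi>] and A\<theta> = adm[OF \<theta>]
  obtain Y Z where YZ: "adjoint_processes M F T W b \<sigma> f g x \<theta> = (Y, Z)" by (meson surj_pair)
  have "\<exists>p. case p of (Y, Z) \<Rightarrow> adjoint_solution M F T W b \<sigma> f g \<theta> (state M F T W b \<sigma> x \<theta>) Y Z"
    using A\<theta> by auto
  from someI_ex[OF this] have adj: "adjoint_solution M F T W b \<sigma> f g \<theta> (state M F T W b \<sigma> x \<theta>) Y Z"
    using YZ unfolding adjoint_processes_def by simp
  define X where "X = state M F T W b \<sigma> x \<theta>"
  define mb where "mb = mean_square M T (\<lambda>s \<omega>. b s (X s \<omega>) (\<phi> s \<omega>) - b s (X s \<omega>) (\<theta> s \<omega>))"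
  define ms where "ms = mean_square M T (\<lambda>s \<omega>. \<sigma> s (X s \<omega>) (\<phi> s \<omega>) - \<sigma> s (X s \<omega>) (\<theta> s \<omega>))"
  define mD where "mD = mean_square M T (\<lambda>s \<omega>. Dx_hamiltonian b \<sigma> f s (X s \<omega>) (Y s \<omega>) (Z s \<omega>) (\<phi> s \<omega>)
    - Dx_hamiltonian b \<sigma> f s (X s \<omega>) (Y s \<omega>) (Z s \<omega>) (\<theta> s \<omega>))"
  define EH where "EH = (\<integral>\<omega>. (LBINT s:{0..T}. hamiltonian b \<sigma> f s (X s \<omega>) (Y s \<omega>) (Z s \<omega>) (\<phi> s \<omega>)
    - hamiltonian b \<sigma> f s (X s \<omega>) (Y s \<omega>) (Z s \<omega>) (\<theta> s \<omega>)) \<partial>M)"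
  define dJ where "dJ = cost_functional M F T W b \<sigma> f g x \<phi> - cost_functional M F T W b \<sigma> f g x \<theta>"
  let ?C = "comparison_constant"
  have C: "0 < ?C" using comparison_constant_ge(1) by linarith
  have "ereal dJ \<le> ereal EH + ereal ?C * enn2ereal mb + ereal ?C * enn2ereal ms + ereal ?C * enn2ereal mD"
  proof (cases "mb < \<infinity> \<and> ms < \<infinity> \<and> mD < \<infinity>")
    case True
    have "dJ \<le> EH + ?C * enn2real mb + ?C * enn2real ms + ?C * enn2real mD"
      unfolding dJ_def cost_functional_def EH_def mb_def ms_def mD_def X_def
      by (rule comparison[where x=x]) (use A\<phi> A\<theta> adj True in \<open>simp_all add: mb_def ms_def mD_def X_def\<close>)
    moreover have "enn2ereal m = ereal (enn2real m)" if "m < \<infinity>" for m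
      using that by (metis enn2ereal_ennreal enn2real_nonneg ennreal_enn2real infinity_ennreal_def)
    ultimately show ?thesis using True by simp
  next
    case False
    have inf: "ereal ?C * enn2ereal m = \<infinity>" if "\<not> m < \<infinity>" for m
      using that C by (simp add: less_top[symmetric])
    define p where "p = ereal ?C * enn2ereal mb"
    define q where "q = ereal ?C * enn2ereal ms"
    define r where "r = ereal ?C * enn2ereal mD"
    have "p = \<infinity> \<or> q = \<infinity> \<or> r = \<infinity>"
      using False inf[of mb] inf[of ms] inf[of mD] unfolding p_def q_def r_def by blast
    then have "ereal EH + p + q + r = \<infinity>" by auto
    then show ?thesis by (simp only: p_def[symmetric] q_def[symmetric] r_def[symmetric] ereal_less_eq)
  qed
  then show ?thesis
    unfolding Let_def YZ dJ_def EH_def mb_def ms_def mD_def X_def by simp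
qed

end

theorem lemma2p3:
  fixes M :: "'w measure" and F :: "real \<Rightarrow> 'w measure" and T K :: real
    and W :: "real \<Rightarrow> 'w \<Rightarrow> real^'e"
    and b :: "real \<Rightarrow> real^'d \<Rightarrow> 'a::metric_space \<Rightarrow> real^'d"
    and \<sigma> :: "real \<Rightarrow> real^'d \<Rightarrow> 'a \<Rightarrow> real^'e^'d"
    and f :: "real \<Rightarrow> real^'d \<Rightarrow> 'a \<Rightarrow> real"
    and g :: "real^'d \<Rightarrow> real"
    and \<phi> \<theta> :: "real \<Rightarrow> 'w \<Rightarrow> 'a"
  assumes T_pos: "0 < T"
    and prob: "prob_space M"
    and filt: "filtration_upto M F T"
    and wiener: "wiener_martingale M F T W"
    and separable: "separable_space (euclidean :: 'a topology)"
    and b_meas: "(\<lambda>(t, x, a). b t x a)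
      \<in> borel_measurable (restrict_space borel {0..T} \<Otimes>\<^sub>M borel \<Otimes>\<^sub>M borel)"
    and \<sigma>_meas: "(\<lambda>(t, x, a). \<sigma> t x a)
      \<in> borel_measurable (restrict_space borel {0..T} \<Otimes>\<^sub>M borel \<Otimes>\<^sub>M borel)"
    and f_meas: "(\<lambda>(t, x, a). f t x a)
      \<in> borel_measurable (restrict_space borel {0..T} \<Otimes>\<^sub>M borel \<Otimes>\<^sub>M borel)"
    and g_meas: "g \<in> borel_measurable borel"
    and b_cont: "\<And>a. continuous_on ({0..T} \<times> UNIV) (\<lambda>(t, x). b t x a)"
    and \<sigma>_cont: "\<And>a. continuous_on ({0..T} \<times> UNIV) (\<lambda>(t, x). \<sigma> t x a)"
    and f_cont: "\<And>a. continuous_on ({0..T} \<times> UNIV) (\<lambda>(t, x). f t x a)"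
    and b_diff: "\<And>t a. t \<in> {0..T} \<Longrightarrow> twice_differentiable (\<lambda>x. b t x a)"
    and \<sigma>_diff: "\<And>t a. t \<in> {0..T} \<Longrightarrow> twice_differentiable (\<lambda>x. \<sigma> t x a)"
    and f_diff: "\<And>t a. t \<in> {0..T} \<Longrightarrow> twice_differentiable (\<lambda>x. f t x a)"
    and g_diff: "twice_differentiable g"
    and K_nonneg: "0 \<le> K"
    and dynamics_bound: "\<And>t x a. t \<in> {0..T} \<Longrightarrow>
      norm (Dx (\<lambda>x. b t x a) x) + norm (Dx (\<lambda>x. \<sigma> t x a) x) + norm (Dx (Dx (\<lambda>x. b t x a)) x) \<le> K"
    and \<sigma>_affine: "\<And>t x a. t \<in> {0..T} \<Longrightarrow> Dx (Dx (\<lambda>x. \<sigma> t x a)) x = 0"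
    and cost_bound: "\<And>t x a. t \<in> {0..T} \<Longrightarrow>
      norm (Dx g x) + norm (Dx (\<lambda>x. f t x a) x) + norm (Dx (Dx g) x)
        + norm (Dx (Dx (\<lambda>x. f t x a)) x) \<le> K"
    and \<phi>_adm: "\<phi> \<in> admissible M F T W b \<sigma> f g"
    and \<theta>_adm: "\<theta> \<in> admissible M F T W b \<sigma> f g"
  shows "\<exists>C>0. \<forall>x.
    let X = state M F T W b \<sigma> x \<theta>;
        (Y, Z) = adjoint_processes M F T W b \<sigma> f g x \<theta>;
        H = hamiltonian b \<sigma> f;
        DH = Dx_hamiltonian b \<sigma> f
    in ereal (cost_functional M F T W b \<sigma> f g x \<phi>
           - cost_functional M F T W b \<sigma> f g x \<theta>) \<le>
         ereal (\<integral>\<omega>. (LBINT s:{0..T}.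
           H s (X s \<omega>) (Y s \<omega>) (Z s \<omega>) (\<phi> s \<omega>) - H s (X s \<omega>) (Y s \<omega>) (Z s \<omega>) (\<theta> s \<omega>)) \<partial>M)
         + ereal C * enn2ereal (mean_square M T (\<lambda>s \<omega>.
             b s (X s \<omega>) (\<phi> s \<omega>) - b s (X s \<omega>) (\<theta> s \<omega>)))
         + ereal C * enn2ereal (mean_square M T (\<lambda>s \<omega>.
             \<sigma> s (X s \<omega>) (\<phi> s \<omega>) - \<sigma> s (X s \<omega>) (\<theta> s \<omega>)))
         + ereal C * enn2ereal (mean_square M T (\<lambda>s \<omega>.
             DH s (X s \<omega>) (Y s \<omega>) (Z s \<omega>) (\<phi> s \<omega>) - DH s (X s \<omega>) (Y s \<omega>) (Z s \<omega>) (\<theta> s \<omega>)))"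
proof -
  interpret control_problem M F T W K b \<sigma> f g
    by (intro control_problem.intro wiener_space.intro wiener_space_axioms.intro
        control_problem_axioms.intro; fact)
  show ?thesis
  \<comment> \<open>A single witness for all \<open>x\<close>: its definition involves only
    \<open>K\<close>, \<open>T\<close> and \<open>CARD('d)\<close>.\<close>
  proof (intro exI[of _ comparison_constant] conjI allI)
    show "0 < comparison_constant" using comparison_constant_ge(1) by linarith
  qed (rule comparison_ereal[OF \<phi>_adm \<theta>_adm])
qed

end
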